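(* Let $k$ be an algebraically closed field, $r\in\mathbb N$, $\delta\in k\setminus\{0\}$ and $A=P_k(r,\delta)$ the partition algebra. Let $0\le n,l\le r$ and let $\lambda$ be a partition of $l$. Then the layer restriction $\mathrm{res}_n\mathrm{Ind}_lM^\lambda$ of the permutation module $M(l,\lambda)=\mathrm{Ind}_lM^\lambda$ is isomorphic, as a $k\Sigma_n$-module, to a direct sum of permutation modules. In particular, it has a filtration by dual Specht modules.
   Context: Partition algebra: $P_k(r,\delta)$ has as $k$-basis the set partitions of $\{1,\dots,r,1',\dots,r'\}$, drawn as diagrams with a top row of dots $1,\dots,r$ and a bottom row $1',\dots,r'$, dots being connected iff they lie in the same part. The product $xy$ is given by writing $x$ on top of $y$, identifying the bottom row of $x$ with the top row of $y$, and replacing each component not connected to the outer top or bottom row by a factor $\delta$. A part meeting both rows is called propagating. Idempotents: $e_0=\frac1\delta\cdot$(diagram with the two parts $\{1,\dots,r\}$ and $\{1',\dots,r'\}$); for $n\ge1$, $e_n$ is the diagram with parts $\{1,1'\},\dots,\{n-1,(n-1)'\}$ and $\{n,\dots,r,n',\dots,r'\}$. Set $J_l:=Ae_lA$ (the span of diagrams with at most $l$ propagating parts), $J_{-1}:=0$. $k\Sigma_l$ ($\Sigma_l$ the symmetric group on $l$ letters, $\Sigma_0$ trivial) is embedded into $e_lAe_l$ by sending $\pi\in\Sigma_l$ to the diagram joining top dot $i$ to bottom dot $\pi(i)'$ for $1\le i\le l$, with the top dots $l+1,\dots,r$ joined to top dot $l$ and the bottom dots $(l+1)',\dots,r'$ joined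 to bottom dot $l'$ (for $l=0$: $k\to ke_0$). $M^\lambda=k\Sigma_l\otimes_{k\Sigma_\lambda}k$ with $\Sigma_\lambda$ the Young subgroup; $\mathrm{Ind}_lM^\lambda:=Ae_l\otimes_{k\Sigma_l}M^\lambda$. For $N\in A\text{-mod}$, $\mathrm{res}_nN:=e_n(A/J_{n-1})\otimes_AN$, regarded as a $k\Sigma_n$-module, where $e_n(A/J_{n-1})$ abbreviates $e_nA/e_nJ_{n-1}$. A permutation module of $k\Sigma_n$ is a module $k\Sigma_n\otimes_{k\Sigma_\nu}k$ for a Young subgroup $\Sigma_\nu\le\Sigma_n$; dual Specht modules are $k$-duals of Specht modules. *)

theory Defs
  imports
    "HOL-Computational_Algebra.Polynomial"
    "HOL-Combinatorics.Permutations"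
    "HOL-Library.Disjoint_Sets"
    "HOL-Algebra.Free_Abelian_Groups"
    "HOL-Algebra.Generated_Groups"
    "HOL-Algebra.AbelCoset"
    "HOL-Algebra.Module"
begin

text \<open>
  The record \<open>module\<close> is used for left modules over arbitrary (noncommutative) rings;
  its \<open>mult\<close> and \<open>one\<close> fields carry no information.  The field \<open>rsmult\<close> is a second, right action.
\<close>

record ('s, 'r, 'x) bimodule = "('s, 'x) module" +
  rsmult :: "'x \<Rightarrow> 'r \<Rightarrow> 'x"

definition module_isomorphic ::
  "('r, 'q) ring_scheme \<Rightarrow> ('r, 'x, 'm) module_scheme \<Rightarrow> ('r, 'y, 'n) module_scheme \<Rightarrow> bool" where
  "module_isomorphic R M N \<longleftrightarrow>
     (\<exists>h \<in> iso (add_monoid M) (add_monoid N).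
        \<forall>a \<in> carrier R. \<forall>x \<in> carrier M. h (a \<odot>\<^bsub>M\<^esub> x) = a \<odot>\<^bsub>N\<^esub> h x)"

text \<open>The coset \<open>U + s c\<close> does not depend on the choice of \<open>c\<close> in the coset \<open>C\<close>, so the unions
  below are unions of equal sets.\<close>

definition quot_module :: "('s, 'x, 'm) module_scheme \<Rightarrow> 'x set \<Rightarrow> ('s, 'x set) module" where
  "quot_module M U =
     \<lparr>carrier = a_rcosets\<^bsub>M\<^esub> U, mult = undefined, one = undefined, zero = U, add = set_add M,
      smult = (\<lambda>s C. \<Union>c\<in>C. U +>\<^bsub>M\<^esub> (s \<odot>\<^bsub>M\<^esub> c))\<rparr>"

definition quot_bimodule ::
  "('s, 'r, 'x, 'm) bimodule_scheme \<Rightarrow> 'x set \<Rightarrow> ('s, 'r, 'x set) bimodule" where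
  "quot_bimodule M U =
     \<lparr>carrier = a_rcosets\<^bsub>M\<^esub> U, mult = undefined, one = undefined, zero = U, add = set_add M,
      smult = (\<lambda>s C. \<Union>c\<in>C. U +>\<^bsub>M\<^esub> (s \<odot>\<^bsub>M\<^esub> c)),
      rsmult = (\<lambda>C a. \<Union>c\<in>C. U +>\<^bsub>M\<^esub> (rsmult M c a))\<rparr>"

definition direct_sum :: "('s, 'x) module list \<Rightarrow> ('s, nat \<Rightarrow> 'x) module" where
  "direct_sum Ms =
     \<lparr>carrier = (\<Pi>\<^sub>E i\<in>{..<length Ms}. carrier (Ms ! i)), mult = undefined, one = undefined,
      zero = (\<lambda>i\<in>{..<length Ms}. \<zero>\<^bsub>Ms ! i\<^esub>),
      add = (\<lambda>f g. \<lambda>i\<in>{..<length Ms}. f i \<oplus>\<^bsub>Ms ! i\<^esub> g i),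
      smult = (\<lambda>s f. \<lambda>i\<in>{..<length Ms}. s \<odot>\<^bsub>Ms ! i\<^esub> f i)\<rparr>"

text \<open>
  Tensor product over \<open>R\<close> of a bimodule \<open>X\<close> (right action by \<open>R\<close>) and a left \<open>R\<close>-module \<open>Y\<close>:
  the free abelian group on \<open>X \<times> Y\<close> modulo biadditivity and \<open>R\<close>-balancedness.  It inherits the left
  action of \<open>X\<close>.
\<close>

definition tensor_relations ::
  "('r, 'q) ring_scheme \<Rightarrow> ('s, 'r, 'x, 'm) bimodule_scheme \<Rightarrow> ('r, 'y, 'n) module_scheme
     \<Rightarrow> (('x \<times> 'y) \<Rightarrow>\<^sub>0 int) set" where
  "tensor_relations R X Y =
     {frag_of (x \<oplus>\<^bsub>X\<^esub> x', y) - frag_of (x, y) - frag_of (x', y) | x x' y.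
        x \<in> carrier X \<and> x' \<in> carrier X \<and> y \<in> carrier Y} \<union>
     {frag_of (x, y \<oplus>\<^bsub>Y\<^esub> y') - frag_of (x, y) - frag_of (x, y') | x y y'.
        x \<in> carrier X \<and> y \<in> carrier Y \<and> y' \<in> carrier Y} \<union>
     {frag_of (rsmult X x a, y) - frag_of (x, a \<odot>\<^bsub>Y\<^esub> y) | x a y.
        x \<in> carrier X \<and> a \<in> carrier R \<and> y \<in> carrier Y}"

definition tensor ::
  "('r, 'q) ring_scheme \<Rightarrow> ('s, 'r, 'x, 'm) bimodule_scheme \<Rightarrow> ('r, 'y, 'n) module_scheme
     \<Rightarrow> ('s, (('x \<times> 'y) \<Rightarrow>\<^sub>0 int) set) module" where
  "tensor R X Y =
     (let F = free_Abelian_group (carrier X \<times> carrier Y);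
          H = generate F (tensor_relations R X Y)
      in \<lparr>carrier = carrier (F Mod H), mult = undefined, one = undefined,
          zero = \<one>\<^bsub>F Mod H\<^esub>, add = monoid.mult (F Mod H),
          smult = (\<lambda>s C. \<Union>f\<in>C. H #>\<^bsub>F\<^esub> frag_extend (\<lambda>(x, y). frag_of (s \<odot>\<^bsub>X\<^esub> x, y)) f)\<rparr>)"

text \<open>
  A diagram is a set partition of top and bottom dots.  The dots \<open>Mid i\<close> occur only while two
  diagrams are being composed.
\<close>

datatype dot = Top nat | Mid nat | Bot nat

type_synonym diagram = "dot set set"

definition diagrams :: "nat \<Rightarrow> diagram set" where
  "diagrams r = {d. partition_on (Top ` {1..r} \<union> Bot ` {1..r}) d}"

fun bot_to_mid :: "dot \<Rightarrow> dot" where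
  "bot_to_mid (Bot i) = Mid i"
| "bot_to_mid v = v"

fun top_to_mid :: "dot \<Rightarrow> dot" where
  "top_to_mid (Top i) = Mid i"
| "top_to_mid v = v"

definition stack :: "diagram \<Rightarrow> diagram \<Rightarrow> (dot \<times> dot) set" where
  "stack x y = (\<Union>p\<in>x. bot_to_mid ` p \<times> bot_to_mid ` p) \<union> (\<Union>p\<in>y. top_to_mid ` p \<times> top_to_mid ` p)"

definition components :: "diagram \<Rightarrow> diagram \<Rightarrow> dot set set" where
  "components x y = Field (stack x y) // (stack x y)\<^sup>+"

definition compose_diagrams :: "diagram \<Rightarrow> diagram \<Rightarrow> diagram" where
  "compose_diagrams x y = (\<lambda>C. C - range Mid) ` components x y - {{}}"

definition closed_components :: "diagram \<Rightarrow> diagram \<Rightarrow> nat" where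
  "closed_components x y = card {C \<in> components x y. C \<subseteq> range Mid}"

definition basis_vec :: "'b \<Rightarrow> 'b \<Rightarrow> 'k::field" where
  "basis_vec b = (\<lambda>b'. if b' = b then 1 else 0)"

text \<open>An element is the function taking each diagram to its coefficient.\<close>

definition partition_algebra :: "nat \<Rightarrow> 'k::field \<Rightarrow> (diagram \<Rightarrow> 'k) ring" where
  "partition_algebra r \<delta> =
     \<lparr>carrier = {f. \<forall>d. d \<notin> diagrams r \<longrightarrow> f d = 0},
      mult = (\<lambda>f g d. \<Sum>x\<in>diagrams r. \<Sum>y\<in>diagrams r.
                if compose_diagrams x y = d then f x * g y * \<delta> ^ closed_components x y else 0),
      one = basis_vec ((\<lambda>i. {Top i, Bot i}) ` {1..r}),
      zero = (\<lambda>_. 0),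
      add = (\<lambda>f g d. f d + g d)\<rparr>"

definition idem :: "nat \<Rightarrow> 'k::field \<Rightarrow> nat \<Rightarrow> diagram \<Rightarrow> 'k" where
  "idem r \<delta> n =
     (if n = 0 then (\<lambda>d. (1 / \<delta>) * basis_vec {Top ` {1..r}, Bot ` {1..r}} d)
      else basis_vec ((\<lambda>i. {Top i, Bot i}) ` {1..<n} \<union> {Top ` {n..r} \<union> Bot ` {n..r}}))"

text \<open>\<open>J\<^sub>l = A e\<^sub>l A\<close> is the additive span of the products \<open>a e\<^sub>l b\<close>, and \<open>J\<^sub>-\<^sub>1 = 0\<close>.\<close>

definition layer_ideal :: "nat \<Rightarrow> 'k::field \<Rightarrow> int \<Rightarrow> (diagram \<Rightarrow> 'k) set" where
  "layer_ideal r \<delta> l =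
     (let A = partition_algebra r \<delta> in
      if l < 0 then {\<zero>\<^bsub>A\<^esub>}
      else generate (add_monoid A)
             {a \<otimes>\<^bsub>A\<^esub> idem r \<delta> (nat l) \<otimes>\<^bsub>A\<^esub> b | a b. a \<in> carrier A \<and> b \<in> carrier A})"

definition Sym :: "nat \<Rightarrow> (nat \<Rightarrow> nat) set" where
  "Sym n = {\<pi>. \<pi> permutes {1..n}}"

text \<open>
  Permutations are multiplied from left to right: the product \<open>\<pi> \<sigma>\<close> is \<open>\<pi>\<close> followed by \<open>\<sigma>\<close>, i.e. the
  map \<open>\<sigma> \<circ> \<pi>\<close>.  This is what makes the map sending \<open>\<pi>\<close> to the diagram joining top dot \<open>i\<close> to
  bottom dot \<open>\<pi> i\<close> multiplicative, with diagrams composed from top to bottom.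
\<close>

definition group_algebra :: "(nat \<Rightarrow> nat) set \<Rightarrow> ((nat \<Rightarrow> nat) \<Rightarrow> 'k::field) ring" where
  "group_algebra G =
     \<lparr>carrier = {f. \<forall>\<pi>. \<pi> \<notin> G \<longrightarrow> f \<pi> = 0},
      mult = (\<lambda>f g \<rho>. \<Sum>\<pi>\<in>G. \<Sum>\<sigma>\<in>G. if \<sigma> \<circ> \<pi> = \<rho> then f \<pi> * g \<sigma> else 0),
      one = basis_vec id,
      zero = (\<lambda>_. 0),
      add = (\<lambda>f g \<pi>. f \<pi> + g \<pi>)\<rparr>"

text \<open>For \<open>l \<ge> 1\<close>, the dots \<open>l, \<dots>, r\<close> of a row form one block, and \<open>min j l = i\<close> says that dot \<open>j\<close>
  lies in the \<open>i\<close>-th block.\<close>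

definition perm_diagram :: "nat \<Rightarrow> nat \<Rightarrow> (nat \<Rightarrow> nat) \<Rightarrow> diagram" where
  "perm_diagram r l \<pi> =
     (\<lambda>i. Top ` {j \<in> {1..r}. min j l = i} \<union> Bot ` {j \<in> {1..r}. min j l = \<pi> i}) ` {1..l}"

definition embed_sym :: "nat \<Rightarrow> 'k::field \<Rightarrow> nat \<Rightarrow> ((nat \<Rightarrow> nat) \<Rightarrow> 'k) \<Rightarrow> diagram \<Rightarrow> 'k" where
  "embed_sym r \<delta> l f =
     (if l = 0 then (\<lambda>d. f id * idem r \<delta> 0 d)
      else (\<lambda>d. \<Sum>\<pi>\<in>Sym l. f \<pi> * basis_vec (perm_diagram r l \<pi>) d))"

definition is_partition :: "nat \<Rightarrow> nat list \<Rightarrow> bool" where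
  "is_partition n \<mu> \<longleftrightarrow> sum_list \<mu> = n \<and> sorted_wrt (\<ge>) \<mu> \<and> 0 \<notin> set \<mu>"

definition young_subgroup :: "nat list \<Rightarrow> (nat \<Rightarrow> nat) set" where
  "young_subgroup \<mu> =
     {\<pi> \<in> Sym (sum_list \<mu>). \<forall>i < length \<mu>.
        let B = {sum_list (take i \<mu>) <.. sum_list (take (Suc i) \<mu>)} in \<pi> ` B = B}"

definition trivial_module :: "(nat \<Rightarrow> nat) set \<Rightarrow> ((nat \<Rightarrow> nat) \<Rightarrow> 'k::field, 'k) module" where
  "trivial_module G =
     \<lparr>carrier = UNIV, mult = undefined, one = undefined, zero = 0, add = (+),
      smult = (\<lambda>f c. (\<Sum>\<pi>\<in>G. f \<pi>) * c)\<rparr>"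

definition regular_bimodule ::
  "('a, 'm) ring_scheme \<Rightarrow> ('a, 'a, 'a) bimodule" where
  "regular_bimodule R =
     \<lparr>carrier = carrier R, mult = undefined, one = undefined, zero = \<zero>\<^bsub>R\<^esub>, add = add R,
      smult = monoid.mult R, rsmult = monoid.mult R\<rparr>"

definition perm_module ::
  "nat \<Rightarrow> nat list \<Rightarrow>
     ((nat \<Rightarrow> nat) \<Rightarrow> 'k::field, ((((nat \<Rightarrow> nat) \<Rightarrow> 'k) \<times> 'k) \<Rightarrow>\<^sub>0 int) set) module" where
  "perm_module l \<mu> =
     tensor (group_algebra (young_subgroup \<mu>)) (regular_bimodule (group_algebra (Sym l)))
       (trivial_module (young_subgroup \<mu>))"

definition ind_bimodule ::
  "nat \<Rightarrow> 'k::field \<Rightarrow> nat \<Rightarrow> (diagram \<Rightarrow> 'k, (nat \<Rightarrow> nat) \<Rightarrow> 'k, diagram \<Rightarrow> 'k) bimodule" where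
  "ind_bimodule r \<delta> l =
     (let A = partition_algebra r \<delta> in
      \<lparr>carrier = {a \<otimes>\<^bsub>A\<^esub> idem r \<delta> l | a. a \<in> carrier A}, mult = undefined, one = undefined,
       zero = \<zero>\<^bsub>A\<^esub>, add = add A,
       smult = monoid.mult A, rsmult = (\<lambda>x f. x \<otimes>\<^bsub>A\<^esub> embed_sym r \<delta> l f)\<rparr>)"

definition layer_ind ::
  "nat \<Rightarrow> 'k::field \<Rightarrow> nat \<Rightarrow> ((nat \<Rightarrow> nat) \<Rightarrow> 'k, 'y) module
     \<Rightarrow> (diagram \<Rightarrow> 'k, (((diagram \<Rightarrow> 'k) \<times> 'y) \<Rightarrow>\<^sub>0 int) set) module" where
  "layer_ind r \<delta> l M = tensor (group_algebra (Sym l)) (ind_bimodule r \<delta> l) M"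

definition eA_bimodule ::
  "nat \<Rightarrow> 'k::field \<Rightarrow> nat \<Rightarrow> ((nat \<Rightarrow> nat) \<Rightarrow> 'k, diagram \<Rightarrow> 'k, diagram \<Rightarrow> 'k) bimodule" where
  "eA_bimodule r \<delta> n =
     (let A = partition_algebra r \<delta> in
      \<lparr>carrier = {idem r \<delta> n \<otimes>\<^bsub>A\<^esub> a | a. a \<in> carrier A}, mult = undefined, one = undefined,
       zero = \<zero>\<^bsub>A\<^esub>, add = add A,
       smult = (\<lambda>f x. embed_sym r \<delta> n f \<otimes>\<^bsub>A\<^esub> x), rsmult = monoid.mult A\<rparr>)"

definition res_bimodule ::
  "nat \<Rightarrow> 'k::field \<Rightarrow> nat \<Rightarrow> ((nat \<Rightarrow> nat) \<Rightarrow> 'k, diagram \<Rightarrow> 'k, (diagram \<Rightarrow> 'k) set) bimodule" where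
  "res_bimodule r \<delta> n =
     quot_bimodule (eA_bimodule r \<delta> n)
       {idem r \<delta> n \<otimes>\<^bsub>partition_algebra r \<delta>\<^esub> a | a. a \<in> layer_ideal r \<delta> (int n - 1)}"

definition layer_res ::
  "nat \<Rightarrow> 'k::field \<Rightarrow> nat \<Rightarrow> (diagram \<Rightarrow> 'k, 'y) module
     \<Rightarrow> ((nat \<Rightarrow> nat) \<Rightarrow> 'k, (((diagram \<Rightarrow> 'k) set \<times> 'y) \<Rightarrow>\<^sub>0 int) set) module" where
  "layer_res r \<delta> n N = tensor (partition_algebra r \<delta>) (res_bimodule r \<delta> n) N"

text \<open>A tableau is the list of its rows; a tabloid is the list of the underlying sets.\<close>

definition tableaux :: "nat \<Rightarrow> nat list \<Rightarrow> nat list list set" where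
  "tableaux n \<mu> = {t. map length t = \<mu> \<and> distinct (concat t) \<and> set (concat t) = {1..n}}"

definition tabloid :: "nat list list \<Rightarrow> nat set list" where
  "tabloid t = map set t"

definition column :: "nat list list \<Rightarrow> nat \<Rightarrow> nat set" where
  "column t j = {row ! j | row. row \<in> set t \<and> j < length row}"

definition column_stabilizer :: "nat \<Rightarrow> nat list list \<Rightarrow> (nat \<Rightarrow> nat) set" where
  "column_stabilizer n t = {\<pi> \<in> Sym n. \<forall>j. \<pi> ` column t j = column t j}"

definition polytabloid :: "nat \<Rightarrow> nat list list \<Rightarrow> nat set list \<Rightarrow> 'k::field" where
  "polytabloid n t =
     (\<lambda>T. \<Sum>\<pi>\<in>column_stabilizer n t. of_int (sign \<pi>) * basis_vec (map (image \<pi>) (tabloid t)) T)"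

text \<open>
  The Specht module is the span of the polytabloids inside the space of formal linear combinations
  of tabloids.  As permutations are multiplied from left to right, the left action of \<open>\<pi>\<close> replaces
  the entries of a tabloid by their images under the inverse of \<open>\<pi>\<close>; hence the coefficient at \<open>T\<close>
  of \<open>\<pi> v\<close> is that of \<open>v\<close> at \<open>\<pi> ` T\<close>.
\<close>

definition specht_module ::
  "nat \<Rightarrow> nat list \<Rightarrow> ((nat \<Rightarrow> nat) \<Rightarrow> 'k::field, nat set list \<Rightarrow> 'k) module" where
  "specht_module n \<mu> =
     \<lparr>carrier = {v. \<exists>c. v = (\<lambda>T. \<Sum>t\<in>tableaux n \<mu>. c t * polytabloid n t T)},
      mult = undefined, one = undefined,
      zero = (\<lambda>_. 0), add = (\<lambda>v w T. v T + w T),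
      smult = (\<lambda>f v T. \<Sum>\<pi>\<in>Sym n. f \<pi> * v (map (image \<pi>) T))\<rparr>"

text \<open>The \<open>k\<close>-dual of a module over the group algebra of \<open>Sym n\<close>, with the contragredient action
  \<open>(\<pi> \<phi>)(x) = \<phi> (\<pi>\<^sup>-\<^sup>1 x)\<close>.\<close>

definition dual_module ::
  "nat \<Rightarrow> ((nat \<Rightarrow> nat) \<Rightarrow> 'k::field, 'x) module \<Rightarrow> ((nat \<Rightarrow> nat) \<Rightarrow> 'k, 'x \<Rightarrow> 'k) module" where
  "dual_module n M =
     \<lparr>carrier = {\<phi> \<in> extensional (carrier M).
        (\<forall>x \<in> carrier M. \<forall>y \<in> carrier M. \<phi> (x \<oplus>\<^bsub>M\<^esub> y) = \<phi> x + \<phi> y) \<and>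
        (\<forall>c. \<forall>x \<in> carrier M. \<phi> ((\<lambda>\<pi>. c * basis_vec id \<pi>) \<odot>\<^bsub>M\<^esub> x) = c * \<phi> x)},
      mult = undefined, one = undefined,
      zero = (\<lambda>x\<in>carrier M. 0),
      add = (\<lambda>\<phi> \<psi>. \<lambda>x\<in>carrier M. \<phi> x + \<psi> x),
      smult = (\<lambda>f \<phi>. \<lambda>x\<in>carrier M. \<Sum>\<pi>\<in>Sym n. f \<pi> * \<phi> (basis_vec (inv_into UNIV \<pi>) \<odot>\<^bsub>M\<^esub> x))\<rparr>"

definition has_dual_specht_filtration ::
  "nat \<Rightarrow> ((nat \<Rightarrow> nat) \<Rightarrow> 'k::field, 'x) module \<Rightarrow> bool" where
  "has_dual_specht_filtration n M \<longleftrightarrow>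
     (\<exists>(m::nat) (U :: nat \<Rightarrow> 'x set) (\<mu> :: nat \<Rightarrow> nat list).
        U 0 = {\<zero>\<^bsub>M\<^esub>} \<and> U m = carrier M \<and>
        (\<forall>i \<le> m. submodule (U i) (group_algebra (Sym n) :: ((nat \<Rightarrow> nat) \<Rightarrow> 'k) ring) M) \<and>
        (\<forall>i < m. U i \<subseteq> U (Suc i) \<and> is_partition n (\<mu> i) \<and>
           module_isomorphic (group_algebra (Sym n) :: ((nat \<Rightarrow> nat) \<Rightarrow> 'k) ring)
             (quot_module (M\<lparr>carrier := U (Suc i)\<rparr>) (U i))
             (dual_module n (specht_module n (\<mu> i)))))"

end

theory Submission
  imports Defs "HOL-Library.Function_Algebras"
begin

text \<open>
  A part of a diagram enters a composition only through the two-colourings of the dots that are constant on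
  all parts: each closed component doubles the number of colourings of the middle row, so counting colourings
  gives the associativity of the product together with the powers of \<open>\<delta>\<close>.

  Modulo \<open>J\<^sub>n\<^sub>-\<^sub>1\<close> only the diagrams from \<open>n\<close> to \<open>l\<close> dots survive in which the \<open>n\<close> top dots lie in distinct
  propagating parts.  The orbits of the Young subgroup of \<open>\<lambda>\<close> on these diagrams are described by the word of the
  \<open>n\<close> block contents of the propagating parts and the multiset of the contents of the other parts.  Hence the layer
  restriction is the space of functions on a finite set of decorated words of length \<open>n\<close>, and the orbits of \<open>\<Sigma>\<^sub>n\<close> on
  it give the permutation modules.

  For the filtration, let \<open>S\<close> be a semistandard tableau of shape \<open>\<rho>\<close>, viewed as a chain of shapes.  A tableau
  \<open>t\<close> of shape \<open>\<rho>\<close> turns \<open>S\<close> into a word; the signed sum of the evaluations at the column permutations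
  of this word is a functional \<open>F\<^sub>S\<^sub>,\<^sub>t\<close>.  Against the vectors obtained from \<open>S'\<close> and a tabloid \<open>T\<close> these functionals
  vanish unless \<open>S'\<close> is dominated by \<open>S\<close>, and for \<open>S' = S\<close> they give the coefficient of \<open>T\<close> in the polytabloid of \<open>t\<close>.
  By the commutation of adding a box with removing a horizontal strip, the pairs of a semistandard and a
  standard tableau of equal shape are as many as the words, so the triangular family is a basis, and the common
  kernels of the \<open>F\<^sub>S\<^sub>,\<^sub>t\<close> for fewer and fewer \<open>S\<close> have dual Specht modules as successive quotients.
\<close>

text \<open>The characteristic of \<open>k\<close> is arbitrary, so nothing here need split and the
  filtration must come from integral combinatorics. The matrix of functionals against vectors is
  unitriangular, hence invertible over every field; that the vectors span follows from the count
  alone, without straightening relations. Dual Specht modules appear because, on vectors killed by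
  the functionals of all chains placed after \<open>S\<close>, the value at \<open>t\<close> is
  linear in the polytabloid of \<open>t\<close>: such a vector is a linear form on a Specht module.
  The tensor products are quotients of free abelian groups and come without a basis. They are
  identified with function spaces from two sides: the universal property yields coefficient
  functionals, and an explicit family of tensors dual to them is shown to generate. The cases
  \<open>n = 0\<close> and \<open>l = 0\<close> are exceptional: the row in question is then a
  single part without propagation, and composing with the diagram of the idempotent creates a closed
  component, which its scalar \<open>1 / \<delta>\<close> cancels.\<close>

abbreviation (input) comp_diag (infixl ";;" 75) where "x ;; y \<equiv> compose_diagrams x y"
abbreviation (input) cc where "cc \<equiv> closed_components"
abbreviation (input) outer :: "nat => dot set" where "outer r \<equiv> Top ` {1..r} \<union> Bot ` {1..r}"
abbreviation (input) dots :: "nat set => nat set => nat set => dot set" where "dots a b c \<equiv> Top ` a \<union> Mid ` b \<union> Bot ` c"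
abbreviation (input) kSym where "kSym n \<equiv> group_algebra (Sym n)"
type_synonym 'k tensors = "((((nat => nat) => 'k) \<times> 'k) \<Rightarrow>\<^sub>0 int) set"

section \<open>Composition of partition diagrams\<close>

text \<open>Fix the colours \<open>W\<close> outside \<open>M\<close>. A part meeting
  \<open>W\<close> must be filled up, a part with a dot outside \<open>M\<close> but none in
  \<open>W\<close> must stay empty, and only the parts inside \<open>M\<close> are free. The
  completions are therefore parametrised by the subsets of \<open>Cl\<close>, through the mutually
  inverse maps \<open>f\<close> and \<open>g\<close>.\<close>

lemma card_saturated_completions:
 assumes P: "partition_on F P" and F: "finite F" and W: "W \<subseteq> F - M"
 shows "card {b. b \<subseteq> M \<inter> F \<and> (\<forall>C\<in>P. C \<subseteq> W \<union> b \<or> C \<inter> (W \<union> b) = {})} =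
  (if \<forall>C\<in>P. C - M \<subseteq> W \<or> (C - M) \<inter> W = {} then 2 ^ card {C\<in>P. C \<subseteq> M} else 0)" (is "card ?S = _")
proof (cases "\<forall>C\<in>P. C - M \<subseteq> W \<or> (C - M) \<inter> W = {}")
 case False
 hence "?S = {}"
  by blast
 with False show ?thesis by (metis (no_types, lifting) card.empty)
next
 case True
 have un: "\<Union>P = F" and dj: "\<And>C D. C \<in> P ==> D \<in> P ==> C \<inter> D \<noteq> {} ==> C = D" and ne: "\<And>C. C \<in> P ==> C \<noteq> {}"
  using P by (auto simp: partition_on_def disjoint_def)
 have finP: "finite P" using F unfolding un[symmetric] by (rule finite_UnionD)
 define Cl where "Cl = {C\<in>P. C \<subseteq> M}"
 define f where "f Q = (\<Union>Q \<union> \<Union>{C\<in>P. C \<inter> W \<noteq> {}}) \<inter> M" for Q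
 define g where "g b = {C\<in>Cl. C \<subseteq> b}" for b
 have key: "C \<subseteq> W \<union> f Q \<or> C \<inter> (W \<union> f Q) = {}" if Q: "Q \<subseteq> Cl" and C: "C \<in> P" for C Q
 proof (cases "C \<inter> W = {}")
  case False
  hence "(C - M) \<inter> W \<noteq> {}" using W by blast
  hence "C - M \<subseteq> W" using True C by blast
  moreover have "C \<inter> M \<subseteq> f Q" using C False unfolding f_def by blast
  ultimately show ?thesis by blast
 next
  case True
  show ?thesis
  proof (cases "C \<in> Q")
   case True
   hence "C \<subseteq> M" using Q unfolding Cl_def by blast
   with True have "C \<subseteq> f Q" unfolding f_def by blast
   thus ?thesis by blast
  next
   case False
   have "v \<notin> f Q" if v: "v \<in> C" for v
   proof
    assume "v \<in> f Q"
    then consider D where "D \<in> Q" "v \<in> D" | D where "D \<in> P" "D \<inter> W \<noteq> {}" "v \<in> D" unfolding f_def by blast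
    thus False
    proof cases
     case (1 D)
     hence "C = D" using dj[of C D] C v Q unfolding Cl_def by blast
     thus ?thesis using 1 False by blast
    next
     case (2 D)
     hence "C = D" using dj[of C D] C v by blast
     thus ?thesis using 2 True by blast
    qed
   qed
   hence "C \<inter> f Q = {}" by blast
   thus ?thesis using True by blast
  qed
 qed
 have "bij_betw f (Pow Cl) ?S"
 proof (rule bij_betw_byWitness[where f' = g])
  show "\<forall>Q\<in>Pow Cl. g (f Q) = Q"
  proof (intro ballI equalityI subsetI)
   fix Q C assume Q: "Q \<in> Pow Cl" and C: "C \<in> g (f Q)"
   hence C': "C \<in> P" "C \<subseteq> M" "C \<subseteq> f Q" by (auto simp: g_def Cl_def)
   obtain v where v: "v \<in> C" using ne C' by blast
   hence "v \<in> f Q" using C' by blast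
   then consider D where "D \<in> Q" "v \<in> D" | D where "D \<in> P" "D \<inter> W \<noteq> {}" "v \<in> D" by (auto simp: f_def)
   thus "C \<in> Q"
   proof cases
    case 1 thus ?thesis using dj[of C D] C' v Q by (auto simp: Cl_def)
   next
    case 2 hence "C = D" using dj[of C D] C' v by auto
    thus ?thesis using 2 W C' by auto
   qed
  qed (auto simp: g_def f_def Cl_def)
  show "\<forall>b\<in>?S. f (g b) = b"
  proof (intro ballI equalityI subsetI)
   fix b v assume b: "b \<in> ?S" and v: "v \<in> f (g b)"
   hence vM: "v \<in> M" by (simp add: f_def)
   from v consider D where "D \<in> g b" "v \<in> D" | D where "D \<in> P" "D \<inter> W \<noteq> {}" "v \<in> D" by (auto simp: f_def)
   thus "v \<in> b"
   proof cases
    case 2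
    hence "D \<subseteq> W \<union> b" using b by blast
    thus ?thesis using 2 W vM by auto
   qed (auto simp: g_def)
  next
   fix b v assume b: "b \<in> ?S" and v: "v \<in> b"
   then obtain C where C: "C \<in> P" "v \<in> C" using un by blast
   hence sub: "C \<subseteq> W \<union> b" using b v by blast
   show "v \<in> f (g b)"
   proof (cases "C \<inter> W = {}")
    case True
    hence "C \<subseteq> b" using sub by blast
    hence "C \<in> g b" using C b by (auto simp: g_def Cl_def)
    thus ?thesis using C v b by (auto simp: f_def)
   qed (use C v b in \<open>auto simp: f_def\<close>)
  qed
  show "f ` Pow Cl \<subseteq> ?S"
  proof (intro image_subsetI CollectI conjI)
   fix Q assume "Q \<in> Pow Cl"
   thus "f Q \<subseteq> M \<inter> F" using un by (auto simp: f_def Cl_def)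
   show "\<forall>C\<in>P. C \<subseteq> W \<union> f Q \<or> C \<inter> (W \<union> f Q) = {}" using key \<open>Q \<in> Pow Cl\<close> by blast
  qed
  show "g ` ?S \<subseteq> Pow Cl"
   by (auto simp: g_def)
 qed
 hence "card ?S = card (Pow Cl)"
  using bij_betw_same_card by fastforce
 also have "\<dots> = 2 ^ card Cl" using finP by (simp add: card_Pow Cl_def)
 finally show ?thesis using True by (simp add: Cl_def)
qed

section \<open>Two-colourings constant on parts\<close>

definition sat :: "diagram => nat set => nat set => bool" where
 "sat d a c \<longleftrightarrow> (\<forall>p\<in>d. p \<subseteq> Top ` a \<union> Bot ` c \<or> p \<inter> (Top ` a \<union> Bot ` c) = {})"

lemma finite_diagrams [simp]: "finite (diagrams r)"
proof -
 have "diagrams r \<subseteq> Pow (Pow (outer r))"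
  by (auto simp: diagrams_def partition_on_def)
 thus ?thesis by (rule finite_subset) simp
qed

lemma sat_empty [simp]: "sat d {} {}"
 by (simp add: sat_def)

lemma diagramD:
 assumes "d \<in> diagrams r"
 shows "\<Union>d = outer r" "\<And>p. p \<in> d ==> p \<noteq> {}"
  "\<And>p q v. p \<in> d ==> q \<in> d ==> v \<in> p ==> v \<in> q ==> p = q"
proof -
 have p: "partition_on (outer r) d" using assms by (simp add: diagrams_def)
 show "\<Union>d = outer r" using p by (rule partition_onD1[symmetric])
 show "\<And>p. p \<in> d ==> p \<noteq> {}" using partition_onD3[OF p] by metis
 show "\<And>p q v. p \<in> d ==> q \<in> d ==> v \<in> p ==> v \<in> q ==> p = q"
  using partition_onD2[OF p] unfolding disjoint_def by blast
qed

text \<open>A part is itself a compatible colour class. Hence a part of \<open>x\<close> is a union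
  of parts of \<open>y\<close> and conversely, and two parts with a common dot coincide.\<close>

lemma diagram_eqI:
 assumes x: "x \<in> diagrams r" and y: "y \<in> diagrams r"
  and eq: "\<And>a c. a \<subseteq> {1..r} ==> c \<subseteq> {1..r} ==> sat x a c \<longleftrightarrow> sat y a c"
 shows "x = y"
proof -
 have sub: "p \<in> y" if x: "x \<in> diagrams r" and y: "y \<in> diagrams r"
  and eq: "\<And>a c. a \<subseteq> {1..r} ==> c \<subseteq> {1..r} ==> sat x a c \<longleftrightarrow> sat y a c" and p: "p \<in> x" for p x y
 proof -
  have self: "\<exists>a c. a \<subseteq> {1..r} \<and> c \<subseteq> {1..r} \<and> sat z a c \<and> q = Top ` a \<union> Bot ` c"
   if z: "z \<in> diagrams r" and q: "q \<in> z" for z q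
  proof (intro exI conjI)
   have "q \<subseteq> outer r" using diagramD(1)[OF z] q by blast
   thus e: "q = Top ` {j. Top j \<in> q} \<union> Bot ` {j. Bot j \<in> q}" by auto
   show "sat z {j. Top j \<in> q} {j. Bot j \<in> q}"
    unfolding sat_def e[symmetric] using diagramD(3)[OF z q] by blast
   show "{j. Top j \<in> q} \<subseteq> {1..r}" "{j. Bot j \<in> q} \<subseteq> {1..r}"
    using \<open>q \<subseteq> _\<close> by auto
  qed
  obtain a c where ac: "a \<subseteq> {1..r}" "c \<subseteq> {1..r}" "sat x a c" "p = Top ` a \<union> Bot ` c" using self[OF x p] by blast
  obtain v where v: "v \<in> p" using diagramD(2)[OF x p] by blast
  hence "v \<in> \<Union>y" using diagramD(1)[OF x] diagramD(1)[OF y] p by blast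
  then obtain q where q: "q \<in> y" "v \<in> q" by blast
  have "sat y a c" using eq ac by blast
  hence 1: "q \<subseteq> p" using q v ac(4) unfolding sat_def by blast
  obtain a' c' where ac': "a' \<subseteq> {1..r}" "c' \<subseteq> {1..r}" "sat y a' c'" "q = Top ` a' \<union> Bot ` c'" using self[OF y q(1)] by blast
  have "sat x a' c'" using eq ac' by blast
  hence "p \<subseteq> q" using q v ac'(4) p unfolding sat_def by blast
  with 1 q show ?thesis by simp
 qed
 show ?thesis using sub[OF x y eq] sub[OF y x eq[symmetric]] by blast
qed

lemma Field_stack:
 assumes "x \<in> diagrams r" "y \<in> diagrams r"
 shows "Field (stack x y) = Top ` {1..r} \<union> Mid ` {1..r} \<union> Bot ` {1..r}"
proof -
 have "Field (stack x y) = bot_to_mid ` \<Union>x \<union> top_to_mid ` \<Union>y"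
  unfolding stack_def Field_def Domain_iff Range_iff by blast
 also have "\<dots> = Top ` {1..r} \<union> Mid ` {1..r} \<union> Bot ` {1..r}"
  unfolding diagramD(1)[OF assms(1)] diagramD(1)[OF assms(2)] by (simp add: image_Un image_image Un_ac)
 finally show ?thesis .
qed

lemma components_partition:
 assumes "x \<in> diagrams r" "y \<in> diagrams r"
 shows "partition_on (Top ` {1..r} \<union> Mid ` {1..r} \<union> Bot ` {1..r}) (components x y)"
proof -
 have sym: "sym (stack x y)" unfolding stack_def sym_def by auto
 have "equiv (Field (stack x y)) ((stack x y)\<^sup>+)"
 proof (rule equivI)
  show "refl_on (Field (stack x y)) ((stack x y)\<^sup>+)"
  proof (rule refl_onI)
   fix v assume "v \<in> Field (stack x y)"
   hence "(v, v) \<in> stack x y" unfolding stack_def Field_def by auto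
   thus "(v, v) \<in> (stack x y)\<^sup>+" by blast
  qed
  show "(stack x y)\<^sup>+ \<subseteq> Field (stack x y) \<times> Field (stack x y)"
   by (metis FieldI1 FieldI2 mem_Sigma_iff subrelI trancl_subset_Field2 subsetD)
  show "sym ((stack x y)\<^sup>+)" using sym by (rule sym_trancl)
  show "trans ((stack x y)\<^sup>+)" by simp
 qed
 thus ?thesis unfolding components_def using partition_on_quotient Field_stack[OF assms] by metis
qed

text \<open>A set is a union of components as soon as no single edge leaves it, because the edge
  relation is symmetric. This removes the transitive closure from all later arguments.\<close>

lemma components_saturated_iff:
 assumes "x \<in> diagrams r" "y \<in> diagrams r"
 shows "(\<forall>C\<in>components x y. C \<subseteq> V \<or> C \<inter> V = {}) \<longleftrightarrow> (\<forall>(s, t)\<in>stack x y. s \<in> V --> t \<in> V)"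
proof
 assume L: "\<forall>C\<in>components x y. C \<subseteq> V \<or> C \<inter> V = {}"
 show "\<forall>(s, t)\<in>stack x y. s \<in> V --> t \<in> V"
 proof (intro ballI, clarify)
  fix s t assume st: "(s, t) \<in> stack x y" "s \<in> V"
  have "(stack x y)\<^sup>+ `` {s} \<in> components x y" using st unfolding components_def by (auto intro!: quotientI FieldI1)
  moreover have "(s, s) \<in> stack x y" using st unfolding stack_def by auto
  hence "s \<in> (stack x y)\<^sup>+ `` {s}" "t \<in> (stack x y)\<^sup>+ `` {s}" using st by blast+
  ultimately show "t \<in> V" using L st(2) by blast
 qed
next
 assume R: "\<forall>(s, t)\<in>stack x y. s \<in> V --> t \<in> V"
 have step: "s \<in> V \<longleftrightarrow> t \<in> V" if "(s, t) \<in> (stack x y)\<^sup>+" for s t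
  using that
 proof (induction rule: trancl_induct)
  case (base z)
  moreover have "(z, s) \<in> stack x y" using base unfolding stack_def by auto
  ultimately show ?case using R by blast
 next
  case (step z w)
  moreover have "(w, z) \<in> stack x y" using step unfolding stack_def by auto
  ultimately show ?case using R by blast
 qed
 show "\<forall>C\<in>components x y. C \<subseteq> V \<or> C \<inter> V = {}"
 proof
  fix C assume "C \<in> components x y"
  then obtain s where "C = (stack x y)\<^sup>+ `` {s}" by (auto simp: components_def quotient_def)
  thus "C \<subseteq> V \<or> C \<inter> V = {}" using step by blast
 qed
qed

text \<open>The set \<open>dots a b c\<close> is a colouring of three rows. An edge of the stack
  comes from a single part of \<open>x\<close> or of \<open>y\<close>, so compatibility can be
  tested on the two halves, which share the middle class \<open>b\<close>.\<close>

lemma stack_closed_iff: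
 assumes "x \<in> diagrams r" "y \<in> diagrams r"
 shows "(\<forall>(s, t)\<in>stack x y. s \<in> dots a b c --> t \<in> dots a b c)
  \<longleftrightarrow> sat x a b \<and> sat y b c"
proof -
 have nomid: "Mid j \<notin> p" if "p \<in> x \<or> p \<in> y" for j p
 proof
  assume "Mid j \<in> p"
  hence "Mid j \<in> \<Union>x \<union> \<Union>y" using that by blast
  thus False unfolding diagramD(1)[OF assms(1)] diagramD(1)[OF assms(2)] by blast
 qed
 have 1: "bot_to_mid v \<in> dots a b c \<longleftrightarrow> v \<in> Top ` a \<union> Bot ` b" if "p \<in> x" "v \<in> p" for p v
  using nomid[of p] that by (cases v) auto
 have 2: "top_to_mid v \<in> dots a b c \<longleftrightarrow> v \<in> Top ` b \<union> Bot ` c" if "p \<in> y" "v \<in> p" for p v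
  using nomid[of p] that by (cases v) auto
 have gen: "(\<forall>(s, t)\<in>stack x y. s \<in> V --> t \<in> V) \<longleftrightarrow>
  (\<forall>p\<in>x. \<forall>v\<in>p. \<forall>w\<in>p. bot_to_mid v \<in> V --> bot_to_mid w \<in> V) \<and>
  (\<forall>p\<in>y. \<forall>v\<in>p. \<forall>w\<in>p. top_to_mid v \<in> V --> top_to_mid w \<in> V)" for V
 proof -
  have "(\<forall>(s, t)\<in>(\<Union>p\<in>z. h ` p \<times> h ` p). s \<in> V --> t \<in> V) \<longleftrightarrow> (\<forall>p\<in>z. \<forall>v\<in>p. \<forall>w\<in>p. h v \<in> V --> h w \<in> V)"
   for z :: "dot set set" and h :: "dot => dot" by blast
  thus ?thesis unfolding stack_def ball_Un by simp
 qed
 have "(\<forall>(s, t)\<in>stack x y. s \<in> dots a b c --> t \<in> dots a b c) \<longleftrightarrow>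
  (\<forall>p\<in>x. \<forall>v\<in>p. \<forall>w\<in>p. bot_to_mid v \<in> dots a b c --> bot_to_mid w \<in> dots a b c) \<and>
  (\<forall>p\<in>y. \<forall>v\<in>p. \<forall>w\<in>p. top_to_mid v \<in> dots a b c --> top_to_mid w \<in> dots a b c)"
  by (rule gen)
 also have "\<dots> \<longleftrightarrow> (\<forall>p\<in>x. \<forall>v\<in>p. \<forall>w\<in>p. v \<in> Top ` a \<union> Bot ` b --> w \<in> Top ` a \<union> Bot ` b) \<and>
   (\<forall>p\<in>y. \<forall>v\<in>p. \<forall>w\<in>p. v \<in> Top ` b \<union> Bot ` c --> w \<in> Top ` b \<union> Bot ` c)"
  by (intro arg_cong2[where f="(\<and>)"] ball_cong refl arg_cong2[where f="(-->)"] 1 2)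
 also have "\<dots> \<longleftrightarrow> sat x a b \<and> sat y b c"
 proof -
  have e: "(\<forall>v\<in>p. \<forall>w\<in>p. v \<in> V --> w \<in> V) \<longleftrightarrow> p \<subseteq> V \<or> p \<inter> V = {}" for p V :: "dot set" by blast
  show ?thesis unfolding sat_def e ..
 qed
 finally show ?thesis .
qed

lemma compose_in_diagrams [simp]:
 assumes "x \<in> diagrams r" "y \<in> diagrams r"
 shows "(x ;; y) \<in> diagrams r"
proof -
 note P = components_partition[OF assms]
 have "partition_on (outer r) ((%C. C - range Mid) ` components x y - {{}})"
 proof (rule partition_onI)
  have "\<Union>((%C. C - range Mid) ` components x y - {{}}) = \<Union>(components x y) - range Mid" by blast
  also have "\<dots> = outer r"
   unfolding partition_onD1[OF P, symmetric] by auto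
  finally show "\<Union>((%C. C - range Mid) ` components x y - {{}}) = outer r" .
  fix p q assume "p \<in> (%C. C - range Mid) ` components x y - {{}}" "q \<in> (%C. C - range Mid) ` components x y - {{}}" "p \<noteq> q"
  then obtain C D where "C \<in> components x y" "D \<in> components x y" "p = C - range Mid" "q = D - range Mid" "C \<noteq> D" by blast
  moreover from this have "C \<inter> D = {}" using partition_onD2[OF P] unfolding disjoint_def by blast
  ultimately show "disjnt p q" unfolding disjnt_def by blast
 qed blast
 thus ?thesis unfolding diagrams_def compose_diagrams_def by simp
qed

text \<open>The middle colourings extending a given outer colouring are the completions counted by
  \<open>card_saturated_completions\<close>, with the middle dots as \<open>M\<close>; the parts
  inside \<open>M\<close> are then the closed components.\<close>

lemma card_colourings:
 assumes x: "x \<in> diagrams r" and y: "y \<in> diagrams r" and a: "a \<subseteq> {1..r}" and c: "c \<subseteq> {1..r}"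
 shows "card {b. b \<subseteq> {1..r} \<and> sat x a b \<and> sat y b c} =
  (if sat (x ;; y) a c then 2 ^ cc x y else 0)" (is "card ?B = _")
proof -
 let ?F = "Top ` {1..r} \<union> Mid ` {1..r} \<union> Bot ` {1..r}"
 let ?W = "Top ` a \<union> Bot ` c"
 let ?S = "{b. b \<subseteq> range Mid \<inter> ?F \<and> (\<forall>C\<in>components x y. C \<subseteq> ?W \<union> b \<or> C \<inter> (?W \<union> b) = {})}"
 have "bij_betw (%b. Mid ` b) ?B
  ?S"
 proof (rule bij_betw_imageI)
  show "inj_on ((`) Mid) ?B"
   by (auto simp: inj_on_def)
  have eq: "(\<forall>C\<in>components x y. C \<subseteq> ?W \<union> Mid ` b \<or> C \<inter> (?W \<union> Mid ` b) = {}) \<longleftrightarrow> sat x a b \<and> sat y b c" for b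
   using components_saturated_iff[OF x y, of "?W \<union> Mid ` b"] stack_closed_iff[OF x y, of a b c] by (simp add: Un_ac)
  have ex: "\<exists>b'. b = Mid ` b' \<and> b' \<subseteq> {1..r}" if "b \<subseteq> range Mid \<inter> ?F" for b
  proof -
   have "b \<subseteq> Mid ` {1..r}" using that by auto
   thus ?thesis by (simp add: subset_image_iff) blast
  qed
  show "((`) Mid) ` ?B =
    ?S"
  proof (intro equalityI subsetI)
   fix b assume b: "b \<in> ?S"
   hence "b \<subseteq> range Mid \<inter> ?F" by simp
   then obtain b' where b': "b = Mid ` b'" "b' \<subseteq> {1..r}" using ex by metis
   have "\<forall>C\<in>components x y. C \<subseteq> ?W \<union> b \<or> C \<inter> (?W \<union> b) = {}" using b by blast
   hence "sat x a b' \<and> sat y b' c" unfolding b'(1) eq .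
   with b' have "b' \<in> ?B" by simp
   thus "b \<in> ((`) Mid) ` ?B" unfolding b'(1) by (rule imageI)
  next
   fix b assume "b \<in> ((`) Mid) ` ?B"
   then obtain b' where b': "b = Mid ` b'" "b' \<subseteq> {1..r}" "sat x a b' \<and> sat y b' c" by blast
   hence "\<forall>C\<in>components x y. C \<subseteq> ?W \<union> b \<or> C \<inter> (?W \<union> b) = {}" unfolding b'(1) eq by blast
   moreover have "b \<subseteq> range Mid \<inter> ?F" using b' by blast
   ultimately show "b \<in> ?S" by blast
  qed
 qed
 hence "card ?B = card ?S"
  by (rule bij_betw_same_card)
 also have "\<dots> = (if \<forall>C\<in>components x y. C - range Mid \<subseteq> ?W \<or> (C - range Mid) \<inter> ?W = {} then 2 ^ card {C\<in>components x y. C \<subseteq> range Mid} else 0)"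
  by (rule card_saturated_completions[OF components_partition[OF x y]]) (use a c in auto)
 also have "(\<forall>C\<in>components x y. C - range Mid \<subseteq> ?W \<or> (C - range Mid) \<inter> ?W = {}) \<longleftrightarrow> sat (x ;; y) a c"
 proof -
  have "(\<forall>C\<in>X. h C \<subseteq> W \<or> h C \<inter> W = {}) \<longleftrightarrow> (\<forall>p\<in>h ` X - {{}}. p \<subseteq> W \<or> p \<inter> W = {})" for X :: "dot set set" and h and W :: "dot set"
   by blast
  thus ?thesis unfolding sat_def compose_diagrams_def .
 qed
 finally show ?thesis unfolding closed_components_def .
qed

text \<open>The matrix of \<open>d\<close>, indexed by sets of dots, in the action of the partition
  algebra with parameter 2 on the \<open>r\<close>-th tensor power of a two-dimensional space. It
  serves to compute composites and is independent of \<open>\<delta>\<close>.\<close>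

definition satc :: "diagram => nat set => nat set => nat" where
 "satc d a c = (if sat d a c then 1 else 0)"

lemma satc_compose:
 assumes "x \<in> diagrams r" "y \<in> diagrams r" "a \<subseteq> {1..r}" "c \<subseteq> {1..r}"
 shows "(\<Sum>b\<in>Pow {1..r}. satc x a b * satc y b c) = satc (x ;; y) a c * 2 ^ cc x y"
proof -
 have "(\<Sum>b\<in>Pow {1..r}. satc x a b * satc y b c) = (\<Sum>b\<in>Pow {1..r}. if sat x a b \<and> sat y b c then 1 else 0)"
  by (rule sum.cong) (auto simp: satc_def)
 also have "\<dots> = card {b. b \<subseteq> {1..r} \<and> sat x a b \<and> sat y b c}"
  by (simp add: sum.If_cases Pow_def Int_def)
 finally show ?thesis using card_colourings[OF assms] by (simp add: satc_def)
qed

text \<open>The empty colouring is compatible with every diagram, so the entry there gives the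
  number of closed components; the remaining entries then determine the composite.\<close>

lemma compose_eqI:
 assumes x: "x \<in> diagrams r" and y: "y \<in> diagrams r" and z: "z \<in> diagrams r"
  and eq: "\<And>a c. a \<subseteq> {1..r} ==> c \<subseteq> {1..r} ==>
   (\<Sum>b\<in>Pow {1..r}. satc x a b * satc y b c) = satc z a c * 2 ^ m"
 shows "(x ;; y) = z \<and> cc x y = m"
proof -
 have eq': "satc (x ;; y) a c * 2 ^ cc x y = satc z a c * 2 ^ m"
  if "a \<subseteq> {1..r}" "c \<subseteq> {1..r}" for a c
  using eq[OF that] satc_compose[OF x y that] by simp
 from eq'[of "{}" "{}"] have m: "cc x y = m" by (simp add: satc_def)
 have "(x ;; y) = z"
 proof (rule diagram_eqI[OF compose_in_diagrams[OF x y] z])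
  fix a c assume "a \<subseteq> {1..r}" "c \<subseteq> {1..r}"
  thus "sat (x ;; y) a c \<longleftrightarrow> sat z a c" using eq'[of a c] by (auto simp: satc_def split: if_splits)
 qed
 with m show ?thesis by blast
qed

text \<open>Both statements express the associativity of a product of three matrices
  \<open>satc\<close>: the entry at the empty colouring compares the exponents, and cancelling the
  common power of two compares the diagrams.\<close>

lemma compose_assoc:
 assumes x: "x \<in> diagrams r" and y: "y \<in> diagrams r" and z: "z \<in> diagrams r"
 shows "((x ;; y) ;; z) = (x ;; (y ;; z))"
  and "cc x y + cc (x ;; y) z =
     cc y z + cc x (y ;; z)"
proof -
 let ?xy = "(x ;; y)" and ?yz = "(y ;; z)" and ?P = "Pow {1..r}"
 have eq: "satc (?xy ;; z) a e * 2 ^ (cc x y + cc ?xy z) =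
  satc (x ;; ?yz) a e * 2 ^ (cc y z + cc x ?yz)"
  if a: "a \<subseteq> {1..r}" and e: "e \<subseteq> {1..r}" for a e
 proof -
  have "satc (?xy ;; z) a e * 2 ^ (cc x y + cc ?xy z)
    = (\<Sum>c\<in>?P. satc ?xy a c * satc z c e) * 2 ^ cc x y"
   using satc_compose[of ?xy r z a e] x y z a e by (simp add: power_add)
  also have "\<dots> = (\<Sum>c\<in>?P. (satc ?xy a c * 2 ^ cc x y) * satc z c e)"
   unfolding sum_distrib_right by (rule sum.cong) auto
  also have "\<dots> = (\<Sum>c\<in>?P. \<Sum>b\<in>?P. satc x a b * satc y b c * satc z c e)"
  proof (rule sum.cong[OF refl])
   fix c assume "c \<in> ?P"
   hence "satc ?xy a c * 2 ^ cc x y = (\<Sum>b\<in>?P. satc x a b * satc y b c)"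
    using satc_compose[OF x y a] by simp
   thus "(satc ?xy a c * 2 ^ cc x y) * satc z c e = (\<Sum>b\<in>?P. satc x a b * satc y b c * satc z c e)"
    by (simp add: sum_distrib_right)
  qed
  also have "\<dots> = (\<Sum>b\<in>?P. \<Sum>c\<in>?P. satc x a b * satc y b c * satc z c e)" by (rule sum.swap)
  also have "\<dots> = (\<Sum>b\<in>?P. satc x a b * (satc ?yz b e * 2 ^ cc y z))"
  proof (rule sum.cong[OF refl])
   fix b assume "b \<in> ?P"
   hence "satc ?yz b e * 2 ^ cc y z = (\<Sum>c\<in>?P. satc y b c * satc z c e)"
    using satc_compose[OF y z, of b e] e by simp
   thus "(\<Sum>c\<in>?P. satc x a b * satc y b c * satc z c e) = satc x a b * (satc ?yz b e * 2 ^ cc y z)"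
    by (simp add: sum_distrib_left mult.assoc)
  qed
  also have "\<dots> = (\<Sum>b\<in>?P. satc x a b * satc ?yz b e) * 2 ^ cc y z"
   unfolding sum_distrib_right by (rule sum.cong) auto
  also have "\<dots> = satc (x ;; ?yz) a e * 2 ^ (cc y z + cc x ?yz)"
   using satc_compose[of x r ?yz a e] x y z a e by (simp add: power_add)
  finally show ?thesis .
 qed
 from eq[of "{}" "{}"] show c: "cc x y + cc (x ;; y) z =
     cc y z + cc x (y ;; z)" by (simp add: satc_def)
 show "((x ;; y) ;; z) = (x ;; (y ;; z))"
 proof (rule diagram_eqI)
  fix a e assume "a \<subseteq> {1..r}" "e \<subseteq> {1..r}"
  thus "sat (?xy ;; z) a e = sat (x ;; ?yz) a e"
  proof -
   have "satc (?xy ;; z) a e * 2 ^ (cc y z + cc x ?yz) =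
    satc (x ;; ?yz) a e * 2 ^ (cc y z + cc x ?yz)"
    using eq[OF \<open>a \<subseteq> {1..r}\<close> \<open>e \<subseteq> {1..r}\<close>] unfolding c .
   hence "satc (?xy ;; z) a e = satc (x ;; ?yz) a e" by simp
   thus ?thesis unfolding satc_def by (simp split: if_splits)
  qed
 qed (use x y z in auto)
qed

section \<open>Diagrams given by labels of the dots\<close>

definition rel :: "diagram => dot => dot => bool" where
 "rel d v v' \<longleftrightarrow> (\<exists>p\<in>d. v \<in> p \<and> v' \<in> p)"

lemma rel_sym: "rel d v v' \<longleftrightarrow> rel d v' v"
 by (auto simp: rel_def)

lemma sat_rel:
 assumes "sat d a c"
 shows "rel d (Top j) (Top j') ==> j \<in> a \<longleftrightarrow> j' \<in> a"
  "rel d (Bot j) (Bot j') ==> j \<in> c \<longleftrightarrow> j' \<in> c"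
  "rel d (Top j) (Bot j') ==> j \<in> a \<longleftrightarrow> j' \<in> c"
proof -
 have "v \<in> Top ` a \<union> Bot ` c \<longleftrightarrow> v' \<in> Top ` a \<union> Bot ` c" if "rel d v v'" for v v'
  using assms that unfolding sat_def rel_def by blast
 from this[of "Top j" "Top j'"] this[of "Bot j" "Bot j'"] this[of "Top j" "Bot j'"]
 show "rel d (Top j) (Top j') ==> j \<in> a \<longleftrightarrow> j' \<in> a"
  "rel d (Bot j) (Bot j') ==> j \<in> c \<longleftrightarrow> j' \<in> c"
  "rel d (Top j) (Bot j') ==> j \<in> a \<longleftrightarrow> j' \<in> c" by auto
qed

lemma part_sat:
 assumes "d \<in> diagrams r" "p \<in> d"
 shows "sat d {j. Top j \<in> p} {j. Bot j \<in> p}" "{j. Top j \<in> p} \<subseteq> {1..r}" "{j. Bot j \<in> p} \<subseteq> {1..r}"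
proof -
 have "p \<subseteq> outer r" using diagramD(1)[OF assms(1)] assms(2) by blast
 hence "p = Top ` {j. Top j \<in> p} \<union> Bot ` {j. Bot j \<in> p}" by auto
 thus "sat d {j. Top j \<in> p} {j. Bot j \<in> p}"
  unfolding sat_def using diagramD(3)[OF assms(1) assms(2)] by (metis disjoint_iff subsetI)
 show "{j. Top j \<in> p} \<subseteq> {1..r}" "{j. Bot j \<in> p} \<subseteq> {1..r}"
  using \<open>p \<subseteq> _\<close> by auto
qed

text \<open>Dots are joined iff they carry equal labels. Only equality matters, so labels may have
  any type and may be renamed injectively; by \<open>diagram_eq_lab\<close> every diagram arises,
  with its own parts as labels. Composites are computed on labels instead of connected
  components.\<close>

definition lab :: "nat => (nat => 'a) => (nat => 'a) => diagram" where
 "lab r u w = (%i. Top ` {j\<in>{1..r}. u j = i} \<union> Bot ` {j\<in>{1..r}. w j = i}) ` (u ` {1..r} \<union> w ` {1..r})"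

lemma lab_in_diagrams [simp]: "lab r u w \<in> diagrams r"
proof -
 have "partition_on (outer r) (lab r u w)"
 proof (rule partition_onI)
  show "\<Union>(lab r u w) = outer r"
   unfolding lab_def by blast
  show "{} \<notin> lab r u w" unfolding lab_def by blast
  fix p q assume "p \<in> lab r u w" "q \<in> lab r u w" "p \<noteq> q"
  then obtain i i' where pq: "p = Top ` {j\<in>{1..r}. u j = i} \<union> Bot ` {j\<in>{1..r}. w j = i}"
   "q = Top ` {j\<in>{1..r}. u j = i'} \<union> Bot ` {j\<in>{1..r}. w j = i'}" unfolding lab_def by blast
  with \<open>p \<noteq> q\<close> have "i \<noteq> i'" by auto
  thus "disjnt p q" unfolding disjnt_def pq by auto
 qed
 thus ?thesis by (simp add: diagrams_def)
qed

lemma rel_lab: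
 "rel (lab r u w) (Top j) (Top j') \<longleftrightarrow> j \<in> {1..r} \<and> j' \<in> {1..r} \<and> u j = u j'"
 "rel (lab r u w) (Bot j) (Bot j') \<longleftrightarrow> j \<in> {1..r} \<and> j' \<in> {1..r} \<and> w j = w j'"
 "rel (lab r u w) (Top j) (Bot j') \<longleftrightarrow> j \<in> {1..r} \<and> j' \<in> {1..r} \<and> u j = w j'"
proof -
 have "rel (lab r u w) v v' \<longleftrightarrow> (\<exists>i\<in>u ` {1..r} \<union> w ` {1..r}. v \<in> Top ` {j\<in>{1..r}. u j = i} \<union> Bot ` {j\<in>{1..r}. w j = i} \<and>
   v' \<in> Top ` {j\<in>{1..r}. u j = i} \<union> Bot ` {j\<in>{1..r}. w j = i})" for v v'
  unfolding rel_def lab_def by (rule bex_simps(7)[THEN trans]) simp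
 thus "rel (lab r u w) (Top j) (Top j') \<longleftrightarrow> j \<in> {1..r} \<and> j' \<in> {1..r} \<and> u j = u j'"
  "rel (lab r u w) (Bot j) (Bot j') \<longleftrightarrow> j \<in> {1..r} \<and> j' \<in> {1..r} \<and> w j = w j'"
  "rel (lab r u w) (Top j) (Bot j') \<longleftrightarrow> j \<in> {1..r} \<and> j' \<in> {1..r} \<and> u j = w j'" by auto
qed

definition compat :: "nat => (nat => 'a) => (nat => 'a) => nat set => nat set => bool" where
 "compat r u w a c \<longleftrightarrow> (\<forall>j\<in>{1..r}. \<forall>j'\<in>{1..r}. (u j = u j' --> (j \<in> a \<longleftrightarrow> j' \<in> a)) \<and>
   (w j = w j' --> (j \<in> c \<longleftrightarrow> j' \<in> c)) \<and> (u j = w j' --> (j \<in> a \<longleftrightarrow> j' \<in> c)))"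

lemma compatD:
 assumes "compat r u w a c" "j \<in> {1..r}" "j' \<in> {1..r}"
 shows "u j = u j' ==> j \<in> a \<longleftrightarrow> j' \<in> a" "w j = w j' ==> j \<in> c \<longleftrightarrow> j' \<in> c" "u j = w j' ==> j \<in> a \<longleftrightarrow> j' \<in> c"
 using assms unfolding compat_def by blast+

lemma sat_lab:
 assumes "a \<subseteq> {1..r}" "c \<subseteq> {1..r}"
 shows "sat (lab r u w) a c \<longleftrightarrow> compat r u w a c"
proof
 assume s: "sat (lab r u w) a c"
 show "compat r u w a c" unfolding compat_def
  using sat_rel[OF s] unfolding rel_lab by blast
next
 assume s: "compat r u w a c"
 show "sat (lab r u w) a c" unfolding sat_def
 proof
  fix p assume "p \<in> lab r u w"
  then obtain i where p: "p = Top ` {j\<in>{1..r}. u j = i} \<union> Bot ` {j\<in>{1..r}. w j = i}" by (auto simp: lab_def)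
  have "v' \<in> Top ` a \<union> Bot ` c" if v: "v \<in> p" "v \<in> Top ` a \<union> Bot ` c" and v': "v' \<in> p" for v v'
  proof -
   have 1: "(\<exists>j. v = Top j \<and> j \<in> {1..r} \<and> u j = i \<and> j \<in> a) \<or> (\<exists>j. v = Bot j \<and> j \<in> {1..r} \<and> w j = i \<and> j \<in> c)"
    using v unfolding p by auto
   have 2: "(\<exists>j. v' = Top j \<and> j \<in> {1..r} \<and> u j = i) \<or> (\<exists>j. v' = Bot j \<and> j \<in> {1..r} \<and> w j = i)"
    using v' unfolding p by auto
   show ?thesis using 1 2
   proof (elim disjE exE)
    fix j j' assume "v = Top j \<and> j \<in> {1..r} \<and> u j = i \<and> j \<in> a" "v' = Top j' \<and> j' \<in> {1..r} \<and> u j' = i"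
    thus ?thesis using compatD(1)[OF s, of j j'] by auto
   next
    fix j j' assume "v = Top j \<and> j \<in> {1..r} \<and> u j = i \<and> j \<in> a" "v' = Bot j' \<and> j' \<in> {1..r} \<and> w j' = i"
    thus ?thesis using compatD(3)[OF s, of j j'] by auto
   next
    fix j j' assume "v = Bot j \<and> j \<in> {1..r} \<and> w j = i \<and> j \<in> c" "v' = Top j' \<and> j' \<in> {1..r} \<and> u j' = i"
    thus ?thesis using compatD(3)[OF s, of j' j] by auto
   next
    fix j j' assume "v = Bot j \<and> j \<in> {1..r} \<and> w j = i \<and> j \<in> c" "v' = Bot j' \<and> j' \<in> {1..r} \<and> w j' = i"
    thus ?thesis using compatD(2)[OF s, of j j'] by auto
   qed
  qed
  thus "p \<subseteq> Top ` a \<union> Bot ` c \<or> p \<inter> (Top ` a \<union> Bot ` c) = {}" by blast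
 qed
qed

lemma diagram_eq_relI:
 assumes x: "x \<in> diagrams r" and y: "y \<in> diagrams r"
  and "\<And>j j'. j \<in> {1..r} ==> j' \<in> {1..r} ==> rel x (Top j) (Top j') \<longleftrightarrow> rel y (Top j) (Top j')"
  and "\<And>j j'. j \<in> {1..r} ==> j' \<in> {1..r} ==> rel x (Bot j) (Bot j') \<longleftrightarrow> rel y (Bot j) (Bot j')"
  and "\<And>j j'. j \<in> {1..r} ==> j' \<in> {1..r} ==> rel x (Top j) (Bot j') \<longleftrightarrow> rel y (Top j) (Bot j')"
 shows "x = y"
proof -
 let ?F = "outer r"
 have e: "rel x v v' \<longleftrightarrow> rel y v v'" if "v \<in> ?F" "v' \<in> ?F" for v v'
  using that assms(3-5) by (auto simp: rel_sym[of _ "Bot _" "Top _"])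
 have "p \<in> y" if x: "x \<in> diagrams r" and y: "y \<in> diagrams r" and p: "p \<in> x"
  and e: "\<And>v v'. v \<in> ?F ==> v' \<in> ?F ==> rel x v v' \<longleftrightarrow> rel y v v'" for x y p
 proof -
  obtain v where v: "v \<in> p" using diagramD(2)[OF x p] by blast
  have pF: "p \<subseteq> ?F" using diagramD(1)[OF x] p by blast
  then obtain q where q: "q \<in> y" "v \<in> q" using v diagramD(1)[OF y] by blast
  have qF: "q \<subseteq> ?F" using diagramD(1)[OF y] q by blast
  have "v' \<in> p \<longleftrightarrow> v' \<in> q" for v'
  proof (cases "v' \<in> ?F")
   case True
   have "v' \<in> p \<longleftrightarrow> rel x v v'" unfolding rel_def using v p diagramD(3)[OF x] by blast
   also have "\<dots> \<longleftrightarrow> rel y v v'" using e v pF True by blast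
   also have "\<dots> \<longleftrightarrow> v' \<in> q" unfolding rel_def using q diagramD(3)[OF y] by blast
   finally show ?thesis .
  qed (use pF qF in blast)
  hence "p = q" by blast
  thus ?thesis using q by simp
 qed
 from this[OF x y _ e] this[OF y x _ e[symmetric]] show ?thesis by blast
qed

lemma lab_eq_iff:
 "lab r u w = lab r u' w' \<longleftrightarrow> (\<forall>j\<in>{1..r}. \<forall>j'\<in>{1..r}. (u j = u j' \<longleftrightarrow> u' j = u' j') \<and>
   (w j = w j' \<longleftrightarrow> w' j = w' j') \<and> (u j = w j' \<longleftrightarrow> u' j = w' j'))"
proof
 assume e: "lab r u w = lab r u' w'"
 show "\<forall>j\<in>{1..r}. \<forall>j'\<in>{1..r}. (u j = u j' \<longleftrightarrow> u' j = u' j') \<and>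
   (w j = w j' \<longleftrightarrow> w' j = w' j') \<and> (u j = w j' \<longleftrightarrow> u' j = w' j')"
  using rel_lab[of r u w] unfolding e rel_lab by blast
next
 assume "\<forall>j\<in>{1..r}. \<forall>j'\<in>{1..r}. (u j = u j' \<longleftrightarrow> u' j = u' j') \<and>
   (w j = w j' \<longleftrightarrow> w' j = w' j') \<and> (u j = w j' \<longleftrightarrow> u' j = w' j')"
 thus "lab r u w = lab r u' w'"
  by (intro diagram_eq_relI[of _ r] lab_in_diagrams) (simp_all add: rel_lab)
qed

lemma lab_cong:
 "(\<And>j. j \<in> {1..r} ==> u j = u' j) ==> (\<And>j. j \<in> {1..r} ==> w j = w' j) ==> lab r u w = lab r u' w'"
 unfolding lab_eq_iff by simp

lemma lab_inj:
 assumes "inj_on f (u ` {1..r} \<union> w ` {1..r})"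
 shows "lab r (%j. f (u j)) (%j. f (w j)) = lab r u w"
proof -
 have "f x = f y \<longleftrightarrow> x = y" if "x \<in> u ` {1..r} \<union> w ` {1..r}" "y \<in> u ` {1..r} \<union> w ` {1..r}" for x y
  using assms that by (simp add: inj_on_eq_iff)
 thus ?thesis unfolding lab_eq_iff by blast
qed

definition part :: "diagram => dot => dot set" where
 "part d v = (THE p. p \<in> d \<and> v \<in> p)"

lemma part_eq:
 assumes "d \<in> diagrams r" "p \<in> d" "v \<in> p"
 shows "part d v = p"
 unfolding part_def
proof (rule the_equality)
 show "p \<in> d \<and> v \<in> p" using assms by blast
 show "q = p" if "q \<in> d \<and> v \<in> q" for q
  using diagramD(3)[OF assms(1) _ assms(2) _ assms(3)] that by blast
qed

lemma part:
 assumes "d \<in> diagrams r" "v \<in> outer r"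
 shows "part d v \<in> d" "v \<in> part d v"
proof -
 obtain p where "p \<in> d" "v \<in> p" using diagramD(1)[OF assms(1)] assms(2) by blast
 thus "part d v \<in> d" "v \<in> part d v" using part_eq[OF assms(1)] by auto
qed

lemma part_eq_iff:
 assumes "d \<in> diagrams r" "v \<in> outer r" "v' \<in> outer r"
 shows "part d v = part d v' \<longleftrightarrow> rel d v v'"
proof
 assume "rel d v v'"
 then obtain p where "p \<in> d" "v \<in> p" "v' \<in> p" unfolding rel_def by blast
 thus "part d v = part d v'" using part_eq[OF assms(1)] by simp
next
 assume "part d v = part d v'"
 thus "rel d v v'" using part[OF assms(1,2)] part[OF assms(1,3)] unfolding rel_def by auto
qed

lemma diagram_eq_lab:
 assumes "d \<in> diagrams r"
 shows "d = lab r (%j. part d (Top j)) (%j. part d (Bot j))"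
 by (rule diagram_eq_relI[OF assms lab_in_diagrams]) (simp_all add: rel_lab part_eq_iff[OF assms])

text \<open>The map \<open>g\<close> sends a label of the upper diagram to its label after gluing,
  and the lower diagram carries the glued labels on its top row. The assumptions say that an upper
  part not reaching the middle row is merged neither with another such part nor with anything below,
  and that every middle dot is connected to an outer row, which excludes closed components. Then a
  compatible outer colouring has exactly one extension to the middle row, and the sum over
  \<open>b\<close> has a single term.\<close>

lemma compose_lab_glue:
 assumes priv: "\<And>j. j \<in> {1..r} ==> u j \<notin> v ` {1..r} ==> g (u j) \<notin> g ` v ` {1..r} \<union> w ` {1..r}"
  and inj: "\<And>j j'. j \<in> {1..r} ==> j' \<in> {1..r} ==> u j \<notin> v ` {1..r} ==> u j' \<notin> v ` {1..r} ==> g (u j) = g (u j') ==> u j = u j'"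
  and cov: "\<And>j. j \<in> {1..r} ==> g (v j) \<in> w ` {1..r} \<union> g ` u ` {1..r}"
 shows "((lab r u v) ;; (lab r (%j. g (v j)) w)) = lab r (%j. g (u j)) w \<and>
  cc (lab r u v) (lab r (%j. g (v j)) w) = 0"
proof (rule compose_eqI)
 fix a c assume a: "a \<subseteq> {1..r}" and c: "c \<subseteq> {1..r}"
 \<comment> \<open>The forced middle colouring: a middle dot is coloured if its glued label occurs
   on a coloured outer dot.\<close>
 define b0 where "b0 = {j\<in>{1..r}. g (v j) \<in> g ` u ` a \<union> w ` c}"
 have b0: "b0 \<subseteq> {1..r}" by (auto simp: b0_def)
 have toV: "\<exists>j'\<in>{1..r}. u j = v j'" if "j \<in> {1..r}" "g (u j) \<in> g ` v ` {1..r} \<union> w ` {1..r}" for j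
  using priv[OF that(1)] that(2) by blast
 have main: "sat (lab r u v) a b \<and> sat (lab r (%j. g (v j)) w) b c \<longleftrightarrow> b = b0 \<and> sat (lab r (%j. g (u j)) w) a c"
  if b: "b \<subseteq> {1..r}" for b
 proof
  assume "sat (lab r u v) a b \<and> sat (lab r (%j. g (v j)) w) b c"
  hence x: "compat r u v a b" and y: "compat r (%j. g (v j)) w b c"
   using sat_lab[OF a b] sat_lab[OF b c] by blast+
  have uv: "j \<in> a \<longleftrightarrow> j' \<in> b" if jr: "j \<in> {1..r}" and "j' \<in> {1..r}" "g (u j) = g (v j')" for j j'
  proof -
   have "g (u j) \<in> g ` v ` {1..r} \<union> w ` {1..r}" using \<open>j' \<in> {1..r}\<close> \<open>g (u j) = g (v j')\<close> by (metis UnI1 imageI)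
   then obtain k where "k \<in> {1..r}" "u j = v k" using toV[OF jr] by metis
   thus ?thesis using compatD(3)[OF x, of j k] compatD(1)[OF y, of k j'] jr \<open>j' \<in> {1..r}\<close> \<open>g (u j) = g (v j')\<close> by simp
  qed
  have uw: "j \<in> a \<longleftrightarrow> j' \<in> c" if jr: "j \<in> {1..r}" and "j' \<in> {1..r}" "g (u j) = w j'" for j j'
  proof -
   have "g (u j) \<in> g ` v ` {1..r} \<union> w ` {1..r}" using \<open>j' \<in> {1..r}\<close> \<open>g (u j) = w j'\<close> by (metis UnI2 imageI)
   then obtain k where "k \<in> {1..r}" "u j = v k" using toV[OF jr] by metis
   thus ?thesis using compatD(3)[OF x, of j k] compatD(3)[OF y, of k j'] jr \<open>j' \<in> {1..r}\<close> \<open>g (u j) = w j'\<close> by simp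
  qed
  have uu: "j \<in> a \<longleftrightarrow> j' \<in> a" if "j \<in> {1..r}" "j' \<in> {1..r}" "g (u j) = g (u j')" for j j'
  proof (cases "u j \<in> v ` {1..r} \<or> u j' \<in> v ` {1..r}")
   case True
   hence "\<exists>k\<in>{1..r}. g (u j) = g (v k)" using that(3) by (metis imageE)
   then obtain k where "k \<in> {1..r}" "g (u j) = g (v k)" by blast
   thus ?thesis using uv[of j k] uv[of j' k] that by simp
  next
   case False
   thus ?thesis using inj[OF that(1,2)] that compatD(1)[OF x that(1,2)] by blast
  qed
  have "compat r (%j. g (u j)) w a c"
   unfolding compat_def using uu uw compatD(2)[OF y] by blast
  hence s: "sat (lab r (%j. g (u j)) w) a c" using sat_lab[OF a c] by blast
  have "j \<in> b \<longleftrightarrow> j \<in> b0" if j: "j \<in> {1..r}" for j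
  proof
   assume jb: "j \<in> b"
   from cov[OF j] consider k where "k \<in> {1..r}" "g (v j) = w k" | k where "k \<in> {1..r}" "g (v j) = g (u k)" by blast
   thus "j \<in> b0"
   proof cases
    case 1 thus ?thesis using compatD(3)[OF y j, of k] jb j by (auto simp: b0_def)
   next
    case 2 thus ?thesis using uv[of k j] jb j by (auto simp: b0_def)
   qed
  next
   assume jb: "j \<in> b0"
   then consider k where "k \<in> c" "g (v j) = w k" | k where "k \<in> a" "g (v j) = g (u k)" by (auto simp: b0_def)
   thus "j \<in> b"
   proof cases
    case 1 thus ?thesis using compatD(3)[OF y j, of k] c j by auto
   next
    case 2 thus ?thesis using uv[of k j] a j by auto
   qed
  qed
  hence "b = b0" using b b0 by blast
  with s show "b = b0 \<and> sat (lab r (%j. g (u j)) w) a c" by simp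
 next
  assume "b = b0 \<and> sat (lab r (%j. g (u j)) w) a c"
  hence bb: "b = b0" and z: "compat r (%j. g (u j)) w a c" using sat_lab[OF a c] by blast+
  have ub: "j' \<in> b0 \<longleftrightarrow> j \<in> a" if "j \<in> {1..r}" "j' \<in> {1..r}" "g (u j) = g (v j')" for j j'
  proof
   assume "j' \<in> b0"
   then consider k where "k \<in> c" "g (v j') = w k" | k where "k \<in> a" "g (v j') = g (u k)" by (auto simp: b0_def)
   thus "j \<in> a"
   proof cases
    case 1 thus ?thesis using compatD(3)[OF z that(1), of k] c that by auto
   next
    case 2 thus ?thesis using compatD(1)[OF z that(1), of k] a that by auto
   qed
  next
   assume "j \<in> a"
   hence "g (v j') \<in> g ` u ` a" unfolding that(3)[symmetric] by (intro imageI)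
   thus "j' \<in> b0" using that(2) by (simp add: b0_def)
  qed
  have wb: "j' \<in> b0 \<longleftrightarrow> j \<in> c" if "j \<in> {1..r}" "j' \<in> {1..r}" "w j = g (v j')" for j j'
  proof
   assume "j' \<in> b0"
   then consider k where "k \<in> c" "g (v j') = w k" | k where "k \<in> a" "g (v j') = g (u k)" by (auto simp: b0_def)
   thus "j \<in> c"
   proof cases
    case 1 thus ?thesis using compatD(2)[OF z that(1), of k] c that by auto
   next
    case 2 thus ?thesis using compatD(3)[OF z _ that(1), of k] a that by auto
   qed
  next
   assume "j \<in> c"
   hence "g (v j') \<in> w ` c" unfolding that(3)[symmetric] by (rule imageI)
   thus "j' \<in> b0" using that(2) by (simp add: b0_def)
  qed
  have bb': "j \<in> b0 \<longleftrightarrow> j' \<in> b0" if "j \<in> {1..r}" "j' \<in> {1..r}" "g (v j) = g (v j')" for j j'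
   using that by (simp add: b0_def)
  have "compat r u v a b0" unfolding compat_def
  proof (intro ballI conjI impI)
   fix j j' assume j: "j \<in> {1..r}" "j' \<in> {1..r}"
   { assume "u j = u j'" thus "j \<in> a \<longleftrightarrow> j' \<in> a" using compatD(1)[OF z j] by simp }
   { assume "v j = v j'" thus "j \<in> b0 \<longleftrightarrow> j' \<in> b0" using bb'[OF j] by simp }
   { assume "u j = v j'" thus "j \<in> a \<longleftrightarrow> j' \<in> b0" using ub[OF j] by simp }
  qed
  moreover have "compat r (%j. g (v j)) w b0 c" unfolding compat_def
  proof (intro ballI conjI impI)
   fix j j' assume j: "j \<in> {1..r}" "j' \<in> {1..r}"
   { assume "g (v j) = g (v j')" thus "j \<in> b0 \<longleftrightarrow> j' \<in> b0" by (rule bb'[OF j]) }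
   { assume "w j = w j'" thus "j \<in> c \<longleftrightarrow> j' \<in> c" using compatD(2)[OF z j] by simp }
   { assume "g (v j) = w j'" thus "j \<in> b0 \<longleftrightarrow> j' \<in> c" using wb[OF j(2,1)] by simp }
  qed
  ultimately show "sat (lab r u v) a b \<and> sat (lab r (%j. g (v j)) w) b c"
   using sat_lab[OF a b0] sat_lab[OF b0 c] bb by blast
 qed
 have "(\<Sum>b\<in>Pow {1..r}. satc (lab r u v) a b * satc (lab r (%j. g (v j)) w) b c)
  = (\<Sum>b\<in>Pow {1..r}. if b = b0 then satc (lab r (%j. g (u j)) w) a c else 0)"
 proof (rule sum.cong[OF refl])
  fix b assume "b \<in> Pow {1..r}"
  thus "satc (lab r u v) a b * satc (lab r (%j. g (v j)) w) b c = (if b = b0 then satc (lab r (%j. g (u j)) w) a c else 0)"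
   using main[of b] unfolding satc_def by auto
 qed
 also have "\<dots> = satc (lab r (%j. g (u j)) w) a c" using b0 by simp
 finally show "(\<Sum>b\<in>Pow {1..r}. satc (lab r u v) a b * satc (lab r (%j. g (v j)) w) b c) = satc (lab r (%j. g (u j)) w) a c * 2 ^ 0" by simp
qed simp_all

text \<open>The middle row belongs to single parts without outer dots, so it is coloured as a whole,
  by \<open>{}\<close> or by \<open>{1..r}\<close>, whatever the outer colours are: one closed
  component. For \<open>r = 0\<close> these two colourings would coincide. \<open>Inl\<close> and
  \<open>Inr\<close> keep upper and lower labels apart.\<close>

lemma compose_lab_cut:
 assumes r: "r \<ge> 1" and t: "\<And>j. j \<in> {1..r} ==> t j \<noteq> e" and w: "\<And>j. j \<in> {1..r} ==> w j \<noteq> e'"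
 shows "((lab r t (%_. e)) ;; (lab r (%_. e') w)) = lab r (%j. Inl (t j)) (%j. Inr (w j)) \<and>
  cc (lab r t (%_. e)) (lab r (%_. e') w) = 1"
proof (rule compose_eqI)
 fix a c assume a: "a \<subseteq> {1..r}" and c: "c \<subseteq> {1..r}"
 let ?z = "lab r (%j. Inl (t j)) (%j. Inr (w j))"
 have main: "sat (lab r t (%_. e)) a b \<and> sat (lab r (%_. e') w) b c \<longleftrightarrow> b \<in> {{}, {1..r}} \<and> sat ?z a c"
  if b: "b \<subseteq> {1..r}" for b
 proof -
  have 1: "(\<forall>j\<in>{1..r}. \<forall>j'\<in>{1..r}. j \<in> b \<longleftrightarrow> j' \<in> b) \<longleftrightarrow> b \<in> {{}, {1..r}}" using b by blast
  have "sat (lab r t (%_. e)) a b \<longleftrightarrow> (\<forall>j\<in>{1..r}. \<forall>j'\<in>{1..r}. t j = t j' --> (j \<in> a \<longleftrightarrow> j' \<in> a)) \<and> b \<in> {{}, {1..r}}"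
   unfolding sat_lab[OF a b] compat_def 1[symmetric] using t by blast
  moreover have "sat (lab r (%_. e') w) b c \<longleftrightarrow> (\<forall>j\<in>{1..r}. \<forall>j'\<in>{1..r}. w j = w j' --> (j \<in> c \<longleftrightarrow> j' \<in> c)) \<and> b \<in> {{}, {1..r}}"
   unfolding sat_lab[OF b c] compat_def 1[symmetric] using w[THEN not_sym] by blast
  moreover have "sat ?z a c \<longleftrightarrow> (\<forall>j\<in>{1..r}. \<forall>j'\<in>{1..r}. t j = t j' --> (j \<in> a \<longleftrightarrow> j' \<in> a)) \<and> (\<forall>j\<in>{1..r}. \<forall>j'\<in>{1..r}. w j = w j' --> (j \<in> c \<longleftrightarrow> j' \<in> c))"
   unfolding sat_lab[OF a c] compat_def by auto
  ultimately show ?thesis by blast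
 qed
 have "(\<Sum>b\<in>Pow {1..r}. satc (lab r t (%_. e)) a b * satc (lab r (%_. e') w) b c)
  = (\<Sum>b\<in>Pow {1..r}. if b \<in> {{}, {1..r}} then satc ?z a c else 0)"
 proof (rule sum.cong[OF refl])
  fix b assume "b \<in> Pow {1..r}"
  thus "satc (lab r t (%_. e)) a b * satc (lab r (%_. e') w) b c = (if b \<in> {{}, {1..r}} then satc ?z a c else 0)"
   using main[of b] unfolding satc_def by auto
 qed
 also have "\<dots> = (\<Sum>b\<in>{{}, {1..r}}. satc ?z a c)"
  by (rule sum.mono_neutral_cong_right) auto
 also have "\<dots> = satc ?z a c * 2" using r by auto
 finally show "(\<Sum>b\<in>Pow {1..r}. satc (lab r t (%_. e)) a b * satc (lab r (%_. e') w) b c) = satc ?z a c * 2 ^ 1" by simp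
qed simp_all

section \<open>Reflection of diagrams\<close>

fun flip_dot :: "dot => dot" where
 "flip_dot (Top i) = Bot i" | "flip_dot (Bot i) = Top i" | "flip_dot (Mid i) = Mid i"

definition flip :: "diagram => diagram" where "flip d = image flip_dot ` d"

lemma flip_dot_flip_dot [simp]: "flip_dot (flip_dot v) = v" by (cases v) auto

lemma flip_flip [simp]: "flip (flip d) = d"
 by (simp add: flip_def image_image)

lemma rel_flip: "rel (flip d) v v' \<longleftrightarrow> rel d (flip_dot v) (flip_dot v')"
proof -
 have "v \<in> flip_dot ` p \<longleftrightarrow> flip_dot v \<in> p" for v p by (metis flip_dot_flip_dot imageE imageI)
 thus ?thesis unfolding rel_def flip_def by simp
qed

lemma flip_in_diagrams [simp]: "flip d \<in> diagrams r \<longleftrightarrow> d \<in> diagrams r"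
proof -
 have inj: "inj flip_dot" by (metis flip_dot_flip_dot injI)
 have *: "flip d \<in> diagrams r" if "d \<in> diagrams r" for d
 proof -
  have "partition_on (flip_dot ` (outer r)) (flip d)"
  proof -
   have "partition_on (outer r) d" using that by (simp add: diagrams_def)
   from partition_on_inj_image[OF this inj_on_subset[OF inj]]
   have "partition_on (flip_dot ` (outer r)) (image flip_dot ` d - {{}})" by simp
   moreover have "image flip_dot ` d - {{}} = flip d" unfolding flip_def using diagramD(2)[OF that] by auto
   ultimately show ?thesis by simp
  qed
  moreover have "flip_dot ` (outer r) = outer r"
   by (simp add: image_Un image_image Un_commute)
  ultimately show ?thesis by (simp add: diagrams_def)
 qed
 from *[of d] *[of "flip d"] show ?thesis by auto
qed

lemma flip_lab [simp]: "flip (lab r u w) = lab r w u"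
 by (rule diagram_eq_relI[of _ r]) (auto simp: rel_flip rel_lab rel_sym[of _ "Bot _" "Top _"])

lemma sat_flip [simp]: "sat (flip d) a c \<longleftrightarrow> sat d c a"
proof -
 have 1: "flip_dot ` p \<subseteq> Top ` a \<union> Bot ` c \<longleftrightarrow> p \<subseteq> Top ` c \<union> Bot ` a" for p
 proof -
  have "flip_dot v \<in> Top ` a \<union> Bot ` c \<longleftrightarrow> v \<in> Top ` c \<union> Bot ` a" for v by (cases v) auto
  thus ?thesis by blast
 qed
 have 2: "flip_dot ` p \<inter> (Top ` a \<union> Bot ` c) = {} \<longleftrightarrow> p \<inter> (Top ` c \<union> Bot ` a) = {}" for p
 proof -
  have "flip_dot v \<in> Top ` a \<union> Bot ` c \<longleftrightarrow> v \<in> Top ` c \<union> Bot ` a" for v by (cases v) auto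
  thus ?thesis by blast
 qed
 show ?thesis unfolding sat_def flip_def ball_simps 1 2 ..
qed

text \<open>Exchanging the rows transposes the matrix \<open>satc\<close>. Through this
  anti-automorphism the statements on bottom rows follow from those on top rows.\<close>

lemma compose_flip:
 assumes x: "x \<in> diagrams r" and y: "y \<in> diagrams r"
 shows "((flip y) ;; (flip x)) = flip (x ;; y) \<and>
  cc (flip y) (flip x) = cc x y"
proof (rule compose_eqI)
 fix a c assume "a \<subseteq> {1..r}" "c \<subseteq> {1..r}"
 thus "(\<Sum>b\<in>Pow {1..r}. satc (flip y) a b * satc (flip x) b c) = satc (flip (x ;; y)) a c * 2 ^ cc x y"
  using satc_compose[OF x y, of c a] by (simp add: satc_def mult.commute)
qed (use x y in auto)

section \<open>Diagrams with a fixed top or bottom row\<close>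

abbreviation pinv :: "('a => 'a) => 'a => 'a" where "pinv \<equiv> inv_into UNIV"

text \<open>A label names a block of the bottom row, and a top dot carries the label of the block to
  which \<open>\<pi>\<close> joins it. For \<open>n = 0\<close> this is the diagram of the
  idempotent without its scalar \<open>1 / \<delta>\<close>.\<close>

definition pdiag :: "nat => nat => (nat => nat) => diagram" where
 "pdiag r n \<pi> = (if n = 0 then lab r (%_. 0::nat) (%_. 1) else lab r (%j. \<pi> (min j n)) (%j. min j n))"

lemma pdiag_in_diagrams [simp]: "pdiag r n \<pi> \<in> diagrams r"
 by (simp add: pdiag_def)

lemma flip_pdiag:
 assumes "\<pi> permutes {1..n}"
 shows "flip (pdiag r n \<pi>) = pdiag r n (pinv \<pi>)"
proof -
 have "pinv \<pi> (min j n) = min j' n \<longleftrightarrow> min j n = \<pi> (min j' n)" for j j'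
  using permutes_inv_eq[OF assms] by metis
 moreover have "pinv \<pi> x = pinv \<pi> y \<longleftrightarrow> x = y" "\<pi> x = \<pi> y \<longleftrightarrow> x = y" for x y
  using permutes_inj[OF assms] permutes_inj[OF permutes_inv[OF assms]] by (auto dest: injD)
 ultimately show ?thesis unfolding pdiag_def by (simp add: lab_eq_iff)
qed

text \<open>Describes the diagrams that are unchanged when \<open>pdiag r n id\<close> is put on top
  of them. For \<open>n = 0\<close> the whole top row is one part without propagation; otherwise the
  top dots from \<open>n\<close> on hang together.\<close>

definition tfix :: "nat => nat => diagram => bool" where
 "tfix r n d \<longleftrightarrow> d \<in> diagrams r \<and>
   (if n = 0 then \<forall>j\<in>{1..r}. \<forall>j'\<in>{1..r}. rel d (Top j) (Top j') \<and> \<not> rel d (Top j) (Bot j')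
   else \<forall>j\<in>{1..r}. rel d (Top j) (Top (min j n)))"

definition bfix :: "nat => nat => diagram => bool" where
 "bfix r l d = tfix r l (flip d)"

lemma tfix_diagram: "tfix r n d ==> d \<in> diagrams r"
 by (simp add: tfix_def)

lemma bfix_diagram: "bfix r n d ==> d \<in> diagrams r"
 by (simp add: bfix_def tfix_def)

lemma sat_composeD:
 assumes "x \<in> diagrams r" "y \<in> diagrams r" "a \<subseteq> {1..r}" "c \<subseteq> {1..r}"
 shows "sat (x ;; y) a c \<longleftrightarrow> (\<exists>b. b \<subseteq> {1..r} \<and> sat x a b \<and> sat y b c)"
proof -
 have "finite {b. b \<subseteq> {1..r} \<and> sat x a b \<and> sat y b c}" by (rule finite_subset[of _ "Pow {1..r}"]) auto
 hence "(\<exists>b. b \<subseteq> {1..r} \<and> sat x a b \<and> sat y b c) \<longleftrightarrow> card {b. b \<subseteq> {1..r} \<and> sat x a b \<and> sat y b c} \<noteq> 0"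
  by (auto simp: card_eq_0_iff)
 moreover have "sat (x ;; y) a c \<longleftrightarrow> card {b. b \<subseteq> {1..r} \<and> sat x a b \<and> sat y b c} \<noteq> 0"
  unfolding card_colourings[OF assms] by simp
 ultimately show ?thesis by blast
qed

text \<open>The part of a dot is the smallest compatible colour class containing it. So relations in
  a composite can be read off from its colourings, which are what is known about it.\<close>

lemma rel_iff_sat:
 assumes d: "d \<in> diagrams r"
 shows "j \<in> {1..r} ==> rel d (Top j) (Top j') \<longleftrightarrow> (\<forall>a c. a \<subseteq> {1..r} --> c \<subseteq> {1..r} --> sat d a c --> j \<in> a --> j' \<in> a)"
  and "j \<in> {1..r} ==> rel d (Top j) (Bot j') \<longleftrightarrow> (\<forall>a c. a \<subseteq> {1..r} --> c \<subseteq> {1..r} --> sat d a c --> j \<in> a --> j' \<in> c)"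
proof -
 assume j: "j \<in> {1..r}"
 let ?p = "part d (Top j)"
 have p: "?p \<in> d" "Top j \<in> ?p" using part[OF d, of "Top j"] j by auto
 note s = part_sat[OF d p(1)]
 show "rel d (Top j) (Top j') \<longleftrightarrow> (\<forall>a c. a \<subseteq> {1..r} --> c \<subseteq> {1..r} --> sat d a c --> j \<in> a --> j' \<in> a)"
 proof
  assume "\<forall>a c. a \<subseteq> {1..r} --> c \<subseteq> {1..r} --> sat d a c --> j \<in> a --> j' \<in> a"
  hence "Top j' \<in> ?p" using s p by blast
  thus "rel d (Top j) (Top j')" using p unfolding rel_def by blast
 qed (use sat_rel(1) in blast)
 show "rel d (Top j) (Bot j') \<longleftrightarrow> (\<forall>a c. a \<subseteq> {1..r} --> c \<subseteq> {1..r} --> sat d a c --> j \<in> a --> j' \<in> c)"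
 proof
  assume "\<forall>a c. a \<subseteq> {1..r} --> c \<subseteq> {1..r} --> sat d a c --> j \<in> a --> j' \<in> c"
  hence "Bot j' \<in> ?p" using s p by blast
  thus "rel d (Top j) (Bot j')" using p unfolding rel_def by blast
 qed (use sat_rel(3) in blast)
qed

lemma tfix_compose:
 assumes x: "x \<in> diagrams r" and y: "y \<in> diagrams r" and "tfix r n x"
 shows "tfix r n (x ;; y)"
proof -
 let ?z = "(x ;; y)"
 have z: "?z \<in> diagrams r" using x y by simp
 show ?thesis
 proof (cases "n = 0")
  case False
  have "rel ?z (Top j) (Top (min j n))" if j: "j \<in> {1..r}" for j
   unfolding rel_iff_sat(1)[OF z j]
  proof (intro allI impI)
   fix a c assume a: "a \<subseteq> {1..r}" and c: "c \<subseteq> {1..r}" and s: "sat ?z a c" and ja: "j \<in> a"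
   then obtain b where "sat x a b" unfolding sat_composeD[OF x y a c] by blast
   moreover have "rel x (Top j) (Top (min j n))" using assms False j by (simp add: tfix_def)
   ultimately show "min j n \<in> a" using sat_rel(1) ja by blast
  qed
  thus ?thesis using z False by (simp add: tfix_def)
 next
  case True
  have 1: "rel ?z (Top j) (Top j')" if j: "j \<in> {1..r}" "j' \<in> {1..r}" for j j'
   unfolding rel_iff_sat(1)[OF z j(1)]
  proof (intro allI impI)
   fix a c assume a: "a \<subseteq> {1..r}" and c: "c \<subseteq> {1..r}" and s: "sat ?z a c" and ja: "j \<in> a"
   then obtain b where "sat x a b" unfolding sat_composeD[OF x y a c] by blast
   moreover have "rel x (Top j) (Top j')" using assms True j by (simp add: tfix_def)
   ultimately show "j' \<in> a" using sat_rel(1) ja by blast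
  qed
  have 2: "\<not> rel ?z (Top j) (Bot j')" if j: "j \<in> {1..r}" "j' \<in> {1..r}" for j j'
  proof
   \<comment> \<open>The top row is one part of \<open>x\<close>. Colouring it alone is compatible
     with \<open>x\<close>, and the empty colouring continues it through \<open>y\<close>; hence no
     bottom dot of the composite is joined to it.\<close>
   have sx: "sat x {1..r} {}"
   proof -
    let ?p = "part x (Top j)"
    have p: "?p \<in> x" "Top j \<in> ?p" using part[OF x, of "Top j"] j by auto
    have "{k. Top k \<in> ?p} = {1..r}"
    proof -
     have "Top k \<in> ?p" if "k \<in> {1..r}" for k
     proof -
      have "rel x (Top j) (Top k)" using assms True j that by (simp add: tfix_def)
      thus ?thesis using part_eq_iff[OF x, of "Top j" "Top k"] part(2)[OF x, of "Top k"] j that by auto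
     qed
     thus ?thesis using part_sat(2)[OF x p(1)] by blast
    qed
    moreover have "{k. Bot k \<in> ?p} = {}"
    proof -
     have "Bot k \<notin> ?p" for k
     proof
      assume k: "Bot k \<in> ?p"
      hence "rel x (Top j) (Bot k)" "k \<in> {1..r}" using p part_sat(3)[OF x p(1)] unfolding rel_def by blast+
      thus False using assms True j by (simp add: tfix_def)
     qed
     thus ?thesis by blast
    qed
    ultimately show ?thesis using part_sat(1)[OF x p(1)] by simp
   qed
   hence "sat ?z {1..r} {}" unfolding sat_composeD[OF x y order_refl empty_subsetI] using sat_empty by blast
   moreover assume "rel ?z (Top j) (Bot j')"
   ultimately show False using sat_rel(3) j(1) by blast
  qed
  show ?thesis using z True 1 2 by (simp add: tfix_def)
 qed
qed

lemma bfix_compose: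
 assumes "x \<in> diagrams r" "y \<in> diagrams r" "bfix r n y"
 shows "bfix r n (x ;; y)"
proof -
 have "tfix r n ((flip y) ;; (flip x))" using assms by (intro tfix_compose) (auto simp: bfix_def)
 thus ?thesis using compose_flip[OF assms(1,2)] by (simp add: bfix_def)
qed

lemma tfix_pdiag:
 assumes "n \<le> r" shows "tfix r n (pdiag r n \<pi>)"
 using assms by (auto simp: tfix_def pdiag_def rel_lab)

lemma bfix_pdiag:
 assumes "n \<le> r" "\<pi> permutes {1..n}" shows "bfix r n (pdiag r n \<pi>)"
 unfolding bfix_def flip_pdiag[OF assms(2)] using assms by (intro tfix_pdiag)

lemma tfix_lab_form:
 assumes "tfix r n d" "n \<noteq> 0" "n \<le> r"
 shows "d = lab r (%j. part d (Top (min j n))) (%j. part d (Bot j))"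
proof -
 have d: "d \<in> diagrams r" using assms tfix_diagram by blast
 have "part d (Top (min j n)) = part d (Top j)" if "j \<in> {1..r}" for j
  using that assms part_eq_iff[OF d, of "Top j" "Top (min j n)"] by (auto simp: tfix_def min_def)
 hence "lab r (%j. part d (Top (min j n))) (%j. part d (Bot j)) = lab r (%j. part d (Top j)) (%j. part d (Bot j))"
  by (intro lab_cong) auto
 thus ?thesis using diagram_eq_lab[OF d] by simp
qed

lemma min_image:
 assumes "n \<noteq> 0" "n \<le> (r :: nat)" shows "(%j. min j n) ` {1..r} = {1..n}"
proof (intro equalityI subsetI)
 fix i assume "i \<in> {1..n}"
 thus "i \<in> (%j. min j n) ` {1..r}" using assms by (intro image_eqI[of _ _ i]) auto
qed (use assms in auto)

lemma pdiag_compose_lab: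
 assumes "n \<noteq> 0" "n \<le> r" "\<pi> permutes {1..n}"
 shows "((pdiag r n \<pi>) ;; (lab r (%j. u (min j n)) w)) = lab r (%j. u (\<pi> (min j n))) w \<and>
  cc (pdiag r n \<pi>) (lab r (%j. u (min j n)) w) = 0"
proof -
 note img = min_image[OF assms(1,2)]
 have in_img: "\<pi> (min j n) \<in> (%j. min j n) ` {1..r}" if "j \<in> {1..r}" for j
  unfolding img using assms that permutes_in_image[OF assms(3), of "min j n"] by auto
 have "((lab r (%j. \<pi> (min j n)) (%j. min j n)) ;; (lab r (%j. u (min j n)) w)) = lab r (%j. u (\<pi> (min j n))) w \<and>
  cc (lab r (%j. \<pi> (min j n)) (%j. min j n)) (lab r (%j. u (min j n)) w) = 0"
 proof (rule compose_lab_glue)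
  fix j assume j: "j \<in> {1..r}"
  let ?i = "pinv \<pi> (min j n)"
  have i: "?i \<in> {1..n}" using permutes_in_image[OF permutes_inv[OF assms(3)], of "min j n"] j assms by auto
  have "min j n = \<pi> (min ?i n)" using i permutes_inverses(1)[OF assms(3)] by (simp add: min_absorb1)
  thus "u (min j n) \<in> w ` {1..r} \<union> u ` (%j. \<pi> (min j n)) ` {1..r}"
   using i assms(2) by (intro UnI2 imageI image_eqI[of _ "%j. \<pi> (min j n)" ?i]) auto
 qed (use in_img in blast)+
 thus ?thesis using assms by (simp add: pdiag_def)
qed

text \<open>For \<open>n = 0\<close> the middle row is cut off and forms one closed component. For
  \<open>n > 0\<close> every middle dot is joined to an outer dot, so nothing is closed and only the
  top labels are permuted.\<close>

lemma pdiag_compose_tfix: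
 assumes "tfix r n d" "n \<le> r" "\<pi> permutes {1..n}" "r \<ge> 1"
 shows "cc (pdiag r n \<pi>) d = (if n = 0 then 1 else 0)"
  and "n \<noteq> 0 ==> ((pdiag r n \<pi>) ;; d) = lab r (%j. part d (Top (\<pi> (min j n)))) (%j. part d (Bot j))"
  and "\<pi> = id ==> ((pdiag r n \<pi>) ;; d) = d"
  and "n = 0 ==> ((pdiag r n \<pi>) ;; d) = d"
proof -
 have d: "d \<in> diagrams r" using assms tfix_diagram by blast
 { assume n: "n \<noteq> 0"
  note * = pdiag_compose_lab[OF n assms(2,3), of "%j. part d (Top j)" "%j. part d (Bot j)", folded tfix_lab_form[OF assms(1) n assms(2)]]
  thus "((pdiag r n \<pi>) ;; d) = lab r (%j. part d (Top (\<pi> (min j n)))) (%j. part d (Bot j))" by simp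
  from * n have "cc (pdiag r n \<pi>) d = (if n = 0 then 1 else 0)" by simp
  moreover have "\<pi> = id --> ((pdiag r n \<pi>) ;; d) = d" using * tfix_lab_form[OF assms(1) n assms(2)] by auto
  moreover note calculation }
 note pos = this
 { assume n: "n = 0"
  define t0 where "t0 = part d (Top 1)"
  have one: "1 \<in> {1..r}" using assms(4) by simp
  have eq: "part d (Top j) = t0" if j: "j \<in> {1..r}" for j
  proof -
   have "rel d (Top j) (Top 1)" using assms(1) n j one unfolding tfix_def by auto
   thus ?thesis unfolding t0_def using part_eq_iff[OF d, of "Top j" "Top 1"] j one by blast
  qed
  have ne: "part d (Bot j) \<noteq> t0" if j: "j \<in> {1..r}" for j
  proof -
   have "\<not> rel d (Top 1) (Bot j)" using assms(1) n j one unfolding tfix_def by auto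
   thus ?thesis unfolding t0_def using part_eq_iff[OF d, of "Top 1" "Bot j"] j one by auto
  qed
  have dl: "d = lab r (%_. t0) (%j. part d (Bot j))"
   using diagram_eq_lab[OF d] lab_cong[of r "%j. part d (Top j)" "%_. t0"] eq by auto
  have "((lab r (%_. 0::nat) (%_. 1)) ;; (lab r (%_. t0) (%j. part d (Bot j)))) = lab r (%j. Inl (0::nat)) (%j. Inr (part d (Bot j))) \<and>
    cc (lab r (%_. 0::nat) (%_. 1)) (lab r (%_. t0) (%j. part d (Bot j))) = 1"
   by (rule compose_lab_cut) (use assms(4) ne in auto)
  moreover have "lab r (%j. Inl (0::nat)) (%j. Inr (part d (Bot j))) = lab r (%_. t0) (%j. part d (Bot j))"
   unfolding lab_eq_iff using ne[THEN not_sym] by simp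
  ultimately have "((lab r (%_. 0::nat) (%_. 1)) ;; d) = d \<and> cc (lab r (%_. 0::nat) (%_. 1)) d = 1"
   unfolding dl[symmetric] by simp
  hence "cc (pdiag r n \<pi>) d = 1 \<and> ((pdiag r n \<pi>) ;; d) = d"
   using n by (simp add: pdiag_def) }
 note zero = this
 show "cc (pdiag r n \<pi>) d = (if n = 0 then 1 else 0)" using pos zero by (cases "n = 0") auto
 show "\<pi> = id ==> ((pdiag r n \<pi>) ;; d) = d" using pos zero by (cases "n = 0") auto
 show "n = 0 ==> ((pdiag r n \<pi>) ;; d) = d" using zero by auto
qed

lemma bfix_compose_pdiag:
 assumes "bfix r l d" "l \<le> r" "\<pi> permutes {1..l}" "r \<ge> 1"
 shows "cc d (pdiag r l \<pi>) = (if l = 0 then 1 else 0)"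
  and "l \<noteq> 0 ==> (d ;; (pdiag r l \<pi>)) = lab r (%j. part d (Top j)) (%j. part d (Bot (pinv \<pi> (min j l))))"
  and "\<pi> = id ==> (d ;; (pdiag r l \<pi>)) = d"
  and "l = 0 ==> (d ;; (pdiag r l \<pi>)) = d"
proof -
 have d: "d \<in> diagrams r" using assms bfix_diagram by blast
 have t: "tfix r l (flip d)" using assms by (simp add: bfix_def)
 have c: "((pdiag r l (pinv \<pi>)) ;; (flip d)) = flip (d ;; (pdiag r l \<pi>))"
  "cc (pdiag r l (pinv \<pi>)) (flip d) = cc d (pdiag r l \<pi>)"
  using compose_flip[OF d pdiag_in_diagrams, of l \<pi>] flip_pdiag[OF assms(3)] by auto
 have c': "(d ;; (pdiag r l \<pi>)) = flip ((pdiag r l (pinv \<pi>)) ;; (flip d))"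
  unfolding c(1) by simp
 note P = pdiag_compose_tfix[OF t assms(2) permutes_inv[OF assms(3)] assms(4)]
 show "cc d (pdiag r l \<pi>) = (if l = 0 then 1 else 0)" using P(1) c by simp
 show "\<pi> = id ==> (d ;; (pdiag r l \<pi>)) = d" using P(3) c' by simp
 show "l = 0 ==> (d ;; (pdiag r l \<pi>)) = d" using P(4) c' by simp
 assume l: "l \<noteq> 0"
 have inr: "pinv \<pi> (min j l) \<in> {1..r}" if "j \<in> {1..r}" for j
  using permutes_in_image[OF permutes_inv[OF assms(3)], of "min j l"] that assms l by auto
 have f: "flip d \<in> diagrams r" using d by simp
 show "(d ;; (pdiag r l \<pi>)) = lab r (%j. part d (Top j)) (%j. part d (Bot (pinv \<pi> (min j l))))"
  unfolding c' P(2)[OF l] flip_lab lab_eq_iff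
 proof (intro ballI conjI)
  fix j j' assume j: "j \<in> {1..r}" "j' \<in> {1..r}"
  note i = inr[OF j(1)] inr[OF j(2)]
  show "(part (flip d) (Bot j) = part (flip d) (Bot j')) = (part d (Top j) = part d (Top j'))"
   using j part_eq_iff[OF f, of "Bot j" "Bot j'"] part_eq_iff[OF d, of "Top j" "Top j'"] by (simp add: rel_flip)
  show "(part (flip d) (Top (pinv \<pi> (min j l))) = part (flip d) (Top (pinv \<pi> (min j' l)))) =
   (part d (Bot (pinv \<pi> (min j l))) = part d (Bot (pinv \<pi> (min j' l))))"
   using i part_eq_iff[OF f, of "Top (pinv \<pi> (min j l))" "Top (pinv \<pi> (min j' l))"] part_eq_iff[OF d, of "Bot (pinv \<pi> (min j l))" "Bot (pinv \<pi> (min j' l))"] by (simp add: rel_flip)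
  show "(part (flip d) (Bot j) = part (flip d) (Top (pinv \<pi> (min j' l)))) = (part d (Top j) = part d (Bot (pinv \<pi> (min j' l))))"
   using j i part_eq_iff[OF f, of "Bot j" "Top (pinv \<pi> (min j' l))"] part_eq_iff[OF d, of "Top j" "Bot (pinv \<pi> (min j' l))"] by (simp add: rel_flip)
 qed
qed

lemma pdiag_compose_pdiag:
 assumes "n \<le> r" "\<pi> permutes {1..n}" "\<sigma> permutes {1..n}" "r \<ge> 1"
 shows "((pdiag r n \<pi>) ;; (pdiag r n \<sigma>)) = pdiag r n (\<sigma> \<circ> \<pi>)"
proof (cases "n = 0")
 case True
 thus ?thesis using pdiag_compose_tfix(4)[OF tfix_pdiag[OF assms(1)] assms(1,2,4) True] by (simp add: pdiag_def)
next
 case False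
 from pdiag_compose_lab[OF False assms(1,2), of \<sigma> "%j. min j n"] False show ?thesis
  by (simp add: pdiag_def)
qed

section \<open>Propagating parts and factorisation through fewer dots\<close>

definition nondeg :: "nat => nat => diagram => bool" where
 "nondeg r n d \<longleftrightarrow> (\<forall>i\<in>{1..n}. (\<exists>j\<in>{1..r}. rel d (Top i) (Bot j)) \<and> (\<forall>i'\<in>{1..n}. rel d (Top i) (Top i') --> i = i'))"

text \<open>Suppose the first \<open>n\<close> top dots lie in distinct propagating parts. Each set
  \<open>s\<close> of them gives a compatible colouring with classes \<open>T s\<close> and
  \<open>B s\<close>, which a factorisation through \<open>m\<close> dots extends to a middle
  colouring \<open>b s\<close>. If two sets had the same middle colouring, their halves could be
  interchanged, and propagation would force the sets to be equal. Hence
  \<open>2 ^ n \<le> 2 ^ m\<close>, against \<open>m < n\<close>.\<close>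

lemma not_nondeg_of_small:
 assumes x: "x \<in> diagrams r" and y: "y \<in> diagrams r" and mn: "m < n" and n: "n \<le> r"
  and d: "d = ((x ;; (pdiag r m id)) ;; y)"
 shows "\<not> nondeg r n d"
proof
 assume nd: "nondeg r n d"
 let ?x = "(x ;; (pdiag r m id))"
 have x': "?x \<in> diagrams r" using x by simp
 have dd: "d \<in> diagrams r" using d x y by simp
 have bx: "bfix r m ?x" by (rule bfix_compose) (use x mn n permutes_id bfix_pdiag in auto)
 define T where "T s = (\<Union>i\<in>s. {j. Top j \<in> part d (Top i)})" for s
 define B where "B s = (\<Union>i\<in>s. {j. Bot j \<in> part d (Top i)})" for s
 have pd: "part d (Top i) \<in> d" "Top i \<in> part d (Top i)" if "i \<in> {1..n}" for i
  using part[OF dd, of "Top i"] that n by auto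
 have sub: "T s \<subseteq> {1..r}" "B s \<subseteq> {1..r}" if "s \<subseteq> {1..n}" for s
  using part_sat(2,3)[OF dd pd(1)] that unfolding T_def B_def by blast+
 have sT: "sat d (T s) (B s)" if s: "s \<subseteq> {1..n}" for s
  unfolding sat_def
 proof
  fix p assume p: "p \<in> d"
  have eq: "Top ` T s \<union> Bot ` B s = (\<Union>i\<in>s. part d (Top i))"
  proof -
   have "part d (Top i) \<subseteq> outer r" if "i \<in> s" for i
    using diagramD(1)[OF dd] pd(1)[of i] that s by blast
   hence nomid: "Mid k \<notin> part d (Top i)" if "i \<in> s" for i k using that by blast
   have "v \<in> Top ` T s \<union> Bot ` B s \<longleftrightarrow> v \<in> (\<Union>i\<in>s. part d (Top i))" for v
    using nomid unfolding T_def B_def by (cases v) auto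
   thus ?thesis by blast
  qed
  show "p \<subseteq> Top ` T s \<union> Bot ` B s \<or> p \<inter> (Top ` T s \<union> Bot ` B s) = {}"
  proof (cases "\<exists>i\<in>s. p = part d (Top i)")
   case True thus ?thesis unfolding eq by blast
  next
   case False
   have "p \<inter> part d (Top i) = {}" if "i \<in> s" for i
    using diagramD(3)[OF dd p pd(1)[of i]] False that s by blast
   thus ?thesis unfolding eq by blast
  qed
 qed
 \<comment> \<open>The part of a top dot in \<open>s\<close> propagates to the bottom row, where
   only parts indexed by \<open>t\<close> are coloured; as the parts are distinct, the dot itself
   lies in \<open>t\<close>.\<close>
 have cross: "s \<subseteq> t" if st: "s \<subseteq> {1..n}" "t \<subseteq> {1..n}" "sat d (T s) (B t)" for s t
 proof
  fix i assume i: "i \<in> s"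
  hence i': "i \<in> {1..n}" using st by blast
  then obtain j where j: "j \<in> {1..r}" "rel d (Top i) (Bot j)" using nd unfolding nondeg_def by blast
  have "i \<in> T s" using i pd(2)[OF i'] unfolding T_def by blast
  hence "j \<in> B t" using sat_rel(3)[OF st(3) j(2)] by blast
  then obtain k where k: "k \<in> t" "Bot j \<in> part d (Top k)" unfolding B_def by blast
  have k': "k \<in> {1..n}" using k st by blast
  have "part d (Top i) = part d (Top k)"
   using part_eq[OF dd pd(1)[OF k'] k(2)] part_eq_iff[OF dd, of "Top i" "Bot j"] j i' n by auto
  hence "rel d (Top i) (Top k)" using part_eq_iff[OF dd, of "Top i" "Top k"] i' k' n by auto
  thus "i \<in> t" using nd i' k' k(1) unfolding nondeg_def by blast
 qed
 have "\<exists>b. b \<subseteq> {1..r} \<and> sat ?x (T s) b \<and> sat y b (B s)" if s: "s \<subseteq> {1..n}" for s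
  using sT[OF s] sat_composeD[OF x' y sub[OF s]] unfolding d by blast
 then obtain b where b: "b s \<subseteq> {1..r}" "sat ?x (T s) (b s)" "sat y (b s) (B s)" if "s \<subseteq> {1..n}" for s
  by metis
 have dsat: "sat d (T s) (B t)" if "s \<subseteq> {1..n}" "t \<subseteq> {1..n}" "sat ?x (T s) (b t)" for s t
  unfolding d sat_composeD[OF x' y sub(1)[OF that(1)] sub(2)[OF that(2)]]
  using b(1,3)[OF that(2)] that(3) by metis
 show False
 proof (cases "m = 0")
  case True
  text \<open>Here the middle row of dots is one non-propagating part, so colourings of the two halves can be combined freely.\<close>
  have "sat ?x (T {1}) {}"
   unfolding sat_def
  proof
   fix p assume p: "p \<in> ?x"
   have "p \<subseteq> Top ` T {1} \<union> Bot ` b {1} \<or> p \<inter> (Top ` T {1} \<union> Bot ` b {1}) = {}"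
    using b(2)[of "{1}"] mn p unfolding sat_def by auto
   moreover have "p \<inter> range Top = {} \<or> p \<inter> range Bot = {}"
   proof (rule ccontr)
    assume "\<not> (p \<inter> range Top = {} \<or> p \<inter> range Bot = {})"
    then obtain j j' where jj: "Top j \<in> p" "Bot j' \<in> p" by blast
    hence "rel ?x (Top j) (Bot j')" "j \<in> {1..r}" "j' \<in> {1..r}" using p part_sat(2,3)[OF x' p] unfolding rel_def by blast+
    moreover have "\<not> rel (flip ?x) (Top j') (Bot j)" using bx True \<open>j \<in> {1..r}\<close> \<open>j' \<in> {1..r}\<close> by (simp add: bfix_def tfix_def)
    ultimately show False by (simp add: rel_flip rel_sym[of _ "Bot _" "Top _"])
   qed
   ultimately consider "p \<inter> (Top ` T {1} \<union> Bot ` b {1}) = {}" | "p \<inter> range Top = {}"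
    | "p \<subseteq> Top ` T {1} \<union> Bot ` b {1}" "p \<inter> range Bot = {}" by blast
   thus "p \<subseteq> Top ` T {1} \<union> Bot ` {} \<or> p \<inter> (Top ` T {1} \<union> Bot ` {}) = {}"
    by cases blast+
  qed
  moreover have "sat y {} (B {})" by (simp add: B_def)
  ultimately have "sat d (T {1}) (B {})"
   unfolding d using sat_composeD[OF x' y, of "T {1}" "B {}"] sub[of "{1}"] sub(2)[of "{}"] mn by auto
  thus False using cross[of "{1}" "{}"] mn by auto
 next
  case False
  \<comment> \<open>In \<open>?x\<close> the bottom dot \<open>j\<close> is joined to
    \<open>min j m\<close>, so a middle colouring is known from the first \<open>m\<close>
    dots.\<close>
  have inj: "inj_on (%s. b s \<inter> {1..m}) (Pow {1..n})"
  proof (rule inj_onI)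
   fix s t assume st: "s \<in> Pow {1..n}" "t \<in> Pow {1..n}" "b s \<inter> {1..m} = b t \<inter> {1..m}"
   have mem: "j \<in> b s \<longleftrightarrow> min j m \<in> b s" if "s \<in> Pow {1..n}" "j \<in> {1..r}" for s j
   proof -
    have "rel (flip ?x) (Top j) (Top (min j m))" using bx False that by (simp add: bfix_def tfix_def)
    hence "rel ?x (Bot j) (Bot (min j m))" by (simp add: rel_flip)
    thus ?thesis using sat_rel(2)[OF b(2)] that by blast
   qed
   have "j \<in> b s \<longleftrightarrow> j \<in> b t" if j: "j \<in> {1..r}" for j
   proof -
    have "min j m \<in> {1..m}" using j False by auto
    thus ?thesis using mem[OF st(1) j] mem[OF st(2) j] st(3) by blast
   qed
   hence e: "b s = b t" using b(1) st by blast
   have "s \<subseteq> t" using cross dsat[of s t] b(2)[of s] st e by auto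
   moreover have "t \<subseteq> s" using cross dsat[of t s] b(2)[of t] st e by auto
   ultimately show "s = t" by blast
  qed
  hence "card (Pow {1..n}) \<le> card (Pow {1..m})"
   by (rule card_inj_on_le) auto
  thus False using mn by (simp add: card_Pow)
 qed
qed

text \<open>Among the parts of the first \<open>Suc m\<close> top dots at most \<open>m\<close>
  reach the bottom row, because one of these dots does not propagate or shares its part with
  another. The parts that do, collected in \<open>P\<close>, can be led through separate blocks of a
  middle row with \<open>m\<close> blocks.\<close>

lemma small_factorisation:
 assumes d: "tfix r (Suc m) d" and nd: "\<not> nondeg r (Suc m) d" and m: "Suc m \<le> r"
 shows "\<exists>a\<in>diagrams r. \<exists>b\<in>diagrams r. d = ((a ;; (pdiag r m id)) ;; b)"
proof -
 have dd: "d \<in> diagrams r" using d tfix_diagram by blast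
 define t where "t j = part d (Top (min j (Suc m)))" for j
 define w where "w j = part d (Bot j)" for j
 have dl: "d = lab r t w" unfolding t_def w_def by (rule tfix_lab_form[OF d]) (use m in auto)
 define P where "P = t ` {1..Suc m} \<inter> w ` {1..r}"
 have timg: "t j \<in> t ` {1..Suc m}" if "j \<in> {1..r}" for j
  using that by (intro image_eqI[of _ _ "min j (Suc m)"]) (auto simp: t_def)
 have cardP: "card P \<le> m"
 proof -
  from nd obtain i where i: "i \<in> {1..Suc m}" and
   "(\<forall>j\<in>{1..r}. \<not> rel d (Top i) (Bot j)) \<or> (\<exists>i'\<in>{1..Suc m}. rel d (Top i) (Top i') \<and> i \<noteq> i')"
   unfolding nondeg_def by blast
  hence "P \<subseteq> t ` ({1..Suc m} - {i})"
  proof (elim disjE)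
   assume a: "\<forall>j\<in>{1..r}. \<not> rel d (Top i) (Bot j)"
   have "t i \<notin> w ` {1..r}"
   proof
    assume "t i \<in> w ` {1..r}"
    then obtain j where "j \<in> {1..r}" "part d (Top i) = part d (Bot j)" using i by (auto simp: t_def w_def)
    thus False using a part_eq_iff[OF dd, of "Top i" "Bot j"] i m by auto
   qed
   thus ?thesis unfolding P_def by blast
  next
   assume "\<exists>i'\<in>{1..Suc m}. rel d (Top i) (Top i') \<and> i \<noteq> i'"
   then obtain i' where i': "i' \<in> {1..Suc m}" "rel d (Top i) (Top i')" "i \<noteq> i'" by blast
   hence "t i = t i'" using i m part_eq_iff[OF dd, of "Top i" "Top i'"] by (auto simp: t_def)
   hence "t k \<in> t ` ({1..Suc m} - {i})" if "k \<in> {1..Suc m}" for k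
    using i' that by (cases "k = i") auto
   thus ?thesis unfolding P_def by blast
  qed
  hence "card P \<le> card ({1..Suc m} - {i})" by (meson finite_Diff finite_atLeastAtMost surj_card_le)
  thus ?thesis using i by simp
 qed
 have finP: "finite P" by (simp add: P_def)
 show ?thesis
 proof (cases "P = {}")
  case True
  \<comment> \<open>Nothing propagates, so the two halves meet in a single middle part, labelled
    \<open>None\<close>, that is joined to no outer dot.\<close>
  let ?a = "lab r (%j. Some (t j)) (%_. None)" and ?b = "lab r (%_. None) (%j. Some (w j))"
  have "bfix r m ?a" using m by (auto simp: bfix_def tfix_def rel_lab)
  hence a: "(?a ;; (pdiag r m id)) = ?a"
   by (rule bfix_compose_pdiag(3)) (use m permutes_id in auto)
  have "(?a ;; ?b) = lab r (%j. Inl (Some (t j))) (%j. Inr (Some (w j)))"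
   by (rule compose_lab_cut[THEN conjunct1]) (use m in auto)
  also have "\<dots> = lab r t w"
   unfolding lab_eq_iff using True timg unfolding P_def by fastforce
  finally have "((?a ;; (pdiag r m id)) ;; ?b) = d" using a dl by simp
  thus ?thesis by (metis lab_in_diagrams)
 next
  case False
  hence m0: "m \<noteq> 0" using cardP finP by auto
  obtain h where h: "inj_on h P" "h ` P \<subseteq> {1..m}"
   using card_le_inj[OF finP, of "{1..m}"] cardP by auto
  obtain p0 where p0: "p0 \<in> P" using False by blast
  define g where "g i = (if i \<in> h ` P then inv_into P h i else p0)" for i
  have gh: "g (h p) = p" if "p \<in> P" for p using that h(1) by (simp add: g_def)
  have gP: "g i \<in> P" for i using p0 by (simp add: g_def inv_into_into)
  define G where "G x = (case x of Inl i => g i | Inr p => p)" for x :: "nat + dot set"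
  define u where "u j = (if t j \<in> P then Inl (h (t j)) else Inr (t j))" for j
  define v where "v j = (Inl (min j m) :: nat + dot set)" for j
  have vimg: "v ` {1..r} = Inl ` {1..m}"
  proof (intro equalityI subsetI)
   fix x :: "nat + dot set" assume "x \<in> Inl ` {1..m}"
   then obtain i where "x = Inl i" "i \<in> {1..m}" by blast
   thus "x \<in> v ` {1..r}" using m by (intro image_eqI[of _ _ i]) (auto simp: v_def)
  qed (use m0 in \<open>auto simp: v_def\<close>)
  have Gu: "G (u j) = t j" for j using gh by (simp add: G_def u_def)
  have Gv: "G (v j) = g (min j m)" for j by (simp add: G_def v_def)
  have uv: "u j \<notin> v ` {1..r} \<longleftrightarrow> t j \<notin> P" for j unfolding vimg using h(2) by (auto simp: u_def)
  let ?a = "lab r u v" and ?b = "lab r (%j. G (v j)) w"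
  have "bfix r m ?a" using m m0 by (auto simp: bfix_def tfix_def rel_lab v_def)
  hence a: "(?a ;; (pdiag r m id)) = ?a"
   by (rule bfix_compose_pdiag(3)) (use m permutes_id in auto)
  have "(?a ;; ?b) = lab r (%j. G (u j)) w"
  proof (rule compose_lab_glue[THEN conjunct1])
   fix j assume j: "j \<in> {1..r}" and "u j \<notin> v ` {1..r}"
   hence "t j \<notin> P" using uv by blast
   hence "t j \<notin> w ` {1..r}" using timg[OF j] unfolding P_def by blast
   moreover have "G ` v ` {1..r} \<subseteq> P" using gP by (auto simp: Gv)
   ultimately show "G (u j) \<notin> G ` v ` {1..r} \<union> w ` {1..r}" using \<open>t j \<notin> P\<close> unfolding Gu by blast
  next
   fix j j' assume "u j \<notin> v ` {1..r}" "u j' \<notin> v ` {1..r}" "G (u j) = G (u j')"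
   thus "u j = u j'" unfolding Gu by (simp add: u_def)
  next
   fix j show "G (v j) \<in> w ` {1..r} \<union> G ` u ` {1..r}"
    using gP[of "min j m"] unfolding Gv P_def by blast
  qed
  hence "((?a ;; (pdiag r m id)) ;; ?b) = d" using a dl Gu by simp
  thus ?thesis by (metis lab_in_diagrams)
 qed
qed

section \<open>Young subgroups and orbit types of diagrams\<close>

lemma card_permutes_vimage:
 assumes "\<pi> permutes A"
 shows "card {j\<in>A. Q (\<pi> j)} = card {j\<in>A. Q j}"
proof -
 have "bij_betw \<pi> {j\<in>A. Q (\<pi> j)} {j\<in>A. Q j}"
  using permutes_in_image[OF assms] permutes_inverses[OF assms] permutes_in_image[OF permutes_inv[OF assms]]
  by (intro bij_betw_byWitness[where f' = "pinv \<pi>"]) auto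
 thus ?thesis by (rule bij_betw_same_card)
qed

definition blk :: "nat list => nat => nat" where
 "blk \<mu> j = (LEAST i. j \<le> sum_list (take (Suc i) \<mu>))"

lemma sum_list_take_mono:
 fixes \<mu> :: "nat list"
 shows "i \<le> k ==> sum_list (take i \<mu>) \<le> sum_list (take k \<mu>)"
proof -
 assume "i \<le> k"
 hence "take k \<mu> = take i \<mu> @ take (k - i) (drop i \<mu>)" by (metis le_add_diff_inverse take_add)
 thus ?thesis by simp
qed

lemma blk_le_iff:
 assumes "j \<in> {1..sum_list \<mu>}"
 shows "blk \<mu> j \<le> i \<longleftrightarrow> j \<le> sum_list (take (Suc i) \<mu>)"
proof
 have ex: "j \<le> sum_list (take (Suc (length \<mu>)) \<mu>)" using assms by simp
 show "j \<le> sum_list (take (Suc i) \<mu>)" if "blk \<mu> j \<le> i"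
 proof -
  have "j \<le> sum_list (take (Suc (blk \<mu> j)) \<mu>)"
   unfolding blk_def using ex by (rule LeastI)
  also have "\<dots> \<le> sum_list (take (Suc i) \<mu>)" using that by (intro sum_list_take_mono) simp
  finally show ?thesis .
 qed
 show "blk \<mu> j \<le> i" if "j \<le> sum_list (take (Suc i) \<mu>)"
  unfolding blk_def using that by (rule Least_le)
qed

lemma blk_eq_iff:
 assumes "j \<in> {1..sum_list \<mu>}"
 shows "blk \<mu> j = i \<longleftrightarrow> j \<in> {sum_list (take i \<mu>) <.. sum_list (take (Suc i) \<mu>)}"
proof (cases i)
 case 0
 thus ?thesis using blk_le_iff[OF assms, of 0] assms by auto
next
 case (Suc k)
 have "blk \<mu> j = i \<longleftrightarrow> blk \<mu> j \<le> i \<and> \<not> blk \<mu> j \<le> k" using Suc by auto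
 thus ?thesis unfolding blk_le_iff[OF assms] using Suc by auto
qed

lemma blk_less:
 assumes "j \<in> {1..sum_list \<mu>}"
 shows "blk \<mu> j < length \<mu>"
proof -
 have "length \<mu> \<noteq> 0" using assms by auto
 hence "blk \<mu> j \<le> length \<mu> - 1" using blk_le_iff[OF assms, of "length \<mu> - 1"] assms by simp
 thus ?thesis using \<open>length \<mu> \<noteq> 0\<close> by linarith
qed

lemma block_eq:
 assumes "i < length \<mu>"
 shows "{sum_list (take i \<mu>) <.. sum_list (take (Suc i) \<mu>)} = {j\<in>{1..sum_list \<mu>}. blk \<mu> j = i}"
proof -
 have "sum_list (take (Suc i) \<mu>) \<le> sum_list \<mu>" using sum_list_take_mono[of "Suc i" "length \<mu>" \<mu>] assms by simp
 hence "j \<in> {1..sum_list \<mu>}" if "j \<in> {sum_list (take i \<mu>) <.. sum_list (take (Suc i) \<mu>)}" for j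
  using that by auto
 thus ?thesis using blk_eq_iff[of _ \<mu> i] by blast
qed

lemma card_block:
 assumes "i < length \<mu>"
 shows "card {j\<in>{1..sum_list \<mu>}. blk \<mu> j = i} = \<mu> ! i"
 unfolding block_eq[OF assms, symmetric] using assms by (simp add: take_Suc_conv_app_nth)

text \<open>A permutation mapping a finite block into itself maps it onto itself, so the Young
  subgroup is the stabiliser of the function \<open>blk \<mu>\<close>.\<close>

lemma young_subgroup_iff:
 "\<pi> \<in> young_subgroup \<mu> \<longleftrightarrow> \<pi> permutes {1..sum_list \<mu>} \<and>
   (\<forall>j\<in>{1..sum_list \<mu>}. blk \<mu> (\<pi> j) = blk \<mu> j)"
proof -
 have "(\<forall>i<length \<mu>. \<pi> ` {j\<in>{1..sum_list \<mu>}. blk \<mu> j = i} = {j\<in>{1..sum_list \<mu>}. blk \<mu> j = i}) \<longleftrightarrow>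
   (\<forall>j\<in>{1..sum_list \<mu>}. blk \<mu> (\<pi> j) = blk \<mu> j)" if p: "\<pi> permutes {1..sum_list \<mu>}"
 proof
  assume L: "\<forall>i<length \<mu>. \<pi> ` {j\<in>{1..sum_list \<mu>}. blk \<mu> j = i} = {j\<in>{1..sum_list \<mu>}. blk \<mu> j = i}"
  show "\<forall>j\<in>{1..sum_list \<mu>}. blk \<mu> (\<pi> j) = blk \<mu> j"
  proof
   fix j assume j: "j \<in> {1..sum_list \<mu>}"
   hence "\<pi> j \<in> \<pi> ` {k\<in>{1..sum_list \<mu>}. blk \<mu> k = blk \<mu> j}" by blast
   thus "blk \<mu> (\<pi> j) = blk \<mu> j" using L blk_less[OF j] by blast
  qed
 next
  assume R: "\<forall>j\<in>{1..sum_list \<mu>}. blk \<mu> (\<pi> j) = blk \<mu> j"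
  show "\<forall>i<length \<mu>. \<pi> ` {j\<in>{1..sum_list \<mu>}. blk \<mu> j = i} = {j\<in>{1..sum_list \<mu>}. blk \<mu> j = i}"
  proof (intro allI impI)
   fix i
   let ?B = "{j\<in>{1..sum_list \<mu>}. blk \<mu> j = i}"
   have "\<pi> ` ?B \<subseteq> ?B"
   proof
    fix x assume "x \<in> \<pi> ` ?B"
    then obtain j where j: "j \<in> {1..sum_list \<mu>}" "blk \<mu> j = i" "x = \<pi> j" by blast
    hence "\<pi> j \<in> {1..sum_list \<mu>}" using permutes_in_image[OF p] by blast
    thus "x \<in> ?B" using R j by simp
   qed
   moreover have "card (\<pi> ` ?B) = card ?B" using p by (intro card_image) (meson inj_on_subset permutes_inj subset_UNIV)
   ultimately show "\<pi> ` ?B = ?B" by (intro card_subset_eq) auto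
  qed
 qed
 thus ?thesis unfolding young_subgroup_def Sym_def Let_def mem_Collect_eq
  using block_eq[of _ \<mu>] by auto
qed

text \<open>Only the first \<open>sum_list \<mu>\<close> bottom dots are counted: in the diagrams
  concerned the remaining ones are joined to the last of these or, if this number is 0, form a
  single part.\<close>

definition part_type :: "nat list => dot set => nat list" where
 "part_type \<mu> p = map (%k. card {j\<in>{1..sum_list \<mu>}. blk \<mu> j = k \<and> Bot j \<in> p}) [0..<length \<mu>]"

definition label_type :: "nat list => (nat => 'a) => 'a => nat list" where
 "label_type \<mu> w x = map (%k. card {j\<in>{1..sum_list \<mu>}. blk \<mu> j = k \<and> w j = x}) [0..<length \<mu>]"

text \<open>The parts through the top dots are ordered by these dots, while the parts inside the
  bottom row have no order; hence a word together with a multiset. The word is an extensional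
  function, so that equality of types means equality on \<open>{1..n}\<close>.\<close>

definition diagram_type :: "nat => nat list => diagram => (nat => nat list) \<times> nat list multiset" where
 "diagram_type n \<mu> d = (\<lambda>i\<in>{1..n}. part_type \<mu> (part d (Top i)),
   image_mset (part_type \<mu>) (mset_set {p\<in>d. p \<inter> range Top = {}}))"

lemma diagram_type_lab:
 assumes "sum_list \<mu> \<le> r" "n \<le> r"
 shows "diagram_type n \<mu> (lab r u w) =
  (\<lambda>i\<in>{1..n}. label_type \<mu> w (u i), image_mset (label_type \<mu> w) (mset_set (w ` {1..r} - u ` {1..r})))"
proof -
 define fib where "fib i = Top ` {j\<in>{1..r}. u j = i} \<union> Bot ` {j\<in>{1..r}. w j = i}" for i
 have lab: "lab r u w = fib ` (u ` {1..r} \<union> w ` {1..r})" by (simp add: lab_def fib_def)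
 have ty: "part_type \<mu> (fib x) = label_type \<mu> w x" for x
  unfolding part_type_def label_type_def using assms(1)
  by (intro map_cong refl arg_cong[where f = card]) (auto simp: fib_def)
 have "part (lab r u w) (Top i) = fib (u i)" if "i \<in> {1..n}" for i
  by (rule part_eq[OF lab_in_diagrams]) (use that assms(2) in \<open>auto simp: lab fib_def\<close>)
 hence 1: "(\<lambda>i\<in>{1..n}. part_type \<mu> (part (lab r u w) (Top i))) = (\<lambda>i\<in>{1..n}. label_type \<mu> w (u i))"
  using ty by (intro restrict_ext) simp
 have notop: "fib x \<inter> range Top = {} \<longleftrightarrow> x \<notin> u ` {1..r}" for x
 proof
  assume "fib x \<inter> range Top = {}"
  thus "x \<notin> u ` {1..r}" unfolding fib_def by blast
 qed (auto simp: fib_def)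
 have 2: "{p\<in>lab r u w. p \<inter> range Top = {}} = fib ` (w ` {1..r} - u ` {1..r})"
  unfolding lab using notop by blast
 have "inj_on fib (w ` {1..r} - u ` {1..r})"
 proof (rule inj_onI)
  fix x y assume x: "x \<in> w ` {1..r} - u ` {1..r}" and e: "fib x = fib y"
  then obtain j where "j \<in> {1..r}" "w j = x" by blast
  hence "Bot j \<in> fib x" by (simp add: fib_def)
  hence "Bot j \<in> fib y" using e by simp
  thus "x = y" using \<open>w j = x\<close> by (auto simp: fib_def)
 qed
 hence "mset_set (fib ` (w ` {1..r} - u ` {1..r})) = image_mset fib (mset_set (w ` {1..r} - u ` {1..r}))"
  by (rule image_mset_mset_set[symmetric])
 thus ?thesis unfolding diagram_type_def 1 2 by (simp add: multiset.map_comp comp_def ty)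
qed

lemma nondegD:
 assumes "nondeg r n d" "i \<in> {1..n}"
 shows "\<exists>j\<in>{1..r}. rel d (Top i) (Bot j)" "i' \<in> {1..n} ==> rel d (Top i) (Top i') ==> i = i'"
 using assms unfolding nondeg_def by blast+

lemma nondeg_part_eq_iff:
 assumes d: "d \<in> diagrams r" and nd: "nondeg r n d" and n: "n \<le> r" and i: "i \<in> {1..n}" "i' \<in> {1..n}"
 shows "part d (Top i) = part d (Top i') \<longleftrightarrow> i = i'"
proof
 assume e: "part d (Top i) = part d (Top i')"
 have "i \<in> {1..r}" "i' \<in> {1..r}" using i n by auto
 hence "rel d (Top i) (Top i')" using part_eq_iff[OF d, of "Top i" "Top i'"] e by blast
 thus "i = i'" using nondegD(2)[OF nd i(1) i(2)] by blast
qed simp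

text \<open>The diagrams of \<open>e_n A e_l\<close> with the full number \<open>n\<close> of
  propagating parts, which are those surviving modulo \<open>J_(n-1)\<close>.\<close>

definition core_diagrams :: "nat => nat => nat => diagram set" where
 "core_diagrams r n l = {d. tfix r n d \<and> bfix r l d \<and> nondeg r n d}"

lemma tfix_labels:
 assumes "tfix r n d" "j \<in> {1..r}" "n \<le> r" "r \<ge> 1"
 shows "n \<noteq> 0 ==> part d (Top (min j n)) = part d (Top j)"
  and "n = 0 ==> part d (Top j) = part d (Top 1)"
  and "n = 0 ==> part d (Top j) \<notin> (%j. part d (Bot j)) ` {1..r}"
proof -
 have d: "d \<in> diagrams r" using assms tfix_diagram by blast
 { assume n: "n \<noteq> 0"
  hence "rel d (Top j) (Top (min j n))" using assms by (simp add: tfix_def)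
  moreover have "min j n \<in> {1..r}" using assms n by auto
  ultimately show "part d (Top (min j n)) = part d (Top j)"
   using part_eq_iff[OF d, of "Top j" "Top (min j n)"] assms by blast }
 { assume n: "n = 0"
  have one: "1 \<in> {1..r}" using assms by simp
  have "rel d (Top j) (Top 1)" using assms(1,2) one n unfolding tfix_def by auto
  thus "part d (Top j) = part d (Top 1)"
   using part_eq_iff[OF d, of "Top j" "Top 1"] assms one by blast
  show "part d (Top j) \<notin> (%j. part d (Bot j)) ` {1..r}"
  proof
   assume "part d (Top j) \<in> (%j. part d (Bot j)) ` {1..r}"
   then obtain k where k: "k \<in> {1..r}" "part d (Top j) = part d (Bot k)" by blast
   hence "rel d (Top j) (Bot k)" using part_eq_iff[OF d, of "Top j" "Bot k"] assms by blast
   moreover have "\<not> rel d (Top j) (Bot k)" using assms(1,2) k(1) n unfolding tfix_def by auto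
   ultimately show False by blast
  qed }
qed

lemma bfix_labels:
 assumes "bfix r l d" "j \<in> {1..r}" "l \<le> r" "r \<ge> 1"
 shows "l \<noteq> 0 ==> part d (Bot (min j l)) = part d (Bot j)"
  and "l = 0 ==> part d (Bot j) = part d (Bot 1)"
  and "l = 0 ==> part d (Bot j) \<notin> (%j. part d (Top j)) ` {1..r}"
proof -
 have d: "d \<in> diagrams r" using assms bfix_diagram by blast
 have t: "tfix r l (flip d)" using assms by (simp add: bfix_def)
 have fd: "flip d \<in> diagrams r" using d by simp
 have e: "part (flip d) (Top i) = part (flip d) (Top k) \<longleftrightarrow> part d (Bot i) = part d (Bot k)" if "i \<in> {1..r}" "k \<in> {1..r}" for i k
  using that part_eq_iff[OF fd, of "Top i" "Top k"] part_eq_iff[OF d, of "Bot i" "Bot k"] by (simp add: rel_flip)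
 have e': "part (flip d) (Top i) = part (flip d) (Bot k) \<longleftrightarrow> part d (Bot i) = part d (Top k)" if "i \<in> {1..r}" "k \<in> {1..r}" for i k
  using that part_eq_iff[OF fd, of "Top i" "Bot k"] part_eq_iff[OF d, of "Bot i" "Top k"] by (simp add: rel_flip)
 show "part d (Bot (min j l)) = part d (Bot j)" if "l \<noteq> 0"
  using tfix_labels(1)[OF t assms(2-4) that] e[of "min j l" j] assms that by auto
 show "part d (Bot j) = part d (Bot 1)" if "l = 0"
  using tfix_labels(2)[OF t assms(2-4) that] e[of j 1] assms by auto
 show "part d (Bot j) \<notin> (%j. part d (Top j)) ` {1..r}" if "l = 0"
  using tfix_labels(3)[OF t assms(2-4) that] e'[of j] assms(2) by blast
qed

lemma compose_pdiag_in_core: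
 assumes d: "d \<in> core_diagrams r n l" and p: "\<pi> permutes {1..n}" and n: "n \<le> r" and l: "sum_list \<mu> = l" "l \<le> r" and r: "r \<ge> 1"
 shows "((pdiag r n \<pi>) ;; d) \<in> core_diagrams r n l"
  and "diagram_type n \<mu> ((pdiag r n \<pi>) ;; d) = (fst (diagram_type n \<mu> d) \<circ> \<pi>, snd (diagram_type n \<mu> d))"
proof -
 have t: "tfix r n d" and b: "bfix r l d" and nd: "nondeg r n d" using d by (auto simp: core_diagrams_def)
 have dd: "d \<in> diagrams r" using t tfix_diagram by blast
 let ?u = "%j. part d (Top j)" and ?w = "%j. part d (Bot j)"
 have dl: "d = lab r ?u ?w" using diagram_eq_lab[OF dd] .
 let ?d = "((pdiag r n \<pi>) ;; d)"
 have "?d \<in> core_diagrams r n l \<and> diagram_type n \<mu> ?d = (fst (diagram_type n \<mu> d) \<circ> \<pi>, snd (diagram_type n \<mu> d))"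
 proof (cases "n = 0")
  case True
  hence "?d = d" using pdiag_compose_tfix(4)[OF t n p r] by simp
  moreover have "\<pi> = id" using p True by simp
  ultimately show ?thesis using d by simp
 next
  case False
  let ?u' = "%j. part d (Top (\<pi> (min j n)))"
  have dl': "?d = lab r ?u' ?w" using pdiag_compose_tfix(2)[OF t n p r False] .
  have inp: "\<pi> i \<in> {1..n}" if "i \<in> {1..n}" for i using permutes_in_image[OF p] that by blast
  have reld: "part d (Top i) = part d (Top i') \<longleftrightarrow> i = i'" if "i \<in> {1..n}" "i' \<in> {1..n}" for i i'
   using nondeg_part_eq_iff[OF dd nd n that] .
  have "nondeg r n ?d" unfolding nondeg_def
  proof (intro ballI conjI impI)
   fix i assume i: "i \<in> {1..n}"
   obtain j where j: "j \<in> {1..r}" "rel d (Top (\<pi> i)) (Bot j)" using nd inp[OF i] unfolding nondeg_def by blast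
   hence "rel ?d (Top i) (Bot j)" unfolding dl' rel_lab
    using i n inp[OF i] part_eq_iff[OF dd, of "Top (\<pi> i)" "Bot j"] by auto
   thus "\<exists>j\<in>{1..r}. rel ?d (Top i) (Bot j)" using j by blast
   fix i' assume i': "i' \<in> {1..n}" and "rel ?d (Top i) (Top i')"
   hence "part d (Top (\<pi> i)) = part d (Top (\<pi> i'))" unfolding dl' rel_lab using i by (simp add: min_absorb1)
   hence "\<pi> i = \<pi> i'" using reld inp i i' by blast
   thus "i = i'" using permutes_inj[OF p] by (simp add: inj_eq)
  qed
  moreover have "tfix r n ?d" by (rule tfix_compose) (use dd n tfix_pdiag in auto)
  moreover have "bfix r l ?d" by (rule bfix_compose) (use dd b in auto)
  ultimately have "?d \<in> core_diagrams r n l" by (simp add: core_diagrams_def)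
  moreover have "?u' ` {1..r} = ?u ` {1..r}"
  proof -
   note min = min_image[OF False n]
   have "?u' ` {1..r} = ?u ` (\<pi> ` (%j. min j n) ` {1..r})" by (simp add: image_image)
   also have "\<dots> = ?u ` (%j. min j n) ` {1..r}" unfolding min using permutes_image[OF p] by simp
   also have "\<dots> = ?u ` {1..r}" unfolding image_image
    by (rule image_cong) (use tfix_labels(1)[OF t _ n r False] in auto)
   finally show ?thesis .
  qed
  hence "diagram_type n \<mu> ?d = (\<lambda>i\<in>{1..n}. label_type \<mu> ?w (?u' i), image_mset (label_type \<mu> ?w) (mset_set (?w ` {1..r} - ?u ` {1..r})))"
   unfolding dl' using diagram_type_lab[of \<mu> r n ?u' ?w] l n by simp
  moreover have "diagram_type n \<mu> d = (\<lambda>i\<in>{1..n}. label_type \<mu> ?w (?u i), image_mset (label_type \<mu> ?w) (mset_set (?w ` {1..r} - ?u ` {1..r})))"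
   using diagram_type_lab[of \<mu> r n ?u ?w] l n dl by simp
  moreover have "(\<lambda>i\<in>{1..n}. label_type \<mu> ?w (?u' i)) = (\<lambda>i\<in>{1..n}. label_type \<mu> ?w (?u i)) \<circ> \<pi>"
  proof
   fix i show "(\<lambda>i\<in>{1..n}. label_type \<mu> ?w (?u' i)) i = ((\<lambda>i\<in>{1..n}. label_type \<mu> ?w (?u i)) \<circ> \<pi>) i"
    using inp[of i] permutes_not_in[OF p, of i] by (cases "i \<in> {1..n}") auto
  qed
  ultimately show ?thesis by simp
 qed
 thus "?d \<in> core_diagrams r n l" "diagram_type n \<mu> ?d = (fst (diagram_type n \<mu> d) \<circ> \<pi>, snd (diagram_type n \<mu> d))" by auto
qed

text \<open>Since \<open>\<sigma>\<close> preserves the blocks, the content of every label is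
  unchanged, and so is the set of labels occurring in the bottom row.\<close>

lemma core_compose_pdiag:
 assumes d: "d \<in> core_diagrams r n l" and s: "\<sigma> \<in> young_subgroup \<mu>" and n: "n \<le> r" and l: "sum_list \<mu> = l" "l \<le> r" and r: "r \<ge> 1"
 shows "(d ;; (pdiag r l \<sigma>)) \<in> core_diagrams r n l"
  and "diagram_type n \<mu> (d ;; (pdiag r l \<sigma>)) = diagram_type n \<mu> d"
proof -
 have t: "tfix r n d" and b: "bfix r l d" and nd: "nondeg r n d" using d by (auto simp: core_diagrams_def)
 have dd: "d \<in> diagrams r" using t tfix_diagram by blast
 have p: "\<sigma> permutes {1..l}" and sb: "\<And>j. j \<in> {1..l} ==> blk \<mu> (\<sigma> j) = blk \<mu> j"
  using s l by (auto simp: young_subgroup_iff)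
 let ?u = "%j. part d (Top j)" and ?w = "%j. part d (Bot j)"
 have dl: "d = lab r ?u ?w" using diagram_eq_lab[OF dd] .
 let ?d = "(d ;; (pdiag r l \<sigma>))"
 have "?d \<in> core_diagrams r n l \<and> diagram_type n \<mu> ?d = diagram_type n \<mu> d"
 proof (cases "l = 0")
  case True
  hence "?d = d" using bfix_compose_pdiag(4)[OF b l(2) p r] by simp
  thus ?thesis using d by simp
 next
  case False
  let ?w' = "%j. part d (Bot (pinv \<sigma> (min j l)))"
  have dl': "?d = lab r ?u ?w'" using bfix_compose_pdiag(2)[OF b l(2) p r False] .
  have pi: "pinv \<sigma> permutes {1..l}" using permutes_inv[OF p] .
  have wimg: "?w' ` {1..r} = ?w ` {1..r}"
  proof -
   note min = min_image[OF False l(2)]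
   have "?w' ` {1..r} = ?w ` (pinv \<sigma> ` (%j. min j l) ` {1..r})" by (simp add: image_image)
   also have "\<dots> = ?w ` (%j. min j l) ` {1..r}" unfolding min using permutes_image[OF pi] by simp
   also have "\<dots> = ?w ` {1..r}" unfolding image_image
    by (rule image_cong) (use bfix_labels(1)[OF b _ l(2) r False] in auto)
   finally show ?thesis .
  qed
  have "nondeg r n ?d" unfolding nondeg_def
  proof (intro ballI conjI impI)
   fix i assume i: "i \<in> {1..n}"
   obtain j where j: "j \<in> {1..r}" "rel d (Top i) (Bot j)" using nd i unfolding nondeg_def by blast
   hence "?u i = ?w j" using part_eq_iff[OF dd, of "Top i" "Bot j"] i n by auto
   hence "?u i \<in> ?w' ` {1..r}" unfolding wimg using j by blast
   then obtain j' where "j' \<in> {1..r}" "?u i = ?w' j'" by blast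
   hence "rel ?d (Top i) (Bot j')" unfolding dl' rel_lab using i n by auto
   thus "\<exists>j\<in>{1..r}. rel ?d (Top i) (Bot j)" using \<open>j' \<in> {1..r}\<close> by blast
   fix i' assume i': "i' \<in> {1..n}" and "rel ?d (Top i) (Top i')"
   hence "?u i = ?u i'" unfolding dl' rel_lab by simp
   hence "rel d (Top i) (Top i')" using part_eq_iff[OF dd, of "Top i" "Top i'"] i i' n by auto
   thus "i = i'" using nd i i' unfolding nondeg_def by blast
  qed
  moreover have "tfix r n ?d" by (rule tfix_compose) (use dd t in auto)
  moreover have "bfix r l ?d" by (rule bfix_compose) (use dd l p bfix_pdiag in auto)
  ultimately have "?d \<in> core_diagrams r n l" by (simp add: core_diagrams_def)
  moreover have "label_type \<mu> ?w' x = label_type \<mu> ?w x" for x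
   unfolding label_type_def
  proof (intro map_cong refl)
   fix k
   have "card {j\<in>{1..l}. blk \<mu> j = k \<and> ?w' j = x} = card {j\<in>{1..l}. blk \<mu> (\<sigma> j) = k \<and> ?w' (\<sigma> j) = x}"
    by (rule card_permutes_vimage[OF p, symmetric])
   also have "{j\<in>{1..l}. blk \<mu> (\<sigma> j) = k \<and> ?w' (\<sigma> j) = x} = {j\<in>{1..l}. blk \<mu> j = k \<and> ?w j = x}"
   proof (rule Collect_cong, rule conj_cong[OF refl])
    fix j assume j: "j \<in> {1..l}"
    hence "min (\<sigma> j) l = \<sigma> j" using permutes_in_image[OF p, of j] by auto
    thus "(blk \<mu> (\<sigma> j) = k \<and> ?w' (\<sigma> j) = x) = (blk \<mu> j = k \<and> ?w j = x)"
     using sb[OF j] permutes_inverses(2)[OF p] by simp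
   qed
   finally show "card {j\<in>{1..sum_list \<mu>}. blk \<mu> j = k \<and> ?w' j = x} = card {j\<in>{1..sum_list \<mu>}. blk \<mu> j = k \<and> ?w j = x}" using l by simp
  qed
  hence "label_type \<mu> ?w' = label_type \<mu> ?w" by blast
  hence "diagram_type n \<mu> ?d = diagram_type n \<mu> d"
   using diagram_type_lab[of \<mu> r n ?u ?w'] diagram_type_lab[of \<mu> r n ?u ?w] l n dl dl' wimg by simp
  ultimately show ?thesis by blast
 qed
 thus "?d \<in> core_diagrams r n l" "diagram_type n \<mu> ?d = diagram_type n \<mu> d" by auto
qed

lemma image_mset_eq_bij:
 assumes "finite A" "finite B" and eq: "image_mset f (mset_set A) = image_mset g (mset_set B)"
 shows "\<exists>\<beta>. bij_betw \<beta> A B \<and> (\<forall>x\<in>A. g (\<beta> x) = f x)"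
proof -
 have "card A = card B" using arg_cong[OF eq, of size] by simp
 then obtain b where b: "bij_betw b A B" using assms finite_same_card_bij by blast
 hence "image_mset g (mset_set B) = image_mset (g \<circ> b) (mset_set A)"
  using image_mset_mset_set[of b A] by (simp add: bij_betw_def multiset.map_comp[symmetric])
 then obtain p where p: "p permutes A" "\<forall>x\<in>A. f x = (g \<circ> b) (p x)"
  using image_mset_eq_implies_permutes[OF assms(1), of f "g \<circ> b"] eq by metis
 have "bij_betw (b \<circ> p) A B" using b permutes_imp_bij[OF p(1)] by (rule bij_betw_trans[rotated])
 thus ?thesis using p(2) by (intro exI[of _ "b \<circ> p"]) simp
qed

text \<open>A map \<open>\<phi>\<close> from the parts of \<open>d\<close> to those of
  \<open>d'\<close> is forced on the parts meeting the top row. On the others any bijection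
  \<open>\<beta>\<close> preserving the block contents will do, and equality of the multisets
  provides one. Then the pair of the block and the part of a bottom dot takes each value equally
  often for both diagrams, and a permutation matching these pairs preserves the blocks.\<close>

lemma diagram_type_eq_imp:
 assumes d: "d \<in> core_diagrams r n l" and d': "d' \<in> core_diagrams r n l"
  and eq: "diagram_type n \<mu> d = diagram_type n \<mu> d'" and n: "n \<le> r" and l: "sum_list \<mu> = l" "l \<le> r" and r: "r \<ge> 1"
 shows "\<exists>\<sigma>\<in>young_subgroup \<mu>. d' = (d ;; (pdiag r l \<sigma>))"
proof -
 have t: "tfix r n d" "tfix r n d'" and b: "bfix r l d" "bfix r l d'" and nd: "nondeg r n d" "nondeg r n d'"
  using d d' by (auto simp: core_diagrams_def)
 have dd: "d \<in> diagrams r" "d' \<in> diagrams r" using t tfix_diagram by blast+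
 define u where "u j = part d (Top j)" for j
 define w where "w j = part d (Bot j)" for j
 define u' where "u' j = part d' (Top j)" for j
 define w' where "w' j = part d' (Bot j)" for j
 have dl: "d = lab r u w" "d' = lab r u' w'" unfolding u_def w_def u'_def w'_def using diagram_eq_lab dd by blast+
 have one: "1 \<in> {1..r}" using r by simp
 show ?thesis
 proof (cases "l = 0")
  case True
  \<comment> \<open>With \<open>l = 0\<close> no bottom dot propagates, which is compatible with
    \<open>nondeg\<close> only if there is no top dot to be considered.\<close>
  have n0: "n = 0"
  proof (rule ccontr)
   assume "n \<noteq> 0"
   then obtain j where j: "j \<in> {1..r}" "rel d (Top 1) (Bot j)" using nondegD(1)[OF nd(1), of 1] by auto
   hence "part d (Bot j) = part d (Top 1)" using part_eq_iff[OF dd(1), of "Top 1" "Bot j"] one by auto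
   thus False using bfix_labels(3)[OF b(1) j(1) l(2) r True] one by auto
  qed
  have "d = d'" unfolding dl lab_eq_iff
  proof (intro ballI conjI)
   fix j j' assume j: "j \<in> {1..r}" "j' \<in> {1..r}"
   show "(u j = u j') = (u' j = u' j')" unfolding u_def u'_def
    using tfix_labels(2)[OF t(1) j(1) n r n0] tfix_labels(2)[OF t(1) j(2) n r n0]
     tfix_labels(2)[OF t(2) j(1) n r n0] tfix_labels(2)[OF t(2) j(2) n r n0] by simp
   show "(w j = w j') = (w' j = w' j')" unfolding w_def w'_def
    using bfix_labels(2)[OF b(1) j(1) l(2) r True] bfix_labels(2)[OF b(1) j(2) l(2) r True]
     bfix_labels(2)[OF b(2) j(1) l(2) r True] bfix_labels(2)[OF b(2) j(2) l(2) r True] by simp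
   show "(u j = w j') = (u' j = w' j')" unfolding u_def u'_def w_def w'_def
    using tfix_labels(3)[OF t(1) j(1) n r n0] tfix_labels(3)[OF t(2) j(1) n r n0] j by blast
  qed
  hence "d' = (d ;; (pdiag r l id))" using bfix_compose_pdiag(3)[OF b(1) l(2) permutes_id r refl] by simp
  moreover have "id \<in> young_subgroup \<mu>" by (simp add: young_subgroup_iff permutes_id)
  ultimately show ?thesis by blast
 next
  case False
  have ueq: "u j = u k \<longleftrightarrow> u' j = u' k" if j: "j \<in> {1..r}" "k \<in> {1..r}" for j k
  proof (cases "n = 0")
   case True
   thus ?thesis unfolding u_def u'_def
    using tfix_labels(2)[OF t(1) j(1) n r True] tfix_labels(2)[OF t(1) j(2) n r True]
     tfix_labels(2)[OF t(2) j(1) n r True] tfix_labels(2)[OF t(2) j(2) n r True] by simp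
  next
   case n0: False
   have *: "part e (Top j) = part e (Top k) \<longleftrightarrow> min j n = min k n"
    if e: "tfix r n e" "nondeg r n e" for e
   proof -
    have m: "min j n \<in> {1..n}" "min k n \<in> {1..n}" "min j n \<in> {1..r}" "min k n \<in> {1..r}" using j n n0 by auto
    have "part e (Top j) = part e (Top k) \<longleftrightarrow> part e (Top (min j n)) = part e (Top (min k n))"
     using tfix_labels(1)[OF e(1) j(1) n r n0] tfix_labels(1)[OF e(1) j(2) n r n0] by simp
    also have "\<dots> \<longleftrightarrow> min j n = min k n"
     by (rule nondeg_part_eq_iff[OF tfix_diagram[OF e(1)] e(2) n m(1,2)])
    finally show ?thesis .
   qed
   show ?thesis unfolding u_def u'_def using *[OF t(1) nd(1)] *[OF t(2) nd(2)] by simp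
  qed
  define R where "R = w ` {1..r} - u ` {1..r}"
  define R' where "R' = w' ` {1..r} - u' ` {1..r}"
  have ty: "diagram_type n \<mu> d = (\<lambda>i\<in>{1..n}. label_type \<mu> w (u i), image_mset (label_type \<mu> w) (mset_set R))"
   "diagram_type n \<mu> d' = (\<lambda>i\<in>{1..n}. label_type \<mu> w' (u' i), image_mset (label_type \<mu> w') (mset_set R'))"
   unfolding dl R_def R'_def using l n by (simp_all add: diagram_type_lab)
  have finR: "finite R" "finite R'" by (simp_all add: R_def R'_def)
  have "image_mset (label_type \<mu> w) (mset_set R) = image_mset (label_type \<mu> w') (mset_set R')" using ty eq by simp
  then obtain \<beta> where \<beta>: "bij_betw \<beta> R R'" "\<forall>x\<in>R. label_type \<mu> w' (\<beta> x) = label_type \<mu> w x"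
   using image_mset_eq_bij[of R R' "label_type \<mu> w" "label_type \<mu> w'"] finR by blast
  define \<phi> where "\<phi> x = (if x \<in> R then \<beta> x else u' (inv_into {1..r} u x))" for x
  have \<phi>u: "\<phi> (u j) = u' j" if j: "j \<in> {1..r}" for j
  proof -
   have i: "inv_into {1..r} u (u j) \<in> {1..r}" "u (inv_into {1..r} u (u j)) = u j"
    using inv_into_into[of "u j" u "{1..r}"] f_inv_into_f[of "u j" u "{1..r}"] j by blast+
   have "u j \<notin> R" using j by (auto simp: R_def)
   thus ?thesis using ueq[OF i(1) j] i(2) by (simp add: \<phi>_def)
  qed
  have S: "x \<in> R \<or> x \<in> u ` {1..r}" if "x \<in> u ` {1..r} \<union> w ` {1..r}" for x
   using that unfolding R_def by blast
  have \<phi>R: "\<phi> x \<in> R'" if "x \<in> R" for x using that \<beta>(1) by (auto simp: \<phi>_def bij_betw_def)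
  have inj: "inj_on \<phi> (u ` {1..r} \<union> w ` {1..r})"
  proof (rule inj_onI)
   fix x y assume x: "x \<in> u ` {1..r} \<union> w ` {1..r}" and y: "y \<in> u ` {1..r} \<union> w ` {1..r}" and e: "\<phi> x = \<phi> y"
   have disj: "u' j \<notin> R'" if "j \<in> {1..r}" for j using that by (auto simp: R'_def)
   from S[OF x] S[OF y] show "x = y"
   proof (elim disjE)
    assume xy: "x \<in> R" "y \<in> R"
    hence "\<beta> x = \<beta> y" using e by (simp add: \<phi>_def)
    thus ?thesis using xy \<beta>(1) by (auto simp: bij_betw_def inj_on_def)
   next
    assume xy: "x \<in> R" "y \<in> u ` {1..r}"
    then obtain j where j: "j \<in> {1..r}" "y = u j" by blast
    hence "\<phi> y = u' j" using \<phi>u by simp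
    thus ?thesis using \<phi>R[OF xy(1)] disj[OF j(1)] e by simp
   next
    assume xy: "x \<in> u ` {1..r}" "y \<in> R"
    then obtain j where j: "j \<in> {1..r}" "x = u j" by blast
    hence "\<phi> x = u' j" using \<phi>u by simp
    thus ?thesis using \<phi>R[OF xy(2)] disj[OF j(1)] e by simp
   next
    assume "x \<in> u ` {1..r}" "y \<in> u ` {1..r}"
    then obtain j k where jk: "j \<in> {1..r}" "x = u j" "k \<in> {1..r}" "y = u k" by blast
    hence "u' j = u' k" using \<phi>u e by simp
    thus ?thesis using ueq[OF jk(1,3)] jk by simp
   qed
  qed
  have lty: "label_type \<mu> w' (\<phi> x) = label_type \<mu> w x" if "x \<in> u ` {1..r} \<union> w ` {1..r}" for x
   using S[OF that]
  proof
   assume "x \<in> R" thus ?thesis using \<beta>(2) by (simp add: \<phi>_def)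
  next
   assume "x \<in> u ` {1..r}"
   then obtain j where j: "j \<in> {1..r}" "x = u j" by blast
   show ?thesis
   proof (cases "n = 0")
    \<comment> \<open>For \<open>n = 0\<close> the top part contains no bottom dot, so its content
      is zero for both diagrams.\<close>
    case True
    have "u j \<notin> w ` {1..r}" "u' j \<notin> w' ` {1..r}"
     using tfix_labels(3)[OF t(1) j(1) n r True] tfix_labels(3)[OF t(2) j(1) n r True]
     by (auto simp: u_def w_def u'_def w'_def)
    moreover have "label_type \<mu> v x = label_type \<mu> v' x'" if "x \<notin> v ` {1..r}" "x' \<notin> v' ` {1..r}"
     for x x' :: "dot set" and v v' :: "nat => dot set"
    proof -
     have "{j \<in> {1..sum_list \<mu>}. blk \<mu> j = k \<and> v j = x} = {}" "{j \<in> {1..sum_list \<mu>}. blk \<mu> j = k \<and> v' j = x'} = {}" for k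
      using that l by auto
     thus ?thesis unfolding label_type_def by metis
    qed
    ultimately show ?thesis using \<phi>u[OF j(1)] j(2) by metis
   next
    case n0: False
    hence m: "min j n \<in> {1..n}" using j by auto
    have e: "u j = u (min j n)" "u' j = u' (min j n)"
     using tfix_labels(1)[OF t(1) j(1) n r n0] tfix_labels(1)[OF t(2) j(1) n r n0] by (auto simp: u_def u'_def)
    have "fst (diagram_type n \<mu> d) (min j n) = fst (diagram_type n \<mu> d') (min j n)" using eq by simp
    hence "label_type \<mu> w (u (min j n)) = label_type \<mu> w' (u' (min j n))" unfolding ty using m by simp
    thus ?thesis using \<phi>u[OF j(1)] j(2) e by simp
   qed
  qed
  have onto: "w' j \<in> \<phi> ` (u ` {1..r} \<union> w ` {1..r})" if j: "j \<in> {1..r}" for j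
  proof (cases "w' j \<in> u' ` {1..r}")
   case True
   then obtain k where "k \<in> {1..r}" "w' j = \<phi> (u k)" using \<phi>u by force
   thus ?thesis by blast
  next
   case False
   hence "w' j \<in> R'" using j by (simp add: R'_def)
   then obtain x where "x \<in> R" "w' j = \<beta> x" using \<beta>(1) by (auto simp: bij_betw_def)
   hence "w' j = \<phi> x" "x \<in> w ` {1..r}" by (auto simp: \<phi>_def R_def)
   thus ?thesis by blast
  qed
  have "image_mset (%j. (blk \<mu> j, \<phi> (w j))) (mset_set {1..l}) = image_mset (%j. (blk \<mu> j, w' j)) (mset_set {1..l})"
  proof (rule multiset_eqI)
   fix z :: "nat \<times> dot set"
   obtain k y where z: "z = (k, y)" by fastforce
   have cnt: "count (image_mset f (mset_set {1..l})) z = card {j\<in>{1..l}. f j = z}" for f :: "nat => nat \<times> dot set"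
    by (simp add: count_image_mset' Int_def vimage_def) (metis (mono_tags, lifting) Collect_cong)
   have "card {j\<in>{1..l}. blk \<mu> j = k \<and> \<phi> (w j) = y} = card {j\<in>{1..l}. blk \<mu> j = k \<and> w' j = y}"
   proof (cases "k < length \<mu> \<and> y \<in> \<phi> ` (u ` {1..r} \<union> w ` {1..r})")
    case True
    then obtain x where x: "x \<in> u ` {1..r} \<union> w ` {1..r}" "y = \<phi> x" by blast
    have "label_type \<mu> w' y ! k = label_type \<mu> w x ! k" using lty x by simp
    hence "card {j\<in>{1..l}. blk \<mu> j = k \<and> w' j = y} = card {j\<in>{1..l}. blk \<mu> j = k \<and> w j = x}"
     using True l by (simp add: label_type_def)
    moreover have "{j\<in>{1..l}. blk \<mu> j = k \<and> w j = x} = {j\<in>{1..l}. blk \<mu> j = k \<and> \<phi> (w j) = y}"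
    proof -
     have "w j = x \<longleftrightarrow> \<phi> (w j) = y" if "j \<in> {1..l}" for j
      using that l x inj_on_eq_iff[OF inj, of "w j" x] by auto
     thus ?thesis by blast
    qed
    ultimately show ?thesis by simp
   next
    case no: False
    have "{j\<in>{1..l}. blk \<mu> j = k \<and> \<phi> (w j) = y} = {}"
    proof -
     have "False" if "j \<in> {1..l}" "blk \<mu> j = k" "\<phi> (w j) = y" for j
      using no that l blk_less[of j \<mu>] by auto
     thus ?thesis by blast
    qed
    moreover have "{j\<in>{1..l}. blk \<mu> j = k \<and> w' j = y} = {}"
    proof -
     have "False" if "j \<in> {1..l}" "blk \<mu> j = k" "w' j = y" for j
      using no that l blk_less[of j \<mu>] onto[of j] by auto
     thus ?thesis by blast
    qed
    ultimately show ?thesis by (simp only:)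
   qed
   thus "count (image_mset (%j. (blk \<mu> j, \<phi> (w j))) (mset_set {1..l})) z = count (image_mset (%j. (blk \<mu> j, w' j)) (mset_set {1..l})) z"
    unfolding cnt unfolding z by simp
  qed
  then obtain \<sigma> where \<sigma>: "\<sigma> permutes {1..l}" "\<forall>j\<in>{1..l}. (blk \<mu> j, \<phi> (w j)) = (blk \<mu> (\<sigma> j), w' (\<sigma> j))"
   using image_mset_eq_implies_permutes[of "{1..l}" "%j. (blk \<mu> j, \<phi> (w j))" "%j. (blk \<mu> j, w' j)"] by auto
  have "\<sigma> \<in> young_subgroup \<mu>" using \<sigma> l by (simp add: young_subgroup_iff)
  moreover have "d' = (d ;; (pdiag r l \<sigma>))"
  proof -
   have mi: "pinv \<sigma> (min j l) \<in> {1..l}" if "j \<in> {1..r}" for j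
    using permutes_in_image[OF permutes_inv[OF \<sigma>(1)], of "min j l"] that False by auto
   have w'eq: "\<phi> (w (pinv \<sigma> (min j l))) = w' j" if j: "j \<in> {1..r}" for j
   proof -
    have "\<phi> (w (pinv \<sigma> (min j l))) = w' (min j l)"
     using \<sigma>(2) mi[OF j] permutes_inverses(1)[OF \<sigma>(1)] by simp
    thus ?thesis using bfix_labels(1)[OF b(2) j l(2) r False] by (simp add: w'_def)
   qed
   have "(d ;; (pdiag r l \<sigma>)) = lab r u (%j. w (pinv \<sigma> (min j l)))"
    unfolding u_def w_def by (rule bfix_compose_pdiag(2)[OF b(1) l(2) \<sigma>(1) r False])
   also have "\<dots> = lab r (%j. \<phi> (u j)) (%j. \<phi> (w (pinv \<sigma> (min j l))))"
   proof (rule lab_inj[symmetric])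
    have "(%j. w (pinv \<sigma> (min j l))) ` {1..r} \<subseteq> w ` {1..r}"
     using mi l by fastforce
    thus "inj_on \<phi> (u ` {1..r} \<union> (%j. w (pinv \<sigma> (min j l))) ` {1..r})"
     by (intro inj_on_subset[OF inj]) blast
   qed
   also have "\<dots> = lab r u' w'" using \<phi>u w'eq by (intro lab_cong) auto
   finally show ?thesis using dl by simp
  qed
  ultimately show ?thesis by blast
 qed
qed

section \<open>Tensor products\<close>

lemma comm_group_add_monoidI:
 assumes "comm_group G" "carrier G = carrier M" "monoid.mult G = add M" "one G = zero M"
 shows "comm_group (add_monoid M)"
proof -
 interpret G: comm_group G by fact
 show ?thesis
 proof (rule comm_groupI)
  fix x assume "x \<in> carrier (add_monoid M)"
  hence x: "x \<in> carrier G" using assms by simp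
  thus "\<exists>y\<in>carrier (add_monoid M). y \<otimes>\<^bsub>add_monoid M\<^esub> x = \<one>\<^bsub>add_monoid M\<^esub>"
   using assms G.l_inv[OF x] G.inv_closed[OF x] by (intro bexI[of _ "inv\<^bsub>G\<^esub> x"]) auto
 qed (use G.m_closed G.m_assoc G.m_comm G.one_closed G.l_one assms in auto)
qed

definition pure_tensor ::
 "('r, 'q) ring_scheme => ('s, 'r, 'x, 'm) bimodule_scheme => ('r, 'y, 'n) module_scheme
   => 'x => 'y => (('x \<times> 'y) \<Rightarrow>\<^sub>0 int) set" where
 "pure_tensor R X Y x y =
   generate (free_Abelian_group (carrier X \<times> carrier Y)) (tensor_relations R X Y)
    #>\<^bsub>free_Abelian_group (carrier X \<times> carrier Y)\<^esub> frag_of (x, y)"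

locale tensor_factors =
 fixes R :: "('r, 'q) ring_scheme" and X :: "('s, 'r, 'x, 'm) bimodule_scheme" and Y :: "('r, 'y, 'n) module_scheme"
 assumes X_add: "\<And>x x'. x \<in> carrier X ==> x' \<in> carrier X ==> x \<oplus>\<^bsub>X\<^esub> x' \<in> carrier X"
  and Y_add: "\<And>y y'. y \<in> carrier Y ==> y' \<in> carrier Y ==> y \<oplus>\<^bsub>Y\<^esub> y' \<in> carrier Y"
  and X_rsmult: "\<And>x a. x \<in> carrier X ==> a \<in> carrier R ==> rsmult X x a \<in> carrier X"
  and Y_smult: "\<And>y a. y \<in> carrier Y ==> a \<in> carrier R ==> a \<odot>\<^bsub>Y\<^esub> y \<in> carrier Y"
begin

abbreviation F where "F \<equiv> free_Abelian_group (carrier X \<times> carrier Y)"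
abbreviation H where "H \<equiv> generate F (tensor_relations R X Y)"
abbreviation T where "T \<equiv> tensor R X Y"
abbreviation (input) cl where "cl f \<equiv> H #>\<^bsub>F\<^esub> f"
abbreviation (input) pure where "pure \<equiv> pure_tensor R X Y"

lemma relations_subset: "tensor_relations R X Y \<subseteq> carrier F"
proof -
 interpret F: group F by simp
 have sub: "a - b \<in> carrier F" if "a \<in> carrier F" "b \<in> carrier F" for a b
  using that keys_diff[of a b] by auto
 have of: "frag_of (x, y) \<in> carrier F" if "x \<in> carrier X" "y \<in> carrier Y" for x y using that by simp
 show ?thesis unfolding tensor_relations_def
  using X_add Y_add X_rsmult Y_smult by (intro Un_least subsetI; elim CollectE exE conjE; hypsubst; intro sub of; blast)
qed

lemma H_subgroup: "subgroup H F"
 using group.generate_is_subgroup[OF group_free_Abelian_group relations_subset] .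

lemma H_normal: "H \<lhd> F"
 using comm_group.normal_iff_subgroup[OF abelian_free_Abelian_group] H_subgroup by blast

lemma carrier_T: "carrier T = (%f. cl f) ` carrier F"
 unfolding tensor_def Let_def by (simp add: carrier_FactGroup)

lemma comm_group_T: "comm_group (add_monoid T)"
 by (rule comm_group_add_monoidI[OF comm_group.abelian_FactGroup[OF abelian_free_Abelian_group H_subgroup]])
  (simp_all add: tensor_def Let_def)

lemma coset_add:
 assumes "f \<in> carrier F" "g \<in> carrier F"
 shows "(cl f) \<oplus>\<^bsub>T\<^esub> (cl g) = cl (f + g)"
 using normal.rcos_sum[OF H_normal assms] by (simp add: tensor_def Let_def)

lemma coset_zero: "\<zero>\<^bsub>T\<^esub> = cl 0"
proof -
 interpret F: group F by simp
 show ?thesis using F.coset_mult_one[of H] subgroup.subset[OF H_subgroup] by (simp add: tensor_def Let_def)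
qed

lemma pure_in_T [simp]: "x \<in> carrier X ==> y \<in> carrier Y ==> pure x y \<in> carrier T"
 unfolding pure_tensor_def carrier_T by (intro imageI) simp

lemma coset_eqI:
 assumes "f \<in> carrier F" "g \<in> carrier F" "f - g \<in> H"
 shows "cl f = cl g"
proof -
 interpret F: group F by simp
 have "f = (f - g) \<otimes>\<^bsub>F\<^esub> g" by simp
 hence "f \<in> cl g" unfolding r_coset_def using assms(3) by blast
 thus ?thesis using F.repr_independence[OF _ assms(2) H_subgroup] by blast
qed

lemma pure_add_left:
 assumes "x \<in> carrier X" "x' \<in> carrier X" "y \<in> carrier Y"
 shows "pure (x \<oplus>\<^bsub>X\<^esub> x') y = pure x y \<oplus>\<^bsub>T\<^esub> pure x' y"
proof -
 have i: "frag_of (x, y) \<in> carrier F" "frag_of (x', y) \<in> carrier F" "frag_of (x \<oplus>\<^bsub>X\<^esub> x', y) \<in> carrier F" using assms X_add by simp_all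
 have "frag_of (x, y) + frag_of (x', y) \<in> carrier F" using keys_add[of "frag_of (x, y)" "frag_of (x', y)"] assms by auto
 moreover have "frag_of (x \<oplus>\<^bsub>X\<^esub> x', y) - frag_of (x, y) - frag_of (x', y) \<in> H"
  by (rule generate.incl) (use assms in \<open>unfold tensor_relations_def, blast\<close>)
 ultimately show ?thesis
  unfolding pure_tensor_def coset_add[OF i(1,2)] by (intro coset_eqI i) (simp_all add: diff_diff_eq)
qed

lemma pure_add_right:
 assumes "x \<in> carrier X" "y \<in> carrier Y" "y' \<in> carrier Y"
 shows "pure x (y \<oplus>\<^bsub>Y\<^esub> y') = pure x y \<oplus>\<^bsub>T\<^esub> pure x y'"
proof -
 have i: "frag_of (x, y) \<in> carrier F" "frag_of (x, y') \<in> carrier F" "frag_of (x, y \<oplus>\<^bsub>Y\<^esub> y') \<in> carrier F" using assms Y_add by simp_all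
 have "frag_of (x, y) + frag_of (x, y') \<in> carrier F" using keys_add[of "frag_of (x, y)" "frag_of (x, y')"] assms by auto
 moreover have "frag_of (x, y \<oplus>\<^bsub>Y\<^esub> y') - frag_of (x, y) - frag_of (x, y') \<in> H"
  by (rule generate.incl) (use assms in \<open>unfold tensor_relations_def, blast\<close>)
 ultimately show ?thesis
  unfolding pure_tensor_def coset_add[OF i(1,2)] by (intro coset_eqI i) (simp_all add: diff_diff_eq)
qed

lemma pure_balanced:
 assumes "x \<in> carrier X" "a \<in> carrier R" "y \<in> carrier Y"
 shows "pure (rsmult X x a) y = pure x (a \<odot>\<^bsub>Y\<^esub> y)"
proof -
 have "frag_of (rsmult X x a, y) - frag_of (x, a \<odot>\<^bsub>Y\<^esub> y) \<in> H"
  by (rule generate.incl) (use assms in \<open>unfold tensor_relations_def, blast\<close>)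
 thus ?thesis unfolding pure_tensor_def using assms X_rsmult Y_smult by (intro coset_eqI) simp_all
qed

text \<open>Pure tensors generate the tensor product only as an abelian group, with no scalars at
  hand, so subgroups are the class over which to induct.\<close>

lemma tensor_subgroup_induct:
 assumes K: "subgroup K (add_monoid T)"
  and pure: "\<And>x y. x \<in> carrier X ==> y \<in> carrier Y ==> pure x y \<in> K"
 shows "carrier T \<subseteq> K"
proof
 interpret T: comm_group "add_monoid T" by (rule comm_group_T)
 fix z assume "z \<in> carrier T"
 then obtain f where f: "Poly_Mapping.keys f \<subseteq> carrier X \<times> carrier Y" "z = cl f" by (auto simp: carrier_T)
 have "cl f \<in> K"
 proof (rule free_Abelian_group_induct[where P = "%f. cl f \<in> K", OF f(1)])
  show "cl 0 \<in> K" using subgroup.one_closed[OF K] coset_zero by simp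
 next
  fix f g assume 2: "Poly_Mapping.keys f \<subseteq> carrier X \<times> carrier Y" "Poly_Mapping.keys g \<subseteq> carrier X \<times> carrier Y"
   "cl f \<in> K" "cl g \<in> K"
  have fg: "f - g \<in> carrier F" using 2 keys_diff[of f g] by auto
  have "(cl (f - g)) \<oplus>\<^bsub>T\<^esub> (cl g) = cl f" using coset_add[OF fg, of g] 2 by simp
  moreover have m: "cl (f - g) \<in> carrier T" "cl g \<in> carrier T" using fg 2 by (auto simp: carrier_T)
  ultimately have "cl (f - g) = (cl f) \<otimes>\<^bsub>add_monoid T\<^esub> inv\<^bsub>add_monoid T\<^esub> (cl g)"
   using T.inv_solve_right[of "cl (f - g)" "cl f" "cl g"] T.m_closed[of "cl (f - g)" "cl g"] by simp
  thus "cl (f - g) \<in> K" using 2 subgroup.m_closed[OF K] subgroup.m_inv_closed[OF K] by simp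
 next
  fix a assume "a \<in> carrier X \<times> carrier Y"
  thus "cl (frag_of a) \<in> K" using pure[of "fst a" "snd a"] by (auto simp: pure_tensor_def)
 qed
 thus "z \<in> K" using f by simp
qed

lemma tensor_universal:
 assumes G: "comm_group G"
  and cl: "\<And>x y. x \<in> carrier X ==> y \<in> carrier Y ==> \<beta> x y \<in> carrier G"
  and add_left: "\<And>x x' y. x \<in> carrier X ==> x' \<in> carrier X ==> y \<in> carrier Y ==> \<beta> (x \<oplus>\<^bsub>X\<^esub> x') y = \<beta> x y \<otimes>\<^bsub>G\<^esub> \<beta> x' y"
  and add_right: "\<And>x y y'. x \<in> carrier X ==> y \<in> carrier Y ==> y' \<in> carrier Y ==> \<beta> x (y \<oplus>\<^bsub>Y\<^esub> y') = \<beta> x y \<otimes>\<^bsub>G\<^esub> \<beta> x y'"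
  and bal: "\<And>x a y. x \<in> carrier X ==> a \<in> carrier R ==> y \<in> carrier Y ==> \<beta> (rsmult X x a) y = \<beta> x (a \<odot>\<^bsub>Y\<^esub> y)"
 shows "\<exists>h \<in> hom (add_monoid T) G. \<forall>x\<in>carrier X. \<forall>y\<in>carrier Y. h (pure x y) = \<beta> x y"
proof -
 interpret G: comm_group G by fact
 interpret Fg: group F by simp
 obtain h where h: "h \<in> hom F G" "\<And>p. p \<in> carrier X \<times> carrier Y ==> h (frag_of p) = (case p of (x, y) => \<beta> x y)"
  using G.free_Abelian_group_universal[of "%(x, y). \<beta> x y" "carrier X \<times> carrier Y"] cl by (auto simp: image_subset_iff)
 interpret h: group_hom F G h using h by unfold_locales
 have hadd: "h (f + g) = h f \<otimes>\<^bsub>G\<^esub> h g" if "f \<in> carrier F" "g \<in> carrier F" for f g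
  using h.hom_mult[OF that] by simp
 have hdiff: "h (f - g) = h f \<otimes>\<^bsub>G\<^esub> inv\<^bsub>G\<^esub> h g" if "f \<in> carrier F" "g \<in> carrier F" for f g
 proof -
  have "- g \<in> carrier F" using that by simp
  hence "h (f + - g) = h f \<otimes>\<^bsub>G\<^esub> h (- g)" using hadd that by blast
  moreover have "h (- g) = inv\<^bsub>G\<^esub> h g" using h.hom_inv[OF that(2)] that(2) by simp
  ultimately show ?thesis by simp
 qed
 have dcl: "f - g \<in> carrier F" if "f \<in> carrier F" "g \<in> carrier F" for f g using that keys_diff[of f g] by auto
 have of: "frag_of (x, y) \<in> carrier F" "h (frag_of (x, y)) = \<beta> x y" if "x \<in> carrier X" "y \<in> carrier Y" for x y
  using that h(2) by auto
 have solve: "a \<otimes>\<^bsub>G\<^esub> b \<otimes>\<^bsub>G\<^esub> inv\<^bsub>G\<^esub> a \<otimes>\<^bsub>G\<^esub> inv\<^bsub>G\<^esub> b = \<one>\<^bsub>G\<^esub>" if "a \<in> carrier G" "b \<in> carrier G" for a b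
 proof -
  have "a \<otimes>\<^bsub>G\<^esub> b \<otimes>\<^bsub>G\<^esub> inv\<^bsub>G\<^esub> a = b"
   using that G.m_comm[of a b] G.m_assoc[of b a "inv\<^bsub>G\<^esub> a"] by simp
  thus ?thesis using that by simp
 qed
 have rel: "h f = \<one>\<^bsub>G\<^esub>" if "f \<in> tensor_relations R X Y" for f
  using that unfolding tensor_relations_def
 proof (elim UnE CollectE exE conjE)
  fix x x' y assume f: "f = frag_of (x \<oplus>\<^bsub>X\<^esub> x', y) - frag_of (x, y) - frag_of (x', y)" and i: "x \<in> carrier X" "x' \<in> carrier X" "y \<in> carrier Y"
  show ?thesis unfolding f using i
   by (simp only: hdiff dcl of X_add add_left solve cl)
 next
  fix x y y' assume f: "f = frag_of (x, y \<oplus>\<^bsub>Y\<^esub> y') - frag_of (x, y) - frag_of (x, y')" and i: "x \<in> carrier X" "y \<in> carrier Y" "y' \<in> carrier Y"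
  show ?thesis unfolding f using i
   by (simp only: hdiff dcl of Y_add add_right solve cl)
 next
  fix x a y assume f: "f = frag_of (rsmult X x a, y) - frag_of (x, a \<odot>\<^bsub>Y\<^esub> y)" and i: "x \<in> carrier X" "a \<in> carrier R" "y \<in> carrier Y"
  show ?thesis unfolding f using i
   by (simp only: hdiff dcl of X_rsmult Y_smult bal cl G.r_inv)
 qed
 have HK: "h f = \<one>\<^bsub>G\<^esub>" if "f \<in> H" for f
  using that
 proof (induction rule: generate.induct)
  case one thus ?case using h.hom_one by simp
 next
  case (incl f) thus ?case using rel by simp
 next
  case (inv f) thus ?case using rel relations_subset h.hom_inv[of f] by auto
 next
  case (eng f g)
  have "f \<in> carrier F" "g \<in> carrier F" using eng subgroup.subset[OF H_subgroup] by blast+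
  thus ?case using eng h.hom_mult by simp
 qed
 have well: "h f = h g" if f: "f \<in> carrier F" and g: "g \<in> carrier F" and e: "cl f = cl g" for f g
 proof -
  have "f \<in> cl g" using Fg.rcos_self[OF f H_subgroup] e by simp
  then obtain k where k: "k \<in> H" "f = k \<otimes>\<^bsub>F\<^esub> g" unfolding r_coset_def by blast
  hence "k \<in> carrier F" using subgroup.subset[OF H_subgroup] by blast
  thus ?thesis using k HK h.hom_mult[of k g] g h.hom_closed[of g] by simp
 qed
 obtain h' where h': "h' \<in> hom (F Mod H) G" "\<And>f. f \<in> carrier F ==> h' (cl f) = h f"
  using FactGroup_universal[OF h(1) H_normal well] by metis
 have "h' \<in> hom (add_monoid T) G" using h'(1) unfolding hom_def tensor_def Let_def by simp
 moreover have "\<forall>x\<in>carrier X. \<forall>y\<in>carrier Y. h' (pure x y) = \<beta> x y"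
  unfolding pure_tensor_def using h'(2) of by auto
 ultimately show ?thesis by blast
qed

lemma tensor_hom_eqI:
 assumes G: "comm_group G" and h: "h \<in> hom (add_monoid T) G" "h' \<in> hom (add_monoid T) G"
  and eq: "\<And>x y. x \<in> carrier X ==> y \<in> carrier Y ==> h (pure x y) = h' (pure x y)"
  and z: "z \<in> carrier T"
 shows "h z = h' z"
proof -
 interpret T: comm_group "add_monoid T" by (rule comm_group_T)
 interpret G: comm_group G by fact
 interpret h: group_hom "add_monoid T" G h using h by unfold_locales
 interpret h': group_hom "add_monoid T" G h' using h by unfold_locales
 have "subgroup {z\<in>carrier T. h z = h' z} (add_monoid T)"
 proof (rule T.subgroupI)
  show "{z\<in>carrier T. h z = h' z} \<noteq> {}" using T.one_closed h.hom_one h'.hom_one by auto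
  fix a assume "a \<in> {z\<in>carrier T. h z = h' z}"
  thus "inv\<^bsub>add_monoid T\<^esub> a \<in> {z\<in>carrier T. h z = h' z}"
   using h.hom_inv[of a] h'.hom_inv[of a] T.inv_closed[of a] by simp
  fix b assume "b \<in> {z\<in>carrier T. h z = h' z}"
  thus "a \<otimes>\<^bsub>add_monoid T\<^esub> b \<in> {z\<in>carrier T. h z = h' z}"
   using \<open>a \<in> _\<close> h.hom_mult[of a b] h'.hom_mult[of a b] T.m_closed[of a b] by simp
 qed auto
 from tensor_subgroup_induct[OF this] eq z show ?thesis by auto
qed

text \<open>The map induced on the free abelian group carries each type of relation to a relation of
  the same type, hence preserves the subgroup \<open>H\<close>; the union over a coset in the
  definition of the action is then a single coset.\<close>

lemma smult_T:
 assumes s: "\<And>x. x \<in> carrier X ==> s \<odot>\<^bsub>X\<^esub> x \<in> carrier X"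
  and add: "\<And>x x'. x \<in> carrier X ==> x' \<in> carrier X ==> s \<odot>\<^bsub>X\<^esub> (x \<oplus>\<^bsub>X\<^esub> x') = s \<odot>\<^bsub>X\<^esub> x \<oplus>\<^bsub>X\<^esub> s \<odot>\<^bsub>X\<^esub> x'"
  and rs: "\<And>x a. x \<in> carrier X ==> a \<in> carrier R ==> s \<odot>\<^bsub>X\<^esub> rsmult X x a = rsmult X (s \<odot>\<^bsub>X\<^esub> x) a"
 shows "(%z. s \<odot>\<^bsub>T\<^esub> z) \<in> hom (add_monoid T) (add_monoid T)"
  and "\<And>x y. x \<in> carrier X ==> y \<in> carrier Y ==> s \<odot>\<^bsub>T\<^esub> pure x y = pure (s \<odot>\<^bsub>X\<^esub> x) y"
proof -
 interpret Fg: group F by simp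
 define \<phi> :: "('x \<times> 'y \<Rightarrow>\<^sub>0 int) => ('x \<times> 'y \<Rightarrow>\<^sub>0 int)" where "\<phi> = frag_extend (%(x, y). frag_of (s \<odot>\<^bsub>X\<^esub> x, y))"
 have \<phi>of: "\<phi> (frag_of (x, y)) = frag_of (s \<odot>\<^bsub>X\<^esub> x, y)" for x y by (simp add: \<phi>_def)
 have \<phi>add: "\<phi> (f + g) = \<phi> f + \<phi> g" for f g by (simp add: \<phi>_def frag_extend_add)
 have \<phi>diff: "\<phi> (f - g) = \<phi> f - \<phi> g" for f g by (simp add: \<phi>_def frag_extend_diff)
 have \<phi>0: "\<phi> 0 = 0" by (simp add: \<phi>_def)
 have \<phi>F: "\<phi> f \<in> carrier F" if "f \<in> carrier F" for f
 proof -
  have "Poly_Mapping.keys f \<subseteq> carrier X \<times> carrier Y" using that by simp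
  thus ?thesis
  proof (rule free_Abelian_group_induct[where P = "%f. \<phi> f \<in> carrier F"])
   fix f g assume "\<phi> f \<in> carrier F" "\<phi> g \<in> carrier F"
   thus "\<phi> (f - g) \<in> carrier F" using keys_diff[of "\<phi> f" "\<phi> g"] by (auto simp: \<phi>diff)
  qed (use s \<phi>0 \<phi>of in auto)
 qed
 have rel: "\<phi> f \<in> tensor_relations R X Y" if f: "f \<in> tensor_relations R X Y" for f
 proof -
  consider x x' y where "f = frag_of (x \<oplus>\<^bsub>X\<^esub> x', y) - frag_of (x, y) - frag_of (x', y)" "x \<in> carrier X" "x' \<in> carrier X" "y \<in> carrier Y"
   | x y y' where "f = frag_of (x, y \<oplus>\<^bsub>Y\<^esub> y') - frag_of (x, y) - frag_of (x, y')" "x \<in> carrier X" "y \<in> carrier Y" "y' \<in> carrier Y"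
   | x a y where "f = frag_of (rsmult X x a, y) - frag_of (x, a \<odot>\<^bsub>Y\<^esub> y)" "x \<in> carrier X" "a \<in> carrier R" "y \<in> carrier Y"
   using f unfolding tensor_relations_def by blast
  thus ?thesis
  proof cases
   case 1
   hence "\<phi> f = frag_of (s \<odot>\<^bsub>X\<^esub> x \<oplus>\<^bsub>X\<^esub> s \<odot>\<^bsub>X\<^esub> x', y) - frag_of (s \<odot>\<^bsub>X\<^esub> x, y) - frag_of (s \<odot>\<^bsub>X\<^esub> x', y)"
    by (simp add: \<phi>diff \<phi>of add)
   thus ?thesis using 1 s unfolding tensor_relations_def by blast
  next
   case 2
   hence "\<phi> f = frag_of (s \<odot>\<^bsub>X\<^esub> x, y \<oplus>\<^bsub>Y\<^esub> y') - frag_of (s \<odot>\<^bsub>X\<^esub> x, y) - frag_of (s \<odot>\<^bsub>X\<^esub> x, y')"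
    by (simp add: \<phi>diff \<phi>of)
   thus ?thesis using 2 s unfolding tensor_relations_def by blast
  next
   case 3
   hence "\<phi> f = frag_of (rsmult X (s \<odot>\<^bsub>X\<^esub> x) a, y) - frag_of (s \<odot>\<^bsub>X\<^esub> x, a \<odot>\<^bsub>Y\<^esub> y)"
    by (simp add: \<phi>diff \<phi>of rs)
   thus ?thesis using 3 s unfolding tensor_relations_def by blast
  qed
 qed
 have \<phi>H: "\<phi> f \<in> H" if "f \<in> H" for f
  using that
 proof (induction rule: generate.induct)
  case one thus ?case using generate.one[of F] \<phi>0 by simp
 next
  case (incl f) thus ?case using rel generate.incl by metis
 next
  case (inv f)
  have f: "f \<in> carrier F" "\<phi> f \<in> carrier F" using inv relations_subset \<phi>F by blast+
  have "\<phi> (inv\<^bsub>F\<^esub> f) = inv\<^bsub>F\<^esub> (\<phi> f)" using f \<phi>diff[of 0 f] \<phi>0 by simp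
  thus ?case using generate.inv[OF rel[OF inv]] by simp
 next
  case (eng f g) thus ?case using generate.eng[of "\<phi> f" F _ "\<phi> g"] by (simp add: \<phi>add)
 qed
 have act: "s \<odot>\<^bsub>T\<^esub> (cl f) = cl (\<phi> f)" if f: "f \<in> carrier F" for f
 proof -
  have "cl (\<phi> g) = cl (\<phi> f)" if "g \<in> cl f" for g
  proof -
   obtain k where k: "k \<in> H" "g = k + f" using \<open>g \<in> H #>\<^bsub>F\<^esub> f\<close> unfolding r_coset_def by auto
   have "k \<in> carrier F" using k subgroup.subset[OF H_subgroup] by blast
   hence "g \<in> carrier F" using k f keys_add[of k f] by auto
   moreover have "\<phi> g - \<phi> f \<in> H" using k \<phi>H by (simp add: \<phi>add)
   ultimately show ?thesis using f \<phi>F by (intro coset_eqI)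
  qed
  moreover have "f \<in> cl f" using Fg.rcos_self[OF f H_subgroup] .
  ultimately have "(\<Union>g\<in>cl f. cl (\<phi> g)) = cl (\<phi> f)" by blast
  thus ?thesis unfolding tensor_def Let_def \<phi>_def by simp
 qed
 show "s \<odot>\<^bsub>T\<^esub> pure x y = pure (s \<odot>\<^bsub>X\<^esub> x) y" if "x \<in> carrier X" "y \<in> carrier Y" for x y
  unfolding pure_tensor_def using act[of "frag_of (x, y)"] that by (simp add: \<phi>of)
 show "(%z. s \<odot>\<^bsub>T\<^esub> z) \<in> hom (add_monoid T) (add_monoid T)"
 proof (rule homI)
  fix z z' assume "z \<in> carrier (add_monoid T)" "z' \<in> carrier (add_monoid T)"
  then obtain f g where fg: "f \<in> carrier F" "g \<in> carrier F" "z = cl f" "z' = cl g" by (auto simp: carrier_T)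
  thus "s \<odot>\<^bsub>T\<^esub> z \<in> carrier (add_monoid T)" using act \<phi>F by (simp add: carrier_T)
  have "f + g \<in> carrier F" using fg keys_add[of f g] by auto
  hence "s \<odot>\<^bsub>T\<^esub> (z \<oplus>\<^bsub>T\<^esub> z') = s \<odot>\<^bsub>T\<^esub> z \<oplus>\<^bsub>T\<^esub> s \<odot>\<^bsub>T\<^esub> z'"
   unfolding fg(3,4) coset_add[OF fg(1,2)] act[OF fg(1)] act[OF fg(2)] using act \<phi>add coset_add[OF \<phi>F[OF fg(1)] \<phi>F[OF fg(2)]] by simp
  thus "s \<odot>\<^bsub>T\<^esub> (z \<otimes>\<^bsub>add_monoid T\<^esub> z') = s \<odot>\<^bsub>T\<^esub> z \<otimes>\<^bsub>add_monoid T\<^esub> (s \<odot>\<^bsub>T\<^esub> z')" by simp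
 qed
qed

end

section \<open>Recognising spaces of functions\<close>

definition fun_group :: "'y set => ('y => 'k::field) monoid" where
 "fun_group Y = \<lparr>carrier = {v. \<forall>y. y \<notin> Y --> v y = 0}, monoid.mult = (%v w y. v y + w y), one = (%_. 0)\<rparr>"

lemma fun_group_simps [simp]:
 "v \<in> carrier (fun_group Y) \<longleftrightarrow> (\<forall>y. y \<notin> Y --> v y = 0)"
 "v \<otimes>\<^bsub>fun_group Y\<^esub> w = (%y. v y + w y)" "\<one>\<^bsub>fun_group Y\<^esub> = (%_. 0)"
 by (simp_all add: fun_group_def)

lemma comm_group_fun_group: "comm_group (fun_group Y :: ('y => 'k::field) monoid)"
proof (rule comm_groupI)
 fix v :: "'y => 'k" assume "v \<in> carrier (fun_group Y)"
 thus "\<exists>w\<in>carrier (fun_group Y). w \<otimes>\<^bsub>fun_group Y\<^esub> v = \<one>\<^bsub>fun_group Y\<^esub>"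
  by (intro bexI[of _ "%y. - v y"]) auto
qed (auto simp: add_ac)

text \<open>The elements \<open>T y c\<close> are separated by the functionals in \<open>h\<close>
  and generate \<open>L\<close>. As \<open>L\<close> carries no scalar multiplication by
  \<open>k\<close>, the line through a basis element is given as an additive map \<open>T y\<close>.
  The inverse of \<open>h\<close> is \<open>\<Psi>\<close>: its range is a subgroup containing all
  \<open>T y c\<close>, so it is everything.\<close>

lemma basis_bij_betw:
 fixes h :: "'l => 'y => 'k::field"
 assumes L: "comm_group L" and fin: "finite Y" and h: "h \<in> hom L (fun_group Y)"
  and T: "\<And>y c. y \<in> Y ==> T y c \<in> carrier L"
  and Tadd: "\<And>y c c'. y \<in> Y ==> T y (c + c') = T y c \<otimes>\<^bsub>L\<^esub> T y c'"
  and hT: "\<And>y c. y \<in> Y ==> h (T y c) = (%y'. if y' = y then c else 0)"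
  and span: "\<And>K. subgroup K L ==> (\<And>y c. y \<in> Y ==> T y c \<in> K) ==> carrier L \<subseteq> K"
 shows "bij_betw h (carrier L) {v. \<forall>y. y \<notin> Y --> v y = 0}"
proof -
 interpret L: comm_group L by fact
 interpret Fg: comm_group "fun_group Y :: ('y => 'k) monoid" by (rule comm_group_fun_group)
 interpret h: group_hom L "fun_group Y" h using h by unfold_locales
 define \<Psi> where "\<Psi> v = finprod L (%y. T y (v y)) Y" for v
 have Tc: "(%y. T y (v y)) \<in> Y \<rightarrow> carrier L" for v using T by auto
 have \<Psi>c: "\<Psi> v \<in> carrier L" for v unfolding \<Psi>_def using Tc by (rule L.finprod_closed)
 have \<Psi>add: "\<Psi> (%y. v y + w y) = \<Psi> v \<otimes>\<^bsub>L\<^esub> \<Psi> w" for v w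
 proof -
  have "\<Psi> (%y. v y + w y) = finprod L (%y. T y (v y) \<otimes>\<^bsub>L\<^esub> T y (w y)) Y"
   unfolding \<Psi>_def by (rule L.finprod_cong') (use Tadd T in auto)
  also have "\<dots> = \<Psi> v \<otimes>\<^bsub>L\<^esub> \<Psi> w" unfolding \<Psi>_def by (rule L.finprod_multf) (use Tc in auto)
  finally show ?thesis .
 qed
 have T0: "T y 0 = \<one>\<^bsub>L\<^esub>" if "y \<in> Y" for y
  using Tadd[OF that, of 0 0] T[OF that] L.l_cancel_one[of "T y 0" "T y 0"] by simp
 have h\<Psi>: "h (\<Psi> v) = (%y. if y \<in> Y then v y else 0)" for v
 proof -
  have "h (finprod L (%y. T y (v y)) Z) = (%y. if y \<in> Z then v y else 0)" if "Z \<subseteq> Y" for Z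
   using finite_subset[OF that fin] that
  proof (induction Z rule: finite_induct)
   case empty thus ?case using h.hom_one by (simp add: fun_eq_iff)
  next
   case (insert y Z)
   have c: "T y (v y) \<in> carrier L" "finprod L (%y. T y (v y)) Z \<in> carrier L"
    using T insert by (auto intro!: L.finprod_closed)
   have "finprod L (%y. T y (v y)) (insert y Z) = T y (v y) \<otimes>\<^bsub>L\<^esub> finprod L (%y. T y (v y)) Z"
    by (rule L.finprod_insert) (use insert T in auto)
   thus ?case using h.hom_mult[OF c] insert hT[of y "v y"] by (auto simp: fun_eq_iff)
  qed
  thus ?thesis unfolding \<Psi>_def by blast
 qed
 have "subgroup (range \<Psi>) L"
 proof (rule L.subgroupI)
  fix a b assume "a \<in> range \<Psi>" "b \<in> range \<Psi>"
  then obtain v w where "a = \<Psi> v" "b = \<Psi> w" by blast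
  hence "a \<otimes>\<^bsub>L\<^esub> b = \<Psi> (%y. v y + w y)" using \<Psi>add by simp
  thus "a \<otimes>\<^bsub>L\<^esub> b \<in> range \<Psi>" by simp
 next
  fix a assume "a \<in> range \<Psi>"
  then obtain v where v: "a = \<Psi> v" by blast
  have "\<Psi> (%y. - v y) \<otimes>\<^bsub>L\<^esub> \<Psi> v = \<Psi> (%_. 0)" unfolding \<Psi>add[symmetric] by simp
  also have "\<dots> = \<one>\<^bsub>L\<^esub>" unfolding \<Psi>_def by (rule L.finprod_one_eqI) (use T0 in auto)
  finally have "inv\<^bsub>L\<^esub> a = \<Psi> (%y. - v y)" unfolding v using L.inv_equality[OF _ \<Psi>c \<Psi>c] by blast
  thus "inv\<^bsub>L\<^esub> a \<in> range \<Psi>" by simp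
 qed (use \<Psi>c in auto)
 moreover have "T y c \<in> range \<Psi>" if y: "y \<in> Y" for y c
 proof -
  have "\<Psi> (%y'. if y' = y then c else 0) = finprod L (%y'. if y = y' then T y c else \<one>\<^bsub>L\<^esub>) Y"
   unfolding \<Psi>_def by (rule L.finprod_cong') (use T T0 y in auto)
  also have "\<dots> = T y c" using L.finprod_singleton[OF y fin, of "%_. T y c"] T[OF y] by simp
  finally have "T y c = \<Psi> (%y'. if y' = y then c else 0)" by simp
  thus ?thesis by simp
 qed
 ultimately have ran: "carrier L \<subseteq> range \<Psi>" by (rule span)
 show ?thesis
 proof (rule bij_betw_imageI)
  show "inj_on h (carrier L)"
  proof (rule inj_onI)
   fix x y assume "x \<in> carrier L" "y \<in> carrier L" and e: "h x = h y"
   then obtain v w where v: "x = \<Psi> v" "y = \<Psi> w" using ran by blast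
   have e': "(%\<eta>. if \<eta> \<in> Y then v \<eta> else 0) = (%\<eta>. if \<eta> \<in> Y then w \<eta> else 0)"
    using e unfolding v h\<Psi> .
   have vw: "v \<eta> = w \<eta>" if "\<eta> \<in> Y" for \<eta> using fun_cong[OF e', of \<eta>] that by simp
   have "\<Psi> v = \<Psi> w" unfolding \<Psi>_def
   proof (rule L.finprod_cong'[OF refl Tc])
    fix i assume "i \<in> Y"
    thus "T i (v i) = T i (w i)" using vw by simp
   qed
   thus "x = y" using v by simp
  qed
  show "h ` carrier L = {v. \<forall>y. y \<notin> Y --> v y = 0}"
  proof (intro equalityI subsetI)
   fix v assume "v \<in> h ` carrier L"
   thus "v \<in> {v. \<forall>y. y \<notin> Y --> v y = 0}" using h.hom_closed by auto
  next
   fix v :: "'y => 'k" assume "v \<in> {v. \<forall>y. y \<notin> Y --> v y = 0}"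
   hence "h (\<Psi> v) = v" unfolding h\<Psi> by (auto simp: fun_eq_iff)
   thus "v \<in> h ` carrier L" using \<Psi>c by (metis image_eqI)
  qed
 qed
qed

section \<open>The partition algebra and its layer ideals\<close>

text \<open>The product of a monoid algebra twisted by a weight. The partition algebra, with weight
  \<open>\<delta>\<close> to the number of closed components, and the group algebra, with weight 1,
  are both of this form.\<close>

definition conv :: "'b set => ('b => 'b => 'b) => ('b => 'b => 'k::field) => ('b => 'k) => ('b => 'k) => 'b => 'k" where
 "conv B op wt f g = (%d. \<Sum>x\<in>B. \<Sum>y\<in>B. if op x y = d then f x * g y * wt x y else 0)"

lemma basis_vec_expand:
 assumes "finite B" "\<And>d. d \<notin> B ==> f d = 0"
 shows "f = (%d. \<Sum>x\<in>B. f x * basis_vec x d)"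
proof
 fix d
 have "(\<Sum>x\<in>B. f x * basis_vec x d) = (\<Sum>x\<in>B. if d = x then f x else 0)"
  by (rule sum.cong) (auto simp: basis_vec_def)
 also have "\<dots> = f d" using assms by simp
 finally show "f d = (\<Sum>x\<in>B. f x * basis_vec x d)" by simp
qed

text \<open>The condition \<open>cocycle\<close> is what associativity of the algebra asks of the
  weight; for diagrams it is the second part of \<open>compose_assoc\<close>.\<close>

locale twisted_monoid =
 fixes B :: "'b set" and op :: "'b => 'b => 'b" and wt :: "'b => 'b => 'k::field"
 assumes finB: "finite B"
  and op_closed: "\<And>x y. x \<in> B ==> y \<in> B ==> op x y \<in> B"
  and op_assoc: "\<And>x y z. x \<in> B ==> y \<in> B ==> z \<in> B ==> op (op x y) z = op x (op y z)"
  and cocycle: "\<And>x y z. x \<in> B ==> y \<in> B ==> z \<in> B ==> wt x y * wt (op x y) z = wt y z * wt x (op y z)"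
begin

abbreviation cv (infixl \<open>**\<close> 70) where "f ** g \<equiv> conv B op wt f g"

lemma conv_support: "(f ** g) d \<noteq> 0 ==> \<exists>x\<in>B. \<exists>y\<in>B. d = op x y \<and> f x \<noteq> 0 \<and> g y \<noteq> 0"
proof (rule ccontr)
 assume nz: "(f ** g) d \<noteq> 0" and "\<not> (\<exists>x\<in>B. \<exists>y\<in>B. d = op x y \<and> f x \<noteq> 0 \<and> g y \<noteq> 0)"
 hence "(if op x y = d then f x * g y * wt x y else 0) = 0" if "x \<in> B" "y \<in> B" for x y using that by auto
 hence "(f ** g) d = 0" unfolding conv_def by simp
 thus False using nz by simp
qed

lemma conv_outside: "d \<notin> B ==> (f ** g) d = 0"
 using conv_support op_closed by blast

lemma conv_sum_left: "(%d. \<Sum>i\<in>I. F i d) ** g = (%d. \<Sum>i\<in>I. (F i ** g) d)"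
proof
 fix d
 have "((%d. \<Sum>i\<in>I. F i d) ** g) d = (\<Sum>x\<in>B. \<Sum>y\<in>B. \<Sum>i\<in>I. if op x y = d then F i x * g y * wt x y else 0)"
  unfolding conv_def by (intro sum.cong refl) (simp add: sum_distrib_right)
 also have "\<dots> = (\<Sum>x\<in>B. \<Sum>i\<in>I. \<Sum>y\<in>B. if op x y = d then F i x * g y * wt x y else 0)"
  by (intro sum.cong refl) (rule sum.swap)
 also have "\<dots> = (\<Sum>i\<in>I. (F i ** g) d)" unfolding conv_def by (rule sum.swap)
 finally show "((%d. \<Sum>i\<in>I. F i d) ** g) d = (\<Sum>i\<in>I. (F i ** g) d)" .
qed

lemma conv_sum_right: "f ** (%d. \<Sum>i\<in>I. G i d) = (%d. \<Sum>i\<in>I. (f ** G i) d)"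
proof
 fix d
 have "(f ** (%d. \<Sum>i\<in>I. G i d)) d = (\<Sum>x\<in>B. \<Sum>y\<in>B. \<Sum>i\<in>I. if op x y = d then f x * G i y * wt x y else 0)"
  unfolding conv_def by (intro sum.cong refl) (simp add: sum_distrib_right sum_distrib_left)
 also have "\<dots> = (\<Sum>x\<in>B. \<Sum>i\<in>I. \<Sum>y\<in>B. if op x y = d then f x * G i y * wt x y else 0)"
  by (intro sum.cong refl) (rule sum.swap)
 also have "\<dots> = (\<Sum>i\<in>I. (f ** G i) d)" unfolding conv_def by (rule sum.swap)
 finally show "(f ** (%d. \<Sum>i\<in>I. G i d)) d = (\<Sum>i\<in>I. (f ** G i) d)" .
qed

lemma conv_scale_left: "(%d. c * f d) ** g = (%d. c * (f ** g) d)"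
 unfolding conv_def sum_distrib_left by (intro ext sum.cong refl) simp

lemma conv_scale_right: "f ** (%d. c * g d) = (%d. c * (f ** g) d)"
 unfolding conv_def sum_distrib_left by (intro ext sum.cong refl) simp

lemma conv_add_left: "(%d. f d + f' d) ** g = (%d. (f ** g) d + (f' ** g) d)"
 unfolding conv_def sum.distrib[symmetric] by (intro ext sum.cong refl) (simp add: algebra_simps)

lemma conv_add_right: "f ** (%d. g d + g' d) = (%d. (f ** g) d + (f ** g') d)"
 unfolding conv_def sum.distrib[symmetric] by (intro ext sum.cong refl) (simp add: algebra_simps)

lemma conv_expand:
 "f ** g = (%d. \<Sum>x\<in>B. \<Sum>y\<in>B. f x * g y * wt x y * basis_vec (op x y) d)"
 unfolding conv_def basis_vec_def by (intro ext sum.cong refl) simp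

lemma basis_conv_expand:
 assumes "x \<in> B"
 shows "basis_vec x ** g = (%d. \<Sum>y\<in>B. g y * wt x y * basis_vec (op x y) d)"
proof
 fix d
 have "(basis_vec x ** g) d = (\<Sum>x'\<in>B. if x' = x then (\<Sum>y\<in>B. g y * wt x' y * basis_vec (op x' y) d) else 0)"
  unfolding conv_expand by (intro sum.cong refl) (auto simp: basis_vec_def)
 thus "(basis_vec x ** g) d = (\<Sum>y\<in>B. g y * wt x y * basis_vec (op x y) d)" using assms finB by simp
qed

lemma conv_basis:
 assumes "x \<in> B" "y \<in> B"
 shows "basis_vec x ** basis_vec y = (%d. wt x y * basis_vec (op x y) d)"
proof
 fix d
 have "(basis_vec x ** basis_vec y) d = (\<Sum>y'\<in>B. if y' = y then wt x y' * basis_vec (op x y') d else 0)"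
  unfolding basis_conv_expand[OF assms(1)] by (intro sum.cong refl) (auto simp: basis_vec_def)
 thus "(basis_vec x ** basis_vec y) d = wt x y * basis_vec (op x y) d" using assms finB by simp
qed

lemma conv_basis_expand:
 assumes "y \<in> B"
 shows "f ** basis_vec y = (%d. \<Sum>x\<in>B. f x * wt x y * basis_vec (op x y) d)"
proof
 fix d
 have "(f ** basis_vec y) d = (\<Sum>x\<in>B. \<Sum>y'\<in>B. if y' = y then f x * wt x y' * basis_vec (op x y') d else 0)"
  unfolding conv_expand by (intro sum.cong refl) (auto simp: basis_vec_def)
 thus "(f ** basis_vec y) d = (\<Sum>x\<in>B. f x * wt x y * basis_vec (op x y) d)" using assms finB by simp
qed

lemma conv_assoc: "(f ** g) ** h = f ** (g ** h)"
proof
 fix d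
 have "((f ** g) ** h) d = (\<Sum>x\<in>B. \<Sum>y\<in>B. f x * g y * wt x y * (basis_vec (op x y) ** h) d)"
  by (simp only: conv_expand[of f g] conv_sum_left conv_scale_left)
 also have "\<dots> = (\<Sum>x\<in>B. \<Sum>y\<in>B. \<Sum>z\<in>B. f x * g y * h z * (wt x y * wt (op x y) z) * basis_vec (op (op x y) z) d)"
  by (intro sum.cong refl) (simp add: basis_conv_expand op_closed sum_distrib_left mult_ac)
 also have "\<dots> = (\<Sum>x\<in>B. \<Sum>y\<in>B. \<Sum>z\<in>B. f x * g y * h z * (wt y z * wt x (op y z)) * basis_vec (op x (op y z)) d)"
  by (intro sum.cong refl) (simp add: op_assoc cocycle)
 also have "\<dots> = (\<Sum>y\<in>B. \<Sum>x\<in>B. \<Sum>z\<in>B. f x * g y * h z * (wt y z * wt x (op y z)) * basis_vec (op x (op y z)) d)"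
  by (rule sum.swap)
 also have "\<dots> = (\<Sum>y\<in>B. \<Sum>z\<in>B. \<Sum>x\<in>B. f x * g y * h z * (wt y z * wt x (op y z)) * basis_vec (op x (op y z)) d)"
  by (rule sum.cong[OF refl], rule sum.swap)
 also have "\<dots> = (\<Sum>y\<in>B. \<Sum>z\<in>B. g y * h z * wt y z * (f ** basis_vec (op y z)) d)"
  by (intro sum.cong refl) (simp add: conv_basis_expand op_closed sum_distrib_left mult_ac)
 also have "\<dots> = (f ** (g ** h)) d"
  by (simp only: conv_expand[of g h] conv_sum_right conv_scale_right)
 finally show "((f ** g) ** h) d = (f ** (g ** h)) d" .
qed

end

definition wt :: "'k::field => diagram => diagram => 'k" where
 "wt \<delta> x y = \<delta> ^ cc x y"

abbreviation pmult :: "nat => 'k::field => (diagram => 'k) => (diagram => 'k) => diagram => 'k" where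
 "pmult r \<delta> \<equiv> conv (diagrams r) compose_diagrams (wt \<delta>)"

lemma twisted_monoid_diagrams: "twisted_monoid (diagrams r) compose_diagrams (wt \<delta>)"
proof
 fix x y z assume "x \<in> diagrams r" "y \<in> diagrams r" "z \<in> diagrams r"
 thus "wt \<delta> x y * wt \<delta> (x ;; y) z = wt \<delta> y z * wt \<delta> x (y ;; z)"
  using compose_assoc(2)[of x r y z] by (simp add: wt_def flip: power_add)
qed (use compose_assoc(1) in auto)

lemma partition_algebra_simps [simp]:
 "carrier (partition_algebra r \<delta>) = {f. \<forall>d. d \<notin> diagrams r --> f d = 0}"
 "f \<otimes>\<^bsub>partition_algebra r \<delta>\<^esub> g = pmult r \<delta> f g"
 "\<zero>\<^bsub>partition_algebra r \<delta>\<^esub> = (%_. 0)"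
 "f \<oplus>\<^bsub>partition_algebra r \<delta>\<^esub> g = (%d. f d + g d)"
 "add (partition_algebra r \<delta>) = (%f g d. f d + g d)"
 "monoid.mult (partition_algebra r \<delta>) = pmult r \<delta>"
 by (simp_all add: partition_algebra_def conv_def wt_def fun_eq_iff cong: if_cong)

abbreviation gmult :: "(nat => nat) set => ((nat => nat) => 'k::field) => ((nat => nat) => 'k) => (nat => nat) => 'k" where
 "gmult G \<equiv> conv G (%\<pi> \<sigma>. \<sigma> \<circ> \<pi>) (%_ _. 1)"

lemma group_algebra_simps [simp]:
 "carrier (group_algebra G) = {f. \<forall>\<pi>. \<pi> \<notin> G --> f \<pi> = 0}"
 "f \<otimes>\<^bsub>group_algebra G\<^esub> g = gmult G f g"
 "\<zero>\<^bsub>group_algebra G\<^esub> = (%_. 0)"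
 "f \<oplus>\<^bsub>group_algebra G\<^esub> g = (%d. f d + g d)"
 "add (group_algebra G) = (%f g d. f d + g d)"
 "monoid.mult (group_algebra G) = gmult G"
 by (simp_all add: group_algebra_def conv_def fun_eq_iff cong: if_cong)

lemma Sym_iff [simp]: "\<pi> \<in> Sym n \<longleftrightarrow> \<pi> permutes {1..n}"
 by (simp add: Sym_def)

lemma finite_Sym [simp]: "finite (Sym n)"
 unfolding Sym_def by (rule finite_permutations) simp

lemma twisted_monoid_Sym: "twisted_monoid (Sym n) (%\<pi> \<sigma>. \<sigma> \<circ> \<pi>) (%_ _. 1)"
 by unfold_locales (auto intro: permutes_compose)

lemma young_subset_Sym: "young_subgroup \<mu> \<subseteq> Sym (sum_list \<mu>)"
 by (auto simp: young_subgroup_def)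

lemma id_in_young [simp]: "id \<in> young_subgroup \<mu>"
 by (simp add: young_subgroup_iff permutes_id)

text \<open>The scalar makes \<open>sym_elt r \<delta> n\<close> multiplicative also for \<open>n = 0\<close>, where composing
 with the diagram creates a closed component.\<close>

definition sym_elt :: "nat => 'k::field => nat => (nat => nat) => diagram => 'k" where
 "sym_elt r \<delta> n \<pi> = (%d. (if n = 0 then 1 / \<delta> else 1) * basis_vec (pdiag r n \<pi>) d)"

lemma perm_diagram_eq_pdiag:
 assumes n: "n \<noteq> 0" "n \<le> r" and p: "\<pi> permutes {1..n}"
 shows "perm_diagram r n \<pi> = pdiag r n \<pi>"
proof -
 note min = min_image[OF n]
 have "(%j. \<pi> (min j n)) ` {1..r} = \<pi> ` (%j. min j n) ` {1..r}" by (simp add: image_image)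
 hence img: "(%j. \<pi> (min j n)) ` {1..r} \<union> (%j. min j n) ` {1..r} = \<pi> ` {1..n}"
  unfolding min using permutes_image[OF p] by simp
 have inj: "\<pi> (min j n) = \<pi> i \<longleftrightarrow> min j n = i" for i j using permutes_inj[OF p] by (simp add: inj_eq)
 show ?thesis unfolding perm_diagram_def pdiag_def lab_def using n by (simp only: img image_image inj if_False)
qed

lemma idem_eq:
 assumes "n \<le> r" "r \<ge> 1"
 shows "idem r \<delta> n = sym_elt r \<delta> n id"
proof (cases "n = 0")
 case True
 have "{Top ` {1..r}, Bot ` {1..r}} = lab r (%_. 0::nat) (%_. 1)"
 proof -
  have "(%_. 0::nat) ` {1..r} \<union> (%_. 1) ` {1..r} = {0, 1}" using assms by auto
  hence "lab r (%_. 0::nat) (%_. 1) = {Top ` {j\<in>{1..r}. (0::nat) = 0} \<union> Bot ` {j\<in>{1..r}. (1::nat) = 0},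
   Top ` {j\<in>{1..r}. (0::nat) = 1} \<union> Bot ` {j\<in>{1..r}. (1::nat) = 1}}"
   unfolding lab_def by (simp only: image_insert image_empty)
  moreover have "{j\<in>{1..r}. (0::nat) = 0} = {1..r}" "{j\<in>{1..r}. (1::nat) = 0} = {}"
   "{j\<in>{1..r}. (0::nat) = 1} = {}" "{j\<in>{1..r}. (1::nat) = 1} = {1..r}" by auto
  ultimately show ?thesis by (simp only: image_empty Un_empty_left Un_empty_right)
 qed
 thus ?thesis using True by (simp add: idem_def sym_elt_def pdiag_def)
next
 case False
 have "(%i. {Top i, Bot i}) ` {1..<n} \<union> {Top ` {n..r} \<union> Bot ` {n..r}} = perm_diagram r n id"
 proof -
  have ins: "{1..n} = insert n {1..<n}" using False by auto
  have 1: "{j \<in> {1..r}. min j n = i} = {i}" if "i \<in> {1..<n}" for i using that assms by auto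
  have 2: "{j \<in> {1..r}. min j n = n} = {n..r}" using False by auto
  have "perm_diagram r n id = insert (Top ` {n..r} \<union> Bot ` {n..r}) ((%i. Top ` {j \<in> {1..r}. min j n = i} \<union> Bot ` {j \<in> {1..r}. min j n = i}) ` {1..<n})"
   unfolding perm_diagram_def ins by (simp only: image_insert id_apply 2)
  also have "(%i. Top ` {j \<in> {1..r}. min j n = i} \<union> Bot ` {j \<in> {1..r}. min j n = i}) ` {1..<n} = (%i. {Top i, Bot i}) ` {1..<n}"
   by (rule image_cong[OF refl]) (simp only: 1, blast)
  finally show ?thesis by blast
 qed
 thus ?thesis using False perm_diagram_eq_pdiag[OF False assms(1) permutes_id]
  by (simp add: idem_def sym_elt_def)
qed

lemma embed_sym_eq:
 assumes "n \<le> r" "r \<ge> 1"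
 shows "embed_sym r \<delta> n f = (%d. \<Sum>\<pi>\<in>Sym n. f \<pi> * sym_elt r \<delta> n \<pi> d)"
proof (cases "n = 0")
 case True
 hence "Sym n = {id}" by (auto simp: Sym_def)
 thus ?thesis using True idem_eq[OF assms, of \<delta>] by (simp add: embed_sym_def)
next
 case False
 thus ?thesis using perm_diagram_eq_pdiag[OF False assms(1)]
  by (simp add: embed_sym_def sym_elt_def)
qed

context
 fixes r :: nat and \<delta> :: "'k::field"
 assumes r: "r \<ge> 1" and \<delta>: "\<delta> \<noteq> 0"
begin

interpretation A: twisted_monoid "diagrams r" compose_diagrams "wt \<delta>" by (rule twisted_monoid_diagrams)

lemma sym_elt_mult_basis:
 assumes "tfix r n d" "n \<le> r" "\<pi> permutes {1..n}"
 shows "pmult r \<delta> (sym_elt r \<delta> n \<pi>) (basis_vec d) = basis_vec ((pdiag r n \<pi>) ;; d)"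
 unfolding sym_elt_def A.conv_scale_left
 using A.conv_basis[OF pdiag_in_diagrams tfix_diagram[OF assms(1)], of n \<pi>] pdiag_compose_tfix(1)[OF assms r] \<delta>
 by (simp add: wt_def)

lemma basis_mult_sym_elt:
 assumes "bfix r l d" "l \<le> r" "\<pi> permutes {1..l}"
 shows "pmult r \<delta> (basis_vec d) (sym_elt r \<delta> l \<pi>) = basis_vec (d ;; (pdiag r l \<pi>))"
 unfolding sym_elt_def A.conv_scale_right
 using A.conv_basis[OF bfix_diagram[OF assms(1)] pdiag_in_diagrams, of l \<pi>] bfix_compose_pdiag(1)[OF assms r] \<delta>
 by (simp add: wt_def)

lemma sym_elt_mult:
 assumes "n \<le> r" "\<pi> permutes {1..n}" "\<sigma> permutes {1..n}"
 shows "pmult r \<delta> (sym_elt r \<delta> n \<pi>) (sym_elt r \<delta> n \<sigma>) = sym_elt r \<delta> n (\<sigma> \<circ> \<pi>)"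
proof -
 have "pmult r \<delta> (sym_elt r \<delta> n \<pi>) (sym_elt r \<delta> n \<sigma>) =
  (%d. (if n = 0 then 1 / \<delta> else 1) * pmult r \<delta> (sym_elt r \<delta> n \<pi>) (basis_vec (pdiag r n \<sigma>)) d)"
  by (subst (2) sym_elt_def) (rule A.conv_scale_right)
 thus ?thesis
  unfolding sym_elt_mult_basis[OF tfix_pdiag[OF assms(1)] assms(1,2)] pdiag_compose_pdiag[OF assms r]
  by (simp add: sym_elt_def)
qed

lemma embed_sym_mult:
 assumes n: "n \<le> r"
 shows "pmult r \<delta> (embed_sym r \<delta> n f) (embed_sym r \<delta> n g) = embed_sym r \<delta> n (gmult (Sym n) f g)"
proof
 interpret S: twisted_monoid "Sym n" "%\<pi> \<sigma>. \<sigma> \<circ> \<pi>" "%_ _. 1::'k" by (rule twisted_monoid_Sym)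
 fix d
 have "pmult r \<delta> (embed_sym r \<delta> n f) (embed_sym r \<delta> n g) d =
  (\<Sum>\<pi>\<in>Sym n. \<Sum>\<sigma>\<in>Sym n. f \<pi> * g \<sigma> * pmult r \<delta> (sym_elt r \<delta> n \<pi>) (sym_elt r \<delta> n \<sigma>) d)"
  unfolding embed_sym_eq[OF n r] by (simp add: A.conv_sum_left A.conv_sum_right A.conv_scale_left A.conv_scale_right sum_distrib_left mult_ac)
 also have "\<dots> = (\<Sum>\<pi>\<in>Sym n. \<Sum>\<sigma>\<in>Sym n. f \<pi> * g \<sigma> * sym_elt r \<delta> n (\<sigma> \<circ> \<pi>) d)"
  by (intro sum.cong refl) (simp add: sym_elt_mult[OF n])
 also have "\<dots> = (\<Sum>\<pi>\<in>Sym n. \<Sum>\<sigma>\<in>Sym n. \<Sum>\<rho>\<in>Sym n. if \<rho> = \<sigma> \<circ> \<pi> then f \<pi> * g \<sigma> * sym_elt r \<delta> n \<rho> d else 0)"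
  by (intro sum.cong refl) (use S.op_closed in simp)
 also have "\<dots> = (\<Sum>\<pi>\<in>Sym n. \<Sum>\<rho>\<in>Sym n. \<Sum>\<sigma>\<in>Sym n. if \<rho> = \<sigma> \<circ> \<pi> then f \<pi> * g \<sigma> * sym_elt r \<delta> n \<rho> d else 0)"
  by (rule sum.cong[OF refl], rule sum.swap)
 also have "\<dots> = (\<Sum>\<rho>\<in>Sym n. \<Sum>\<pi>\<in>Sym n. \<Sum>\<sigma>\<in>Sym n. if \<rho> = \<sigma> \<circ> \<pi> then f \<pi> * g \<sigma> * sym_elt r \<delta> n \<rho> d else 0)"
  by (rule sum.swap)
 also have "\<dots> = (\<Sum>\<rho>\<in>Sym n. gmult (Sym n) f g \<rho> * sym_elt r \<delta> n \<rho> d)"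
  unfolding conv_def sum_distrib_right by (intro sum.cong refl) auto
 finally show "pmult r \<delta> (embed_sym r \<delta> n f) (embed_sym r \<delta> n g) d = embed_sym r \<delta> n (gmult (Sym n) f g) d"
  unfolding embed_sym_eq[OF n r] .
qed

lemma embed_sym_basis:
 assumes "n \<le> r" "\<pi> permutes {1..n}"
 shows "embed_sym r \<delta> n (basis_vec \<pi>) = sym_elt r \<delta> n \<pi>"
proof
 fix d
 have "(\<Sum>\<sigma>\<in>Sym n. basis_vec \<pi> \<sigma> * sym_elt r \<delta> n \<sigma> d) = (\<Sum>\<sigma>\<in>Sym n. if \<sigma> = \<pi> then sym_elt r \<delta> n \<sigma> d else 0)"
  by (intro sum.cong refl) (simp add: basis_vec_def)
 also have "\<dots> = sym_elt r \<delta> n \<pi> d" using assms by simp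
 finally show "embed_sym r \<delta> n (basis_vec \<pi>) d = sym_elt r \<delta> n \<pi> d" unfolding embed_sym_eq[OF assms(1) r] .
qed

lemma embed_sym_idem_left:
 assumes n: "n \<le> r"
 shows "pmult r \<delta> (idem r \<delta> n) (embed_sym r \<delta> n f) = embed_sym r \<delta> n f"
proof -
 have "pmult r \<delta> (sym_elt r \<delta> n id) (embed_sym r \<delta> n f) = (%d. \<Sum>\<pi>\<in>Sym n. f \<pi> * pmult r \<delta> (sym_elt r \<delta> n id) (sym_elt r \<delta> n \<pi>) d)"
  unfolding embed_sym_eq[OF n r] by (simp add: A.conv_sum_right A.conv_scale_right)
 also have "\<dots> = embed_sym r \<delta> n f" unfolding embed_sym_eq[OF n r]
  by (intro ext sum.cong refl) (simp add: sym_elt_mult[OF n permutes_id])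
 finally show ?thesis unfolding idem_eq[OF n r] .
qed

lemma embed_sym_idem_right:
 assumes n: "n \<le> r"
 shows "pmult r \<delta> (embed_sym r \<delta> n f) (idem r \<delta> n) = embed_sym r \<delta> n f"
proof -
 have "pmult r \<delta> (embed_sym r \<delta> n f) (sym_elt r \<delta> n id) = (%d. \<Sum>\<pi>\<in>Sym n. f \<pi> * pmult r \<delta> (sym_elt r \<delta> n \<pi>) (sym_elt r \<delta> n id) d)"
  unfolding embed_sym_eq[OF n r] by (simp add: A.conv_sum_left A.conv_scale_left)
 also have "\<dots> = embed_sym r \<delta> n f" unfolding embed_sym_eq[OF n r]
  by (intro ext sum.cong refl) (simp add: sym_elt_mult[OF n _ permutes_id])
 finally show ?thesis unfolding idem_eq[OF n r] .
qed

lemma idem_idem: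
 assumes n: "n \<le> r"
 shows "pmult r \<delta> (idem r \<delta> n) (idem r \<delta> n) = idem r \<delta> n"
 unfolding idem_eq[OF n r] by (simp add: sym_elt_mult[OF n permutes_id permutes_id])

lemma embed_sym_add: "n \<le> r ==> embed_sym r \<delta> n (%\<pi>. f \<pi> + g \<pi>) = (%d. embed_sym r \<delta> n f d + embed_sym r \<delta> n g d)"
 by (simp add: embed_sym_eq[OF _ r] sum.distrib algebra_simps)

lemma embed_sym_outside: "n \<le> r ==> d \<notin> diagrams r ==> embed_sym r \<delta> n f d = 0"
 by (auto simp: embed_sym_eq[OF _ r] sym_elt_def basis_vec_def intro!: sum.neutral)

lemma idem_mult_support:
 assumes "n \<le> r" "pmult r \<delta> (idem r \<delta> n) v d \<noteq> 0"
 shows "tfix r n d"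
proof -
 obtain x y where xy: "x \<in> diagrams r" "y \<in> diagrams r" "d = (x ;; y)" "idem r \<delta> n x \<noteq> 0"
  using A.conv_support[OF assms(2)] by blast
 hence "x = pdiag r n id" unfolding idem_eq[OF assms(1) r] by (auto simp: sym_elt_def basis_vec_def split: if_splits)
 thus ?thesis using xy tfix_compose tfix_pdiag[OF assms(1)] by auto
qed

lemma mult_idem_support:
 assumes "l \<le> r" "pmult r \<delta> v (idem r \<delta> l) d \<noteq> 0"
 shows "bfix r l d"
proof -
 obtain x y where xy: "x \<in> diagrams r" "y \<in> diagrams r" "d = (x ;; y)" "idem r \<delta> l y \<noteq> 0"
  using A.conv_support[OF assms(2)] by blast
 hence "y = pdiag r l id" unfolding idem_eq[OF assms(1) r] by (auto simp: sym_elt_def basis_vec_def split: if_splits)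
 thus ?thesis using xy bfix_compose bfix_pdiag[OF assms(1) permutes_id] by auto
qed

section \<open>Layer ideals and the diagrams in them\<close>

definition small :: "nat => diagram => bool" where
 "small m d \<longleftrightarrow> (\<exists>x\<in>diagrams r. \<exists>y\<in>diagrams r. d = ((x ;; (pdiag r m id)) ;; y))"

lemma small_compose:
 assumes "small m d" "z \<in> diagrams r"
 shows "small m (d ;; z)" "small m (z ;; d)"
proof -
 obtain x y where xy: "x \<in> diagrams r" "y \<in> diagrams r" "d = ((x ;; (pdiag r m id)) ;; y)"
  using assms(1) unfolding small_def by blast
 have "(d ;; z) = ((x ;; (pdiag r m id)) ;; (y ;; z))"
  using xy assms by (simp add: compose_assoc(1)[of _ r])
 thus "small m (d ;; z)" unfolding small_def using xy assms compose_in_diagrams by blast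
 have "(z ;; d) = (((z ;; x) ;; (pdiag r m id)) ;; y)"
  using xy assms by (simp add: compose_assoc(1)[of _ r])
 thus "small m (z ;; d)" unfolding small_def using xy assms compose_in_diagrams by blast
qed

abbreviation "PA \<equiv> partition_algebra r \<delta>"

lemma group_PA: "comm_group (add_monoid PA)"
 by (rule comm_group_add_monoidI[OF comm_group_fun_group[of "diagrams r"]]) (auto simp: fun_group_def)

lemma inv_PA: "f \<in> carrier PA ==> inv\<^bsub>add_monoid PA\<^esub> f = (%d. - f d)"
proof -
 interpret comm_group "add_monoid PA" by (rule group_PA)
 assume "f \<in> carrier PA"
 thus ?thesis by (intro inv_equality) (auto simp: fun_eq_iff)
qed

lemma layer_ideal_subset: "layer_ideal r \<delta> i \<subseteq> carrier PA"
proof -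
 interpret comm_group "add_monoid PA" by (rule group_PA)
 have "generate (add_monoid PA) {pmult r \<delta> (pmult r \<delta> a (idem r \<delta> (nat i))) b | a b. a \<in> carrier PA \<and> b \<in> carrier PA} \<subseteq> carrier (add_monoid PA)"
  by (rule generate_incl) (use A.conv_outside in auto)
 thus ?thesis unfolding layer_ideal_def Let_def by auto
qed

lemma layer_ideal_subgroup: "subgroup (layer_ideal r \<delta> i) (add_monoid PA)"
proof -
 interpret comm_group "add_monoid PA" by (rule group_PA)
 have "subgroup (generate (add_monoid PA) {pmult r \<delta> (pmult r \<delta> a (idem r \<delta> (nat i))) b | a b. a \<in> carrier PA \<and> b \<in> carrier PA}) (add_monoid PA)"
  by (rule generate_is_subgroup) (use A.conv_outside in auto)
 thus ?thesis using triv_subgroup unfolding layer_ideal_def Let_def by auto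
qed

lemma layer_ideal_add: "a \<in> layer_ideal r \<delta> i ==> b \<in> layer_ideal r \<delta> i ==> (%d. a d + b d) \<in> layer_ideal r \<delta> i"
 using subgroup.m_closed[OF layer_ideal_subgroup, of a i b] by simp

lemma layer_ideal_uminus: "a \<in> layer_ideal r \<delta> i ==> (%d. - a d) \<in> layer_ideal r \<delta> i"
 using subgroup.m_inv_closed[OF layer_ideal_subgroup, of a i] inv_PA[of a] layer_ideal_subset[of i] by auto

lemma layer_ideal_zero: "(%d. 0) \<in> layer_ideal r \<delta> i"
 using subgroup.one_closed[OF layer_ideal_subgroup, of i] by simp

lemma layer_ideal_induct [consumes 1, case_names neg zero elt add]:
 assumes "a \<in> layer_ideal r \<delta> i"
  and neg: "\<And>a. P a ==> P (%d. - a d)"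
  and zero: "P (%_. 0)"
  and elt: "\<And>a b. i \<ge> 0 ==> a \<in> carrier PA ==> b \<in> carrier PA ==> P (pmult r \<delta> (pmult r \<delta> a (idem r \<delta> (nat i))) b)"
  and add: "\<And>a b. a \<in> carrier PA ==> b \<in> carrier PA ==> P a ==> P b ==> P (%d. a d + b d)"
 shows "P a"
proof (cases "i < 0")
 case True
 thus ?thesis using assms(1) zero by (simp add: layer_ideal_def)
next
 case False
 interpret comm_group "add_monoid PA" by (rule group_PA)
 let ?S = "{pmult r \<delta> (pmult r \<delta> a (idem r \<delta> (nat i))) b | a b. a \<in> carrier PA \<and> b \<in> carrier PA}"
 have S: "?S \<subseteq> carrier (add_monoid PA)" using A.conv_outside by auto
 have "a \<in> generate (add_monoid PA) ?S" using assms(1) False by (simp add: layer_ideal_def)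
 thus ?thesis
 proof (induction rule: generate.induct)
  case one thus ?case using zero by simp
 next
  case (incl h)
  then obtain a b where "a \<in> carrier PA" "b \<in> carrier PA" "h = pmult r \<delta> (pmult r \<delta> a (idem r \<delta> (nat i))) b" by blast
  thus ?case using elt[of a b] False by simp
 next
  case (inv h)
  then obtain a b where "a \<in> carrier PA" "b \<in> carrier PA" "h = pmult r \<delta> (pmult r \<delta> a (idem r \<delta> (nat i))) b" by blast
  hence "P h" using elt[of a b] False by simp
  have "h d = 0" if "d \<notin> diagrams r" for d unfolding \<open>h = _\<close> by (rule A.conv_outside[OF that])
  hence "h \<in> carrier PA" by simp
  show ?case unfolding inv_PA[OF \<open>h \<in> carrier PA\<close>] by (rule neg[OF \<open>P h\<close>])
 next
  case (eng f g)
  have "f \<in> carrier PA" "g \<in> carrier PA"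
   using generate_in_carrier[OF S eng.hyps(1)] generate_in_carrier[OF S eng.hyps(2)] by simp_all
  from add[OF this eng.IH] show ?case by simp
 qed
qed

lemma conv_uminus_left: "pmult r \<delta> (%d. - f d) g = (%d. - pmult r \<delta> f g d)"
 using A.conv_scale_left[of "-1" f g] by simp

lemma conv_uminus_right: "pmult r \<delta> f (%d. - g d) = (%d. - pmult r \<delta> f g d)"
 using A.conv_scale_right[of f "-1" g] by simp

lemma conv_zero_left: "pmult r \<delta> (%_. 0) g = (%_. 0)"
 using A.conv_scale_left[of 0 "%_. 0" g] by simp

lemma conv_zero_right: "pmult r \<delta> f (%_. 0) = (%_. 0)"
 using A.conv_scale_right[of f 0 "%_. 0"] by simp

lemma layer_ideal_generator:
 assumes "i \<ge> 0" "a \<in> carrier PA" "b \<in> carrier PA"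
 shows "pmult r \<delta> (pmult r \<delta> a (idem r \<delta> (nat i))) b \<in> layer_ideal r \<delta> i"
proof -
 have "pmult r \<delta> (pmult r \<delta> a (idem r \<delta> (nat i))) b \<in>
  {a \<otimes>\<^bsub>PA\<^esub> idem r \<delta> (nat i) \<otimes>\<^bsub>PA\<^esub> b | a b. a \<in> carrier PA \<and> b \<in> carrier PA}"
  by (intro CollectI exI[of _ a] exI[of _ b] conjI assms) simp
 thus ?thesis unfolding layer_ideal_def Let_def using assms(1) by (simp add: generate.incl)
qed

lemma layer_ideal_mult_right:
 assumes "a \<in> layer_ideal r \<delta> i" "b \<in> carrier PA"
 shows "pmult r \<delta> a b \<in> layer_ideal r \<delta> i"
 using assms(1)
proof (induction rule: layer_ideal_induct)
 case (neg a) thus ?case by (simp add: conv_uminus_left layer_ideal_uminus)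
next
 case zero thus ?case by (simp add: conv_zero_left layer_ideal_zero)
next
 case (elt a c)
 have "pmult r \<delta> c b \<in> carrier PA" using A.conv_outside by auto
 hence "pmult r \<delta> (pmult r \<delta> a (idem r \<delta> (nat i))) (pmult r \<delta> c b) \<in> layer_ideal r \<delta> i"
  using elt by (intro layer_ideal_generator)
 thus ?case by (simp add: A.conv_assoc)
next
 case (add a a') thus ?case by (simp add: A.conv_add_left layer_ideal_add)
qed

lemma layer_ideal_mult_left:
 assumes "a \<in> layer_ideal r \<delta> i" "b \<in> carrier PA"
 shows "pmult r \<delta> b a \<in> layer_ideal r \<delta> i"
 using assms(1)
proof (induction rule: layer_ideal_induct)
 case (neg a) thus ?case by (simp add: conv_uminus_right layer_ideal_uminus)
next
 case zero thus ?case by (simp add: conv_zero_right layer_ideal_zero)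
next
 case (elt a c)
 have "pmult r \<delta> b a \<in> carrier PA" using A.conv_outside by auto
 hence "pmult r \<delta> (pmult r \<delta> (pmult r \<delta> b a) (idem r \<delta> (nat i))) c \<in> layer_ideal r \<delta> i"
  using elt by (intro layer_ideal_generator)
 thus ?case by (simp add: A.conv_assoc)
next
 case (add a a') thus ?case by (simp add: A.conv_add_right layer_ideal_add)
qed

text \<open>A product through \<open>e_(n-1)\<close> is supported on diagrams that factor through
  \<open>n - 1\<close> dots, and this passes to sums; for \<open>n = 0\<close> the ideal is zero and
  has no support.\<close>

lemma layer_ideal_support:
 assumes "a \<in> layer_ideal r \<delta> (int n - 1)" "n \<le> r" "a d \<noteq> 0"
 shows "n \<noteq> 0 \<and> small (n - 1) d"
 using assms(1,3)
proof (induction arbitrary: d rule: layer_ideal_induct)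
 case (elt a b)
 hence n: "n \<noteq> 0" "nat (int n - 1) = n - 1" by auto
 obtain x y where xy: "x \<in> diagrams r" "y \<in> diagrams r" "d = (x ;; y)" "pmult r \<delta> a (idem r \<delta> (n - 1)) x \<noteq> 0"
  using A.conv_support[OF elt.prems] n by auto
 obtain z w where zw: "z \<in> diagrams r" "w \<in> diagrams r" "x = (z ;; w)" "idem r \<delta> (n - 1) w \<noteq> 0"
  using A.conv_support[OF xy(4)] by blast
 have "n - 1 \<le> r" using assms by simp
 hence "w = pdiag r (n - 1) id" using zw(4) unfolding idem_eq[OF \<open>n - 1 \<le> r\<close> r] by (auto simp: sym_elt_def basis_vec_def split: if_splits)
 thus ?case using xy zw n unfolding small_def by blast
next
 case (add a b)
 hence "a d \<noteq> 0 \<or> b d \<noteq> 0" by auto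
 thus ?case using add by blast
qed auto

text \<open>By \<open>small_factorisation\<close> the diagram is a product through
  \<open>e_m\<close> up to a scalar \<open>k\<close>, which collects the factor of the idempotent
  and the closed components of two compositions. It can be divided out because
  \<open>\<delta> \<noteq> 0\<close>.\<close>

lemma degenerate_in_layer_ideal:
 assumes "tfix r n d" "\<not> nondeg r n d" "n \<le> r"
 shows "(%d'. s * basis_vec d d') \<in> layer_ideal r \<delta> (int n - 1)"
proof (cases n)
 case 0
 thus ?thesis using assms by (simp add: nondeg_def)
next
 case (Suc m)
 obtain a b where ab: "a \<in> diagrams r" "b \<in> diagrams r" "d = ((a ;; (pdiag r m id)) ;; b)"
  using small_factorisation[of r m d] assms Suc by auto
 let ?x = "(a ;; (pdiag r m id))"
 have m: "m \<le> r" using assms Suc by simp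
 define k where "k = (if m = 0 then 1 / \<delta> else 1) * wt \<delta> a (pdiag r m id) * wt \<delta> ?x b"
 have k0: "k \<noteq> 0" using \<delta> by (simp add: k_def wt_def)
 have xd: "?x \<in> diagrams r" using ab by simp
 have a1: "pmult r \<delta> (basis_vec a) (idem r \<delta> m) = (%d. (if m = 0 then 1 / \<delta> else 1) * (wt \<delta> a (pdiag r m id) * basis_vec ?x d))"
  unfolding idem_eq[OF m r] sym_elt_def A.conv_scale_right A.conv_basis[OF ab(1) pdiag_in_diagrams] ..
 have "pmult r \<delta> (pmult r \<delta> (basis_vec a) (idem r \<delta> m)) (%d. (s / k) * basis_vec b d) = (%d'. s * basis_vec d d')"
  unfolding a1 A.conv_scale_left A.conv_scale_right A.conv_basis[OF xd ab(2)]
  using k0 by (simp add: fun_eq_iff k_def ab(3))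
 moreover have "pmult r \<delta> (pmult r \<delta> (basis_vec a) (idem r \<delta> (nat (int n - 1)))) (%d. (s / k) * basis_vec b d) \<in> layer_ideal r \<delta> (int n - 1)"
 proof -
  have "basis_vec a \<in> carrier PA" "(%d. (s / k) * basis_vec b d) \<in> carrier PA" using ab by (auto simp: basis_vec_def)
  thus ?thesis using Suc by (intro layer_ideal_generator) auto
 qed
 ultimately show ?thesis using Suc by simp
qed

end

section \<open>The layer restriction\<close>

lemma comm_group_funI:
 assumes "add M = (%f g d. f d + g d :: 'k::field)" "zero M = (%_. 0)" "(%_. 0) \<in> carrier M"
  and "\<And>f g. f \<in> carrier M ==> g \<in> carrier M ==> (%d. f d + g d) \<in> carrier M"
  and "\<And>f. f \<in> carrier M ==> (%d. - f d) \<in> carrier M"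
 shows "comm_group (add_monoid M)"
proof (rule comm_groupI)
 fix f assume "f \<in> carrier (add_monoid M)"
 thus "\<exists>g\<in>carrier (add_monoid M). g \<otimes>\<^bsub>add_monoid M\<^esub> f = \<one>\<^bsub>add_monoid M\<^esub>"
  using assms by (intro bexI[of _ "%d. - f d"]) auto
qed (use assms in \<open>auto simp: add_ac\<close>)

lemma inv_funI:
 assumes "comm_group (add_monoid M)" "add M = (%f g d. f d + g d :: 'k::field)" "zero M = (%_. 0)"
  "f \<in> carrier M" "(%d. - f d) \<in> carrier M"
 shows "inv\<^bsub>add_monoid M\<^esub> f = (%d. - f d)"
proof -
 interpret comm_group "add_monoid M" by fact
 show ?thesis using assms by (intro inv_equality) auto
qed

lemma subgroup_funI:
 assumes M: "comm_group (add_monoid M)" "add M = (%f g d. f d + g d :: 'k::field)" "zero M = (%_. 0)"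
  and "U \<subseteq> carrier M" "(%_. 0) \<in> U" "\<And>f g. f \<in> U ==> g \<in> U ==> (%d. f d + g d) \<in> U"
  and neg: "\<And>f. f \<in> U ==> (%d. - f d) \<in> U"
 shows "subgroup U (add_monoid M)"
proof -
 interpret comm_group "add_monoid M" by fact
 show ?thesis
 proof (rule subgroupI)
  fix f assume f: "f \<in> U"
  have "inv\<^bsub>add_monoid M\<^esub> f = (%d. - f d)" by (rule inv_funI[OF M]) (use assms f in auto)
  thus "inv\<^bsub>add_monoid M\<^esub> f \<in> U" using neg[OF f] by simp
 qed (use assms in auto)
qed

lemma Union_const: "C \<noteq> {} ==> (\<And>c. c \<in> C ==> f c = a) ==> (\<Union>c\<in>C. f c) = a"
 by blast

definition act :: "(nat => nat) => (nat => 'w) \<times> 'v => (nat => 'w) \<times> 'v" where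
 "act \<pi> \<eta> = (fst \<eta> \<circ> \<pi>, snd \<eta>)"

locale layer =
 fixes r n l :: nat and \<delta> :: "'k::field" and \<mu> :: "nat list"
 assumes r: "r \<ge> 1" and \<delta>: "\<delta> \<noteq> 0" and n: "n \<le> r" and l: "l \<le> r" and \<mu>: "sum_list \<mu> = l"
begin

sublocale A: twisted_monoid "diagrams r" compose_diagrams "wt \<delta>" by (rule twisted_monoid_diagrams)

abbreviation "pa \<equiv> partition_algebra r \<delta>"
abbreviation pm (infixl \<open>**\<close> 70) where "f ** g \<equiv> pmult r \<delta> f g"
abbreviation "en \<equiv> idem r \<delta> n"
abbreviation "el \<equiv> idem r \<delta> l"
abbreviation "em \<equiv> embed_sym r \<delta>"
abbreviation "JJ \<equiv> layer_ideal r \<delta> (int n - 1)"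
abbreviation "eA \<equiv> eA_bimodule r \<delta> n"
definition "U = {en \<otimes>\<^bsub>pa\<^esub> a | a. a \<in> JJ}"
abbreviation "X3 \<equiv> res_bimodule r \<delta> n"
abbreviation "X2 \<equiv> ind_bimodule r \<delta> l"
abbreviation "kn \<equiv> kSym n :: ((nat => nat) => 'k) ring"
abbreviation "kl \<equiv> group_algebra (Sym l) :: ((nat => nat) => 'k) ring"

lemma pm_in_pa [simp]: "f ** g \<in> carrier pa" using A.conv_outside by auto

lemmas J_mult_left = layer_ideal_mult_left[OF r \<delta>]
 and J_mult_right = layer_ideal_mult_right[OF r \<delta>]
 and J_add = layer_ideal_add[OF r \<delta>]
 and J_uminus = layer_ideal_uminus[OF r \<delta>]
 and J_zero = layer_ideal_zero[OF r \<delta>]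
 and J_subset = layer_ideal_subset[OF r \<delta>]
 and pm_uminus_left = conv_uminus_left[OF r \<delta>]
 and pm_uminus_right = conv_uminus_right[OF r \<delta>]
 and pm_zero_left = conv_zero_left[OF r \<delta>]
 and pm_zero_right = conv_zero_right[OF r \<delta>]

lemma idem_idem': "m \<le> r ==> idem r \<delta> m ** idem r \<delta> m = idem r \<delta> m"
 using idem_idem[OF r \<delta>] .

lemma idem_in_pa: "m \<le> r ==> idem r \<delta> m \<in> carrier pa"
 using idem_idem'[of m] pm_in_pa[of "idem r \<delta> m" "idem r \<delta> m"] by simp

text \<open>Membership in \<open>e_n A\<close> becomes a fixed point equation, which passes to sums
  and products without choosing preimages.\<close>

lemma eA_carrier: "v \<in> carrier eA \<longleftrightarrow> v \<in> carrier pa \<and> en ** v = v"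
proof
 assume "v \<in> carrier eA"
 then obtain a where a: "v = en ** a" by (auto simp: eA_bimodule_def)
 thus "v \<in> carrier pa \<and> en ** v = v" using pm_in_pa[of en a] idem_idem'[OF n] by (simp flip: A.conv_assoc)
next
 assume v: "v \<in> carrier pa \<and> en ** v = v"
 hence "v = en \<otimes>\<^bsub>pa\<^esub> v" by simp
 thus "v \<in> carrier eA" using v unfolding eA_bimodule_def Let_def bimodule.simps module.simps ring.simps partial_object.simps by blast
qed

lemma X2_carrier: "v \<in> carrier X2 \<longleftrightarrow> v \<in> carrier pa \<and> v ** el = v"
proof
 assume "v \<in> carrier X2"
 then obtain a where a: "v = a ** el" by (auto simp: ind_bimodule_def)
 thus "v \<in> carrier pa \<and> v ** el = v" using pm_in_pa[of a el] idem_idem'[OF l] by (simp add: A.conv_assoc)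
next
 assume v: "v \<in> carrier pa \<and> v ** el = v"
 hence "v = v \<otimes>\<^bsub>pa\<^esub> el" by simp
 thus "v \<in> carrier X2" using v unfolding ind_bimodule_def Let_def bimodule.simps module.simps ring.simps partial_object.simps by blast
qed

lemma U_iff: "v \<in> U \<longleftrightarrow> v \<in> JJ \<and> en ** v = v"
proof
 assume "v \<in> U"
 then obtain a where a: "a \<in> JJ" "v = en ** a" by (auto simp: U_def)
 thus "v \<in> JJ \<and> en ** v = v"
  using J_mult_left[OF a(1) idem_in_pa[OF n]] idem_idem'[OF n] by (simp flip: A.conv_assoc)
next
 assume "v \<in> JJ \<and> en ** v = v"
 hence "v = en \<otimes>\<^bsub>pa\<^esub> v" "v \<in> JJ" by simp_all
 thus "v \<in> U" unfolding U_def by blast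
qed

lemma eA_simps:
 "add eA = (%f g d. f d + g d)" "zero eA = (%_. 0)" "rsmult eA x a = x ** a" "f \<odot>\<^bsub>eA\<^esub> x = em n f ** x"
 by (simp_all add: eA_bimodule_def Let_def)

lemma X2_simps:
 "add X2 = (%f g d. f d + g d)" "zero X2 = (%_. 0)" "rsmult X2 x f = x ** em l f" "a \<odot>\<^bsub>X2\<^esub> x = a ** x"
 by (simp_all add: ind_bimodule_def Let_def)

lemma eA_group: "comm_group (add_monoid eA)"
 by (rule comm_group_funI)
  (auto simp: eA_simps eA_carrier A.conv_add_right pm_uminus_right pm_zero_right simp del: add_uminus_conv_diff)

lemma U_subset: "U \<subseteq> carrier eA"
proof
 fix v assume "v \<in> U"
 hence "v \<in> JJ" "en ** v = v" using U_iff[of v] by simp_all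
 thus "v \<in> carrier eA" unfolding eA_carrier using J_subset[THEN subsetD, of v] by simp
qed

lemma U_subgroup: "subgroup U (add_monoid eA)"
 by (rule subgroup_funI[OF eA_group eA_simps(1,2) U_subset])
  (simp_all add: U_iff J_add J_uminus J_zero A.conv_add_right pm_uminus_right pm_zero_right)

definition "cs v = U +>\<^bsub>eA\<^esub> v"

lemma X3_carrier: "carrier X3 = cs ` carrier eA"
 by (auto simp: res_bimodule_def quot_bimodule_def A_RCOSETS_def RCOSETS_def cs_def a_r_coset_def U_def)

lemma cs_add: "v \<in> carrier eA ==> w \<in> carrier eA ==> cs v \<oplus>\<^bsub>X3\<^esub> cs w = cs (%d. v d + w d)"
proof -
 assume vw: "v \<in> carrier eA" "w \<in> carrier eA"
 have "U \<lhd> add_monoid eA" using comm_group.normal_iff_subgroup[OF eA_group] U_subgroup by blast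
 from normal.rcos_sum[OF this, of v w] vw show ?thesis
  by (simp add: res_bimodule_def quot_bimodule_def cs_def a_r_coset_def set_add_def eA_simps U_def)
qed

lemma cs_eqI: "v \<in> carrier eA ==> w \<in> carrier eA ==> (%d. v d - w d) \<in> U ==> cs v = cs w"
proof -
 assume v: "v \<in> carrier eA" "w \<in> carrier eA" "(%d. v d - w d) \<in> U"
 interpret g: comm_group "add_monoid eA" by (rule eA_group)
 have "v = (%d. v d - w d) \<otimes>\<^bsub>add_monoid eA\<^esub> w" by (simp add: eA_simps)
 hence "v \<in> U #>\<^bsub>add_monoid eA\<^esub> w" using v(3) unfolding r_coset_def by blast
 thus ?thesis using g.repr_independence[OF _ _ U_subgroup] v unfolding cs_def a_r_coset_def by simp
qed

lemma cs_eqD: "v \<in> carrier eA ==> w \<in> carrier eA ==> cs v = cs w ==> (%d. v d - w d) \<in> U"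
proof -
 assume v: "v \<in> carrier eA" "w \<in> carrier eA" "cs v = cs w"
 interpret g: comm_group "add_monoid eA" by (rule eA_group)
 have "v \<in> U #>\<^bsub>add_monoid eA\<^esub> v" using g.rcos_self[OF _ U_subgroup] v by simp
 hence "v \<in> U #>\<^bsub>add_monoid eA\<^esub> w" using v(3) unfolding cs_def a_r_coset_def by simp
 then obtain u where "u \<in> U" "v = (%d. u d + w d)" unfolding r_coset_def by (auto simp: eA_simps)
 thus ?thesis by simp
qed

lemma cs_self: "v \<in> carrier eA ==> v \<in> cs v"
proof -
 assume v: "v \<in> carrier eA"
 interpret g: comm_group "add_monoid eA" by (rule eA_group)
 show ?thesis using g.rcos_self[OF _ U_subgroup, of v] v unfolding cs_def a_r_coset_def by simp
qed

lemma cs_memD: "v \<in> carrier eA ==> w \<in> cs v ==> w \<in> carrier eA \<and> (%d. w d - v d) \<in> U"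
proof -
 assume v: "v \<in> carrier eA" and w: "w \<in> cs v"
 then obtain u where u: "u \<in> U" "w = (%d. u d + v d)" unfolding cs_def a_r_coset_def r_coset_def by (auto simp: eA_simps)
 interpret g: comm_group "add_monoid eA" by (rule eA_group)
 have "u \<in> carrier eA" using u U_subset by blast
 hence "w \<in> carrier eA" using g.m_closed[of u v] v u(2) by (simp add: eA_simps)
 thus ?thesis using u by simp
qed

lemma U_mult_right: "u \<in> U ==> a \<in> carrier pa ==> u ** a \<in> U"
 unfolding U_iff by (simp add: J_mult_right flip: A.conv_assoc)

lemma em_in_pa: "m \<le> r ==> em m f \<in> carrier pa"
 using embed_sym_outside[OF r \<delta>] by auto

lemma en_em: "en ** em n f = em n f" using embed_sym_idem_left[OF r \<delta> n] .
lemma el_em: "el ** em l f = em l f" using embed_sym_idem_left[OF r \<delta> l] .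
lemma em_el: "em l f ** el = em l f" using embed_sym_idem_right[OF r \<delta> l] .

lemma U_mult_em: "u \<in> U ==> em n f ** u \<in> U"
proof -
 assume u: "u \<in> U"
 have "em n f ** u \<in> JJ" using J_mult_left u em_in_pa[OF n] unfolding U_iff by blast
 moreover have "en ** (em n f ** u) = em n f ** u" by (simp add: en_em flip: A.conv_assoc)
 ultimately show ?thesis unfolding U_iff by blast
qed

lemma eA_mult: "v \<in> carrier eA ==> v ** a \<in> carrier eA"
 unfolding eA_carrier using pm_in_pa by (simp flip: A.conv_assoc)

lemma eA_em: "em n f ** v \<in> carrier eA"
 unfolding eA_carrier using pm_in_pa by (simp add: en_em flip: A.conv_assoc)

lemma conv_diff_left: "(%d. f d - g d) ** h = (%d. (f ** h) d - (g ** h) d)"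
 using A.conv_add_left[of f "%d. - g d" h] by (simp add: pm_uminus_left)

lemma conv_diff_right: "h ** (%d. f d - g d) = (%d. (h ** f) d - (h ** g) d)"
 using A.conv_add_right[of h f "%d. - g d"] by (simp add: pm_uminus_right)

lemma cs_rsmult: "v \<in> carrier eA ==> a \<in> carrier pa ==> rsmult X3 (cs v) a = cs (v ** a)"
proof -
 assume v: "v \<in> carrier eA" and a: "a \<in> carrier pa"
 have "cs (w ** a) = cs (v ** a)" if "w \<in> cs v" for w
 proof (rule cs_eqI)
  note w = cs_memD[OF v that]
  show "w ** a \<in> carrier eA" "v ** a \<in> carrier eA" using w v by (simp_all only: eA_mult)
  show "(%d. (w ** a) d - (v ** a) d) \<in> U"
   unfolding conv_diff_left[symmetric] by (rule U_mult_right[OF w[THEN conjunct2] a])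
 qed
 moreover have "cs v \<noteq> {}" using cs_self[OF v] by blast
 ultimately have "(\<Union>w\<in>cs v. cs (w ** a)) = cs (v ** a)" using Union_const[of "cs v" "%w. cs (w ** a)"] by blast
 thus ?thesis by (simp add: res_bimodule_def quot_bimodule_def eA_simps cs_def U_def)
qed

lemma cs_smult: "v \<in> carrier eA ==> f \<odot>\<^bsub>X3\<^esub> cs v = cs (em n f ** v)"
proof -
 assume v: "v \<in> carrier eA"
 have "cs (em n f ** w) = cs (em n f ** v)" if "w \<in> cs v" for w
 proof (rule cs_eqI)
  note w = cs_memD[OF v that]
  show "em n f ** w \<in> carrier eA" "em n f ** v \<in> carrier eA" by (simp_all only: eA_em)
  show "(%d. (em n f ** w) d - (em n f ** v) d) \<in> U"
   unfolding conv_diff_right[symmetric] by (rule U_mult_em[OF w[THEN conjunct2]])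
 qed
 moreover have "cs v \<noteq> {}" using cs_self[OF v] by blast
 ultimately have "(\<Union>w\<in>cs v. cs (em n f ** w)) = cs (em n f ** v)" using Union_const[of "cs v" "%w. cs (em n f ** w)"] by blast
 thus ?thesis by (simp add: res_bimodule_def quot_bimodule_def eA_simps cs_def U_def)
qed

subsection \<open>Coefficient functionals\<close>

abbreviation "D \<equiv> core_diagrams r n l"
abbreviation "dt \<equiv> diagram_type n \<mu>"
abbreviation "Y \<equiv> dt ` D"

lemma D_diagrams: "D \<subseteq> diagrams r" using tfix_diagram by (auto simp: core_diagrams_def)

lemma finite_D: "finite D" using finite_subset[OF D_diagrams] by simp

text \<open>The index set of the sum is one orbit of the Young subgroup on the core diagrams.
  Summing over orbits is the effect of tensoring with the trivial module; the other diagrams of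
  \<open>e_n A e_l\<close> are ignored since they lie in \<open>J_(n-1)\<close>.\<close>

definition coef :: "(diagram => 'k) => (nat => nat list) \<times> nat list multiset => 'k" where
 "coef v = (%\<eta>. \<Sum>d\<in>{d\<in>D. dt d = \<eta>}. v d)"

lemma coef_add: "coef (%d. v d + w d) = (%\<eta>. coef v \<eta> + coef w \<eta>)"
 by (simp add: coef_def sum.distrib)

lemma coef_scale: "coef (%d. c * v d) = (%\<eta>. c * coef v \<eta>)"
 by (simp add: coef_def sum_distrib_left)

lemma coef_sum: "coef (%d. \<Sum>i\<in>I. F i d) = (%\<eta>. \<Sum>i\<in>I. coef (F i) \<eta>)"
 unfolding coef_def by (rule ext) (rule sum.swap)

lemma coef_diff: "coef (%d. v d - w d) = (%\<eta>. coef v \<eta> - coef w \<eta>)"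
 by (simp add: coef_def sum_subtractf)

lemma coef_outside: "\<eta> \<notin> Y ==> coef v \<eta> = 0"
 unfolding coef_def by (rule sum.neutral) auto

lemma coef_basis: "coef (basis_vec d) = (%\<eta>. if d \<in> D \<and> dt d = \<eta> then 1 else 0)"
proof
 fix \<eta>
 have "(\<Sum>d'\<in>{d\<in>D. dt d = \<eta>}. if d' = d then 1 else 0 :: 'k) = (if d \<in> {d\<in>D. dt d = \<eta>} then 1 else 0)"
  using finite_D by simp
 thus "coef (basis_vec d) \<eta> = (if d \<in> D \<and> dt d = \<eta> then 1 else 0)"
  by (simp add: coef_def basis_vec_def)
qed

lemma pa_expand: "v \<in> carrier pa ==> v = (%d. \<Sum>x\<in>diagrams r. v x * basis_vec x d)"
 by (rule basis_vec_expand) auto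

lemma X2_support: "v \<in> carrier X2 ==> v d \<noteq> 0 ==> bfix r l d"
 using mult_idem_support[OF r \<delta> l, of v d] by (simp add: X2_carrier)

lemma eA_support: "v \<in> carrier eA ==> v d \<noteq> 0 ==> tfix r n d"
 using idem_mult_support[OF r \<delta> n, of v d] by (simp add: eA_carrier)

text \<open>Right multiplication by \<open>\<sigma>\<close> permutes the diagrams of
  \<open>A e_l\<close> and preserves the type of core diagrams. That it also keeps the other
  diagrams out of \<open>D\<close> follows by multiplying back with the inverse.\<close>

lemma coef_young:
 assumes v: "v \<in> carrier X2" and s: "\<sigma> \<in> young_subgroup \<mu>"
 shows "coef (v ** sym_elt r \<delta> l \<sigma>) = coef v"
proof -
 have p: "\<sigma> permutes {1..l}" using s \<mu> by (simp add: young_subgroup_iff)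
 have pi: "pinv \<sigma> permutes {1..l}" using permutes_inv[OF p] .
 have si: "pinv \<sigma> \<in> young_subgroup \<mu>"
 proof -
  have "blk \<mu> (pinv \<sigma> j) = blk \<mu> j" if "j \<in> {1..l}" for j
  proof -
   have "pinv \<sigma> j \<in> {1..l}" using permutes_in_image[OF pi] that by blast
   hence "blk \<mu> (\<sigma> (pinv \<sigma> j)) = blk \<mu> (pinv \<sigma> j)" using s \<mu> by (simp add: young_subgroup_iff)
   thus ?thesis using permutes_inverses(1)[OF p] by simp
  qed
  thus ?thesis using pi \<mu> by (simp add: young_subgroup_iff)
 qed
 have vp: "v \<in> carrier pa" using v X2_carrier by blast
 have basis: "coef (basis_vec d ** sym_elt r \<delta> l \<sigma>) = coef (basis_vec d)" if d: "bfix r l d" for d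
 proof -
  have dd: "d \<in> diagrams r" using bfix_diagram[OF d] .
  let ?d = "(d ;; (pdiag r l \<sigma>))"
  have bk: "(?d ;; (pdiag r l (pinv \<sigma>))) = d"
  proof -
   have "(?d ;; (pdiag r l (pinv \<sigma>))) = (d ;; ((pdiag r l \<sigma>) ;; (pdiag r l (pinv \<sigma>))))"
    using compose_assoc(1)[OF dd] by simp
   also have "\<dots> = (d ;; (pdiag r l id))"
    unfolding pdiag_compose_pdiag[OF l p pi r] using permutes_inv_o(2)[OF p] by simp
   also have "\<dots> = d" by (rule bfix_compose_pdiag(3)[OF d l permutes_id r refl])
   finally show ?thesis .
  qed
  have "?d \<in> D \<longleftrightarrow> d \<in> D"
  proof
   assume "?d \<in> D"
   from core_compose_pdiag(1)[OF this si n \<mu> l r] show "d \<in> D" unfolding bk .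
  qed (rule core_compose_pdiag(1)[OF _ s n \<mu> l r])
  moreover have "dt ?d = dt d" if "d \<in> D" using core_compose_pdiag(2)[OF that s n \<mu> l r] .
  ultimately have "coef (basis_vec ?d) = coef (basis_vec d)" unfolding coef_basis by auto
  thus ?thesis unfolding basis_mult_sym_elt[OF r \<delta> d l p] .
 qed
 have "coef (v ** sym_elt r \<delta> l \<sigma>) = coef ((%d. \<Sum>x\<in>diagrams r. v x * basis_vec x d) ** sym_elt r \<delta> l \<sigma>)"
  using pa_expand[OF vp] by simp
 also have "\<dots> = (%\<eta>. \<Sum>x\<in>diagrams r. v x * coef (basis_vec x ** sym_elt r \<delta> l \<sigma>) \<eta>)"
  unfolding A.conv_sum_left A.conv_scale_left coef_sum coef_scale ..
 also have "\<dots> = (%\<eta>. \<Sum>x\<in>diagrams r. v x * coef (basis_vec x) \<eta>)"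
  using basis X2_support[OF v] by (intro ext sum.cong refl) (metis mult_zero_left)
 also have "\<dots> = coef (%d. \<Sum>x\<in>diagrams r. v x * basis_vec x d)"
  unfolding coef_sum coef_scale ..
 also have "\<dots> = coef v" using pa_expand[OF vp] by simp
 finally show ?thesis .
qed

text \<open>Putting the diagram of \<open>\<pi>\<close> on top changes the type of a core diagram by
  \<open>act \<pi>\<close>, so the coefficient at \<open>\<eta>\<close> is the former coefficient at
  the type that is moved to \<open>\<eta>\<close>.\<close>

lemma coef_em:
 assumes v: "v \<in> carrier eA" and b: "\<And>d. v d \<noteq> 0 ==> bfix r l d"
 shows "coef (em n f ** v) = (%\<eta>. \<Sum>\<pi>\<in>Sym n. f \<pi> * coef v (act (pinv \<pi>) \<eta>))"
proof -
 have vp: "v \<in> carrier pa" using v eA_carrier by blast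
 have basis: "coef (sym_elt r \<delta> n \<pi> ** basis_vec d) \<eta> = coef (basis_vec d) (act (pinv \<pi>) \<eta>)"
  if d: "tfix r n d" "bfix r l d" and p: "\<pi> permutes {1..n}" for d \<pi> \<eta>
 proof -
  have dd: "d \<in> diagrams r" using bfix_diagram[OF d(2)] .
  have pi: "pinv \<pi> permutes {1..n}" using permutes_inv[OF p] .
  let ?d = "((pdiag r n \<pi>) ;; d)"
  have bk: "((pdiag r n (pinv \<pi>)) ;; ?d) = d"
  proof -
   have "((pdiag r n (pinv \<pi>)) ;; ?d) = (((pdiag r n (pinv \<pi>)) ;; (pdiag r n \<pi>)) ;; d)"
    using compose_assoc(1)[OF pdiag_in_diagrams pdiag_in_diagrams dd] by simp
   also have "\<dots> = ((pdiag r n id) ;; d)"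
    unfolding pdiag_compose_pdiag[OF n pi p r] using permutes_inv_o(1)[OF p] by simp
   also have "\<dots> = d" by (rule pdiag_compose_tfix(3)[OF d(1) n permutes_id r refl])
   finally show ?thesis .
  qed
  have D: "?d \<in> D \<longleftrightarrow> d \<in> D"
  proof
   assume "?d \<in> D"
   from compose_pdiag_in_core(1)[OF this pi n \<mu> l r] show "d \<in> D" unfolding bk .
  qed (rule compose_pdiag_in_core(1)[OF _ p n \<mu> l r])
  have "dt ?d = \<eta> \<longleftrightarrow> dt d = act (pinv \<pi>) \<eta>" if "d \<in> D"
  proof -
   have "dt ?d = act \<pi> (dt d)" using compose_pdiag_in_core(2)[OF that p n \<mu> l r] by (simp add: act_def)
   moreover have "act \<pi> (act (pinv \<pi>) \<eta>) = \<eta>" "act (pinv \<pi>) (act \<pi> (dt d)) = dt d"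
    using permutes_inv_o[OF p] by (simp_all add: act_def comp_assoc)
   ultimately show ?thesis by metis
  qed
  thus ?thesis using D unfolding sym_elt_mult_basis[OF r \<delta> d(1) n p] coef_basis by (cases "d \<in> D") simp_all
 qed
 have "coef (em n f ** v) = coef ((%d. \<Sum>\<pi>\<in>Sym n. f \<pi> * sym_elt r \<delta> n \<pi> d) ** (%d. \<Sum>x\<in>diagrams r. v x * basis_vec x d))"
  using pa_expand[OF vp] embed_sym_eq[OF n r, of \<delta> f] by simp
 also have "\<dots> = (%\<eta>. \<Sum>\<pi>\<in>Sym n. f \<pi> * (\<Sum>x\<in>diagrams r. v x * coef (sym_elt r \<delta> n \<pi> ** basis_vec x) \<eta>))"
  unfolding A.conv_sum_left A.conv_scale_left A.conv_sum_right A.conv_scale_right coef_sum coef_scale ..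
 also have "\<dots> = (%\<eta>. \<Sum>\<pi>\<in>Sym n. f \<pi> * (\<Sum>x\<in>diagrams r. v x * coef (basis_vec x) (act (pinv \<pi>) \<eta>)))"
 proof -
  have e: "v x * coef (sym_elt r \<delta> n \<pi> ** basis_vec x) \<eta> = v x * coef (basis_vec x) (act (pinv \<pi>) \<eta>)"
   if "\<pi> \<in> Sym n" for \<pi> x \<eta>
   using basis[of x \<pi> \<eta>] eA_support[OF v, of x] b[of x] that by (cases "v x = 0") auto
  show ?thesis by (rule ext, rule sum.cong[OF refl], rule arg_cong[where f = "%z. f _ * z"], rule sum.cong[OF refl], rule e)
 qed
 also have "\<dots> = (%\<eta>. \<Sum>\<pi>\<in>Sym n. f \<pi> * coef (%d. \<Sum>x\<in>diagrams r. v x * basis_vec x d) (act (pinv \<pi>) \<eta>))"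
  unfolding coef_sum coef_scale ..
 also have "\<dots> = (%\<eta>. \<Sum>\<pi>\<in>Sym n. f \<pi> * coef v (act (pinv \<pi>) \<eta>))" using pa_expand[OF vp] by simp
 finally show ?thesis .
qed

text \<open>A product with an element of \<open>J_(n-1)\<close> is supported on diagrams factoring
  through \<open>n - 1\<close> dots, and these are degenerate. This makes the functionals well
  defined on the quotient by \<open>e_n J_(n-1)\<close>.\<close>

lemma coef_U:
 assumes u: "u \<in> U" and v: "v \<in> carrier pa"
 shows "coef (u ** v) = (%_. 0)"
proof -
 have "(u ** v) d = 0" if d: "d \<in> D" for d
 proof (rule ccontr)
  assume "(u ** v) d \<noteq> 0"
  then obtain x y where xy: "x \<in> diagrams r" "y \<in> diagrams r" "d = (x ;; y)" "u x \<noteq> 0"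
   using A.conv_support by blast
  have "u \<in> JJ" using u U_iff by blast
  from layer_ideal_support[OF r \<delta> this n xy(4)] have n0: "n \<noteq> 0" and sm: "small r (n - 1) x" by blast+
  from small_compose(1)[OF r \<delta> sm xy(2)] obtain z w where
   "z \<in> diagrams r" "w \<in> diagrams r" "d = ((z ;; (pdiag r (n - 1) id)) ;; w)"
   unfolding xy(3)[symmetric] small_def[OF r \<delta>] by blast
  hence "\<not> nondeg r n d" using not_nondeg_of_small[of z r w "n - 1" n d] n n0 by simp
  thus False using d by (simp add: core_diagrams_def)
 qed
 thus ?thesis unfolding coef_def by (intro ext sum.neutral) auto
qed

end

section \<open>The permutation module as a tensor product\<close>

locale perm_setup =
 fixes m :: nat and \<nu> :: "nat list" and k_type :: "'k::field itself"
 assumes \<nu>: "sum_list \<nu> = m"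
begin

abbreviation "kY \<equiv> group_algebra (young_subgroup \<nu>) :: ((nat => nat) => 'k) ring"
abbreviation "kS \<equiv> kSym m :: ((nat => nat) => 'k) ring"
abbreviation "X1 \<equiv> regular_bimodule kS"
abbreviation "tr \<equiv> trivial_module (young_subgroup \<nu>) :: ((nat => nat) => 'k, 'k) module"
abbreviation "P \<equiv> perm_module m \<nu> :: ((nat => nat) => 'k, 'k tensors) module"

sublocale S: twisted_monoid "Sym m" "%\<pi> \<sigma>. \<sigma> \<circ> \<pi>" "%_ _. 1::'k" by (rule twisted_monoid_Sym)

lemma X1_simps:
 "carrier X1 = carrier kS" "add X1 = (%f g d. f d + g d)" "zero X1 = (%_. 0)" "rsmult X1 = gmult (Sym m)" "smult X1 = gmult (Sym m)"
 by (simp_all add: regular_bimodule_def)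

lemma tr_simps: "carrier tr = UNIV" "add tr = (+)" "f \<odot>\<^bsub>tr\<^esub> c = (\<Sum>\<pi>\<in>young_subgroup \<nu>. f \<pi>) * c"
 by (simp_all add: trivial_module_def)

lemma gmult_in [simp]: "gmult (Sym m) f g \<in> carrier kS"
 using S.conv_outside by auto

sublocale TP: tensor_factors kY X1 tr
 by unfold_locales (use gmult_in in \<open>auto simp: X1_simps tr_simps\<close>)

lemma P_eq: "P = tensor kY X1 tr" by (simp add: perm_module_def)

abbreviation pt where "pt f c \<equiv> pure_tensor kY X1 tr f c"

lemma pt_in: "f \<in> carrier kS ==> pt f c \<in> carrier P"
 unfolding P_eq using TP.pure_in_T[of f c] by (simp add: X1_simps tr_simps)

lemma pt_add_left: "f \<in> carrier kS ==> f' \<in> carrier kS ==> pt (%d. f d + f' d) c = pt f c \<oplus>\<^bsub>P\<^esub> pt f' c"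
 unfolding P_eq using TP.pure_add_left[of f f' c] by (simp add: X1_simps tr_simps)

lemma pt_add_right: "f \<in> carrier kS ==> pt f (c + c') = pt f c \<oplus>\<^bsub>P\<^esub> pt f c'"
 unfolding P_eq using TP.pure_add_right[of f c c'] by (simp add: X1_simps tr_simps)

lemma pt_balanced: "f \<in> carrier kS ==> a \<in> carrier kY ==> pt (gmult (Sym m) f a) c = pt f ((\<Sum>\<pi>\<in>young_subgroup \<nu>. a \<pi>) * c)"
 unfolding P_eq using TP.pure_balanced[of f a c] by (simp add: X1_simps tr_simps)

lemma P_group: "comm_group (add_monoid P)"
 unfolding P_eq by (rule TP.comm_group_T)

lemma P_smult: "(%z. g \<odot>\<^bsub>P\<^esub> z) \<in> hom (add_monoid P) (add_monoid P)"
 "f \<in> carrier kS ==> g \<odot>\<^bsub>P\<^esub> pt f c = pt (gmult (Sym m) g f) c"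
proof -
 have 1: "g \<odot>\<^bsub>X1\<^esub> x \<in> carrier X1" for x using gmult_in by (simp add: X1_simps)
 have 2: "g \<odot>\<^bsub>X1\<^esub> (x \<oplus>\<^bsub>X1\<^esub> x') = g \<odot>\<^bsub>X1\<^esub> x \<oplus>\<^bsub>X1\<^esub> g \<odot>\<^bsub>X1\<^esub> x'" for x x'
  by (simp add: X1_simps S.conv_add_right)
 have 3: "g \<odot>\<^bsub>X1\<^esub> rsmult X1 x a = rsmult X1 (g \<odot>\<^bsub>X1\<^esub> x) a" for x a
  by (simp add: X1_simps S.conv_assoc)
 show "(%z. g \<odot>\<^bsub>P\<^esub> z) \<in> hom (add_monoid P) (add_monoid P)"
  unfolding P_eq by (rule TP.smult_T(1)[OF 1 2 3])
 show "g \<odot>\<^bsub>P\<^esub> pt f c = pt (gmult (Sym m) g f) c" if "f \<in> carrier kS"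
  unfolding P_eq using TP.smult_T(2)[OF 1 2 3, of f c] that by (simp add: X1_simps tr_simps)
qed

lemma P_induct:
 assumes "subgroup K (add_monoid P)" "\<And>f c. f \<in> carrier kS ==> pt f c \<in> K"
 shows "carrier P \<subseteq> K"
 using TP.tensor_subgroup_induct[of K] assms unfolding P_eq by (simp add: X1_simps)

lemma gmult_basis:
 assumes "\<pi> permutes {1..m}" "\<sigma> permutes {1..m}"
 shows "gmult (Sym m) (basis_vec \<pi>) (%\<rho>. (c::'k) * basis_vec \<sigma> \<rho>) = (%\<rho>. c * basis_vec (\<sigma> \<circ> \<pi>) \<rho>)"
 unfolding S.conv_scale_right using assms S.conv_basis[of \<pi> \<sigma>] by simp

lemma scaled_basis_in: "\<pi> permutes {1..m} ==> (%\<rho>. c * basis_vec \<pi> \<rho>) \<in> carrier kS"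
 by (auto simp: basis_vec_def)

text \<open>Multiples of the identity lie in the group algebra of the Young subgroup, so a scalar
  crosses the tensor sign by balancedness. This is the source of \<open>k\<close>-bilinearity, as
  the relations themselves ask only for biadditivity and balancedness.\<close>

lemma pt_scale:
 assumes "\<pi> permutes {1..m}"
 shows "pt (%\<rho>. s * basis_vec \<pi> \<rho>) c = pt (basis_vec \<pi>) (s * c)"
proof -
 have b: "basis_vec \<pi> \<in> carrier kS" using scaled_basis_in[OF assms, of 1] by simp
 have "(%\<rho>. s * basis_vec id \<rho>) \<in> carrier kY" by (auto simp: basis_vec_def)
 from pt_balanced[OF b this, of c]
 have "pt (%\<rho>. s * basis_vec \<pi> \<rho>) c = pt (basis_vec \<pi>) ((\<Sum>\<rho>\<in>young_subgroup \<nu>. s * basis_vec id \<rho>) * c)"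
  unfolding gmult_basis[OF assms permutes_id] by simp
 moreover have "(\<Sum>\<rho>\<in>young_subgroup \<nu>. s * basis_vec id \<rho>) = s"
 proof -
  have "finite (young_subgroup \<nu>)" using finite_subset[OF young_subset_Sym] by simp
  thus ?thesis by (simp add: basis_vec_def if_distrib[of "%x. s * x"] cong: if_cong)
 qed
 ultimately show ?thesis by simp
qed

lemma sum_young_basis: "\<sigma> \<in> young_subgroup \<nu> ==> (\<Sum>\<rho>\<in>young_subgroup \<nu>. basis_vec \<sigma> \<rho>) = (1::'k)"
proof -
 assume s: "\<sigma> \<in> young_subgroup \<nu>"
 have "finite (young_subgroup \<nu>)" using finite_subset[OF young_subset_Sym] by simp
 thus ?thesis using s by (simp add: basis_vec_def)
qed

lemma P_induct_basis:
 assumes K: "subgroup K (add_monoid P)" and b: "\<And>\<pi> c. \<pi> permutes {1..m} ==> pt (basis_vec \<pi>) c \<in> K"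
 shows "carrier P \<subseteq> K"
proof (rule P_induct[OF K])
 interpret P: comm_group "add_monoid P" by (rule P_group)
 fix f c assume f: "f \<in> carrier kS"
 have z: "pt (%_. 0) c \<in> K"
 proof -
  have "pt (%\<rho>. 0 * basis_vec id \<rho>) c = pt (basis_vec id) (0 * c)" by (rule pt_scale[OF permutes_id])
  thus ?thesis using b[OF permutes_id, of 0] by simp
 qed
 have "pt (%\<rho>. \<Sum>\<pi>\<in>B. f \<pi> * basis_vec \<pi> \<rho>) c \<in> K" if "finite B" "B \<subseteq> Sym m" for B
  using that
 proof (induction B rule: finite_induct)
  case empty thus ?case using z by simp
 next
  case (insert \<pi> B)
  hence p: "\<pi> permutes {1..m}" by simp
  have s: "(%\<rho>. \<Sum>\<pi>\<in>B. f \<pi> * basis_vec \<pi> \<rho>) \<in> carrier kS"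
   using insert by (auto simp: basis_vec_def intro!: sum.neutral)
  have "pt (%\<rho>. \<Sum>\<pi>\<in>insert \<pi> B. f \<pi> * basis_vec \<pi> \<rho>) c =
    pt (%\<rho>. f \<pi> * basis_vec \<pi> \<rho>) c \<oplus>\<^bsub>P\<^esub> pt (%\<rho>. \<Sum>\<pi>\<in>B. f \<pi> * basis_vec \<pi> \<rho>) c"
   unfolding sum.insert[OF insert.hyps] by (rule pt_add_left[OF scaled_basis_in[OF p] s])
  moreover have "pt (%\<rho>. f \<pi> * basis_vec \<pi> \<rho>) c \<in> K" unfolding pt_scale[OF p] by (rule b[OF p])
  ultimately show ?case using insert subgroup.m_closed[OF K, of "pt (%\<rho>. f \<pi> * basis_vec \<pi> \<rho>) c"] by simp
 qed
 from this[OF finite_Sym order_refl] show "pt f c \<in> K"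
  using basis_vec_expand[OF finite_Sym, of m f] f by simp
qed

end

section \<open>Functionals on the iterated tensor product\<close>

context layer
begin

interpretation PS: perm_setup l \<mu> "TYPE('k)" by unfold_locales (rule \<mu>)

abbreviation "P \<equiv> PS.P"
abbreviation "N \<equiv> layer_ind r \<delta> l P"

lemma X2_add: "v \<in> carrier X2 ==> w \<in> carrier X2 ==> (%d. v d + w d) \<in> carrier X2"
 unfolding X2_carrier by (simp add: A.conv_add_left)

lemma X2_em: "v ** em l f \<in> carrier X2"
 unfolding X2_carrier using pm_in_pa by (simp add: A.conv_assoc em_el)

lemma X2_mult: "v \<in> carrier X2 ==> a ** v \<in> carrier X2"
 unfolding X2_carrier using pm_in_pa by (simp add: A.conv_assoc)

lemma TN: "tensor_factors kl X2 P"
proof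
 show "x \<oplus>\<^bsub>X2\<^esub> x' \<in> carrier X2" if "x \<in> carrier X2" "x' \<in> carrier X2" for x x'
  using X2_add[OF that] by (simp add: X2_simps)
 show "y \<oplus>\<^bsub>P\<^esub> y' \<in> carrier P" if "y \<in> carrier P" "y' \<in> carrier P" for y y'
  using monoid.m_closed[OF group.is_monoid[OF comm_group.axioms(2)[OF PS.P_group]], of y y'] that by simp
 show "rsmult X2 x a \<in> carrier X2" for x a using X2_em by (simp add: X2_simps)
 show "a \<odot>\<^bsub>P\<^esub> y \<in> carrier P" if "y \<in> carrier P" for a y
  using hom_carrier[OF PS.P_smult(1)[of a]] that by auto
qed

lemma N_eq: "N = tensor kl X2 P" by (simp add: layer_ind_def)

interpretation TN: tensor_factors kl X2 P by (rule TN)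

lemma N_group: "comm_group (add_monoid N)" unfolding N_eq by (rule TN.comm_group_T)

lemma N_smult: "(%z. a \<odot>\<^bsub>N\<^esub> z) \<in> hom (add_monoid N) (add_monoid N)"
 "v \<in> carrier X2 ==> p \<in> carrier P ==> a \<odot>\<^bsub>N\<^esub> pure_tensor kl X2 P v p = pure_tensor kl X2 P (a ** v) p"
proof -
 have 1: "a \<odot>\<^bsub>X2\<^esub> x \<in> carrier X2" if "x \<in> carrier X2" for x using X2_mult[OF that] by (simp add: X2_simps)
 have 2: "a \<odot>\<^bsub>X2\<^esub> (x \<oplus>\<^bsub>X2\<^esub> x') = a \<odot>\<^bsub>X2\<^esub> x \<oplus>\<^bsub>X2\<^esub> a \<odot>\<^bsub>X2\<^esub> x'" for x x'
  by (simp add: X2_simps A.conv_add_right)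
 have 3: "a \<odot>\<^bsub>X2\<^esub> rsmult X2 x f = rsmult X2 (a \<odot>\<^bsub>X2\<^esub> x) f" for x f
  by (simp add: X2_simps A.conv_assoc)
 show "(%z. a \<odot>\<^bsub>N\<^esub> z) \<in> hom (add_monoid N) (add_monoid N)"
  unfolding N_eq by (rule TN.smult_T(1)[OF 1 2 3])
 show "a \<odot>\<^bsub>N\<^esub> pure_tensor kl X2 P v p = pure_tensor kl X2 P (a ** v) p" if "v \<in> carrier X2" "p \<in> carrier P"
  unfolding N_eq using TN.smult_T(2)[OF 1 2 3 that] by (simp add: X2_simps)
qed

abbreviation "L \<equiv> layer_res r \<delta> n N"

lemma TL: "tensor_factors pa X3 N"
proof
 show "C \<oplus>\<^bsub>X3\<^esub> C' \<in> carrier X3" if C: "C \<in> carrier X3" "C' \<in> carrier X3" for C C'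
 proof -
  obtain v w where v: "v \<in> carrier eA" "w \<in> carrier eA" "C = cs v" "C' = cs w" using C X3_carrier by auto
  have "(%d. v d + w d) \<in> carrier eA" using v unfolding eA_carrier by (simp add: A.conv_add_right)
  thus ?thesis unfolding v(3,4) cs_add[OF v(1,2)] X3_carrier by blast
 qed
 show "y \<oplus>\<^bsub>N\<^esub> y' \<in> carrier N" if "y \<in> carrier N" "y' \<in> carrier N" for y y'
  using monoid.m_closed[OF group.is_monoid[OF comm_group.axioms(2)[OF N_group]], of y y'] that by simp
 show "rsmult X3 C a \<in> carrier X3" if C: "C \<in> carrier X3" "a \<in> carrier pa" for C a
 proof -
  obtain v where v: "v \<in> carrier eA" "C = cs v" using C X3_carrier by auto
  show ?thesis unfolding v(2) cs_rsmult[OF v(1) C(2)] X3_carrier using eA_mult[OF v(1)] by blast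
 qed
 show "a \<odot>\<^bsub>N\<^esub> y \<in> carrier N" if "y \<in> carrier N" for a y
  using hom_carrier[OF N_smult(1)[of a]] that by auto
qed

lemma L_eq: "L = tensor pa X3 N" by (simp add: layer_res_def)

interpretation TL: tensor_factors pa X3 N by (rule TL)

lemma L_group: "comm_group (add_monoid L)" unfolding L_eq by (rule TL.comm_group_T)

lemma L_smult: "(%z. f \<odot>\<^bsub>L\<^esub> z) \<in> hom (add_monoid L) (add_monoid L)"
 "v \<in> carrier eA ==> z \<in> carrier N ==> f \<odot>\<^bsub>L\<^esub> pure_tensor pa X3 N (cs v) z = pure_tensor pa X3 N (cs (em n f ** v)) z"
proof -
 have 1: "f \<odot>\<^bsub>X3\<^esub> C \<in> carrier X3" if C: "C \<in> carrier X3" for C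
 proof -
  obtain v where v: "v \<in> carrier eA" "C = cs v" using C X3_carrier by auto
  show ?thesis unfolding v(2) cs_smult[OF v(1)] X3_carrier using eA_em by blast
 qed
 have 2: "f \<odot>\<^bsub>X3\<^esub> (C \<oplus>\<^bsub>X3\<^esub> C') = f \<odot>\<^bsub>X3\<^esub> C \<oplus>\<^bsub>X3\<^esub> f \<odot>\<^bsub>X3\<^esub> C'" if C: "C \<in> carrier X3" "C' \<in> carrier X3" for C C'
 proof -
  obtain v w where v: "v \<in> carrier eA" "w \<in> carrier eA" "C = cs v" "C' = cs w" using C X3_carrier by auto
  have vw: "(%d. v d + w d) \<in> carrier eA" using v unfolding eA_carrier by (simp add: A.conv_add_right)
  show ?thesis unfolding v(3,4) cs_add[OF v(1,2)] cs_smult[OF vw] cs_smult[OF v(1)] cs_smult[OF v(2)] cs_add[OF eA_em eA_em] A.conv_add_right ..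
 qed
 have 3: "f \<odot>\<^bsub>X3\<^esub> rsmult X3 C a = rsmult X3 (f \<odot>\<^bsub>X3\<^esub> C) a" if C: "C \<in> carrier X3" "a \<in> carrier pa" for C a
 proof -
  obtain v where v: "v \<in> carrier eA" "C = cs v" using C X3_carrier by auto
  show ?thesis unfolding v(2) cs_rsmult[OF v(1) C(2)] cs_smult[OF v(1)] cs_smult[OF eA_mult[OF v(1)]] cs_rsmult[OF eA_em C(2)] A.conv_assoc ..
 qed
 show "(%z. f \<odot>\<^bsub>L\<^esub> z) \<in> hom (add_monoid L) (add_monoid L)"
  unfolding L_eq by (rule TL.smult_T(1)[OF 1 2 3])
 show "f \<odot>\<^bsub>L\<^esub> pure_tensor pa X3 N (cs v) z = pure_tensor pa X3 N (cs (em n f ** v)) z" if v: "v \<in> carrier eA" and "z \<in> carrier N"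
 proof -
  have "cs v \<in> carrier X3" using v X3_carrier by blast
  from TL.smult_T(2)[OF 1 2 3 this that(2)] show ?thesis unfolding L_eq cs_smult[OF v] by simp
 qed
qed

abbreviation "fY \<equiv> fun_group Y :: ((nat => nat list) \<times> nat list multiset => 'k) monoid"

lemma coef_mult_young:
 assumes v: "v \<in> carrier X2" and a: "a \<in> carrier PS.kY"
 shows "coef (v ** em l a) = (%\<eta>. (\<Sum>\<sigma>\<in>young_subgroup \<mu>. a \<sigma>) * coef v \<eta>)"
proof -
 have "coef (v ** em l a) = (%\<eta>. \<Sum>\<sigma>\<in>Sym l. a \<sigma> * coef (v ** sym_elt r \<delta> l \<sigma>) \<eta>)"
  unfolding embed_sym_eq[OF l r] A.conv_sum_right A.conv_scale_right coef_sum coef_scale ..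
 also have "\<dots> = (%\<eta>. \<Sum>\<sigma>\<in>young_subgroup \<mu>. a \<sigma> * coef (v ** sym_elt r \<delta> l \<sigma>) \<eta>)"
  by (rule ext, rule sum.mono_neutral_right) (use a young_subset_Sym[of \<mu>] \<mu> in auto)
 also have "\<dots> = (%\<eta>. (\<Sum>\<sigma>\<in>young_subgroup \<mu>. a \<sigma>) * coef v \<eta>)"
  unfolding sum_distrib_right by (intro ext sum.cong refl) (simp add: coef_young[OF v])
 finally show ?thesis .
qed

lemma coef_in_fY: "(%\<eta>. c * coef v \<eta>) \<in> carrier fY"
 using coef_outside by auto

text \<open>The innermost of three nested uses of the universal property. Together they define the
  coefficients of \<open>u \<otimes> (v \<otimes> (f \<otimes> c))\<close> as \<open>c\<close> times
  those of the product \<open>u v f\<close>. Balancedness over the Young subgroup is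
  \<open>coef_mult_young\<close>.\<close>

lemma P_functional:
 assumes v: "v \<in> carrier X2"
 shows "\<exists>h \<in> hom (add_monoid P) fY. \<forall>f\<in>carrier kl. \<forall>c. h (PS.pt f c) = (%\<eta>. c * coef (v ** em l f) \<eta>)"
proof -
 have "\<exists>h \<in> hom (add_monoid (tensor PS.kY PS.X1 PS.tr)) fY. \<forall>x\<in>carrier PS.X1. \<forall>y\<in>carrier PS.tr.
  h (PS.pt x y) = (%\<eta>. y * coef (v ** em l x) \<eta>)"
 proof (rule PS.TP.tensor_universal[OF comm_group_fun_group])
  show "(%\<eta>. y * coef (v ** em l x) \<eta>) \<in> carrier fY" for x y by (rule coef_in_fY)
  fix x x' y assume "x \<in> carrier PS.X1" "x' \<in> carrier PS.X1" "y \<in> carrier PS.tr"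
  show "(%\<eta>. y * coef (v ** em l (x \<oplus>\<^bsub>PS.X1\<^esub> x')) \<eta>) = (%\<eta>. y * coef (v ** em l x) \<eta>) \<otimes>\<^bsub>fY\<^esub> (%\<eta>. y * coef (v ** em l x') \<eta>)"
   by (simp add: PS.X1_simps embed_sym_add[OF r \<delta> l] A.conv_add_right coef_add algebra_simps)
 next
  fix x y y'
  show "(%\<eta>. (y \<oplus>\<^bsub>PS.tr\<^esub> y') * coef (v ** em l x) \<eta>) = (%\<eta>. y * coef (v ** em l x) \<eta>) \<otimes>\<^bsub>fY\<^esub> (%\<eta>. y' * coef (v ** em l x) \<eta>)"
   by (simp add: PS.tr_simps algebra_simps)
 next
  fix x a y assume x: "x \<in> carrier PS.X1" and a: "a \<in> carrier PS.kY"
  have "coef (v ** em l (rsmult PS.X1 x a)) = coef ((v ** em l x) ** em l a)"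
   unfolding PS.X1_simps embed_sym_mult[OF r \<delta> l, symmetric] A.conv_assoc ..
  also have "\<dots> = (%\<eta>. (\<Sum>\<sigma>\<in>young_subgroup \<mu>. a \<sigma>) * coef (v ** em l x) \<eta>)"
   by (rule coef_mult_young[OF X2_em a])
  finally show "(%\<eta>. y * coef (v ** em l (rsmult PS.X1 x a)) \<eta>) = (%\<eta>. (a \<odot>\<^bsub>PS.tr\<^esub> y) * coef (v ** em l x) \<eta>)"
   by (simp add: PS.tr_simps mult_ac)
 qed
 thus ?thesis unfolding PS.P_eq by (simp add: PS.X1_simps PS.tr_simps)
qed

abbreviation "nt v p \<equiv> pure_tensor kl X2 P v p"

lemma hom_eq_on_P:
 assumes "h \<in> hom (add_monoid P) fY" "h' \<in> hom (add_monoid P) fY"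
  and "\<And>f c. f \<in> carrier kl ==> h (PS.pt f c) = h' (PS.pt f c)" "p \<in> carrier P"
 shows "h p = h' p"
 using PS.TP.tensor_hom_eqI[OF comm_group_fun_group, of h Y h' p] assms unfolding PS.P_eq by (simp add: PS.X1_simps)

lemma hom_add_fY:
 assumes "h \<in> hom G fY" "h' \<in> hom G fY"
 shows "(%p. (%\<eta>. h p \<eta> + h' p \<eta>)) \<in> hom G fY"
 using assms unfolding hom_def by (auto simp: Pi_iff)

text \<open>For fixed \<open>u\<close> the functional on \<open>P\<close> has to depend additively
  on \<open>v\<close> and in a balanced way over the group algebra of \<open>Sym l\<close>. Both are
  equations between homomorphisms on \<open>P\<close>, so they are checked on pure tensors.\<close>

lemma N_functional:
 assumes u: "u \<in> carrier eA"
 shows "\<exists>h \<in> hom (add_monoid N) fY. \<forall>v\<in>carrier X2. \<forall>f\<in>carrier kl. \<forall>c. h (nt v (PS.pt f c)) = (%\<eta>. c * coef (u ** v ** em l f) \<eta>)"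
proof -
 have uv: "u ** v \<in> carrier X2" if "v \<in> carrier X2" for v using X2_mult[OF that] .
 \<comment> \<open>The formula on pure tensors fixes such a homomorphism only on the carrier, so one
   is chosen for each \<open>v\<close>.\<close>
 define p where "p v = (SOME h. h \<in> hom (add_monoid P) fY \<and> (\<forall>f\<in>carrier kl. \<forall>c. h (PS.pt f c) = (%\<eta>. c * coef (u ** v ** em l f) \<eta>)))" for v
 have p: "p v \<in> hom (add_monoid P) fY" "\<And>f c. f \<in> carrier kl ==> p v (PS.pt f c) = (%\<eta>. c * coef (u ** v ** em l f) \<eta>)"
  if v: "v \<in> carrier X2" for v
 proof -
  have "\<exists>h. h \<in> hom (add_monoid P) fY \<and> (\<forall>f\<in>carrier kl. \<forall>c. h (PS.pt f c) = (%\<eta>. c * coef (u ** v ** em l f) \<eta>))"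
   using P_functional[OF uv[OF v]] by blast
  from someI_ex[OF this, folded p_def] show "p v \<in> hom (add_monoid P) fY" "\<And>f c. f \<in> carrier kl ==> p v (PS.pt f c) = (%\<eta>. c * coef (u ** v ** em l f) \<eta>)"
   by blast+
 qed
 have "\<exists>h \<in> hom (add_monoid (tensor kl X2 P)) fY. \<forall>x\<in>carrier X2. \<forall>y\<in>carrier P. h (nt x y) = p x y"
 proof (rule TN.tensor_universal[OF comm_group_fun_group])
  show "p x y \<in> carrier fY" if "x \<in> carrier X2" "y \<in> carrier P" for x y
   using hom_carrier[OF p(1)[OF that(1)]] that(2) by auto
  fix x x' y assume x: "x \<in> carrier X2" "x' \<in> carrier X2" and y: "y \<in> carrier P"
  have xx: "(%d. x d + x' d) \<in> carrier X2" by (rule X2_add[OF x])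
  have "p (%d. x d + x' d) y = (%\<eta>. p x y \<eta> + p x' y \<eta>)"
  proof (rule hom_eq_on_P[OF p(1)[OF xx] hom_add_fY[OF p(1)[OF x(1)] p(1)[OF x(2)]] _ y])
   fix f c assume f: "f \<in> carrier kl"
   show "p (%d. x d + x' d) (PS.pt f c) = (%\<eta>. p x (PS.pt f c) \<eta> + p x' (PS.pt f c) \<eta>)"
    unfolding p(2)[OF xx f] p(2)[OF x(1) f] p(2)[OF x(2) f]
    by (simp add: A.conv_add_right A.conv_add_left coef_add algebra_simps)
  qed
  thus "p (x \<oplus>\<^bsub>X2\<^esub> x') y = p x y \<otimes>\<^bsub>fY\<^esub> p x' y" by (simp add: X2_simps)
 next
  fix x y y' assume "x \<in> carrier X2" "y \<in> carrier P" "y' \<in> carrier P"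
  thus "p x (y \<oplus>\<^bsub>P\<^esub> y') = p x y \<otimes>\<^bsub>fY\<^esub> p x y'" using hom_mult[OF p(1)[of x], of y y'] by simp
 next
  fix x a y assume x: "x \<in> carrier X2" and a: "a \<in> carrier kl" and y: "y \<in> carrier P"
  have xa: "x ** em l a \<in> carrier X2" by (rule X2_em)
  have h: "(%y. p x (a \<odot>\<^bsub>P\<^esub> y)) \<in> hom (add_monoid P) fY"
   using hom_compose[OF PS.P_smult(1)[of a] p(1)[OF x]] by (simp add: comp_def)
  have "p (x ** em l a) y = p x (a \<odot>\<^bsub>P\<^esub> y)"
  proof (rule hom_eq_on_P[OF p(1)[OF xa] h _ y])
   fix f c assume f: "f \<in> carrier kl"
   show "p (x ** em l a) (PS.pt f c) = p x (a \<odot>\<^bsub>P\<^esub> PS.pt f c)"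
    unfolding p(2)[OF xa f] PS.P_smult(2)[OF f] p(2)[OF x PS.gmult_in] embed_sym_mult[OF r \<delta> l, symmetric]
    by (simp add: A.conv_assoc)
  qed
  thus "p (rsmult X2 x a) y = p x (a \<odot>\<^bsub>P\<^esub> y)" by (simp add: X2_simps)
 qed
 then obtain h where "h \<in> hom (add_monoid N) fY" "\<forall>x\<in>carrier X2. \<forall>y\<in>carrier P. h (nt x y) = p x y"
  unfolding N_eq by blast
 thus ?thesis using p(2) PS.pt_in by (intro bexI[of _ h]) auto
qed

lemma hom_eq_on_N:
 assumes h: "h \<in> hom (add_monoid N) G" "h' \<in> hom (add_monoid N) G" and G: "comm_group G"
  and eq: "\<And>v f c. v \<in> carrier X2 ==> f \<in> carrier kl ==> h (nt v (PS.pt f c)) = h' (nt v (PS.pt f c))" and z: "z \<in> carrier N"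
 shows "h z = h' z"
proof -
 have "h (nt v p) = h' (nt v p)" if v: "v \<in> carrier X2" and p: "p \<in> carrier P" for v p
 proof -
  have lin: "(%p. nt v p) \<in> hom (add_monoid P) (add_monoid N)"
   unfolding N_eq using TN.pure_add_right[OF v] TN.pure_in_T[OF v] by (intro homI) auto
  have 1: "(%p. h (nt v p)) \<in> hom (add_monoid P) G" "(%p. h' (nt v p)) \<in> hom (add_monoid P) G"
   using hom_compose[OF lin h(1)] hom_compose[OF lin h(2)] by (simp_all add: comp_def)
  show ?thesis
  proof (rule PS.TP.tensor_hom_eqI[OF G, folded PS.P_eq, OF 1 _ p])
   fix x y assume "x \<in> carrier PS.X1"
   thus "h (nt v (PS.pt x y)) = h' (nt v (PS.pt x y))" using eq[OF v] unfolding PS.X1_simps by blast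
  qed
 qed
 thus ?thesis by (rule TN.tensor_hom_eqI[OF G, folded N_eq, OF h _ z])
qed

abbreviation "lt v z \<equiv> pure_tensor pa X3 N (cs v) z"

text \<open>Besides additivity and balancedness, the functional must depend only on the coset of
  \<open>u\<close>. This is \<open>qcs\<close>, which rests on \<open>coef_U\<close>; after it, any
  system of representatives \<open>rep\<close> may be used.\<close>

lemma L_functional:
 "\<exists>h \<in> hom (add_monoid L) fY. \<forall>u\<in>carrier eA. \<forall>v\<in>carrier X2. \<forall>f\<in>carrier kl. \<forall>c.
   h (lt u (nt v (PS.pt f c))) = (%\<eta>. c * coef (u ** v ** em l f) \<eta>)"
proof -
 define q where "q u = (SOME h. h \<in> hom (add_monoid N) fY \<and> (\<forall>v\<in>carrier X2. \<forall>f\<in>carrier kl. \<forall>c. h (nt v (PS.pt f c)) = (%\<eta>. c * coef (u ** v ** em l f) \<eta>)))" for u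
 have q: "q u \<in> hom (add_monoid N) fY" "\<And>v f c. v \<in> carrier X2 ==> f \<in> carrier kl ==> q u (nt v (PS.pt f c)) = (%\<eta>. c * coef (u ** v ** em l f) \<eta>)"
  if u: "u \<in> carrier eA" for u
 proof -
  have "\<exists>h. h \<in> hom (add_monoid N) fY \<and> (\<forall>v\<in>carrier X2. \<forall>f\<in>carrier kl. \<forall>c. h (nt v (PS.pt f c)) = (%\<eta>. c * coef (u ** v ** em l f) \<eta>))"
   using N_functional[OF u] by blast
  from someI_ex[OF this, folded q_def] show "q u \<in> hom (add_monoid N) fY" "\<And>v f c. v \<in> carrier X2 ==> f \<in> carrier kl ==> q u (nt v (PS.pt f c)) = (%\<eta>. c * coef (u ** v ** em l f) \<eta>)"
   by blast+
 qed
 define rep where "rep C = (SOME u. u \<in> carrier eA \<and> cs u = C)" for C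
 have rep: "rep C \<in> carrier eA" "cs (rep C) = C" if "C \<in> carrier X3" for C
 proof -
  have "C \<in> cs ` carrier eA" using that unfolding X3_carrier .
  hence "\<exists>u. u \<in> carrier eA \<and> cs u = C" by (metis imageE)
  from someI_ex[OF this, folded rep_def] show "rep C \<in> carrier eA" "cs (rep C) = C" by blast+
 qed
 have qcs: "q u z = q u' z" if u: "u \<in> carrier eA" "u' \<in> carrier eA" "cs u = cs u'" and z: "z \<in> carrier N" for u u' z
 proof (rule hom_eq_on_N[OF q(1)[OF u(1)] q(1)[OF u(2)] comm_group_fun_group _ z])
  fix v f c assume v: "v \<in> carrier X2" and f: "f \<in> carrier kl"
  have "coef ((%d. u d - u' d) ** (v ** em l f)) = (%_. 0)"
   by (rule coef_U[OF cs_eqD[OF u] pm_in_pa])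
  hence "coef (u ** (v ** em l f)) = coef (u' ** (v ** em l f))"
   unfolding conv_diff_left coef_diff by (simp add: fun_eq_iff)
  thus "q u (nt v (PS.pt f c)) = q u' (nt v (PS.pt f c))"
   unfolding q(2)[OF u(1) v f] q(2)[OF u(2) v f] A.conv_assoc by simp
 qed
 have "\<exists>h \<in> hom (add_monoid (tensor pa X3 N)) fY. \<forall>x\<in>carrier X3. \<forall>y\<in>carrier N. h (pure_tensor pa X3 N x y) = q (rep x) y"
 proof (rule TL.tensor_universal[OF comm_group_fun_group])
  show "q (rep x) y \<in> carrier fY" if "x \<in> carrier X3" "y \<in> carrier N" for x y
   using hom_carrier[OF q(1)[OF rep(1)[OF that(1)]]] that(2) by auto
  fix x x' y assume x: "x \<in> carrier X3" "x' \<in> carrier X3" and y: "y \<in> carrier N"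
  let ?u = "rep x" and ?u' = "rep x'" and ?w = "%d. rep x d + rep x' d"
  have w: "?w \<in> carrier eA" using rep(1)[OF x(1)] rep(1)[OF x(2)] unfolding eA_carrier by (simp add: A.conv_add_right)
  have xx: "x \<oplus>\<^bsub>X3\<^esub> x' = cs ?w" using cs_add[OF rep(1)[OF x(1)] rep(1)[OF x(2)]] rep(2) x by simp
  have inX: "x \<oplus>\<^bsub>X3\<^esub> x' \<in> carrier X3" using TL.X_add[OF x] .
  have "q (rep (x \<oplus>\<^bsub>X3\<^esub> x')) y = q ?w y"
   by (rule qcs[OF rep(1)[OF inX] w _ y]) (use rep(2)[OF inX] xx in simp)
  also have "\<dots> = (%\<eta>. q ?u y \<eta> + q ?u' y \<eta>)"
  proof (rule hom_eq_on_N[OF q(1)[OF w] hom_add_fY[OF q(1)[OF rep(1)[OF x(1)]] q(1)[OF rep(1)[OF x(2)]]] comm_group_fun_group _ y])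
   fix v f c assume v: "v \<in> carrier X2" and f: "f \<in> carrier kl"
   show "q ?w (nt v (PS.pt f c)) = (%\<eta>. q ?u (nt v (PS.pt f c)) \<eta> + q ?u' (nt v (PS.pt f c)) \<eta>)"
    unfolding q(2)[OF w v f] q(2)[OF rep(1)[OF x(1)] v f] q(2)[OF rep(1)[OF x(2)] v f]
    by (simp add: A.conv_add_left coef_add algebra_simps)
  qed
  finally show "q (rep (x \<oplus>\<^bsub>X3\<^esub> x')) y = q (rep x) y \<otimes>\<^bsub>fY\<^esub> q (rep x') y" by simp
 next
  fix x y y' assume x: "x \<in> carrier X3" and y: "y \<in> carrier N" "y' \<in> carrier N"
  show "q (rep x) (y \<oplus>\<^bsub>N\<^esub> y') = q (rep x) y \<otimes>\<^bsub>fY\<^esub> q (rep x) y'"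
   using hom_mult[OF q(1)[OF rep(1)[OF x]], of y y'] y by simp
 next
  fix x a y assume x: "x \<in> carrier X3" and a: "a \<in> carrier pa" and y: "y \<in> carrier N"
  let ?u = "rep x"
  have ua: "?u ** a \<in> carrier eA" by (rule eA_mult[OF rep(1)[OF x]])
  have xa: "rsmult X3 x a = cs (?u ** a)" using cs_rsmult[OF rep(1)[OF x] a] rep(2)[OF x] by simp
  have inX: "rsmult X3 x a \<in> carrier X3" by (rule TL.X_rsmult[OF x a])
  have "q (rep (rsmult X3 x a)) y = q (?u ** a) y"
   by (rule qcs[OF rep(1)[OF inX] ua _ y]) (use rep(2)[OF inX] xa in simp)
  also have "\<dots> = q ?u (a \<odot>\<^bsub>N\<^esub> y)"
  proof (rule hom_eq_on_N[OF q(1)[OF ua] _ comm_group_fun_group _ y])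
   show "(%y. q ?u (a \<odot>\<^bsub>N\<^esub> y)) \<in> hom (add_monoid N) fY"
    using hom_compose[OF N_smult(1)[of a] q(1)[OF rep(1)[OF x]]] by (simp add: comp_def)
   fix v f c assume v: "v \<in> carrier X2" and f: "f \<in> carrier kl"
   show "q (?u ** a) (nt v (PS.pt f c)) = q ?u (a \<odot>\<^bsub>N\<^esub> nt v (PS.pt f c))"
    unfolding q(2)[OF ua v f] N_smult(2)[OF v PS.pt_in[OF f]] q(2)[OF rep(1)[OF x] X2_mult[OF v] f] by (simp add: A.conv_assoc)
  qed
  finally show "q (rep (rsmult X3 x a)) y = q (rep x) (a \<odot>\<^bsub>N\<^esub> y)" .
 qed
 then obtain h where h: "h \<in> hom (add_monoid L) fY" "\<forall>x\<in>carrier X3. \<forall>y\<in>carrier N. h (pure_tensor pa X3 N x y) = q (rep x) y"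
  unfolding L_eq by blast
 show ?thesis
 proof (rule bexI[OF _ h(1)], intro ballI allI)
  fix u v f c assume u: "u \<in> carrier eA" and v: "v \<in> carrier X2" and f: "f \<in> carrier kl"
  have cu: "cs u \<in> carrier X3" using u X3_carrier by blast
  have z: "nt v (PS.pt f c) \<in> carrier N" unfolding N_eq by (rule TN.pure_in_T[OF v PS.pt_in[OF f]])
  have "h (lt u (nt v (PS.pt f c))) = q (rep (cs u)) (nt v (PS.pt f c))" using h(2) cu z by blast
  also have "\<dots> = q u (nt v (PS.pt f c))" by (rule qcs[OF rep(1)[OF cu] u rep(2)[OF cu] z])
  also have "\<dots> = (%\<eta>. c * coef (u ** v ** em l f) \<eta>)" by (rule q(2)[OF u v f])
  finally show "h (lt u (nt v (PS.pt f c))) = (%\<eta>. c * coef (u ** v ** em l f) \<eta>)" .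
 qed
qed

end

section \<open>Permutation modules and words\<close>

text \<open>The permutation module on the set \<open>Y\<close>, as functions. Permutations are
  multiplied from left to right, so composing words with permutations is a right action, and moving
  the argument of a function by the inverse gives a left action.\<close>

definition fun_module :: "nat => 'y set => ((nat => nat) => 'y => 'y) => ((nat => nat) => 'k::field, 'y => 'k) module" where
 "fun_module n Y a = \<lparr>carrier = {v. \<forall>y. y \<notin> Y --> v y = 0}, mult = undefined, one = undefined,
   zero = (%_. 0), add = (%v w y. v y + w y),
   smult = (%f v y. \<Sum>\<pi>\<in>Sym n. f \<pi> * v (a (pinv \<pi>) y))\<rparr>"

lemma fun_module_simps:
 "carrier (fun_module n Y a) = {v. \<forall>y. y \<notin> Y --> v y = 0}"
 "zero (fun_module n Y a) = (%_. 0)" "add (fun_module n Y a) = (%v w y. v y + w y)"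
 "f \<odot>\<^bsub>fun_module n Y a\<^esub> v = (%y. \<Sum>\<pi>\<in>Sym n. f \<pi> * v (a (pinv \<pi>) y))"
 by (simp_all add: fun_module_def)

lemma subgroup_hom_vimage:
 assumes G: "comm_group G" "comm_group H" and h: "h \<in> hom G H" and K: "subgroup K H"
 shows "subgroup {x \<in> carrier G. h x \<in> K} G"
proof -
 interpret G: comm_group G by fact
 interpret H: comm_group H by fact
 interpret h: group_hom G H h using h by unfold_locales
 show ?thesis
  by (rule G.subgroupI) (use subgroup.one_closed[OF K] subgroup.m_closed[OF K] subgroup.m_inv_closed[OF K] h.hom_one in auto)
qed

lemma module_isomorphicI:
 assumes h: "h \<in> hom (add_monoid M) (fun_group Y)" "bij_betw h (carrier M) {v. \<forall>y. y \<notin> Y --> v y = (0::'k::field)}"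
  and eq: "\<And>f z. f \<in> carrier R ==> z \<in> carrier M ==> h (f \<odot>\<^bsub>M\<^esub> z) = (%y. \<Sum>\<pi>\<in>Sym n. f \<pi> * h z (a (pinv \<pi>) y))"
 shows "module_isomorphic R M (fun_module n Y a)"
proof -
 have "h \<in> iso (add_monoid M) (add_monoid (fun_module n Y a))"
  using h unfolding iso_def hom_def by (auto simp: fun_module_simps Pi_iff)
 thus ?thesis unfolding module_isomorphic_def by (intro bexI[of _ h]) (auto simp: fun_module_simps eq)
qed

definition comp_act :: "('a => 'a) => ('a => 'b) => 'a => 'b" where
 "comp_act \<pi> w = w \<circ> \<pi>"

text \<open>A model of the cosets of the Young subgroup: the symmetric group permutes these words
  transitively, and the word \<open>wd\<close> of block indices has the Young subgroup as its
  stabiliser.\<close>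

definition words :: "nat => nat list => (nat => nat) set" where
 "words m \<nu> = {w \<in> {1..m} \<rightarrow>\<^sub>E {..<length \<nu>}. \<forall>i<length \<nu>. card {j\<in>{1..m}. w j = i} = \<nu> ! i}"

lemma finite_words [simp]: "finite (words m \<nu>)"
 by (rule finite_subset[of _ "{1..m} \<rightarrow>\<^sub>E {..<length \<nu>}"]) (auto simp: words_def intro: finite_PiE)

lemma comp_in_extensional: "w \<in> extensional A ==> \<pi> permutes A ==> w \<circ> \<pi> \<in> extensional A"
 by (auto simp: extensional_def permutes_def)

lemma words_comp:
 assumes "w \<in> words m \<nu>" "\<pi> permutes {1..m}"
 shows "w \<circ> \<pi> \<in> words m \<nu>"
proof -
 have "w \<circ> \<pi> \<in> {1..m} \<rightarrow>\<^sub>E {..<length \<nu>}"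
  using assms comp_in_extensional[of w "{1..m}" \<pi>] permutes_in_image[OF assms(2)] by (auto simp: words_def PiE_def Pi_iff)
 moreover have "card {j\<in>{1..m}. (w \<circ> \<pi>) j = i} = card {j\<in>{1..m}. w j = i}" for i
  using card_permutes_vimage[OF assms(2), of "%j. w j = i"] by simp
 ultimately show ?thesis using assms by (simp add: words_def)
qed

context perm_setup
begin

definition wd :: "nat => nat" where "wd = (\<lambda>j\<in>{1..m}. blk \<nu> j)"

lemma wd_words: "wd \<in> words m \<nu>"
proof -
 have "{j \<in> {1..m}. wd j = i} = {j\<in>{1..sum_list \<nu>}. blk \<nu> j = i}" for i using \<nu> by (auto simp: wd_def)
 thus ?thesis unfolding words_def using card_block[of _ \<nu>] blk_less[of _ \<nu>] \<nu>
  by (auto simp: wd_def)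
qed

lemma wd_transitive:
 assumes w: "w \<in> words m \<nu>"
 shows "\<exists>\<pi>. \<pi> permutes {1..m} \<and> w = wd \<circ> \<pi>"
proof -
 have "image_mset w (mset_set {1..m}) = image_mset wd (mset_set {1..m})"
 proof (rule multiset_eqI)
  fix i
  have c: "count (image_mset v (mset_set {1..m})) i = (if i < length \<nu> then \<nu> ! i else 0)" if "v \<in> words m \<nu>" for v
  proof -
   have "count (image_mset v (mset_set {1..m})) i = card {j\<in>{1..m}. v j = i}"
    by (simp add: count_image_mset' Int_def vimage_def) (metis (mono_tags, lifting) Collect_cong)
   also have "\<dots> = (if i < length \<nu> then \<nu> ! i else 0)"
   proof (cases "i < length \<nu>")
    case True thus ?thesis using that by (simp add: words_def)
   next
    case False
    hence "{j\<in>{1..m}. v j = i} = {}" using that by (auto simp: words_def)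
    thus ?thesis using False by (simp only: card.empty if_False)
   qed
   finally show ?thesis .
  qed
  show "count (image_mset w (mset_set {1..m})) i = count (image_mset wd (mset_set {1..m})) i"
   unfolding c[OF w] c[OF wd_words] ..
 qed
 then obtain p where p: "p permutes {1..m}" "\<forall>j\<in>{1..m}. w j = wd (p j)"
  using image_mset_eq_implies_permutes[of "{1..m}" w wd] by auto
 have "w = wd \<circ> p"
 proof
  fix j show "w j = (wd \<circ> p) j"
   using p w permutes_not_in[OF p(1), of j] by (cases "j \<in> {1..m}") (auto simp: words_def wd_def PiE_def extensional_def)
 qed
 thus ?thesis using p by blast
qed

lemma wd_young: "\<sigma> permutes {1..m} ==> wd \<circ> \<sigma> = wd \<longleftrightarrow> \<sigma> \<in> young_subgroup \<nu>"
proof -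
 assume s: "\<sigma> permutes {1..m}"
 have "wd \<circ> \<sigma> = wd \<longleftrightarrow> (\<forall>j\<in>{1..m}. blk \<nu> (\<sigma> j) = blk \<nu> j)"
 proof
  assume e: "wd \<circ> \<sigma> = wd"
  show "\<forall>j\<in>{1..m}. blk \<nu> (\<sigma> j) = blk \<nu> j"
  proof
   fix j assume j: "j \<in> {1..m}"
   thus "blk \<nu> (\<sigma> j) = blk \<nu> j" using fun_cong[OF e, of j] permutes_in_image[OF s, of j] by (simp add: wd_def)
  qed
 next
  assume e: "\<forall>j\<in>{1..m}. blk \<nu> (\<sigma> j) = blk \<nu> j"
  show "wd \<circ> \<sigma> = wd"
  proof
   fix j show "(wd \<circ> \<sigma>) j = wd j"
    using e permutes_in_image[OF s, of j] permutes_not_in[OF s, of j] by (cases "j \<in> {1..m}") (auto simp: wd_def)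
  qed
 qed
 thus ?thesis using s \<nu> by (simp add: young_subgroup_iff)
qed

text \<open>The analogue of \<open>coef\<close> for the group algebra: the index set is the coset of
  the Young subgroup belonging to the word \<open>w\<close>.\<close>

definition wcoef :: "((nat => nat) => 'k) => (nat => nat) => 'k" where
 "wcoef f = (%w. \<Sum>\<pi>\<in>{\<pi>\<in>Sym m. wd \<circ> \<pi> = w}. f \<pi>)"

lemma wcoef_add: "wcoef (%d. v d + w d) = (%\<eta>. wcoef v \<eta> + wcoef w \<eta>)"
 by (simp add: wcoef_def sum.distrib)

lemma wcoef_scale: "wcoef (%d. c * v d) = (%\<eta>. c * wcoef v \<eta>)"
 by (simp add: wcoef_def sum_distrib_left)

lemma wcoef_sum: "wcoef (%d. \<Sum>i\<in>I. F i d) = (%\<eta>. \<Sum>i\<in>I. wcoef (F i) \<eta>)"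
 unfolding wcoef_def by (rule ext) (rule sum.swap)

lemma wcoef_outside: "w \<notin> words m \<nu> ==> wcoef f w = 0"
 unfolding wcoef_def by (rule sum.neutral) (use words_comp[OF wd_words] in auto)

lemma wcoef_basis: "\<pi> permutes {1..m} ==> wcoef (basis_vec \<pi>) = (%w. if w = wd \<circ> \<pi> then 1 else 0)"
proof
 fix w assume p: "\<pi> permutes {1..m}"
 have "(\<Sum>\<rho>\<in>{\<rho>\<in>Sym m. wd \<circ> \<rho> = w}. if \<rho> = \<pi> then 1 else 0 :: 'k) = (if \<pi> \<in> {\<rho>\<in>Sym m. wd \<circ> \<rho> = w} then 1 else 0)"
  by (rule sum.delta) (rule finite_subset[OF _ finite_Sym[of m]], blast)
 thus "wcoef (basis_vec \<pi>) w = (if w = wd \<circ> \<pi> then 1 else 0)" using p by (auto simp: wcoef_def basis_vec_def)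
qed

lemma wcoef_gmult: "wcoef (gmult (Sym m) f g) = (%w. \<Sum>\<pi>\<in>Sym m. \<Sum>\<sigma>\<in>Sym m. f \<pi> * g \<sigma> * (if w = wd \<circ> \<sigma> \<circ> \<pi> then 1 else 0))"
proof -
 have "wcoef (gmult (Sym m) f g) = (%w. \<Sum>\<pi>\<in>Sym m. \<Sum>\<sigma>\<in>Sym m. f \<pi> * g \<sigma> * 1 * wcoef (basis_vec (\<sigma> \<circ> \<pi>)) w)"
  unfolding S.conv_expand wcoef_sum wcoef_scale ..
 also have "\<dots> = (%w. \<Sum>\<pi>\<in>Sym m. \<Sum>\<sigma>\<in>Sym m. f \<pi> * g \<sigma> * (if w = wd \<circ> \<sigma> \<circ> \<pi> then 1 else 0))"
 proof (intro ext sum.cong refl)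
  fix w \<pi> \<sigma> assume "\<pi> \<in> Sym m" "\<sigma> \<in> Sym m"
  hence "wcoef (basis_vec (\<sigma> \<circ> \<pi>)) = (%w. if w = wd \<circ> (\<sigma> \<circ> \<pi>) then 1 else 0)" by (intro wcoef_basis permutes_compose) auto
  thus "f \<pi> * g \<sigma> * 1 * wcoef (basis_vec (\<sigma> \<circ> \<pi>)) w = f \<pi> * g \<sigma> * (if w = wd \<circ> \<sigma> \<circ> \<pi> then 1 else 0)" by (simp add: comp_assoc)
 qed
 finally show ?thesis .
qed

lemma wcoef_expand: "wcoef f = (%w. \<Sum>\<pi>\<in>Sym m. f \<pi> * (if w = wd \<circ> \<pi> then 1 else 0))"
proof
 fix w
 have "(\<Sum>\<pi>\<in>Sym m. f \<pi> * (if w = wd \<circ> \<pi> then 1 else 0)) = (\<Sum>\<pi>\<in>Sym m. if wd \<circ> \<pi> = w then f \<pi> else 0)"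
  by (rule sum.cong) auto
 also have "\<dots> = (\<Sum>\<pi>\<in>Sym m \<inter> {\<pi>. wd \<circ> \<pi> = w}. f \<pi>)" by (simp add: sum.inter_restrict)
 finally show "wcoef f w = (\<Sum>\<pi>\<in>Sym m. f \<pi> * (if w = wd \<circ> \<pi> then 1 else 0))" by (simp add: wcoef_def Int_def)
qed

lemma wcoef_young:
 assumes "a \<in> carrier kY"
 shows "wcoef (gmult (Sym m) f a) = (%w. (\<Sum>\<sigma>\<in>young_subgroup \<nu>. a \<sigma>) * wcoef f w)"
proof
 fix w
 have sub: "young_subgroup \<nu> \<subseteq> Sym m" using young_subset_Sym[of \<nu>] \<nu> by simp
 have "wcoef (gmult (Sym m) f a) w = (\<Sum>\<pi>\<in>Sym m. \<Sum>\<sigma>\<in>young_subgroup \<nu>. f \<pi> * a \<sigma> * (if w = wd \<circ> \<sigma> \<circ> \<pi> then 1 else 0))"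
  unfolding wcoef_gmult by (intro sum.cong refl sum.mono_neutral_right) (use sub assms in auto)
 also have "\<dots> = (\<Sum>\<pi>\<in>Sym m. \<Sum>\<sigma>\<in>young_subgroup \<nu>. f \<pi> * a \<sigma> * (if w = wd \<circ> \<pi> then 1 else 0))"
 proof (intro sum.cong refl)
  fix \<pi> \<sigma> assume "\<sigma> \<in> young_subgroup \<nu>"
  hence "wd \<circ> \<sigma> = wd" using wd_young sub by auto
  thus "f \<pi> * a \<sigma> * (if w = wd \<circ> \<sigma> \<circ> \<pi> then 1 else 0) = f \<pi> * a \<sigma> * (if w = wd \<circ> \<pi> then 1 else 0)" by simp
 qed
 also have "\<dots> = (\<Sum>\<sigma>\<in>young_subgroup \<nu>. a \<sigma>) * wcoef f w"
  unfolding wcoef_expand sum_distrib_left sum_distrib_right by (intro sum.cong refl) simp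
 finally show "wcoef (gmult (Sym m) f a) w = (\<Sum>\<sigma>\<in>young_subgroup \<nu>. a \<sigma>) * wcoef f w" .
qed

lemma wcoef_act: "wcoef (gmult (Sym m) g f) = (%w. \<Sum>\<pi>\<in>Sym m. g \<pi> * wcoef f (comp_act (pinv \<pi>) w))"
proof
 fix w
 have "w = wd \<circ> \<sigma> \<circ> \<pi> \<longleftrightarrow> w \<circ> pinv \<pi> = wd \<circ> \<sigma>" if "\<pi> permutes {1..m}" for \<pi> \<sigma>
 proof
  assume "w = wd \<circ> \<sigma> \<circ> \<pi>"
  thus "w \<circ> pinv \<pi> = wd \<circ> \<sigma>" using permutes_inv_o(1)[OF that] by (simp add: comp_assoc)
 next
  assume "w \<circ> pinv \<pi> = wd \<circ> \<sigma>"
  hence "(w \<circ> pinv \<pi>) \<circ> \<pi> = wd \<circ> \<sigma> \<circ> \<pi>" by simp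
  thus "w = wd \<circ> \<sigma> \<circ> \<pi>" using permutes_inv_o(2)[OF that] by (simp add: comp_assoc)
 qed
 thus "wcoef (gmult (Sym m) g f) w = (\<Sum>\<pi>\<in>Sym m. g \<pi> * wcoef f (comp_act (pinv \<pi>) w))"
  unfolding wcoef_gmult comp_act_def unfolding wcoef_expand sum_distrib_left by (intro sum.cong refl) simp
qed

theorem perm_module_iso_words: "module_isomorphic kS P (fun_module m (words m \<nu>) comp_act)"
proof -
 interpret P: comm_group "add_monoid P" by (rule P_group)
 have "\<exists>h \<in> hom (add_monoid (tensor kY X1 tr)) (fun_group (words m \<nu>)). \<forall>x\<in>carrier X1. \<forall>y\<in>carrier tr. h (pt x y) = (%w. y * wcoef x w)"
 proof (rule TP.tensor_universal[OF comm_group_fun_group])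
  show "(%w. y * wcoef x w) \<in> carrier (fun_group (words m \<nu>))" for x y using wcoef_outside by simp
  show "(%w. y * wcoef (x \<oplus>\<^bsub>X1\<^esub> x') w) = (%w. y * wcoef x w) \<otimes>\<^bsub>fun_group (words m \<nu>)\<^esub> (%w. y * wcoef x' w)" for x x' y
   by (simp add: X1_simps wcoef_add algebra_simps)
  show "(%w. (y \<oplus>\<^bsub>tr\<^esub> y') * wcoef x w) = (%w. y * wcoef x w) \<otimes>\<^bsub>fun_group (words m \<nu>)\<^esub> (%w. y' * wcoef x w)" for x y y'
   by (simp add: tr_simps algebra_simps)
  show "(%w. y * wcoef (rsmult X1 x a) w) = (%w. (a \<odot>\<^bsub>tr\<^esub> y) * wcoef x w)" if "a \<in> carrier kY" for x a y
   unfolding X1_simps wcoef_young[OF that] tr_simps by (simp add: mult_ac)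
 qed
 then obtain h where h: "h \<in> hom (add_monoid P) (fun_group (words m \<nu>))" and hp: "\<And>f c. f \<in> carrier kS ==> h (pt f c) = (%w. c * wcoef f w)"
  unfolding P_eq X1_simps tr_simps by blast
 define pw where "pw w = (SOME \<pi>. \<pi> permutes {1..m} \<and> w = wd \<circ> \<pi>)" for w
 have pw: "pw w permutes {1..m}" "w = wd \<circ> pw w" if "w \<in> words m \<nu>" for w
  using someI_ex[OF wd_transitive[OF that], folded pw_def] by blast+
 have bin: "basis_vec \<pi> \<in> carrier kS" if "\<pi> permutes {1..m}" for \<pi> using scaled_basis_in[OF that, of 1] by simp
 have bij: "bij_betw h (carrier (add_monoid P)) {v. \<forall>w. w \<notin> words m \<nu> --> v w = 0}"
 proof (rule basis_bij_betw[OF P_group finite_words h, where T = "%w c. pt (basis_vec (pw w)) c"])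
  fix w c c' assume w: "w \<in> words m \<nu>"
  show "pt (basis_vec (pw w)) c \<in> carrier (add_monoid P)" using pt_in[OF bin[OF pw(1)[OF w]]] by simp
  show "pt (basis_vec (pw w)) (c + c') = pt (basis_vec (pw w)) c \<otimes>\<^bsub>add_monoid P\<^esub> pt (basis_vec (pw w)) c'"
   using pt_add_right[OF bin[OF pw(1)[OF w]]] by simp
  show "h (pt (basis_vec (pw w)) c) = (%w'. if w' = w then c else 0)"
   unfolding hp[OF bin[OF pw(1)[OF w]]] wcoef_basis[OF pw(1)[OF w]] pw(2)[OF w, symmetric] by auto
 next
  fix K assume K: "subgroup K (add_monoid P)" and T: "\<And>w c. w \<in> words m \<nu> ==> pt (basis_vec (pw w)) c \<in> K"
  have "carrier P \<subseteq> K"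
  proof (rule P_induct_basis[OF K])
   fix \<pi> c assume p: "\<pi> permutes {1..m}"
   let ?w = "wd \<circ> \<pi>"
   have w: "?w \<in> words m \<nu>" by (rule words_comp[OF wd_words p])
   \<comment> \<open>Two permutations with the same word differ by an element of the Young subgroup,
     which the trivial module absorbs.\<close>
   let ?s = "\<pi> \<circ> pinv (pw ?w)"
   have sp: "?s permutes {1..m}" by (rule permutes_compose[OF permutes_inv[OF pw(1)[OF w]] p])
   have "wd \<circ> ?s = (wd \<circ> pw ?w) \<circ> pinv (pw ?w)" using pw(2)[OF w] by (simp add: comp_assoc[symmetric])
   also have "\<dots> = wd" using permutes_inv_o(1)[OF pw(1)[OF w]] by (simp add: comp_assoc)
   finally have sy: "?s \<in> young_subgroup \<nu>" using wd_young[OF sp] by blast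
   have "?s \<circ> pw ?w = \<pi>" using permutes_inv_o(2)[OF pw(1)[OF w]] by (simp add: comp_assoc)
   hence "gmult (Sym m) (basis_vec (pw ?w)) (basis_vec ?s) = (basis_vec \<pi> :: _ => 'k)"
    using gmult_basis[OF pw(1)[OF w] sp, of 1] by simp
   moreover have "(basis_vec ?s :: _ => 'k) \<in> carrier kY" using sy by (auto simp: basis_vec_def)
   ultimately have "pt (basis_vec \<pi>) c = pt (basis_vec (pw ?w)) ((\<Sum>\<rho>\<in>young_subgroup \<nu>. basis_vec ?s \<rho>) * c)"
    using pt_balanced[OF bin[OF pw(1)[OF w]], of "basis_vec ?s" c] by simp
   thus "pt (basis_vec \<pi>) c \<in> K" using T[OF w, of c] sum_young_basis[OF sy] by simp
  qed
  thus "carrier (add_monoid P) \<subseteq> K" by simp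
 qed
 show ?thesis
 proof (rule module_isomorphicI[OF h])
  show "bij_betw h (carrier P) {v. \<forall>w. w \<notin> words m \<nu> --> v w = 0}" using bij by simp
  fix g z assume "g \<in> carrier kS" and z: "z \<in> carrier P"
  show "h (g \<odot>\<^bsub>P\<^esub> z) = (%w. \<Sum>\<pi>\<in>Sym m. g \<pi> * h z (comp_act (pinv \<pi>) w))"
  proof (rule TP.tensor_hom_eqI[OF comm_group_fun_group[of "words m \<nu>"], folded P_eq, OF _ _ _ z])
   show "(%z. h (g \<odot>\<^bsub>P\<^esub> z)) \<in> hom (add_monoid P) (fun_group (words m \<nu>))"
    using hom_compose[OF P_smult(1) h, of g] by (simp add: comp_def)
   show "(%z. (%w. \<Sum>\<pi>\<in>Sym m. g \<pi> * h z (comp_act (pinv \<pi>) w))) \<in> hom (add_monoid P) (fun_group (words m \<nu>))"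
   proof (rule homI)
    fix z assume "z \<in> carrier (add_monoid P)"
    hence hz: "h z \<in> carrier (fun_group (words m \<nu>))" using hom_carrier[OF h] by auto
    have "h z (comp_act (pinv \<pi>) w) = 0" if "w \<notin> words m \<nu>" "\<pi> \<in> Sym m" for w \<pi>
    proof -
     have "\<pi> permutes {1..m}" using that by simp
     hence "comp_act (pinv \<pi>) w \<notin> words m \<nu>"
      using words_comp[of "comp_act (pinv \<pi>) w" m \<nu> \<pi>] that(1) permutes_inv_o(2)[of \<pi> "{1..m}"] by (auto simp: comp_act_def comp_assoc)
     thus ?thesis using hz by simp
    qed
    thus "(%w. \<Sum>\<pi>\<in>Sym m. g \<pi> * h z (comp_act (pinv \<pi>) w)) \<in> carrier (fun_group (words m \<nu>))" by simp
   next
    fix y z assume "y \<in> carrier (add_monoid P)" "z \<in> carrier (add_monoid P)"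
    hence "h (y \<otimes>\<^bsub>add_monoid P\<^esub> z) = (%w. h y w + h z w)" using hom_mult[OF h, of y z] by simp
    thus "(%w. \<Sum>\<pi>\<in>Sym m. g \<pi> * h (y \<otimes>\<^bsub>add_monoid P\<^esub> z) (comp_act (pinv \<pi>) w)) =
     (%w. \<Sum>\<pi>\<in>Sym m. g \<pi> * h y (comp_act (pinv \<pi>) w)) \<otimes>\<^bsub>fun_group (words m \<nu>)\<^esub> (%w. \<Sum>\<pi>\<in>Sym m. g \<pi> * h z (comp_act (pinv \<pi>) w))"
     by (simp add: sum.distrib algebra_simps)
   qed
   fix x c assume x: "x \<in> carrier X1"
   hence x': "x \<in> carrier kS" by (simp only: X1_simps)
   show "h (g \<odot>\<^bsub>P\<^esub> pt x c) = (%w. \<Sum>\<pi>\<in>Sym m. g \<pi> * h (pt x c) (comp_act (pinv \<pi>) w))"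
    unfolding P_smult(2)[OF x'] hp[OF gmult_in] hp[OF x'] wcoef_act by (simp add: sum_distrib_left mult_ac)
  qed
 qed
qed

end

section \<open>Generators of the layer restriction\<close>

context layer
begin

interpretation PS: perm_setup l \<mu> "TYPE('k)" by unfold_locales (rule \<mu>)
interpretation TN: tensor_factors kl X2 P by (rule TN)
interpretation TL: tensor_factors pa X3 N by (rule TL)

lemma gmult_id: "f \<in> carrier kl ==> gmult (Sym l) f (basis_vec id) = f"
proof -
 assume f: "f \<in> carrier kl"
 have "gmult (Sym l) f (basis_vec id) = (%d. \<Sum>x\<in>Sym l. f x * 1 * basis_vec (id \<circ> x) d)"
  by (rule PS.S.conv_basis_expand) (simp add: permutes_id)
 also have "\<dots> = f" using basis_vec_expand[OF finite_Sym, of l f] f by simp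
 finally show ?thesis .
qed

lemma basis_id_in: "basis_vec id \<in> carrier kl" by (auto simp: basis_vec_def permutes_id)

lemma el_X2: "el \<in> carrier X2"
 using X2_carrier idem_in_pa[OF l] idem_idem'[OF l] by blast

lemma basis_eA:
 assumes "tfix r n d" shows "basis_vec d \<in> carrier eA"
proof -
 have "en ** basis_vec d = basis_vec d"
  unfolding idem_eq[OF n r] sym_elt_mult_basis[OF r \<delta> assms n permutes_id] pdiag_compose_tfix(3)[OF assms n permutes_id r refl] ..
 thus ?thesis using tfix_diagram[OF assms] unfolding eA_carrier by (auto simp: basis_vec_def)
qed

lemma basis_X2:
 assumes "bfix r l d" shows "basis_vec d \<in> carrier X2"
proof -
 have "basis_vec d ** el = basis_vec d"
  unfolding idem_eq[OF l r] basis_mult_sym_elt[OF r \<delta> assms l permutes_id] bfix_compose_pdiag(3)[OF assms l permutes_id r refl] ..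
 thus ?thesis using bfix_diagram[OF assms] unfolding X2_carrier by (auto simp: basis_vec_def)
qed

text \<open>These elements generate the induced module over \<open>A\<close>: by
  \<open>nt_em\<close> and \<open>smult_gen\<close>, the tensor
  \<open>v \<otimes> (f \<otimes> c)\<close> is the product \<open>v f\<close> applied to
  \<open>gen c\<close>.\<close>

definition "gen c = nt el (PS.pt (basis_vec id) c)"

lemma nt_in_N: "v \<in> carrier X2 ==> f \<in> carrier kl ==> nt v (PS.pt f c) \<in> carrier N"
 unfolding N_eq by (intro TN.pure_in_T PS.pt_in)

lemma gen_in_N: "gen c \<in> carrier N"
 unfolding gen_def by (rule nt_in_N[OF el_X2 basis_id_in])

lemma smult_gen:
 assumes x: "x \<in> carrier X2" shows "x \<odot>\<^bsub>N\<^esub> gen c = nt x (PS.pt (basis_vec id) c)"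
 unfolding gen_def N_smult(2)[OF el_X2 PS.pt_in[OF basis_id_in]] using x X2_carrier by simp

lemma nt_em:
 assumes x: "x \<in> carrier X2" and f: "f \<in> carrier kl"
 shows "nt (x ** em l f) (PS.pt (basis_vec id) c) = nt x (PS.pt f c)"
 using TN.pure_balanced[OF x f PS.pt_in[OF basis_id_in, of c]] PS.P_smult(2)[OF basis_id_in, of f c]
 unfolding gmult_id[OF f] X2_simps by simp

lemma em_smult_gen:
 assumes f: "f \<in> carrier kl" shows "em l f \<odot>\<^bsub>N\<^esub> gen c = nt el (PS.pt f c)"
proof -
 have "em l f \<in> carrier X2" using X2_carrier em_in_pa[OF l] em_el by blast
 hence "em l f \<odot>\<^bsub>N\<^esub> gen c = nt (em l f) (PS.pt (basis_vec id) c)" by (rule smult_gen)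
 also have "\<dots> = nt (el ** em l f) (PS.pt (basis_vec id) c)" by (simp add: el_em)
 also have "\<dots> = nt el (PS.pt f c)" by (rule nt_em[OF el_X2 f])
 finally show ?thesis .
qed

lemma lt_balanced:
 assumes "u \<in> carrier eA" "a \<in> carrier pa" "z \<in> carrier N"
 shows "lt (u ** a) z = lt u (a \<odot>\<^bsub>N\<^esub> z)"
proof -
 have "cs u \<in> carrier X3" using assms(1) X3_carrier by blast
 from TL.pure_balanced[OF this assms(2,3)] show ?thesis unfolding cs_rsmult[OF assms(1,2)] .
qed

lemma lt_add:
 assumes "u \<in> carrier eA" "v \<in> carrier eA" "z \<in> carrier N"
 shows "lt (%d. u d + v d) z = lt u z \<oplus>\<^bsub>L\<^esub> lt v z"
proof -
 have "cs u \<in> carrier X3" "cs v \<in> carrier X3" using assms(1,2) X3_carrier by blast+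
 from TL.pure_add_left[OF this assms(3)] show ?thesis unfolding cs_add[OF assms(1,2)] L_eq .
qed

lemma lt_in_L: "u \<in> carrier eA ==> z \<in> carrier N ==> lt u z \<in> carrier L"
 unfolding L_eq using X3_carrier by (intro TL.pure_in_T) auto

lemma L_subgroup_induct:
 assumes K: "subgroup K (add_monoid L)"
  and gen: "\<And>u v f c. u \<in> carrier eA ==> v \<in> carrier X2 ==> f \<in> carrier kl ==> lt u (nt v (PS.pt f c)) \<in> K"
 shows "carrier L \<subseteq> K"
proof (rule TL.tensor_subgroup_induct[folded L_eq, OF K])
 fix C z assume "C \<in> carrier X3" and z: "z \<in> carrier N"
 hence "C \<in> cs ` carrier eA" unfolding X3_carrier by blast
 then obtain u where u: "u \<in> carrier eA" "C = cs u" by (rule imageE)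
 have cu: "cs u \<in> carrier X3" unfolding X3_carrier using u(1) by (rule imageI)
 have lin: "(%z. lt u z) \<in> hom (add_monoid N) (add_monoid L)"
  unfolding L_eq using TL.pure_add_right[OF cu] TL.pure_in_T[OF cu] by (intro homI) auto
 have "carrier N \<subseteq> {z \<in> carrier (add_monoid N). lt u z \<in> K}"
 proof (rule TN.tensor_subgroup_induct[folded N_eq, OF subgroup_hom_vimage[OF N_group L_group lin K]])
  fix v p assume v: "v \<in> carrier X2" and p: "p \<in> carrier P"
  have lin2: "(%p. nt v p) \<in> hom (add_monoid P) (add_monoid N)"
   unfolding N_eq using TN.pure_add_right[OF v] TN.pure_in_T[OF v] by (intro homI) auto
  have comp: "(%p. lt u (nt v p)) \<in> hom (add_monoid P) (add_monoid L)"
   using hom_compose[OF lin2 lin] by (simp add: comp_def)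
  have "carrier P \<subseteq> {p \<in> carrier (add_monoid P). lt u (nt v p) \<in> K}"
   by (rule PS.P_induct[OF subgroup_hom_vimage[OF PS.P_group L_group comp K]]) (use gen[OF u(1) v] PS.pt_in in simp)
  thus "nt v p \<in> {z \<in> carrier (add_monoid N). lt u z \<in> K}"
   using p hom_carrier[OF lin2] by auto
 qed
 thus "pure_tensor pa X3 N C z \<in> K" using z u(2) by auto
qed

lemma hom_eq_on_L:
 assumes h: "h \<in> hom (add_monoid L) fY" "h' \<in> hom (add_monoid L) fY"
  and eq: "\<And>u v f c. u \<in> carrier eA ==> v \<in> carrier X2 ==> f \<in> carrier kl ==> h (lt u (nt v (PS.pt f c))) = h' (lt u (nt v (PS.pt f c)))"
  and z: "z \<in> carrier L"
 shows "h z = h' z"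
proof (rule TL.tensor_hom_eqI[OF comm_group_fun_group, folded L_eq, OF h _ z])
 fix C z assume "C \<in> carrier X3" and z: "z \<in> carrier N"
 hence "C \<in> cs ` carrier eA" unfolding X3_carrier by blast
 then obtain u where u: "u \<in> carrier eA" "C = cs u" by (rule imageE)
 have cu: "cs u \<in> carrier X3" unfolding X3_carrier using u(1) by (rule imageI)
 have lin: "(%z. lt u z) \<in> hom (add_monoid N) (add_monoid L)"
  unfolding L_eq using TL.pure_add_right[OF cu] TL.pure_in_T[OF cu] by (intro homI) auto
 have 1: "(%z. h (lt u z)) \<in> hom (add_monoid N) fY" "(%z. h' (lt u z)) \<in> hom (add_monoid N) fY"
  using hom_compose[OF lin h(1)] hom_compose[OF lin h(2)] by (simp_all add: comp_def)
 have "h (lt u z) = h' (lt u z)" by (rule hom_eq_on_N[OF 1 comm_group_fun_group _ z]) (rule eq[OF u(1)])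
 thus "h (pure_tensor pa X3 N C z) = h' (pure_tensor pa X3 N C z)" unfolding u(2) .
qed

lemma lt_zero:
 assumes K: "subgroup K (add_monoid L)" and z: "z \<in> carrier N"
 shows "lt (%_. 0) z \<in> K"
proof -
 interpret L: comm_group "add_monoid L" by (rule L_group)
 have 0: "(%_. 0) \<in> carrier eA" using U_iff J_zero pm_zero_right U_subset by blast
 have "lt (%_. 0) z = lt (%_. 0) z \<oplus>\<^bsub>L\<^esub> lt (%_. 0) z" using lt_add[OF 0 0 z] by simp
 hence "lt (%_. 0) z = \<one>\<^bsub>add_monoid L\<^esub>"
  using L.l_cancel_one'[of "lt (%_. 0) z" "lt (%_. 0) z"] lt_in_L[OF 0 z] by simp
 thus ?thesis using subgroup.one_closed[OF K] by simp
qed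

text \<open>Moving everything to the left turns
  \<open>u \<otimes> (v \<otimes> (f \<otimes> c))\<close> into
  \<open>u v f \<otimes> gen c\<close>, and \<open>u v f\<close> is a combination of diagrams. The
  degenerate ones vanish in the quotient by \<open>U\<close>; every other is the representative of
  its type times an element of the Young subgroup, by \<open>diagram_type_eq_imp\<close>, and that
  element can be moved back to the right and disappears.\<close>

lemma L_span:
 assumes K: "subgroup K (add_monoid L)"
  and rep: "\<And>\<eta>. \<eta> \<in> Y ==> d \<eta> \<in> D \<and> dt (d \<eta>) = \<eta>"
  and T: "\<And>\<eta> c. \<eta> \<in> Y ==> lt (basis_vec (d \<eta>)) (gen c) \<in> K"
 shows "carrier L \<subseteq> K"
proof (rule L_subgroup_induct[OF K])
 fix u v f c assume u: "u \<in> carrier eA" and v: "v \<in> carrier X2" and f: "f \<in> carrier kl"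
 note g = gen_in_N
 let ?x = "v ** em l f"
 let ?y = "u ** ?x"
 have xX: "?x \<in> carrier X2" by (rule X2_em)
 have yX: "?y \<in> carrier X2" by (rule X2_mult[OF xX])
 have yA: "?y \<in> carrier eA" by (rule eA_mult[OF u])
 have scal: "(%d'. s * basis_vec e d') \<in> carrier eA" if "tfix r n e" for s e
  using basis_eA[OF that] unfolding eA_carrier by (simp add: A.conv_scale_right)
 have one: "lt (%d'. s * basis_vec e d') (gen c) \<in> K" if e: "tfix r n e" "bfix r l e" for e s
 proof (cases "nondeg r n e")
  case False
  have "(%d'. s * basis_vec e d') \<in> U"
   unfolding U_iff using degenerate_in_layer_ideal[OF r \<delta> e(1) False n, of s] scal[OF e(1), of s] unfolding eA_carrier by blast
  hence "cs (%d'. s * basis_vec e d') = cs (%_. 0)"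
   using U_subset J_zero U_iff pm_zero_right by (intro cs_eqI scal e) auto
  thus ?thesis using lt_zero[OF K g, of c] by simp
 next
  case True
  hence eD: "e \<in> D" using e by (simp add: core_diagrams_def)
  let ?\<eta> = "dt e"
  have \<eta>: "?\<eta> \<in> Y" using eD by blast
  note r\<eta> = rep[OF \<eta>]
  have dfix: "tfix r n (d ?\<eta>)" "bfix r l (d ?\<eta>)" using r\<eta> by (simp_all add: core_diagrams_def)
  obtain \<sigma> where s: "\<sigma> \<in> young_subgroup \<mu>" "e = ((d ?\<eta>) ;; (pdiag r l \<sigma>))"
   using diagram_type_eq_imp[of "d ?\<eta>" r n l e \<mu>] r\<eta> eD n \<mu> l r by auto
  have sp: "\<sigma> permutes {1..l}" using s \<mu> by (simp add: young_subgroup_iff)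
  let ?t = "%\<rho>. s * basis_vec \<sigma> \<rho> :: 'k"
  have sin: "?t \<in> carrier kl" by (rule PS.scaled_basis_in[OF sp])
  have emb: "em l ?t = (%d'. s * sym_elt r \<delta> l \<sigma> d')"
  proof -
   have "em l ?t = (%d'. s * em l (basis_vec \<sigma>) d')"
    unfolding embed_sym_eq[OF l r] sum_distrib_left by (simp add: mult_ac)
   thus ?thesis unfolding embed_sym_basis[OF r \<delta> l sp] .
  qed
  have "(%d'. s * basis_vec e d') = basis_vec (d ?\<eta>) ** em l ?t"
   unfolding emb A.conv_scale_right basis_mult_sym_elt[OF r \<delta> dfix(2) l sp] s(2)[symmetric] ..
  hence "lt (%d'. s * basis_vec e d') (gen c) = lt (basis_vec (d ?\<eta>)) (em l ?t \<odot>\<^bsub>N\<^esub> gen c)"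
   using lt_balanced[OF basis_eA[OF dfix(1)] em_in_pa[OF l] g] by simp
  also have "\<dots> = lt (basis_vec (d ?\<eta>)) (nt el (PS.pt ?t c))"
   unfolding em_smult_gen[OF sin] ..
  \<comment> \<open>As \<open>\<sigma>\<close> lies in the Young subgroup, it acts on the trivial
    module as 1, and only the scalar \<open>s\<close> is left.\<close>
  also have "PS.pt ?t c = PS.pt (basis_vec id) (s * c)"
  proof -
   have "?t \<in> carrier PS.kY" using s(1) by (auto simp: basis_vec_def)
   from PS.pt_balanced[OF basis_id_in this, of c]
   have "PS.pt ?t c = PS.pt (basis_vec id) ((\<Sum>\<rho>\<in>young_subgroup \<mu>. s * basis_vec \<sigma> \<rho>) * c)"
    unfolding PS.gmult_basis[OF permutes_id sp] by simp
   thus ?thesis using PS.sum_young_basis[OF s(1)] by (simp flip: sum_distrib_left)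
  qed
  finally have "lt (%d'. s * basis_vec e d') (gen c) = lt (basis_vec (d ?\<eta>)) (gen (s * c))" unfolding gen_def .
  thus ?thesis using T[OF \<eta>, of "s * c"] by (simp only:)
 qed
 have "lt (%d'. \<Sum>e\<in>B. ?y e * basis_vec e d') (gen c) \<in> K \<and> (%d'. \<Sum>e\<in>B. ?y e * basis_vec e d') \<in> carrier eA"
  if "finite B" "B \<subseteq> {e. ?y e \<noteq> 0}" for B
  using that
 proof (induction B rule: finite_induct)
  case empty
  thus ?case using lt_zero[OF K g, of c] U_iff J_zero pm_zero_right U_subset by auto
 next
  case (insert e B)
  have e: "tfix r n e" "bfix r l e" using insert eA_support[OF yA, of e] X2_support[OF yX, of e] by auto
  have IH: "lt (%d'. \<Sum>e\<in>B. ?y e * basis_vec e d') (gen c) \<in> K" "(%d'. \<Sum>e\<in>B. ?y e * basis_vec e d') \<in> carrier eA"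
   using insert by auto
  have "lt (%d'. ?y e * basis_vec e d' + (\<Sum>e\<in>B. ?y e * basis_vec e d')) (gen c) =
    lt (%d'. ?y e * basis_vec e d') (gen c) \<oplus>\<^bsub>L\<^esub> lt (%d'. \<Sum>e\<in>B. ?y e * basis_vec e d') (gen c)"
   by (rule lt_add[OF scal[OF e(1)] IH(2) g])
  moreover have "\<dots> \<in> K" using subgroup.m_closed[OF K one[OF e, of "?y e"] IH(1)] by simp
  moreover have "(%d'. ?y e * basis_vec e d' + (\<Sum>e\<in>B. ?y e * basis_vec e d')) \<in> carrier eA"
   using scal[OF e(1), of "?y e"] IH(2) unfolding eA_carrier by (simp add: A.conv_add_right)
  ultimately show ?case unfolding sum.insert[OF insert.hyps] by simp
 qed
 from this[of "{e\<in>diagrams r. ?y e \<noteq> 0}"]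
 have "lt (%d'. \<Sum>e\<in>{e\<in>diagrams r. ?y e \<noteq> 0}. ?y e * basis_vec e d') (gen c) \<in> K" by auto
 moreover have "(%d'. \<Sum>e\<in>{e\<in>diagrams r. ?y e \<noteq> 0}. ?y e * basis_vec e d') = ?y"
 proof -
  have "(%d'. \<Sum>e\<in>{e\<in>diagrams r. ?y e \<noteq> 0}. ?y e * basis_vec e d') = (%d'. \<Sum>e\<in>diagrams r. ?y e * basis_vec e d')"
   by (rule ext, rule sum.mono_neutral_left) auto
  thus ?thesis using pa_expand[OF pm_in_pa[of u ?x]] by simp
 qed
 ultimately have "lt ?y (gen c) \<in> K" by simp
 moreover have "lt u (nt v (PS.pt f c)) = lt ?y (gen c)"
 proof -
  have "nt v (PS.pt f c) = ?x \<odot>\<^bsub>N\<^esub> gen c" unfolding smult_gen[OF xX] nt_em[OF v f] ..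
  thus ?thesis using lt_balanced[OF u pm_in_pa[of v "em l f"] g, of c] by simp
 qed
 ultimately show "lt u (nt v (PS.pt f c)) \<in> K" by simp
qed

lemma act_Y:
 assumes "\<eta> \<in> Y" "\<pi> permutes {1..n}" shows "act \<pi> \<eta> \<in> Y"
proof -
 obtain d where d: "d \<in> D" "\<eta> = dt d" using assms(1) by blast
 have "dt ((pdiag r n \<pi>) ;; d) = act \<pi> \<eta>" "((pdiag r n \<pi>) ;; d) \<in> D"
  using compose_pdiag_in_core[OF d(1) assms(2) n \<mu> l r] d(2) by (auto simp: act_def)
 thus ?thesis by (metis imageI)
qed

text \<open>Choosing one diagram for each type, the tensors with \<open>gen c\<close> are dual to
  the functionals of \<open>L_functional\<close> and generate by \<open>L_span\<close>, so
  \<open>basis_bij_betw\<close> applies. Equivariance is \<open>coef_em\<close>.\<close>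

theorem layer_res_iso: "module_isomorphic kn L (fun_module n Y act)"
proof -
 obtain h where h: "h \<in> hom (add_monoid L) fY"
  and hg: "\<And>u v f c. u \<in> carrier eA ==> v \<in> carrier X2 ==> f \<in> carrier kl ==> h (lt u (nt v (PS.pt f c))) = (%\<eta>. c * coef (u ** v ** em l f) \<eta>)"
  using L_functional by blast
 define d where "d \<eta> = (SOME d. d \<in> D \<and> dt d = \<eta>)" for \<eta>
 have d: "d \<eta> \<in> D \<and> dt (d \<eta>) = \<eta>" if "\<eta> \<in> Y" for \<eta>
  unfolding d_def by (rule someI_ex) (use that in blast)
 note g = gen_in_N
 have bij: "bij_betw h (carrier (add_monoid L)) {v. \<forall>\<eta>. \<eta> \<notin> Y --> v \<eta> = 0}"
 proof (rule basis_bij_betw[OF L_group _ h, where T = "%\<eta> c. lt (basis_vec (d \<eta>)) (gen c)"])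
  show "finite Y" using finite_D by simp
  fix \<eta> and c c' :: 'k assume \<eta>: "\<eta> \<in> Y"
  have f: "tfix r n (d \<eta>)" "bfix r l (d \<eta>)" using d[OF \<eta>] by (simp_all add: core_diagrams_def)
  note bA = basis_eA[OF f(1)]
  have cu: "cs (basis_vec (d \<eta>)) \<in> carrier X3" unfolding X3_carrier using bA by (rule imageI)
  show "lt (basis_vec (d \<eta>)) (gen c) \<in> carrier (add_monoid L)" using lt_in_L[OF bA g] by simp
  have "gen (c + c') = gen c \<oplus>\<^bsub>N\<^esub> gen c'"
   unfolding gen_def PS.pt_add_right[OF basis_id_in] N_eq by (rule TN.pure_add_right[OF el_X2 PS.pt_in[OF basis_id_in] PS.pt_in[OF basis_id_in]])
  thus "lt (basis_vec (d \<eta>)) (gen (c + c')) = lt (basis_vec (d \<eta>)) (gen c) \<otimes>\<^bsub>add_monoid L\<^esub> lt (basis_vec (d \<eta>)) (gen c')"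
   using TL.pure_add_right[OF cu g[of c] g[of c']] unfolding L_eq by simp
  have "basis_vec (d \<eta>) ** el = basis_vec (d \<eta>)" using basis_X2[OF f(2)] unfolding X2_carrier by blast
  hence "basis_vec (d \<eta>) ** el ** em l (basis_vec id) = basis_vec (d \<eta>)"
   unfolding embed_sym_basis[OF r \<delta> l permutes_id] idem_eq[OF l r, symmetric] by simp
  thus "h (lt (basis_vec (d \<eta>)) (gen c)) = (%\<eta>'. if \<eta>' = \<eta> then c else 0)"
   unfolding gen_def hg[OF bA el_X2 basis_id_in] using d[OF \<eta>] by (auto simp: coef_basis)
 next
  fix K assume K: "subgroup K (add_monoid L)" "\<And>\<eta> c. \<eta> \<in> Y ==> lt (basis_vec (d \<eta>)) (gen c) \<in> K"
  show "carrier (add_monoid L) \<subseteq> K" using L_span[OF K(1) d K(2)] by simp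
 qed
 show ?thesis
 proof (rule module_isomorphicI[OF h])
  show "bij_betw h (carrier L) {v. \<forall>\<eta>. \<eta> \<notin> Y --> v \<eta> = 0}" using bij by simp
  fix g z assume "g \<in> carrier kn" and z: "z \<in> carrier L"
  show "h (g \<odot>\<^bsub>L\<^esub> z) = (%\<eta>. \<Sum>\<pi>\<in>Sym n. g \<pi> * h z (act (pinv \<pi>) \<eta>))"
  proof (rule hom_eq_on_L[OF _ _ _ z])
   show "(%z. h (g \<odot>\<^bsub>L\<^esub> z)) \<in> hom (add_monoid L) fY"
    using hom_compose[OF L_smult(1) h, of g] by (simp add: comp_def)
   show "(%z. (%\<eta>. \<Sum>\<pi>\<in>Sym n. g \<pi> * h z (act (pinv \<pi>) \<eta>))) \<in> hom (add_monoid L) fY"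
   proof (rule homI)
    fix z assume "z \<in> carrier (add_monoid L)"
    hence hz: "h z \<in> carrier fY" using hom_carrier[OF h] by auto
    have "h z (act (pinv \<pi>) \<eta>) = 0" if "\<eta> \<notin> Y" "\<pi> \<in> Sym n" for \<eta> \<pi>
    proof -
     have p: "\<pi> permutes {1..n}" using that by simp
     have "act \<pi> (act (pinv \<pi>) \<eta>) = \<eta>" using permutes_inv_o(2)[OF p] by (simp add: act_def comp_assoc)
     hence "act (pinv \<pi>) \<eta> \<notin> Y" using act_Y[OF _ p] that(1) by metis
     thus ?thesis using hz unfolding fun_group_simps by blast
    qed
    thus "(%\<eta>. \<Sum>\<pi>\<in>Sym n. g \<pi> * h z (act (pinv \<pi>) \<eta>)) \<in> carrier fY" by simp
   next
    fix y z assume "y \<in> carrier (add_monoid L)" "z \<in> carrier (add_monoid L)"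
    hence "h (y \<otimes>\<^bsub>add_monoid L\<^esub> z) = (%w. h y w + h z w)" using hom_mult[OF h, of y z] by simp
    thus "(%\<eta>. \<Sum>\<pi>\<in>Sym n. g \<pi> * h (y \<otimes>\<^bsub>add_monoid L\<^esub> z) (act (pinv \<pi>) \<eta>)) =
     (%\<eta>. \<Sum>\<pi>\<in>Sym n. g \<pi> * h y (act (pinv \<pi>) \<eta>)) \<otimes>\<^bsub>fY\<^esub> (%\<eta>. \<Sum>\<pi>\<in>Sym n. g \<pi> * h z (act (pinv \<pi>) \<eta>))"
     by (simp add: sum.distrib algebra_simps)
   qed
   fix u v f c assume u: "u \<in> carrier eA" and v: "v \<in> carrier X2" and f: "f \<in> carrier kl"
   have 1: "u ** v ** em l f \<in> carrier eA" by (intro eA_mult u)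
   have 2: "u ** v ** em l f \<in> carrier X2" by (rule X2_em)
   have "em n g ** u ** v ** em l f = em n g ** (u ** v ** em l f)" by (simp only: A.conv_assoc)
   hence "coef (em n g ** u ** v ** em l f) = (%\<eta>. \<Sum>\<pi>\<in>Sym n. g \<pi> * coef (u ** v ** em l f) (act (pinv \<pi>) \<eta>))"
    using coef_em[OF 1 X2_support[OF 2], of g] by simp
   thus "h (g \<odot>\<^bsub>L\<^esub> lt u (nt v (PS.pt f c))) = (%\<eta>. \<Sum>\<pi>\<in>Sym n. g \<pi> * h (lt u (nt v (PS.pt f c))) (act (pinv \<pi>) \<eta>))"
    unfolding L_smult(2)[OF u nt_in_N[OF v f]] hg[OF eA_em v f] hg[OF u v f] by (simp add: sum_distrib_left mult_ac)
  qed
 qed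
qed

end

section \<open>Decomposition into permutation modules\<close>

definition module_iso :: "('r, 'q) ring_scheme => ('r, 'x, 'm) module_scheme => ('r, 'y, 'n) module_scheme => ('x => 'y) => bool" where
 "module_iso R M N h \<longleftrightarrow> h \<in> hom (add_monoid M) (add_monoid N) \<and> bij_betw h (carrier M) (carrier N) \<and>
   (\<forall>a\<in>carrier R. \<forall>x\<in>carrier M. h (a \<odot>\<^bsub>M\<^esub> x) = a \<odot>\<^bsub>N\<^esub> h x)"

lemma module_isomorphic_iff: "module_isomorphic R M N \<longleftrightarrow> (\<exists>h. module_iso R M N h)"
 unfolding module_isomorphic_def module_iso_def iso_def by auto

definition smult_closed :: "('r, 'q) ring_scheme => ('r, 'x, 'm) module_scheme => bool" where
 "smult_closed R M \<longleftrightarrow> (\<forall>a\<in>carrier R. \<forall>x\<in>carrier M. a \<odot>\<^bsub>M\<^esub> x \<in> carrier M) \<and>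
   (\<forall>x\<in>carrier M. \<forall>y\<in>carrier M. x \<oplus>\<^bsub>M\<^esub> y \<in> carrier M)"

lemma module_iso_sym:
 assumes M: "smult_closed R M" and h: "module_iso R M N h"
 shows "module_iso R N M (inv_into (carrier M) h)"
proof -
 let ?g = "inv_into (carrier M) h"
 have b: "bij_betw h (carrier M) (carrier N)" using h by (simp add: module_iso_def)
 have g: "?g y \<in> carrier M" "h (?g y) = y" if "y \<in> carrier N" for y
  using that b by (auto simp: bij_betw_def inv_into_into f_inv_into_f)
 have inj: "x = ?g y" if "x \<in> carrier M" "h x = y" for x y using that b by (auto simp: bij_betw_def)
 have "?g (y \<oplus>\<^bsub>N\<^esub> y') = ?g y \<oplus>\<^bsub>M\<^esub> ?g y'" if "y \<in> carrier N" "y' \<in> carrier N" for y y'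
 proof (rule inj[symmetric])
  show "?g y \<oplus>\<^bsub>M\<^esub> ?g y' \<in> carrier M" using M g that by (simp add: smult_closed_def)
  have "h (?g y \<otimes>\<^bsub>add_monoid M\<^esub> ?g y') = h (?g y) \<otimes>\<^bsub>add_monoid N\<^esub> h (?g y')"
   using h g that unfolding module_iso_def by (intro hom_mult) auto
  thus "h (?g y \<oplus>\<^bsub>M\<^esub> ?g y') = y \<oplus>\<^bsub>N\<^esub> y'" using g that by simp
 qed
 moreover have "?g (a \<odot>\<^bsub>N\<^esub> y) = a \<odot>\<^bsub>M\<^esub> ?g y" if "a \<in> carrier R" "y \<in> carrier N" for a y
  by (rule inj[symmetric]) (use M h g that in \<open>auto simp: smult_closed_def module_iso_def\<close>)
 moreover have "bij_betw ?g (carrier N) (carrier M)" using b by (rule bij_betw_inv_into)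
 ultimately show ?thesis unfolding module_iso_def hom_def using g by auto
qed

lemma module_iso_trans:
 assumes "module_iso R M N h" "module_iso R N Q g"
 shows "module_iso R M Q (g \<circ> h)"
proof -
 have "g \<circ> h \<in> hom (add_monoid M) (add_monoid Q)" using assms unfolding module_iso_def by (intro hom_compose) auto
 moreover have "bij_betw (g \<circ> h) (carrier M) (carrier Q)" using assms unfolding module_iso_def by (intro bij_betw_trans) auto
 moreover have "h x \<in> carrier N" if "x \<in> carrier M" for x using assms(1) that by (auto simp: module_iso_def bij_betw_def)
 ultimately show ?thesis using assms by (auto simp: module_iso_def)
qed

lemma direct_sum_simps:
 "carrier (direct_sum Ms) = (\<Pi>\<^sub>E i\<in>{..<length Ms}. carrier (Ms ! i))"
 "zero (direct_sum Ms) = (\<lambda>i\<in>{..<length Ms}. \<zero>\<^bsub>Ms ! i\<^esub>)"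
 "f \<oplus>\<^bsub>direct_sum Ms\<^esub> g = (\<lambda>i\<in>{..<length Ms}. f i \<oplus>\<^bsub>Ms ! i\<^esub> g i)"
 "s \<odot>\<^bsub>direct_sum Ms\<^esub> f = (\<lambda>i\<in>{..<length Ms}. s \<odot>\<^bsub>Ms ! i\<^esub> f i)"
 by (simp_all add: direct_sum_def)

lemma smult_closed_direct_sum:
 assumes "\<And>i. i < length Ms ==> smult_closed R (Ms ! i)"
 shows "smult_closed R (direct_sum Ms)"
 using assms unfolding smult_closed_def direct_sum_simps by (auto simp: PiE_def Pi_iff)

lemma direct_sum_iso_fun_module:
 fixes Ms :: "((nat => nat) => 'k::field, 'x) module list"
 assumes g: "\<And>i. i < length Ms ==> module_iso (kSym n) (Ms ! i) (fun_module n (W i) comp_act) (g i)"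
 shows "module_iso (kSym n) (direct_sum Ms) (fun_module n (SIGMA i:{..<length Ms}. W i) (%\<pi> (i, w). (i, w \<circ> \<pi>)))
  (%z (i, w). if i < length Ms then g i (z i) w else 0)" (is "module_iso _ ?S ?F ?H")
proof -
 let ?len = "length Ms"
 have gh: "g i \<in> hom (add_monoid (Ms ! i)) (add_monoid (fun_module n (W i) comp_act))"
  and gb: "bij_betw (g i) (carrier (Ms ! i)) {v. \<forall>w. w \<notin> W i --> v w = 0}"
  and ge: "\<And>f x. f \<in> carrier (kSym n) ==> x \<in> carrier (Ms ! i) ==> g i (f \<odot>\<^bsub>Ms ! i\<^esub> x) = (%w. \<Sum>\<pi>\<in>Sym n. f \<pi> * g i x (w \<circ> pinv \<pi>))"
  if "i < ?len" for i
  using g[OF that] by (auto simp: module_iso_def fun_module_simps comp_act_def)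
 have zin: "z i \<in> carrier (Ms ! i)" if "z \<in> carrier ?S" "i < ?len" for z i
  using that by (auto simp: direct_sum_simps)
 have gadd: "g i (x \<oplus>\<^bsub>Ms ! i\<^esub> y) = (%w. g i x w + g i y w)" if "i < ?len" "x \<in> carrier (Ms ! i)" "y \<in> carrier (Ms ! i)" for i x y
  using hom_mult[OF gh[OF that(1)], of x y] that by (simp add: fun_module_simps)
 have g0: "g i x w = 0" if "i < ?len" "x \<in> carrier (Ms ! i)" "w \<notin> W i" for i x w
  using gb[OF that(1)] that(2,3) by (auto simp: bij_betw_def)
 have "?H \<in> hom (add_monoid ?S) (add_monoid ?F)"
  by (rule homI) (auto simp: fun_module_simps direct_sum_simps fun_eq_iff gadd zin intro!: g0)
 moreover have "bij_betw ?H (carrier ?S) (carrier ?F)"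
 proof (rule bij_betw_imageI)
  show "inj_on ?H (carrier ?S)"
  proof (rule inj_onI)
   fix z z' assume z: "z \<in> carrier ?S" "z' \<in> carrier ?S" and e: "?H z = ?H z'"
   have "z i = z' i" if i: "i < ?len" for i
   proof -
    have "g i (z i) w = g i (z' i) w" for w using fun_cong[OF e, of "(i, w)"] i by simp
    hence "g i (z i) = g i (z' i)" by blast
    thus ?thesis using gb[OF i] zin[OF z(1) i] zin[OF z(2) i] by (auto simp: bij_betw_def inj_on_def)
   qed
   thus "z = z'" using z unfolding direct_sum_simps by (intro PiE_ext) auto
  qed
  show "?H ` carrier ?S = carrier ?F"
  proof (intro equalityI subsetI)
   fix v assume "v \<in> ?H ` carrier ?S"
   thus "v \<in> carrier ?F" by (auto simp: fun_module_simps zin intro!: g0)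
  next
   fix v assume v: "v \<in> carrier ?F"
   define z where "z = (\<lambda>i\<in>{..<?len}. inv_into (carrier (Ms ! i)) (g i) (%w. v (i, w)))"
   have zi: "z i \<in> carrier (Ms ! i)" "g i (z i) = (%w. v (i, w))" if i: "i < ?len" for i
   proof -
    have "(%w. v (i, w)) \<in> g i ` carrier (Ms ! i)" using gb[OF i] v by (auto simp: bij_betw_def fun_module_simps)
    thus "z i \<in> carrier (Ms ! i)" "g i (z i) = (%w. v (i, w))"
     using i by (simp_all add: z_def inv_into_into f_inv_into_f)
   qed
   have "z \<in> carrier ?S" unfolding direct_sum_simps using zi(1) by (auto simp: z_def)
   moreover have "?H z = v" using zi(2) v by (auto simp: fun_module_simps)
   ultimately show "v \<in> ?H ` carrier ?S" by blast
  qed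
 qed
 moreover have "?H (f \<odot>\<^bsub>?S\<^esub> z) = f \<odot>\<^bsub>?F\<^esub> ?H z"
  if f: "f \<in> carrier (kSym n)" and z: "z \<in> carrier ?S" for f z
  using ge[OF _ f zin[OF z]] by (auto simp: fun_module_simps direct_sum_simps fun_eq_iff)
 ultimately show ?thesis unfolding module_iso_def by blast
qed

text \<open>The action is a function on a whole type, and a module element is 0 outside its set. So
  points outside \<open>Y'\<close> have to stay outside, or the value 0 there would not be
  preserved.\<close>

lemma fun_module_transport:
 assumes b: "bij_betw \<beta> Y' Y" and beqv: "\<And>y \<pi>. y \<in> Y' ==> \<pi> permutes {1..n} ==> a' \<pi> y \<in> Y' \<and> \<beta> (a' \<pi> y) = a \<pi> (\<beta> y)"
  and out: "\<And>y \<pi>. y \<notin> Y' ==> \<pi> permutes {1..n} ==> a' \<pi> y \<notin> Y'"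
 shows "module_iso R (fun_module n Y a) (fun_module n Y' a') (%v y. if y \<in> Y' then v (\<beta> y) else (0::'k::field))" (is "module_iso R ?M ?N ?h")
proof -
 have "bij_betw ?h (carrier ?M) (carrier ?N)"
 proof (rule bij_betw_byWitness[where f' = "%u y. if y \<in> Y then u (inv_into Y' \<beta> y) else 0"])
  show "\<forall>v\<in>carrier ?M. (%y. if y \<in> Y then ?h v (inv_into Y' \<beta> y) else 0) = v"
   using b by (auto simp: fun_module_simps fun_eq_iff bij_betw_def inv_into_into f_inv_into_f)
  show "\<forall>u\<in>carrier ?N. ?h (%y. if y \<in> Y then u (inv_into Y' \<beta> y) else 0) = u"
   using b by (auto simp: fun_module_simps fun_eq_iff bij_betw_def)
 qed (auto simp: fun_module_simps)
 moreover have "?h \<in> hom (add_monoid ?M) (add_monoid ?N)" by (rule homI) (auto simp: fun_module_simps)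
 moreover have "?h (f \<odot>\<^bsub>?M\<^esub> v) = f \<odot>\<^bsub>?N\<^esub> ?h v" for f v
  using beqv out by (auto simp: fun_module_simps fun_eq_iff permutes_inv intro!: sum.cong)
 ultimately show ?thesis by (simp add: module_iso_def)
qed

text \<open>Listing the letters by decreasing multiplicity makes the content of a word a
  partition.\<close>

lemma word_letters:
 fixes M :: "'a multiset"
 shows "\<exists>xs. distinct xs \<and> set xs = set_mset M \<and> is_partition (size M) (map (count M) xs)"
proof -
 obtain ys where ys: "distinct ys" "set ys = set_mset M" using finite_distinct_list[OF finite_set_mset[of M]] by blast
 define xs where "xs = sort_key (%x. - int (count M x)) ys"
 have xs: "distinct xs" "set xs = set_mset M" using ys by (simp_all add: xs_def)
 have "sorted (map (%x. - int (count M x)) xs)" by (simp add: xs_def)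
 hence s: "sorted_wrt (\<ge>) (map (count M) xs)" unfolding sorted_map by (simp add: sorted_wrt_map)
 have "sum_list (map (count M) xs) = (\<Sum>x\<in>set xs. count M x)" using xs(1) by (simp add: sum_list_distinct_conv_sum_set)
 also have "\<dots> = size M" unfolding xs(2) by (simp add: size_multiset_overloaded_eq)
 finally have "is_partition (size M) (map (count M) xs)" using s xs by (auto simp: is_partition_def count_eq_zero_iff)
 thus ?thesis using xs by blast
qed

lemma count_word: "count (image_mset w (mset_set {1..n})) x = card {j\<in>{1..n::nat}. w j = x}"
 by (simp add: count_image_mset' Int_def vimage_def) (metis (mono_tags, lifting) Collect_cong)

lemma permuted_word: "\<pi> permutes {1..n} ==> w \<circ> \<pi> \<in> words n \<nu> ==> w \<in> words n \<nu>"
 using words_comp[of "w \<circ> \<pi>" n \<nu> "pinv \<pi>"] by (simp add: permutes_inv comp_assoc permutes_inv_o)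

abbreviation (input) wmod where "wmod n \<nu>s \<equiv> fun_module n (SIGMA i:{..<length \<nu>s}. words n (\<nu>s ! i)) (%\<pi> (i, w). (i, w \<circ> \<pi>))"

text \<open>The orbits are the fibres of \<open>key\<close>: the multiset of letters together with
  the second component, which is not moved. Replacing letters by their positions in the list
  \<open>xs\<close> turns an orbit into the set of all words of a fixed content.\<close>

lemma fun_module_orbits:
 fixes Y :: "((nat => 'a) \<times> 'b) set"
 assumes fin: "finite Y" and ext: "\<And>\<eta>. \<eta> \<in> Y ==> fst \<eta> \<in> extensional {1..n}"
  and act: "\<And>\<eta> \<pi>. \<eta> \<in> Y ==> \<pi> permutes {1..n} ==> act \<pi> \<eta> \<in> Y"
 shows "\<exists>\<nu>s. (\<forall>\<nu>\<in>set \<nu>s. is_partition n \<nu>) \<and> (\<exists>h. module_iso R (fun_module n Y act)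
  (wmod n \<nu>s :: (_, _ => 'k::field) module) h)"
proof -
 define key where "key \<eta> = (image_mset (fst \<eta>) (mset_set {1..n}), snd \<eta>)" for \<eta> :: "(nat => 'a) \<times> 'b"
 obtain ks where ks: "distinct ks" "set ks = key ` Y" using finite_distinct_list[of "key ` Y"] fin by auto
 define xs where "xs M = (SOME xs. distinct xs \<and> set xs = set_mset M \<and> is_partition (size M) (map (count M) xs))" for M :: "'a multiset"
 have xs: "distinct (xs M)" "set (xs M) = set_mset M" "is_partition (size M) (map (count M) (xs M))" for M
  using someI_ex[OF word_letters[of M], folded xs_def] by blast+
 define \<nu> where "\<nu> k = map (count (fst k)) (xs (fst k))" for k :: "'a multiset \<times> 'b"
 have part: "is_partition n (\<nu> k)" if "k \<in> set ks" for k
 proof -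
  have "size (fst k) = n" using that ks by (auto simp: key_def)
  thus ?thesis using xs(3)[of "fst k"] by (simp add: \<nu>_def)
 qed
 define b where "b k w = ((\<lambda>j\<in>{1..n}. xs (fst k) ! (w j)), snd k)" for k :: "'a multiset \<times> 'b" and w :: "nat => nat"
 have len: "length (\<nu> k) = length (xs (fst k))" for k by (simp add: \<nu>_def)
 have wlt: "w j < length (xs (fst k))" if "w \<in> words n (\<nu> k)" "j \<in> {1..n}" for w j k
  using that len by (auto simp: words_def)
 have bkey: "key (b k w) = k" if w: "w \<in> words n (\<nu> k)" and k: "k \<in> set ks" for k w
 proof -
  have "image_mset (fst (b k w)) (mset_set {1..n}) = fst k"
  proof (rule multiset_eqI)
   fix x
   have c: "count (image_mset (fst (b k w)) (mset_set {1..n})) x = card {j\<in>{1..n}. xs (fst k) ! (w j) = x}"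
    unfolding count_word b_def by (rule arg_cong[where f = card]) auto
   show "count (image_mset (fst (b k w)) (mset_set {1..n})) x = count (fst k) x"
   proof (cases "x \<in> set (xs (fst k))")
    case True
    then obtain i where i: "i < length (xs (fst k))" "x = xs (fst k) ! i" by (metis in_set_conv_nth)
    have "{j\<in>{1..n}. xs (fst k) ! (w j) = x} = {j\<in>{1..n}. w j = i}"
     using wlt[OF w] i nth_eq_iff_index_eq[OF xs(1)] by auto
    moreover have "card {j\<in>{1..n}. w j = i} = \<nu> k ! i" using w i len by (simp add: words_def)
    ultimately show ?thesis unfolding c using i by (simp add: \<nu>_def)
   next
    case False
    hence "{j\<in>{1..n}. xs (fst k) ! (w j) = x} = {}" using wlt[OF w] by auto
    thus ?thesis unfolding c using False xs(2)[of "fst k"] by (simp add: not_in_iff)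
   qed
  qed
  thus ?thesis by (simp add: key_def b_def prod_eq_iff)
 qed
 have bsurj: "\<exists>w\<in>words n (\<nu> (key \<eta>)). \<eta> = b (key \<eta>) w" if \<eta>: "fst \<eta> \<in> extensional {1..n}" for \<eta>
 proof -
  let ?k = "key \<eta>" and ?f = "fst \<eta>"
  let ?M = "image_mset ?f (mset_set {1..n})"
  have M: "fst ?k = ?M" by (simp add: key_def)
  have "\<exists>i. j \<in> {1..n} --> i < length (xs ?M) \<and> ?f j = xs ?M ! i" for j
  proof (cases "j \<in> {1..n}")
   case True
   hence "?f j \<in> set (xs ?M)" unfolding xs(2) by simp
   thus ?thesis by (metis in_set_conv_nth)
  qed blast
  then obtain v where v: "\<And>j. j \<in> {1..n} ==> v j < length (xs ?M) \<and> ?f j = xs ?M ! (v j)" by metis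
  let ?w = "\<lambda>j\<in>{1..n}. v j"
  have "?w \<in> words n (\<nu> ?k)" unfolding words_def
  proof (intro CollectI conjI allI impI)
   show "?w \<in> {1..n} \<rightarrow>\<^sub>E {..<length (\<nu> ?k)}" using v by (auto simp: len M)
   fix i assume "i < length (\<nu> ?k)"
   hence i: "i < length (xs ?M)" by (simp add: len M)
   have "{j \<in> {1..n}. ?w j = i} = {j\<in>{1..n}. ?f j = xs ?M ! i}"
    using v nth_eq_iff_index_eq[OF xs(1)[of ?M]] i by auto
   hence "card {j \<in> {1..n}. ?w j = i} = count ?M (xs ?M ! i)" unfolding count_word by simp
   thus "card {j \<in> {1..n}. ?w j = i} = \<nu> ?k ! i" using i by (simp add: \<nu>_def M)
  qed
  moreover have "\<eta> = b ?k ?w"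
  proof -
   have "fst \<eta> = (\<lambda>j\<in>{1..n}. xs ?M ! (?w j))"
   proof
    fix j show "fst \<eta> j = (\<lambda>j\<in>{1..n}. xs ?M ! (?w j)) j"
     using v[of j] \<eta> by (cases "j \<in> {1..n}") (auto simp: extensional_def)
   qed
   thus ?thesis by (simp add: b_def M prod_eq_iff) (simp add: key_def)
  qed
  ultimately show ?thesis by blast
 qed
 have bY: "b k w \<in> Y" if w: "w \<in> words n (\<nu> k)" and k: "k \<in> set ks" for k w
 proof -
  obtain \<eta> where \<eta>: "\<eta> \<in> Y" "key \<eta> = k" using k ks by auto
  \<comment> \<open>The word has the same letters with the same multiplicities as one occurring in
    \<open>Y\<close>, so it is a rearrangement of it, and \<open>Y\<close> is closed under
    rearrangement.\<close>
  have e: "image_mset (fst (b k w)) (mset_set {1..n}) = image_mset (fst \<eta>) (mset_set {1..n})" "snd (b k w) = snd \<eta>"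
   using bkey[OF w k] \<eta>(2) by (auto simp: key_def b_def)
  then obtain p where p: "p permutes {1..n}" "\<forall>j\<in>{1..n}. fst (b k w) j = fst \<eta> (p j)"
   using image_mset_eq_implies_permutes[of "{1..n}" "fst (b k w)" "fst \<eta>"] by auto
  have "fst (b k w) = fst \<eta> \<circ> p"
  proof
   fix j show "fst (b k w) j = (fst \<eta> \<circ> p) j"
    using p ext[OF \<eta>(1)] permutes_not_in[OF p(1), of j] by (cases "j \<in> {1..n}") (auto simp: b_def extensional_def)
  qed
  hence "b k w = act p \<eta>" using e(2) by (simp add: act_def prod_eq_iff)
  thus ?thesis using act[OF \<eta>(1) p(1)] by simp
 qed
 define \<nu>s where "\<nu>s = map \<nu> ks"
 have nth: "\<nu>s ! i = \<nu> (ks ! i)" "ks ! i \<in> set ks" if "i < length \<nu>s" for i using that by (simp_all add: \<nu>s_def)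
 let ?Y' = "SIGMA i:{..<length \<nu>s}. words n (\<nu>s ! i)"
 let ?\<beta> = "%(i, w). b (ks ! i) w"
 have len': "length \<nu>s = length ks" by (simp add: \<nu>s_def)
 have key: "key (?\<beta> y) = ks ! fst y" if "y \<in> ?Y'" for y
  using that bkey[of "snd y" "ks ! fst y"] nth[of "fst y"] by auto
 have bij: "bij_betw ?\<beta> ?Y' Y"
 proof (rule bij_betw_imageI)
  show "inj_on ?\<beta> ?Y'"
  proof (rule inj_onI)
   fix y y' assume y: "y \<in> ?Y'" "y' \<in> ?Y'" and e: "?\<beta> y = ?\<beta> y'"
   have k: "ks ! fst y = ks ! fst y'" using key[OF y(1)] key[OF y(2)] e by simp
   hence i: "fst y = fst y'" using nth_eq_iff_index_eq[OF ks(1)] y len' by auto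
   have w: "snd y \<in> words n (\<nu> (ks ! fst y))" "snd y' \<in> words n (\<nu> (ks ! fst y))" using y nth k by auto
   have "snd y j = snd y' j" for j
   proof (cases "j \<in> {1..n}")
    case True
    have "xs (fst (ks ! fst y)) ! snd y j = xs (fst (ks ! fst y)) ! snd y' j"
     using fun_cong[OF arg_cong[OF e, of fst], of j] True i by (simp add: b_def case_prod_beta)
    thus ?thesis using nth_eq_iff_index_eq[OF xs(1)] wlt[OF w(1) True] wlt[OF w(2) True] by simp
   next
    case False thus ?thesis using w by (auto simp: words_def PiE_def extensional_def)
   qed
   thus "y = y'" using i by (auto simp: prod_eq_iff)
  qed
  show "?\<beta> ` ?Y' = Y"
  proof (intro equalityI subsetI)
   fix y assume y: "y \<in> Y"
   then obtain i where i: "i < length ks" "key y = ks ! i" using ks by (metis imageI in_set_conv_nth)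
   then obtain w where "w \<in> words n (\<nu>s ! i)" "y = b (ks ! i) w" using bsurj[OF ext[OF y]] nth(1)[of i] len' by auto
   thus "y \<in> ?\<beta> ` ?Y'" using i len' by (intro image_eqI[of _ _ "(i, w)"]) auto
  next
   fix y assume "y \<in> ?\<beta> ` ?Y'"
   then obtain i w where "i < length \<nu>s" "w \<in> words n (\<nu>s ! i)" "y = b (ks ! i) w" by auto
   thus "y \<in> Y" using bY[of w "ks ! i"] nth[of i] by simp
  qed
 qed
 have eqv: "?\<beta> (i, w \<circ> \<pi>) = act \<pi> (?\<beta> (i, w))" if p: "\<pi> permutes {1..n}" for i w \<pi>
 proof -
  have "(\<lambda>j\<in>{1..n}. xs (fst (ks ! i)) ! ((w \<circ> \<pi>) j)) j = ((\<lambda>j\<in>{1..n}. xs (fst (ks ! i)) ! (w j)) \<circ> \<pi>) j" for j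
   using permutes_in_image[OF p, of j] permutes_not_in[OF p, of j] by (cases "j \<in> {1..n}") auto
  thus ?thesis by (auto simp: b_def act_def fun_eq_iff)
 qed
 have "module_iso R (fun_module n Y act) (fun_module n ?Y' (%\<pi> (i, w). (i, w \<circ> \<pi>))) (%v y. if y \<in> ?Y' then v (?\<beta> y) else (0::'k))"
 proof (rule fun_module_transport[OF bij])
  fix y :: "nat \<times> (nat => nat)" and \<pi> assume p: "\<pi> permutes {1..n}"
  obtain i w where y: "y = (i, w)" by (cases y)
  show "(case y of (i, w) => (i, w \<circ> \<pi>)) \<in> ?Y' \<and> ?\<beta> (case y of (i, w) => (i, w \<circ> \<pi>)) = act \<pi> (?\<beta> y)" if "y \<in> ?Y'"
   using that words_comp[OF _ p, of w] eqv[OF p, of i w] unfolding y by simp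
  show "(case y of (i, w) => (i, w \<circ> \<pi>)) \<notin> ?Y'" if "y \<notin> ?Y'"
   using that permuted_word[OF p, of w] unfolding y by auto
 qed
 thus ?thesis using part by (intro exI[of _ \<nu>s]) (auto simp: \<nu>s_def)
qed

lemma smult_closed_perm_module:
 assumes "sum_list \<nu> = m"
 shows "smult_closed (kSym m) (perm_module m \<nu> :: (_, (((((nat => nat) => 'k::field) \<times> 'k) \<Rightarrow>\<^sub>0 int) set)) module)"
  and "\<exists>h. module_iso (kSym m) (perm_module m \<nu> :: (_, 'k tensors) module) (fun_module m (words m \<nu>) comp_act) h"
proof -
 interpret PS: perm_setup m \<nu> "TYPE('k)" by unfold_locales (rule assms)
 interpret P: comm_group "add_monoid PS.P" by (rule PS.P_group)
 show "smult_closed (kSym m) PS.P" unfolding smult_closed_def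
  using hom_carrier[OF PS.P_smult(1)] P.m_closed by auto
 show "\<exists>h. module_iso (kSym m) PS.P (fun_module m (words m \<nu>) comp_act) h"
  using PS.perm_module_iso_words unfolding module_isomorphic_iff .
qed

lemma fun_module_iso_direct_sum:
 assumes "\<And>\<nu>. \<nu> \<in> set \<nu>s ==> sum_list \<nu> = n"
 shows "\<exists>h. module_iso (kSym n) (wmod n \<nu>s :: ((nat => nat) => 'k::field, _) module)
  (direct_sum (map (perm_module n) \<nu>s)) h"
proof -
 define Ms where "Ms = (map (perm_module n) \<nu>s :: (_, 'k tensors) module list)"
 have Ms: "length Ms = length \<nu>s" "i < length Ms ==> Ms ! i = perm_module n (\<nu>s ! i)" "i < length Ms ==> sum_list (\<nu>s ! i) = n" for i
  using assms by (simp_all add: Ms_def)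
 have "\<exists>h. module_iso (kSym n) (Ms ! i) (fun_module n (words n (\<nu>s ! i)) comp_act) h" if "i < length Ms" for i
  using smult_closed_perm_module(2)[OF Ms(3)[OF that], where 'k = 'k] Ms(2)[OF that] by simp
 then obtain g where "\<And>i. i < length Ms ==> module_iso (kSym n) (Ms ! i) (fun_module n (words n (\<nu>s ! i)) comp_act) (g i)"
  by metis
 note iso = direct_sum_iso_fun_module[OF this, unfolded Ms(1)]
 have "smult_closed (kSym n) (direct_sum Ms)"
  by (rule smult_closed_direct_sum) (simp add: Ms smult_closed_perm_module(1))
 from module_iso_sym[OF this iso] show ?thesis unfolding Ms_def[symmetric] by blast
qed

context layer
begin

theorem layer_res_words:
 "\<exists>\<nu>s. (\<forall>\<nu>\<in>set \<nu>s. is_partition n \<nu>) \<and>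
  (\<exists>h. module_iso kn L (wmod n \<nu>s) h)"
proof -
 obtain g where g: "module_iso kn L (fun_module n Y act) g" using layer_res_iso unfolding module_isomorphic_iff by blast
 have "\<exists>\<nu>s. (\<forall>\<nu>\<in>set \<nu>s. is_partition n \<nu>) \<and> (\<exists>h. module_iso kn (fun_module n Y act)
  (wmod n \<nu>s :: (_, _ => 'k) module) h)"
  by (rule fun_module_orbits) (use finite_D act_Y in \<open>auto simp: diagram_type_def\<close>)
 thus ?thesis using module_iso_trans[OF g] by blast
qed

end

section \<open>Counting semistandard tableaux\<close>

definition desc :: "(nat => nat) => bool" where
 "desc p \<longleftrightarrow> (\<forall>i. p (Suc i) \<le> p i)"

lemma descD: "desc p ==> j \<le> i ==> p i \<le> p j"
 unfolding desc_def by (rule lift_Suc_antimono_le) auto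

text \<open>Partitions as infinite sequences with trailing zeros, which spares comparing lengths
  when boxes are added or removed. A partition of \<open>n\<close> has at most \<open>n\<close>
  nonzero parts.\<close>

definition Par :: "nat => (nat => nat) set" where
 "Par n = {p. desc p \<and> (\<forall>i\<ge>n. p i = 0) \<and> (\<Sum>i<n. p i) = n}"

text \<open>\<open>hstrip b r\<close> says that \<open>r / b\<close> is a horizontal strip.\<close>

definition hstrip :: "(nat => nat) => (nat => nat) => bool" where
 "hstrip b r \<longleftrightarrow> (\<forall>i. b i \<le> r i \<and> r (Suc i) \<le> b i)"

lemma ParD:
 assumes "p \<in> Par n"
 shows "desc p" "i \<ge> n ==> p i = 0" "N \<ge> n ==> (\<Sum>i<N. p i) = n"
proof -
 show "desc p" "i \<ge> n ==> p i = 0" using assms by (auto simp: Par_def)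
 assume "N \<ge> n"
 hence "(\<Sum>i<N. p i) = (\<Sum>i<n. p i)" by (intro sum.mono_neutral_right) (use assms in \<open>auto simp: Par_def\<close>)
 thus "(\<Sum>i<N. p i) = n" using assms by (simp add: Par_def)
qed

text \<open>Any bound \<open>N\<close> on the support is enough: a nonzero entry at a position
  \<open>i \<ge> n\<close> would make the first \<open>i + 1\<close> entries at least 1, with a sum
  exceeding \<open>n\<close>.\<close>

lemma ParI:
 assumes a: "desc p" and N: "\<forall>i\<ge>N. p i = 0" "(\<Sum>i<N. p i) = n"
 shows "p \<in> Par n"
proof -
 have z: "p i = 0" if "i \<ge> n" for i
 proof (rule ccontr)
  assume "p i \<noteq> 0"
  have "i < N" using N(1) \<open>p i \<noteq> 0\<close> by (meson not_less)
  have "p j \<ge> 1" if "j \<le> i" for j using descD[OF a that] \<open>p i \<noteq> 0\<close> by linarith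
  hence "(\<Sum>j<Suc i. 1) \<le> (\<Sum>j<Suc i. p j)" by (intro sum_mono) auto
  also have "\<dots> \<le> (\<Sum>j<N. p j)" using \<open>i < N\<close> by (intro sum_mono2) auto
  finally show False using N(2) that by simp
 qed
 have "(\<Sum>i<n. p i) = (\<Sum>i<max n N. p i)" by (rule sum.mono_neutral_left) (use z in auto)
 also have "\<dots> = (\<Sum>i<N. p i)" by (rule sum.mono_neutral_right) (use N in auto)
 finally show ?thesis using a z N(2) by (simp add: Par_def)
qed

lemma finite_Par [simp]: "finite (Par n)"
proof -
 have "Par n \<subseteq> {p. \<forall>i. (i \<in> {..<n} --> p i \<in> {..n}) \<and> (i \<notin> {..<n} --> p i = 0)}"
 proof (intro subsetI CollectI allI conjI impI)
  fix p i assume p: "p \<in> Par n"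
  show "p i \<in> {..n}" if "i \<in> {..<n}"
   using member_le_sum[of i "{..<n}" p] that ParD(3)[OF p, of n] by simp
  show "p i = 0" if "i \<notin> {..<n}" using that ParD(2)[OF p] by simp
 qed
 thus ?thesis by (rule finite_subset) (rule finite_set_of_finite_funs, simp_all)
qed

lemma Par_0: "Par 0 = {%_. 0}"
proof
 show "Par 0 \<subseteq> {%_. 0}"
 proof
  fix p assume p: "p \<in> Par 0"
  have "p = (%_. 0)" by (rule ext) (rule ParD(2)[OF p], simp)
  thus "p \<in> {%_. 0}" by simp
 qed
 show "{%_. 0} \<subseteq> Par 0" by (simp add: Par_def desc_def)
qed

lemma hstrip_desc:
 assumes "hstrip b r" shows "desc b" "desc r"
proof -
 have "b (Suc i) \<le> b i" "r (Suc i) \<le> r i" for i using assms unfolding hstrip_def by (meson order_trans)+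
 thus "desc b" "desc r" by (simp_all add: desc_def)
qed

lemma hstrip_size_le:
 assumes "hstrip b r" "b \<in> Par p" "r \<in> Par q" shows "p \<le> q"
proof -
 let ?N = "max p q"
 have "(\<Sum>i<?N. b i) \<le> (\<Sum>i<?N. r i)" using assms(1) by (intro sum_mono) (auto simp: hstrip_def)
 thus ?thesis using ParD(3)[OF assms(2), of ?N] ParD(3)[OF assms(3), of ?N] by simp
qed

lemma sum_upd:
 fixes p :: "nat => nat"
 shows "i < N ==> (\<Sum>j<N. (p(i := x)) j) + p i = (\<Sum>j<N. p j) + (x::nat)"
proof -
 assume i: "i < N"
 have "(\<Sum>j<N. (p(i := x)) j) = x + (\<Sum>j\<in>{..<N} - {i}. (p(i := x)) j)" using sum.remove[OF finite_lessThan, of i N "p(i := x)"] i by simp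
 also have "(\<Sum>j\<in>{..<N} - {i}. (p(i := x)) j) = (\<Sum>j\<in>{..<N} - {i}. p j)" by (rule sum.cong) auto
 finally show ?thesis using sum.remove[OF finite_lessThan, of i N p] i by simp
qed

abbreviation up :: "(nat => nat) => nat => nat => nat" where "up p i \<equiv> p(i := Suc (p i))"
abbreviation down :: "(nat => nat) => nat => nat => nat" where "down p i \<equiv> p(i := p i - 1)"

lemma add_box:
 assumes k: "c \<in> Par n" and a: "desc (up c i)"
 shows "(up c i) \<in> Par (Suc n)"
proof (rule ParI[OF a, of "max n (Suc i)"])
 show "\<forall>j\<ge>max n (Suc i). (up c i) j = 0" using ParD(2)[OF k] by auto
 show "(\<Sum>j<max n (Suc i). (up c i) j) = Suc n"
  using sum_upd[of i "max n (Suc i)" c "Suc (c i)"] ParD(3)[OF k, of "max n (Suc i)"] by simp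
qed

lemma remove_box:
 assumes k: "c \<in> Par (Suc n)" and a: "desc (down c i)" and p: "c i > 0"
 shows "(down c i) \<in> Par n"
proof (rule ParI[OF a, of "max (Suc n) (Suc i)"])
 show "\<forall>j\<ge>max (Suc n) (Suc i). (down c i) j = 0" using ParD(2)[OF k] by auto
 show "(\<Sum>j<max (Suc n) (Suc i). (down c i) j) = n"
  using sum_upd[of i "max (Suc n) (Suc i)" c "c i - 1"] ParD(3)[OF k, of "max (Suc n) (Suc i)"] p by simp
qed

lemma hstrip_box:
 assumes h: "hstrip c r" and k: "c \<in> Par n" and l: "r \<in> Par (Suc n)"
 shows "\<exists>i. r = (up c i)"
proof -
 have "c \<noteq> r"
 proof
  assume "c = r"
  hence "n = Suc n" using ParD(3)[OF k, of "Suc n"] ParD(3)[OF l, of "Suc n"] by simp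
  thus False by simp
 qed
 then obtain i where "c i \<noteq> r i" by blast
 hence i: "c i < r i" using h by (auto simp: hstrip_def le_less)
 have "r j = (up c i) j" for j
 proof (rule ccontr)
  assume j: "r j \<noteq> (up c i) j"
  let ?N = "max (Suc n) (max (Suc i) (Suc j))"
  have le: "(up c i) m \<le> r m" for m using h i by (auto simp: hstrip_def)
  hence "(up c i) j < r j" using j le_neq_implies_less by metis
  hence "(\<Sum>m<?N. (up c i) m) < (\<Sum>m<?N. r m)"
   using le by (intro sum_strict_mono_ex1) (auto intro!: bexI[of _ j])
  thus False using sum_upd[of i ?N c "Suc (c i)"] ParD(3)[OF k, of ?N] ParD(3)[OF l, of ?N] by simp
 qed
 thus ?thesis by blast
qed

lemma hstrip_add_iff:
 assumes "desc c"
 shows "hstrip c (up c i) \<longleftrightarrow> desc (up c i)"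
proof
 assume a: "desc (up c i)"
 show "hstrip c (up c i)" unfolding hstrip_def
 proof (intro allI conjI)
  fix j
  show "c j \<le> (up c i) j" by simp
  have "(up c i) (Suc j) \<le> (up c i) j" using a by (simp add: desc_def)
  moreover have "c (Suc j) \<le> c j" using assms by (simp add: desc_def)
  ultimately show "(up c i) (Suc j) \<le> c j" by (auto split: if_splits)
 qed
qed (rule hstrip_desc)

lemma hstrip_remove_iff:
 assumes "desc c" "c i > 0"
 shows "hstrip (down c i) c \<longleftrightarrow> desc (down c i)"
proof
 assume a: "desc (down c i)"
 show "hstrip (down c i) c" unfolding hstrip_def
 proof (intro allI conjI)
  fix j
  show "(down c i) j \<le> c j" by simp
  have "(down c i) (Suc j) \<le> (down c i) j" using a by (simp add: desc_def)
  moreover have "c (Suc j) \<le> c j" using assms by (simp add: desc_def)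
  ultimately show "c (Suc j) \<le> (down c i) j" by (auto split: if_splits)
 qed
qed (rule hstrip_desc)

text \<open>The local form of \<open>D\<^sub>m U = U D\<^sub>m + D\<^sub>m\<^sub>-\<^sub>1\<close> on Young's lattice, where \<open>U\<close> adds a box and
 \<open>D\<^sub>m\<close> removes a horizontal strip of size \<open>m\<close>: if \<open>c / b\<close> is a horizontal strip, the rows in which a box
 may be removed from \<open>b\<close> are, shifted by one, those other than the first in which a box may be added to \<open>c\<close>.\<close>

lemma hstrip_add_to_outer:
 assumes k: "desc c" and n: "desc b"
 shows "desc (up c i) \<and> hstrip b (up c i) \<longleftrightarrow>
  (\<forall>j. j \<noteq> i --> b j \<le> c j) \<and> b i \<le> Suc (c i) \<and> (\<forall>j. Suc j \<noteq> i --> c (Suc j) \<le> b j) \<and> (\<forall>j. Suc j = i --> c i < b j)" (is "?L \<longleftrightarrow> ?R")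
proof -
 have "hstrip b (up c i) \<longleftrightarrow> ?R"
  unfolding hstrip_def by (auto simp: Suc_le_eq all_conj_distrib split: if_splits)
 thus ?thesis using hstrip_desc(2) by blast
qed

text \<open>The conditions agree with those for adding a box in row \<open>i\<close> of
  \<open>c\<close>, except that the strict inequality \<open>c (Suc j) < b j\<close> is required at
  \<open>j = i\<close> instead of \<open>j = i - 1\<close>. This is the shift by one row.\<close>

lemma hstrip_remove_from_inner:
 assumes k: "desc c" and n: "desc b" and p: "b i > 0"
 shows "desc (down b i) \<and> hstrip (down b i) c \<longleftrightarrow>
  (\<forall>j. j \<noteq> i --> b j \<le> c j) \<and> b i \<le> Suc (c i) \<and> (\<forall>j. j \<noteq> i --> c (Suc j) \<le> b j) \<and> c (Suc i) < b i" (is "?L \<longleftrightarrow> ?R")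
proof -
 have "hstrip (down b i) c \<longleftrightarrow> ?R"
 proof -
  have 1: "b i - 1 \<le> c i \<longleftrightarrow> b i \<le> Suc (c i)" "c (Suc i) \<le> b i - 1 \<longleftrightarrow> c (Suc i) < b i" using p by auto
  have "hstrip (down b i) c \<longleftrightarrow> (\<forall>j. j \<noteq> i --> b j \<le> c j \<and> c (Suc j) \<le> b j) \<and> b i - 1 \<le> c i \<and> c (Suc i) \<le> b i - 1"
   unfolding hstrip_def by (auto split: if_splits)
  thus ?thesis unfolding 1 by blast
 qed
 thus ?thesis using hstrip_desc(1) by blast
qed

definition up_rows :: "(nat => nat) => (nat => nat) => nat set" where
 "up_rows c b = {i. desc (up c i) \<and> hstrip b (up c i)}"

definition down_rows :: "(nat => nat) => (nat => nat) => nat set" where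
 "down_rows c b = {i. b i > 0 \<and> desc (down b i) \<and> hstrip (down b i) c}"

lemma card_up_rows:
 assumes k: "desc c" and n: "desc b" and fin: "\<forall>i\<ge>N. b i = 0"
 shows "finite (up_rows c b)" "finite (down_rows c b)"
  "card (up_rows c b) = card (down_rows c b) + (if hstrip b c then 1 else 0)"
proof -
 show fd: "finite (down_rows c b)"
 proof (rule finite_subset)
  show "down_rows c b \<subseteq> {..<N}"
  proof
   fix i assume "i \<in> down_rows c b"
   hence "b i \<noteq> 0" by (simp add: down_rows_def)
   thus "i \<in> {..<N}" using fin by (meson lessThan_iff not_less)
  qed
 qed simp
 have up: "i \<in> up_rows c b \<longleftrightarrow> (\<forall>j. j \<noteq> i --> b j \<le> c j) \<and> b i \<le> Suc (c i) \<and> (\<forall>j. Suc j \<noteq> i --> c (Suc j) \<le> b j) \<and> (\<forall>j. Suc j = i --> c i < b j)" for i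
  unfolding up_rows_def using hstrip_add_to_outer[OF k n] by blast
 have down: "i \<in> down_rows c b \<longleftrightarrow> b i > 0 \<and> (\<forall>j. j \<noteq> i --> b j \<le> c j) \<and> b i \<le> Suc (c i) \<and> (\<forall>j. j \<noteq> i --> c (Suc j) \<le> b j) \<and> c (Suc i) < b i" for i
  unfolding down_rows_def using hstrip_remove_from_inner[OF k n] by blast
 have "finite (up_rows c b) \<and> card (up_rows c b) = card (down_rows c b) + (if hstrip b c then 1 else 0)"
 proof (cases "hstrip b c")
  case True
  hence s: "b j \<le> c j" "c (Suc j) \<le> b j" for j by (auto simp: hstrip_def)
  \<comment> \<open>Row 0 can always take a new box; it accounts for the extra summand.\<close>
  have "up_rows c b = insert 0 (Suc ` {i. c (Suc i) < b i})"
  proof (intro Set.set_eqI)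
   fix i show "i \<in> up_rows c b \<longleftrightarrow> i \<in> insert 0 (Suc ` {i. c (Suc i) < b i})"
    unfolding up using s by (cases i) (auto simp: le_SucI)
  qed
  moreover have "down_rows c b = {i. c (Suc i) < b i}"
   using s down by (auto simp: le_SucI)
  ultimately have e: "up_rows c b = insert 0 (Suc ` down_rows c b)" by simp
  have "card (insert 0 (Suc ` down_rows c b)) = Suc (card (Suc ` down_rows c b))"
   using fd by (intro card_insert_disjoint) auto
  thus ?thesis using True fd unfolding e by (simp add: card_image)
 next
  case False
  \<comment> \<open>Without the strip condition the defect can only sit in the row of the box, where
    \<open>b i = Suc (c i)\<close>. There it can be repaired from either side, so both sets have the
    same rows.\<close>
  have "up_rows c b = down_rows c b"
  proof (intro Set.set_eqI iffI)
   fix i assume i: "i \<in> up_rows c b"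
   have below: "c (Suc j) \<le> b j" for j using i unfolding up by (cases "Suc j = i") (auto simp: less_imp_le)
   have ni: "b i = Suc (c i)"
   proof (rule ccontr)
    assume "b i \<noteq> Suc (c i)"
    hence "b j \<le> c j" for j using i unfolding up by (cases "j = i") auto
    thus False using False below by (simp add: hstrip_def)
   qed
   have "c (Suc i) \<le> c i" using k by (simp add: desc_def)
   thus "i \<in> down_rows c b" unfolding down using i ni below unfolding up by auto
  next
   fix i assume i: "i \<in> down_rows c b"
   have below: "c (Suc j) \<le> b j" for j using i unfolding down by (cases "j = i") (auto simp: less_imp_le)
   have ni: "b i = Suc (c i)"
   proof (rule ccontr)
    assume "b i \<noteq> Suc (c i)"
    hence "b j \<le> c j" for j using i unfolding down by (cases "j = i") auto
    thus False using False below by (simp add: hstrip_def)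
   qed
   have "b i \<le> b j" if "Suc j = i" for j using n that by (auto simp: desc_def)
   thus "i \<in> up_rows c b" unfolding up using i ni below unfolding down by fastforce
  qed
  thus ?thesis using False fd by simp
 qed
 thus "finite (up_rows c b)" "card (up_rows c b) = card (down_rows c b) + (if hstrip b c then 1 else 0)" by auto
qed

text \<open>A shape that differs from a given one by one box is determined by the row of this box,
  so the shapes on both sides are counted by \<open>up_rows\<close> and \<open>down_rows\<close>.
  The clause with \<open>q\<close> makes the second set empty for \<open>p = 0\<close>, where no box
  can be removed.\<close>

lemma local_commutation:
 assumes k: "c \<in> Par n" and v: "b \<in> Par p"
 shows "card {r\<in>Par (Suc n). hstrip c r \<and> hstrip b r} =
  card {d. (\<exists>q. p = Suc q \<and> d \<in> Par q) \<and> hstrip d c \<and> hstrip d b} + (if hstrip b c then 1 else 0)" (is "card ?U = card ?D + _")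
proof -
 have ka: "desc c" and va: "desc b" using ParD k v by blast+
 have "bij_betw (%i. up c i) (up_rows c b) ?U"
 proof (rule bij_betw_imageI)
  show "inj_on (%i. up c i) (up_rows c b)"
  proof (rule inj_onI)
   fix i j assume e: "(up c i) = (up c j)"
   show "i = j"
   proof (rule ccontr)
    assume "i \<noteq> j"
    thus False using fun_cong[OF e, of i] by simp
   qed
  qed
  show "(%i. up c i) ` up_rows c b = ?U"
  proof (intro equalityI subsetI)
   fix r assume "r \<in> (%i. up c i) ` up_rows c b"
   thus "r \<in> ?U"
    using add_box[OF k] hstrip_add_iff[OF ka] by (auto simp: up_rows_def)
  next
   fix r assume l: "r \<in> ?U"
   then obtain i where i: "r = (up c i)" using hstrip_box[OF _ k] by blast
   hence "i \<in> up_rows c b" using l ParD(1)[of r "Suc n"] by (simp add: up_rows_def)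
   thus "r \<in> (%i. up c i) ` up_rows c b" using i by blast
  qed
 qed
 hence 1: "card ?U = card (up_rows c b)" by (rule bij_betw_same_card[symmetric])
 have "bij_betw (%i. down b i) (down_rows c b) ?D"
 proof (rule bij_betw_imageI)
  show "inj_on (%i. down b i) (down_rows c b)"
  proof (rule inj_onI)
   fix i j assume ij: "i \<in> down_rows c b" "j \<in> down_rows c b" "(down b i) = (down b j)"
   show "i = j"
   proof (rule ccontr)
    assume "i \<noteq> j"
    hence "b i - 1 = b i" using fun_cong[OF ij(3), of i] by simp
    moreover have "b i > 0" using ij(1) by (simp add: down_rows_def)
    ultimately show False by linarith
   qed
  qed
  show "(%i. down b i) ` down_rows c b = ?D"
  proof (intro equalityI subsetI)
   fix d assume "d \<in> (%i. down b i) ` down_rows c b"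
   then obtain i where i: "d = (down b i)" "i \<in> down_rows c b" by blast
   hence pos: "b i > 0" and a: "desc (down b i)" and h: "hstrip (down b i) c" by (auto simp: down_rows_def)
   have "p \<noteq> 0"
   proof
    assume "p = 0" hence "b = (%_. 0)" using v Par_0 by simp
    thus False using pos by simp
   qed
   then obtain q where q: "p = Suc q" by (cases p) auto
   show "d \<in> ?D"
    using q remove_box[of b q i] v a pos h hstrip_remove_iff[OF va pos] i by auto
  next
   fix d assume s: "d \<in> ?D"
   then obtain q where q: "p = Suc q" "d \<in> Par q" by blast
   then obtain i where i: "b = (up d i)" using hstrip_box[of d b q] s v by blast
   hence e: "(down b i) = d" and pos: "b i > 0" by auto
   have "i \<in> down_rows c b" unfolding down_rows_def mem_Collect_eq e using s pos ParD(1)[OF q(2)] by blast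
   thus "d \<in> (%i. down b i) ` down_rows c b" using e by blast
  qed
 qed
 hence 2: "card ?D = card (down_rows c b)" by (rule bij_betw_same_card[symmetric])
 show ?thesis unfolding 1 2 using card_up_rows(3)[OF ka va] ParD(2)[OF v] by blast
qed

text \<open>The number of semistandard chains; the multiplicities of the letters are listed from the last letter to the first.\<close>

fun kostka :: "nat list => (nat => nat) => nat" where
 "kostka [] r = (if r = (%_. 0) then 1 else 0)"
| "kostka (m # ms) r = (\<Sum>b\<in>{b\<in>Par (sum_list ms). hstrip b r}. kostka ms b)"

abbreviation nonz :: "nat list => nat set" where "nonz ms \<equiv> {i. i < length ms \<and> ms ! i > 0}"
abbreviation dec :: "nat list => nat => nat list" where "dec ms i \<equiv> ms[i := ms ! i - 1]"

lemma sum_list_decrease: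
 assumes "i < length (ms :: nat list)" "ms ! i > 0" "sum_list ms = Suc n"
 shows "sum_list (dec ms i) = n"
 using assms by (simp add: sum_list_update)

text \<open>The box added to \<open>c\<close> is moved past the strips of the chain one after the
  other. At the outermost strip the commutation rule either lets it pass, which leads by induction
  to the summands of positive index, or takes a box from the strip, which lowers the multiplicity of
  its letter and gives the summand of index 0.\<close>

lemma kostka_add_box:
 assumes "c \<in> Par n" "sum_list ms = Suc n"
 shows "(\<Sum>r\<in>{r\<in>Par (Suc n). hstrip c r}. kostka ms r) = (\<Sum>i\<in>nonz ms. kostka (dec ms i) c)"
 using assms
proof (induction ms arbitrary: c n)
 case Nil thus ?case by simp
next
 case (Cons m ms)
 let ?p = "sum_list ms" and ?R = "{r\<in>Par (Suc n). hstrip c r}"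
 let ?Q = "{d. (\<exists>q. ?p = Suc q \<and> d \<in> Par q) \<and> hstrip d c}"
 have finQ: "finite ?Q"
 proof (rule finite_subset)
  show "?Q \<subseteq> Par (?p - 1)" by auto
 qed simp
 have "(\<Sum>r\<in>?R. kostka (m # ms) r) =
  (\<Sum>r\<in>?R. \<Sum>b\<in>Par ?p. if hstrip b r then kostka ms b else 0)"
  by (intro sum.cong refl) (simp add: sum.inter_filter[symmetric])
 also have "\<dots> = (\<Sum>b\<in>Par ?p. \<Sum>r\<in>?R. if hstrip b r then kostka ms b else 0)"
  by (rule sum.swap)
 also have "\<dots> = (\<Sum>b\<in>Par ?p. card {r\<in>Par (Suc n). hstrip c r \<and> hstrip b r} * kostka ms b)"
 proof (rule sum.cong[OF refl])
  fix b
  have "(\<Sum>r\<in>?R. if hstrip b r then kostka ms b else 0) =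
   (\<Sum>r\<in>{r\<in>?R. hstrip b r}. kostka ms b)"
   by (rule sum.inter_filter[symmetric]) simp
  also have "\<dots> = card {r\<in>?R. hstrip b r} * kostka ms b" by simp
  also have "{r\<in>?R. hstrip b r} = {r\<in>Par (Suc n). hstrip c r \<and> hstrip b r}" by blast
  finally show "(\<Sum>r\<in>?R. if hstrip b r then kostka ms b else 0) =
   card {r\<in>Par (Suc n). hstrip c r \<and> hstrip b r} * kostka ms b" .
 qed
 also have "\<dots> = (\<Sum>b\<in>Par ?p. card {d\<in>?Q. hstrip d b} * kostka ms b) + (\<Sum>b\<in>Par ?p. if hstrip b c then kostka ms b else 0)"
  unfolding sum.distrib[symmetric]
 proof (rule sum.cong[OF refl])
  fix b assume "b \<in> Par ?p"
  from local_commutation[OF Cons.prems(1) this]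
  have "card {r\<in>Par (Suc n). hstrip c r \<and> hstrip b r} = card {d\<in>?Q. hstrip d b} + (if hstrip b c then 1 else 0)"
   by (simp add: conj_assoc)
  thus "card {r\<in>Par (Suc n). hstrip c r \<and> hstrip b r} * kostka ms b =
   card {d\<in>?Q. hstrip d b} * kostka ms b + (if hstrip b c then kostka ms b else 0)"
   by (simp add: algebra_simps)
 qed
 also have "(\<Sum>b\<in>Par ?p. if hstrip b c then kostka ms b else 0) = (if m > 0 then kostka (dec (m # ms) 0) c else 0)"
 proof (cases "m > 0")
  case True thus ?thesis by (simp add: sum.inter_filter[symmetric])
 next
  case False
  \<comment> \<open>For \<open>m = 0\<close> the shape \<open>b\<close> would have one box more than
    \<open>c\<close>. So the term vanishes, in accordance with \<open>nonz\<close>, which then omits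
    the index 0.\<close>
  hence "\<not> hstrip b c" if "b \<in> Par ?p" for b using hstrip_size_le[OF _ that Cons.prems(1)] Cons.prems(2) by auto
  thus ?thesis using False by (simp cong: sum.cong)
 qed
 also have "(\<Sum>b\<in>Par ?p. card {d\<in>?Q. hstrip d b} * kostka ms b) = (\<Sum>i\<in>nonz ms. kostka (m # dec ms i) c)"
 proof -
  have "(\<Sum>b\<in>Par ?p. card {d\<in>?Q. hstrip d b} * kostka ms b) = (\<Sum>b\<in>Par ?p. \<Sum>d\<in>?Q. if hstrip d b then kostka ms b else 0)"
   by (rule sum.cong[OF refl]) (simp add: sum.inter_filter[OF finQ, symmetric])
  also have "\<dots> = (\<Sum>d\<in>?Q. \<Sum>b\<in>Par ?p. if hstrip d b then kostka ms b else 0)" by (rule sum.swap)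
  also have "\<dots> = (\<Sum>d\<in>?Q. \<Sum>i\<in>nonz ms. kostka (dec ms i) d)"
  proof (rule sum.cong[OF refl])
   fix d assume "d \<in> ?Q"
   then obtain q where q: "?p = Suc q" "d \<in> Par q" by blast
   have "(\<Sum>b\<in>Par ?p. if hstrip d b then kostka ms b else 0) = (\<Sum>b\<in>{b\<in>Par (Suc q). hstrip d b}. kostka ms b)"
    unfolding q(1) by (rule sum.inter_filter[symmetric]) simp
   also have "\<dots> = (\<Sum>i\<in>nonz ms. kostka (dec ms i) d)" by (rule Cons.IH[OF q(2,1)])
   finally show "(\<Sum>b\<in>Par ?p. if hstrip d b then kostka ms b else 0) = (\<Sum>i\<in>nonz ms. kostka (dec ms i) d)" .
  qed
  also have "\<dots> = (\<Sum>i\<in>nonz ms. \<Sum>d\<in>?Q. kostka (dec ms i) d)" by (rule sum.swap)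
  also have "\<dots> = (\<Sum>i\<in>nonz ms. kostka (m # dec ms i) c)"
  proof (rule sum.cong[OF refl])
   fix i assume "i \<in> nonz ms"
   hence i: "i < length ms" "ms ! i > 0" by auto
   have "?p \<noteq> 0" using i member_le_sum_list[OF nth_mem[OF i(1)]] by linarith
   then obtain q where q: "?p = Suc q" by (cases ?p) auto
   have "?Q = {d\<in>Par (sum_list (dec ms i)). hstrip d c}" unfolding sum_list_decrease[OF i q] using q by auto
   thus "(\<Sum>d\<in>?Q. kostka (dec ms i) d) = kostka (m # dec ms i) c" by simp
  qed
  finally show ?thesis .
 qed
 also have "(\<Sum>i\<in>nonz ms. kostka (m # dec ms i) c) + (if m > 0 then kostka (dec (m # ms) 0) c else 0) =
  (\<Sum>i\<in>nonz (m # ms). kostka (dec (m # ms) i) c)"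
 proof -
  have set: "nonz (m # ms) = (if m > 0 then {0} else {}) \<union> Suc ` nonz ms"
  proof (intro Set.set_eqI)
   fix i show "i \<in> nonz (m # ms) \<longleftrightarrow> i \<in> (if m > 0 then {0} else {}) \<union> Suc ` nonz ms"
    by (cases i) auto
  qed
  show ?thesis unfolding set by (subst sum.union_disjoint) (auto simp: sum.reindex)
 qed
 finally show ?case .
qed

text \<open>With every multiplicity equal to 1 the chains are the standard tableaux of the
  shape.\<close>

definition std_count :: "nat => (nat => nat) => nat" where
 "std_count n = kostka (replicate n 1)"

text \<open>Removing the outermost box of the standard chain leaves, for every smaller shape
  \<open>c\<close>, a sum over the shapes that cover \<open>c\<close>, to which
  \<open>kostka_add_box\<close> applies.\<close>

lemma sum_kostka_std_step:
 assumes "sum_list ms = Suc n"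
 shows "(\<Sum>r\<in>Par (Suc n). kostka ms r * std_count (Suc n) r) =
  (\<Sum>i\<in>nonz ms. \<Sum>c\<in>Par n. kostka (dec ms i) c * std_count n c)"
proof -
 have "(\<Sum>r\<in>Par (Suc n). kostka ms r * std_count (Suc n) r) =
  (\<Sum>r\<in>Par (Suc n). \<Sum>c\<in>Par n. if hstrip c r then kostka ms r * std_count n c else 0)"
 proof (rule sum.cong[OF refl])
  fix r
  have "std_count (Suc n) r = (\<Sum>c\<in>{c\<in>Par n. hstrip c r}. std_count n c)" by (simp add: std_count_def sum_list_replicate)
  also have "\<dots> = (\<Sum>c\<in>Par n. if hstrip c r then std_count n c else 0)" by (rule sum.inter_filter) simp
  finally show "kostka ms r * std_count (Suc n) r = (\<Sum>c\<in>Par n. if hstrip c r then kostka ms r * std_count n c else 0)"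
   by (simp add: sum_distrib_left if_distrib cong: if_cong)
 qed
 also have "\<dots> = (\<Sum>c\<in>Par n. \<Sum>r\<in>Par (Suc n). if hstrip c r then kostka ms r * std_count n c else 0)" by (rule sum.swap)
 also have "\<dots> = (\<Sum>c\<in>Par n. \<Sum>i\<in>nonz ms. kostka (dec ms i) c * std_count n c)"
 proof (rule sum.cong[OF refl])
  fix c assume k: "c \<in> Par n"
  have "(\<Sum>r\<in>Par (Suc n). if hstrip c r then kostka ms r * std_count n c else 0) = (\<Sum>r\<in>{r\<in>Par (Suc n). hstrip c r}. kostka ms r * std_count n c)"
   by (rule sum.inter_filter[symmetric]) simp
  also have "\<dots> = (\<Sum>r\<in>{r\<in>Par (Suc n). hstrip c r}. kostka ms r) * std_count n c" by (rule sum_distrib_right[symmetric])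
  also have "\<dots> = (\<Sum>i\<in>nonz ms. kostka (dec ms i) c * std_count n c)"
   unfolding kostka_add_box[OF k assms] by (rule sum_distrib_right)
  finally show "(\<Sum>r\<in>Par (Suc n). if hstrip c r then kostka ms r * std_count n c else 0) = (\<Sum>i\<in>nonz ms. kostka (dec ms i) c * std_count n c)" .
 qed
 also have "\<dots> = (\<Sum>i\<in>nonz ms. \<Sum>c\<in>Par n. kostka (dec ms i) c * std_count n c)" by (rule sum.swap)
 finally show ?thesis .
qed

lemma card_words_step:
 "card (words (Suc n) ms) = (\<Sum>i\<in>nonz ms. card (words n (dec ms i)))"
proof -
 let ?I = "nonz ms"
 have fibre: "card {w\<in>words (Suc n) ms. w (Suc n) = i} = card (words n (dec ms i))" if i: "i \<in> ?I" for i
 proof -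
  have set: "{1..Suc n} = insert (Suc n) {1..n}" by auto
  have cnt: "{j\<in>{1..Suc n}. (w(Suc n := i)) j = k} = (if k = i then insert (Suc n) {j\<in>{1..n}. w j = k} else {j\<in>{1..n}. w j = k})" for w :: "nat => nat" and k
   unfolding set by auto
  have card: "card {j\<in>{1..Suc n}. (w(Suc n := i)) j = k} = (if k = i then Suc (card {j\<in>{1..n}. w j = k}) else card {j\<in>{1..n}. w j = k})" for w :: "nat => nat" and k
   unfolding cnt by simp
  have word_iff: "w(Suc n := i) \<in> words (Suc n) ms \<longleftrightarrow> restrict w {1..n} \<in> words n (dec ms i)" if w: "\<forall>j. j \<notin> {1..Suc n} --> w j = undefined" for w
  proof -
   have "w(Suc n := i) \<in> {1..Suc n} \<rightarrow>\<^sub>E {..<length ms} \<longleftrightarrow> restrict w {1..n} \<in> {1..n} \<rightarrow>\<^sub>E {..<length ms}"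
    using i w unfolding set PiE_def Pi_def extensional_def by auto
   moreover have "(\<forall>k<length ms. card {j\<in>{1..Suc n}. (w(Suc n := i)) j = k} = ms ! k) \<longleftrightarrow>
    (\<forall>k<length ms. card {j\<in>{1..n}. restrict w {1..n} j = k} = dec ms i ! k)"
   proof (rule all_cong)
    fix k assume k: "k < length ms"
    have "{j\<in>{1..n}. restrict w {1..n} j = k} = {j\<in>{1..n}. w j = k}" by auto
    thus "card {j\<in>{1..Suc n}. (w(Suc n := i)) j = k} = ms ! k \<longleftrightarrow> card {j\<in>{1..n}. restrict w {1..n} j = k} = dec ms i ! k"
     unfolding card using i k by (auto simp: nth_list_update)
   qed
   ultimately show ?thesis by (simp add: words_def)
  qed
  have "bij_betw (%w. restrict w {1..n}) {w\<in>words (Suc n) ms. w (Suc n) = i} (words n (dec ms i))"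
  proof (rule bij_betw_byWitness[where f' = "%w. w(Suc n := i)"])
   show "\<forall>w\<in>{w\<in>words (Suc n) ms. w (Suc n) = i}. (restrict w {1..n})(Suc n := i) = w"
    by (auto simp: words_def PiE_def extensional_def fun_eq_iff)
   show "\<forall>w\<in>words n (dec ms i). restrict (w(Suc n := i)) {1..n} = w"
    by (auto simp: words_def PiE_def extensional_def fun_eq_iff)
   show "(%w. restrict w {1..n}) ` {w\<in>words (Suc n) ms. w (Suc n) = i} \<subseteq> words n (dec ms i)"
   proof (rule image_subsetI)
    fix w assume w: "w \<in> {w\<in>words (Suc n) ms. w (Suc n) = i}"
    hence "w(Suc n := i) \<in> words (Suc n) ms" by auto
    moreover have "\<forall>j. j \<notin> {1..Suc n} --> w j = undefined" using w unfolding words_def PiE_def extensional_def by blast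
    ultimately show "restrict w {1..n} \<in> words n (dec ms i)" using word_iff by blast
   qed
   show "(%w. w(Suc n := i)) ` words n (dec ms i) \<subseteq> {w\<in>words (Suc n) ms. w (Suc n) = i}"
   proof (rule image_subsetI)
    fix w assume w: "w \<in> words n (dec ms i)"
    hence e: "\<forall>j. j \<notin> {1..n} --> w j = undefined" unfolding words_def PiE_def extensional_def by blast
    hence "restrict w {1..n} = w" by (auto simp: fun_eq_iff)
    moreover have "\<forall>j. j \<notin> {1..Suc n} --> w j = undefined" using e by (meson atLeastAtMost_iff le_SucI)
    ultimately have "w(Suc n := i) \<in> words (Suc n) ms" using word_iff[of w] w by presburger
    thus "w(Suc n := i) \<in> {w\<in>words (Suc n) ms. w (Suc n) = i}" by simp
   qed
  qed
  thus ?thesis by (rule bij_betw_same_card)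
 qed
 have "words (Suc n) ms = (\<Union>i\<in>?I. {w\<in>words (Suc n) ms. w (Suc n) = i})"
 proof -
  have "w (Suc n) \<in> ?I" if w: "w \<in> words (Suc n) ms" for w
  proof -
   have l: "w (Suc n) < length ms" using w by (auto simp: words_def)
   hence "card {j\<in>{1..Suc n}. w j = w (Suc n)} = ms ! w (Suc n)" using w by (simp add: words_def)
   moreover have "card {j\<in>{1..Suc n}. w j = w (Suc n)} \<noteq> 0" by (auto simp: card_eq_0_iff)
   ultimately show ?thesis using l by auto
  qed
  thus ?thesis by blast
 qed
 hence "card (words (Suc n) ms) = card (\<Union>i\<in>?I. {w\<in>words (Suc n) ms. w (Suc n) = i})" by simp
 also have "\<dots> = (\<Sum>i\<in>?I. card {w\<in>words (Suc n) ms. w (Suc n) = i})"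
  by (rule card_UN_disjoint) auto
 also have "\<dots> = (\<Sum>i\<in>?I. card (words n (dec ms i)))" using fibre by (intro sum.cong refl)
 finally show ?thesis .
qed

text \<open>Both sides satisfy the same recursion: for words by deleting the last letter, for pairs
  of chains by removing a box and lowering a multiplicity. This is the count behind the
  Robinson-Schensted-Knuth correspondence, obtained without a bijection.\<close>

theorem sum_kostka_std:
 "sum_list ms = n ==> (\<Sum>r\<in>Par n. kostka ms r * std_count n r) = card (words n ms)"
proof (induction n arbitrary: ms)
 case 0
 have "kostka ms (%_. 0) = 1" if "sum_list ms = 0" for ms
  using that
 proof (induction ms)
  case (Cons m ms)
  have "{b \<in> Par 0. hstrip b (%_. 0)} = {%_. 0}" unfolding Par_0 by (auto simp: hstrip_def)
  moreover have z: "sum_list ms = 0" using Cons.prems by simp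
  ultimately show ?case using Cons.IH[OF z] unfolding kostka.simps z by simp
 qed simp
 hence "(\<Sum>r\<in>Par 0. kostka ms r * std_count 0 r) = 1" using 0 by (simp add: Par_0 std_count_def)
 moreover have "words 0 ms = {%_. undefined}" using 0 by (auto simp: words_def)
 ultimately show ?case by simp
next
 case (Suc n)
 show ?case unfolding sum_kostka_std_step[OF Suc.prems] card_words_step
 proof (rule sum.cong[OF refl])
  fix i assume "i \<in> nonz ms"
  thus "(\<Sum>c\<in>Par n. kostka (dec ms i) c * std_count n c) = card (words n (dec ms i))"
   using sum_list_decrease[of i ms n] Suc.prems by (intro Suc.IH) auto
 qed
qed

section \<open>Tableaux and tabloids\<close>

text \<open>The shape \<open>S k\<close> consists of the cells with letters \<open>\<ge> k\<close>.
  The outermost strip carries the letter 0, so entries decrease weakly along the rows and strictly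
  down the columns, the reverse of the usual convention.\<close>

fun sst :: "nat list => (nat => nat) => (nat => nat => nat) set" where
 "sst [] \<rho> = (if \<rho> = (%_. 0) then {%_ _. 0} else {})"
| "sst (m # ms) \<rho> = (\<Union>\<nu>\<in>{\<nu>\<in>Par (sum_list ms). hstrip \<nu> \<rho>}. case_nat \<rho> ` sst ms \<nu>)"

lemma sst_0: "S \<in> sst ms \<rho> ==> S 0 = \<rho>"
 by (cases ms) (auto split: if_splits)

lemma card_sst: "finite (sst ms \<rho>) \<and> card (sst ms \<rho>) = kostka ms \<rho>"
proof (induction ms arbitrary: \<rho>)
 case (Cons m ms)
 have inj: "inj_on (case_nat \<rho>) A" for A :: "(nat => nat => nat) set"
 proof (rule inj_onI)
  fix S S' assume e: "case_nat \<rho> S = case_nat \<rho> S'"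
  show "S = S'"
  proof
   fix k show "S k = S' k" using fun_cong[OF e, of "Suc k"] by simp
  qed
 qed
 have "card (sst (m # ms) \<rho>) = (\<Sum>\<nu>\<in>{\<nu>\<in>Par (sum_list ms). hstrip \<nu> \<rho>}. card (case_nat \<rho> ` sst ms \<nu>))"
  unfolding sst.simps
 proof (rule card_UN_disjoint)
  show "\<forall>\<nu>\<in>{\<nu>\<in>Par (sum_list ms). hstrip \<nu> \<rho>}. \<forall>\<nu>'\<in>{\<nu>\<in>Par (sum_list ms). hstrip \<nu> \<rho>}. \<nu> \<noteq> \<nu>' -->
   case_nat \<rho> ` sst ms \<nu> \<inter> case_nat \<rho> ` sst ms \<nu>' = {}"
  proof (intro ballI impI, rule ccontr)
   fix \<nu> \<nu>' assume "\<nu> \<noteq> \<nu>'" "case_nat \<rho> ` sst ms \<nu> \<inter> case_nat \<rho> ` sst ms \<nu>' \<noteq> {}"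
   then obtain S S' where "S \<in> sst ms \<nu>" "S' \<in> sst ms \<nu>'" "case_nat \<rho> S = case_nat \<rho> S'" by blast
   thus False using inj[of UNIV] sst_0 \<open>\<nu> \<noteq> \<nu>'\<close> by (metis UNIV_I inj_on_def)
  qed
 qed (use Cons.IH in auto)
 also have "\<dots> = kostka (m # ms) \<rho>" using Cons.IH by (simp add: card_image[OF inj])
 finally show ?case using Cons.IH by simp
qed simp

lemma sst_D:
 "S \<in> sst ms \<rho> ==> \<rho> \<in> Par (sum_list ms) ==> S k \<in> Par (sum_list (drop k ms)) \<and> hstrip (S (Suc k)) (S k)"
proof (induction ms arbitrary: \<rho> S k)
 case Nil thus ?case by (auto simp: Par_0 hstrip_def split: if_splits)
next
 case (Cons m ms)
 then obtain \<nu> S' where "\<nu> \<in> Par (sum_list ms)" "hstrip \<nu> \<rho>" "S' \<in> sst ms \<nu>" "S = case_nat \<rho> S'" by auto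
 thus ?case using Cons.IH[of S' \<nu>] Cons.prems(2) sst_0[of S' ms \<nu>] by (cases k) auto
qed

text \<open>Shapes are functions while counting but lists without zeros in tableaux; this passes
  from the former to the latter.\<close>

definition plist :: "(nat => nat) => nat list" where
 "plist \<rho> = map \<rho> [0..<(LEAST i. \<rho> i = 0)]"

lemma plist:
 assumes "\<rho> \<in> Par n"
 shows "i < length (plist \<rho>) \<longleftrightarrow> \<rho> i > 0" "i < length (plist \<rho>) ==> plist \<rho> ! i = \<rho> i" "is_partition n (plist \<rho>)"
proof -
 have z: "\<rho> n = 0" using ParD(2)[OF assms] by simp
 obtain l where l: "plist \<rho> = map \<rho> [0..<l]" "\<rho> l = 0" "l \<le> n" "\<And>i. i < l ==> \<rho> i \<noteq> 0"
  by (rule that[of "LEAST i. \<rho> i = 0", OF plist_def LeastI[of "%i. \<rho> i = 0", OF z] Least_le[of "%i. \<rho> i = 0", OF z]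
     not_less_Least[of _ "%i. \<rho> i = 0"]])
 have zero: "\<rho> i = 0" if "l \<le> i" for i using descD[OF ParD(1)[OF assms] that] l(2) by simp
 have iff: "i < l \<longleftrightarrow> \<rho> i > 0" for i using l(4)[of i] zero[of i] by (cases "i < l") (simp_all add: not_less)
 show "i < length (plist \<rho>) \<longleftrightarrow> \<rho> i > 0" "i < length (plist \<rho>) ==> plist \<rho> ! i = \<rho> i"
  using iff[of i] by (simp_all add: l(1))
 have "sum_list (plist \<rho>) = (\<Sum>i<l. \<rho> i)" by (simp add: l(1) interv_sum_list_conv_sum_set_nat atLeast0LessThan)
 also have "\<dots> = (\<Sum>i<n. \<rho> i)" using l(3) zero by (intro sum.mono_neutral_left) auto
 finally have "sum_list (plist \<rho>) = n" using ParD(3)[OF assms] by simp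
 moreover have "sorted_wrt (\<ge>) (plist \<rho>)"
  unfolding sorted_wrt_iff_nth_less by (auto simp: l(1) intro: descD[OF ParD(1)[OF assms]])
 ultimately show "is_partition n (plist \<rho>)" unfolding is_partition_def l(1) by (auto dest: l(4))
qed

definition trow :: "nat set list => nat => nat" where
 "trow T a = (THE i. i < length T \<and> a \<in> T ! i)"

definition tcol :: "nat list list => nat => nat" where
 "tcol t a = (THE j. \<exists>i<length t. j < length (t ! i) \<and> t ! i ! j = a)"

lemma distinct_concat_nth:
 "distinct (concat t) ==> i < length t ==> j < length (t ! i) ==> i' < length t ==> j' < length (t ! i') ==>
  t ! i ! j = t ! i' ! j' ==> i = i' \<and> j = j'"
proof (induction t arbitrary: i i')
 case (Cons x t)
 have out: "t ! m ! q \<in> set (concat t)" if "m < length t" "q < length (t ! m)" for m q using that by (auto intro!: bexI[of _ "t ! m"])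
 show ?case
 proof (cases i)
  case 0
  hence "i' = 0" using Cons.prems out[of "i' - 1" j'] nth_mem[of j x] by (cases i') auto
  thus ?thesis using 0 Cons.prems nth_eq_iff_index_eq[of x j j'] by simp
 next
  case (Suc k)
  have "i' \<noteq> 0"
  proof
   assume "i' = 0"
   hence "x ! j' \<in> set x" "x ! j' \<in> set (concat t)" using Suc Cons.prems out[of k j] by auto
   thus False using Cons.prems(1) unfolding concat.simps distinct_append by blast
  qed
  then obtain k' where "i' = Suc k'" by (cases i') auto
  thus ?thesis using Suc Cons.prems Cons.IH[of k k'] by simp
 qed
qed simp

context
 fixes t n \<mu> assumes t: "t \<in> tableaux n \<mu>"
begin

lemma tableau_lengths: "length t = length \<mu>" "i < length \<mu> ==> length (t ! i) = \<mu> ! i"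
 using t by (auto simp: tableaux_def)

lemma tableau_nth:
 assumes "i < length \<mu>" "j < \<mu> ! i"
 shows "t ! i ! j \<in> {1..n}" "trow (tabloid t) (t ! i ! j) = i" "tcol t (t ! i ! j) = j"
proof -
 have d: "distinct (concat t)" using t by (simp add: tableaux_def)
 have "t ! i ! j \<in> set (concat t)" using assms tableau_lengths by (auto intro!: bexI[of _ "t ! i"])
 thus "t ! i ! j \<in> {1..n}" using t unfolding tableaux_def by blast
 show "trow (tabloid t) (t ! i ! j) = i" unfolding trow_def tabloid_def length_map
 proof (rule the_equality)
  show "i < length t \<and> t ! i ! j \<in> map set t ! i" using assms tableau_lengths by simp
  fix i' assume "i' < length t \<and> t ! i ! j \<in> map set t ! i'"
  then obtain j' where "i' < length t" "j' < length (t ! i')" "t ! i' ! j' = t ! i ! j" by (auto simp: in_set_conv_nth)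
  thus "i' = i" using distinct_concat_nth[OF d, of i' j' i j] assms tableau_lengths by simp
 qed
 show "tcol t (t ! i ! j) = j" unfolding tcol_def
 proof (rule the_equality)
  show "\<exists>i'<length t. j < length (t ! i') \<and> t ! i' ! j = t ! i ! j" using assms tableau_lengths by auto
  fix j' assume "\<exists>i'<length t. j' < length (t ! i') \<and> t ! i' ! j' = t ! i ! j"
  thus "j' = j" using distinct_concat_nth[OF d, of _ j' i j] assms tableau_lengths by auto
 qed
qed

lemma tableau_cell:
 assumes "a \<in> {1..n}"
 shows "trow (tabloid t) a < length \<mu>" "tcol t a < \<mu> ! trow (tabloid t) a" "t ! trow (tabloid t) a ! tcol t a = a"
proof -
 have "a \<in> set (concat t)" using assms t by (simp add: tableaux_def)
 then obtain x where "x \<in> set t" "a \<in> set x" by auto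
 then obtain i j where ij: "i < length t" "j < length (t ! i)" "a = t ! i ! j" by (metis in_set_conv_nth)
 thus "trow (tabloid t) a < length \<mu>" "tcol t a < \<mu> ! trow (tabloid t) a" "t ! trow (tabloid t) a ! tcol t a = a"
  using tableau_nth[of i j] tableau_lengths by auto
qed

lemma column_eq: "column t j = {a\<in>{1..n}. tcol t a = j}"
proof (intro Set.set_eqI iffI)
 fix a assume "a \<in> column t j"
 then obtain i where "i < length t" "j < length (t ! i)" "a = t ! i ! j" by (auto simp: column_def in_set_conv_nth)
 thus "a \<in> {a\<in>{1..n}. tcol t a = j}" using tableau_nth[of i j] tableau_lengths by auto
next
 fix a assume a: "a \<in> {a\<in>{1..n}. tcol t a = j}"
 thus "a \<in> column t j" unfolding column_def
  using tableau_cell[of a] tableau_lengths by (intro CollectI exI[of _ "t ! trow (tabloid t) a"]) auto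
qed

lemma column_stabilizer_iff: "\<pi> \<in> column_stabilizer n t \<longleftrightarrow> \<pi> permutes {1..n} \<and> (\<forall>a\<in>{1..n}. tcol t (\<pi> a) = tcol t a)"
proof -
 have "(\<forall>j. \<pi> ` column t j = column t j) \<longleftrightarrow> (\<forall>a\<in>{1..n}. tcol t (\<pi> a) = tcol t a)" if p: "\<pi> permutes {1..n}"
 proof
  assume a: "\<forall>j. \<pi> ` column t j = column t j"
  show "\<forall>a\<in>{1..n}. tcol t (\<pi> a) = tcol t a"
  proof
   fix a assume "a \<in> {1..n}"
   hence "\<pi> a \<in> \<pi> ` column t (tcol t a)" by (auto simp: column_eq)
   thus "tcol t (\<pi> a) = tcol t a" using a by (auto simp: column_eq)
  qed
 next
  assume a: "\<forall>a\<in>{1..n}. tcol t (\<pi> a) = tcol t a"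
  show "\<forall>j. \<pi> ` column t j = column t j"
  proof
   fix j
   have "\<pi> ` column t j \<subseteq> column t j" using a permutes_in_image[OF p] by (auto simp: column_eq)
   moreover have "finite (column t j)" by (simp add: column_eq)
   ultimately show "\<pi> ` column t j = column t j"
    using endo_inj_surj inj_on_subset[OF permutes_inj[OF p]] by blast
  qed
 qed
 thus ?thesis by (auto simp: column_stabilizer_def)
qed

lemma finite_column_stabilizer: "finite (column_stabilizer n t)"
 by (rule finite_subset[of _ "Sym n"]) (auto simp: column_stabilizer_def)

lemma tabloid_nth:
 assumes "i < length \<mu>" shows "tabloid t ! i = {a\<in>{1..n}. trow (tabloid t) a = i}"
proof -
 have "tabloid t ! i = set (t ! i)" using assms tableau_lengths by (simp add: tabloid_def)
 also have "\<dots> = {a\<in>{1..n}. trow (tabloid t) a = i}"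
 proof (intro Set.set_eqI iffI)
  fix a assume "a \<in> set (t ! i)"
  then obtain j where "j < length (t ! i)" "a = t ! i ! j" by (auto simp: in_set_conv_nth)
  thus "a \<in> {a\<in>{1..n}. trow (tabloid t) a = i}" using tableau_nth[OF assms] tableau_lengths(2)[OF assms] by auto
 next
  fix a assume "a \<in> {a\<in>{1..n}. trow (tabloid t) a = i}"
  thus "a \<in> set (t ! i)" using tableau_cell[of a] tableau_lengths(2)[OF assms] nth_mem[of "tcol t a" "t ! i"] by auto
 qed
 finally show ?thesis .
qed

lemma tableau_image:
 assumes "\<pi> permutes {1..n}"
 shows "map (map \<pi>) t \<in> tableaux n \<mu>" "tabloid (map (map \<pi>) t) = map (image \<pi>) (tabloid t)"
  "a \<in> {1..n} ==> tcol (map (map \<pi>) t) (\<pi> a) = tcol t a"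
proof -
 have "map length (map (map \<pi>) t) = map length t" by simp
 moreover have "distinct (map \<pi> (concat t))" using t permutes_inj[OF assms] by (simp add: tableaux_def distinct_map inj_on_def)
 moreover have "set (map \<pi> (concat t)) = {1..n}" using t permutes_image[OF assms] unfolding set_map by (simp add: tableaux_def)
 ultimately show "map (map \<pi>) t \<in> tableaux n \<mu>" using t by (auto simp: tableaux_def map_concat)
 show "tabloid (map (map \<pi>) t) = map (image \<pi>) (tabloid t)" by (simp add: tabloid_def)
 have "\<And>i j. i < length t \<and> j < length (t ! i) ==> \<pi> (t ! i ! j) = \<pi> a \<longleftrightarrow> t ! i ! j = a"
  using permutes_inj[OF assms] by (auto simp: inj_def)
 thus "tcol (map (map \<pi>) t) (\<pi> a) = tcol t a"
  unfolding tcol_def by (intro arg_cong[where f = The] ext) (auto simp: )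
qed

end

lemma tabloid_eqI:
 assumes "t \<in> tableaux n \<mu>" "t' \<in> tableaux n \<mu>" "\<And>a. a \<in> {1..n} ==> trow (tabloid t) a = trow (tabloid t') a"
 shows "tabloid t = tabloid t'"
proof (rule nth_equalityI)
 show "length (tabloid t) = length (tabloid t')" using tableau_lengths(1)[OF assms(1)] tableau_lengths(1)[OF assms(2)] by (simp add: tabloid_def)
 fix i assume "i < length (tabloid t)"
 hence "i < length \<mu>" using tableau_lengths(1)[OF assms(1)] by (simp add: tabloid_def)
 from tabloid_nth[OF assms(1) this] tabloid_nth[OF assms(2) this]
 show "tabloid t ! i = tabloid t' ! i" using assms(3) by auto
qed

lemma trow_image:
 assumes "\<pi> permutes A" shows "trow (map (image \<pi>) T) a = trow T (pinv \<pi> a)"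
proof -
 have "a \<in> \<pi> ` X \<longleftrightarrow> pinv \<pi> a \<in> X" for X
  using permutes_inverses[OF assms] image_eqI[of a \<pi> "pinv \<pi> a" X] by auto
 thus ?thesis unfolding trow_def by (simp cong: conj_cong)
qed

lemma finite_tableaux [simp]: "finite (tableaux n \<mu>)"
proof -
 have "tableaux n \<mu> \<subseteq> {t. set t \<subseteq> {x. set x \<subseteq> {1..n} \<and> length x \<le> sum_list \<mu>} \<and> length t = length \<mu>}"
 proof
  fix t assume t: "t \<in> tableaux n \<mu>"
  have "length x \<le> sum_list \<mu>" if "x \<in> set t" for x
   using t member_le_sum_list[of "length x" \<mu>] that by (auto simp: tableaux_def)
  thus "t \<in> {t. set t \<subseteq> {x. set x \<subseteq> {1..n} \<and> length x \<le> sum_list \<mu>} \<and> length t = length \<mu>}"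
   using t by (auto simp: tableaux_def)
 qed
 thus ?thesis
  by (rule finite_subset) (intro finite_lists_length_eq finite_lists_length_le finite_atLeastAtMost)
qed

text \<open>The combinatorial core of the triangularity of the pairings below.  Here \<open>row\<close> and \<open>col\<close> give the position of an element in a
 tableau, \<open>q\<close> gives its row in a tabloid that meets no column twice in a row, and \<open>L\<close> is a filling that strictly
 decreases down the columns.\<close>

locale column_filling =
 fixes X :: "'a set" and row col q L :: "'a => nat"
 assumes fin: "finite X"
  and inj: "a \<in> X ==> b \<in> X ==> col a = col b ==> row a = row b ==> a = b"
  and down: "a \<in> X ==> i < row a ==> \<exists>b\<in>X. col b = col a \<and> row b = i"
  and decr: "a \<in> X ==> b \<in> X ==> col a = col b ==> row a < row b ==> L b < L a"
  and good: "a \<in> X ==> b \<in> X ==> col a = col b ==> q a = q b ==> a = b"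
begin

text \<open>If some cell of the column below row \<open>i\<close> has a label
  \<open>\<ge> k\<close>, then all \<open>i + 1\<close> cells down to row \<open>i\<close> do, and
  the left side cannot exceed \<open>i + 1\<close> as \<open>q\<close> is injective on the column.
  Otherwise every cell with label \<open>\<ge> k\<close> lies in a row \<open>\<le> i\<close>, and
  the right side counts all of them.\<close>

lemma column_le:
 "card {a\<in>X. col a = j \<and> q a \<le> i \<and> k \<le> L a} \<le> card {a\<in>X. col a = j \<and> row a \<le> i \<and> k \<le> L a}" (is "card ?Q \<le> card ?R")
proof (cases "\<exists>a\<in>X. col a = j \<and> k \<le> L a \<and> row a > i")
 case True
 then obtain a where a: "a \<in> X" "col a = j" "k \<le> L a" "row a > i" by blast
 have "card ?Q \<le> card {..i}" by (rule card_inj_on_le[of q]) (auto simp: inj_on_def intro: good)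
 also have "{..i} \<subseteq> row ` ?R"
 proof
  fix m assume "m \<in> {..i}"
  then obtain b where "b \<in> X" "col b = j" "row b = m" using down[OF a(1), of m] a by auto
  thus "m \<in> row ` ?R" using decr[of b a] a \<open>m \<in> {..i}\<close> by force
 qed
 hence "card {..i} \<le> card ?R" using fin by (intro surj_card_le) auto
 finally show ?thesis .
next
 case False
 thus ?thesis using fin by (intro card_mono) (auto simp: not_less)
qed

lemma split_columns:
 "card {a\<in>X. P a} = (\<Sum>j\<in>col ` X. card {a\<in>X. col a = j \<and> P a})"
proof -
 have "card {a\<in>X. P a} = card (\<Union>j\<in>col ` X. {a\<in>X. col a = j \<and> P a})" by (rule arg_cong[where f = card]) auto
 also have "\<dots> = (\<Sum>j\<in>col ` X. card {a\<in>X. col a = j \<and> P a})"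
 proof (rule card_UN_disjoint[where I = "col ` X" and A = "%j. {a\<in>X. col a = j \<and> P a}"])
  show "\<forall>i\<in>col ` X. \<forall>j\<in>col ` X. i \<noteq> j --> {a\<in>X. col a = i \<and> P a} \<inter> {a\<in>X. col a = j \<and> P a} = {}" by blast
 qed (simp_all add: fin)
 finally show ?thesis .
qed

lemma filling_le: "card {a\<in>X. q a \<le> i \<and> k \<le> L a} \<le> card {a\<in>X. row a \<le> i \<and> k \<le> L a}"
 unfolding split_columns[of "%a. q a \<le> i \<and> k \<le> L a"] split_columns[of "%a. row a \<le> i \<and> k \<le> L a"]
 by (intro sum_mono column_le)

text \<open>Equality of the sums over all columns forces equality in each column. For
  \<open>i = row b\<close> and \<open>k = L b\<close> the cells on the left are among those on the
  right, since labels \<open>\<ge> L b\<close> occur only down to the row of \<open>b\<close>; so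
  the two sets agree and \<open>q b \<le> row b\<close>. As \<open>q\<close> is injective on
  columns, induction on the row excludes a strict inequality.\<close>

lemma filling_rigid:
 assumes e: "\<And>i k. card {a\<in>X. q a \<le> i \<and> k \<le> L a} = card {a\<in>X. row a \<le> i \<and> k \<le> L a}" and b: "b \<in> X"
 shows "q b = row b"
proof -
 have le: "q b \<le> row b" if b: "b \<in> X" for b
 proof -
  let ?Q = "%q. {a\<in>X. col a = col b \<and> q a \<le> row b \<and> L b \<le> L a}"
  have "card (?Q q) = card (?Q row)"
   by (rule sum_mono_inv[where f = "%j. card {a\<in>X. col a = j \<and> q a \<le> row b \<and> L b \<le> L a}" and I = "col ` X",
    OF e[of "row b" "L b", unfolded split_columns[of "%a. q a \<le> row b \<and> L b \<le> L a"] split_columns[of "%a. row a \<le> row b \<and> L b \<le> L a"]] column_le])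
    (use b fin in auto)
  moreover have "?Q q \<subseteq> ?Q row" using decr[OF b] by (auto simp: leI) (metis leD leI)
  ultimately have "?Q q = ?Q row" using fin by (intro card_subset_eq) auto
  thus ?thesis using b by auto
 qed
 from b show ?thesis
 proof (induction "row b" arbitrary: b rule: less_induct)
  case less
  show ?case
  proof (rule ccontr)
   assume "q b \<noteq> row b"
   hence lt: "q b < row b" using le[OF less.prems] by simp
   then obtain a where a: "a \<in> X" "col a = col b" "row a = q b" using down[OF less.prems] by blast
   hence "q a = q b" using less.hyps[of a] lt by simp
   thus False using good[of a b] a less.prems lt by auto
  qed
 qed
qed

end

section \<open>Pairing words with tableaux\<close>

definition psum :: "(nat => nat => nat) => nat => nat => nat" where
 "psum S i k = (\<Sum>i'\<le>i. S k i')"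

text \<open>Along each row of \<open>T\<close> the word \<open>w\<close> has the same letters, with
  multiplicities, as the corresponding row of \<open>S\<close>. The condition is written with
  cumulative counts because these are what the dominance order compares.\<close>

definition matches :: "nat => (nat => nat => nat) => nat set list => (nat => nat) => bool" where
 "matches n S T w \<longleftrightarrow> (\<forall>i k. card {a\<in>{1..n}. trow T a \<le> i \<and> k \<le> w a} = psum S i k)"

text \<open>The entry in a cell receives the letter \<open>k\<close> for which the strip from
  \<open>S (Suc k)\<close> to \<open>S k\<close> contains the cell. The minimum exists because the
  chain ends in the empty shape.\<close>

definition sword :: "nat => (nat => nat => nat) => nat list list => nat => nat" where
 "sword n S t = (\<lambda>a\<in>{1..n}. LEAST k. S (Suc k) (trow (tabloid t) a) \<le> tcol t a)"

text \<open>The functional denoted by \<open>F\<close> in the overview. The word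
  \<open>sword n S t \<circ> pinv \<pi>\<close> is the one obtained from \<open>t\<close> after
  \<open>\<pi>\<close> has been applied to its entries.\<close>

definition pairing :: "nat => (nat => nat => nat) => nat list list => ((nat => nat) => 'k::field) => 'k" where
 "pairing n S t u = (\<Sum>\<pi>\<in>column_stabilizer n t. of_int (sign \<pi>) * u (sword n S t \<circ> pinv \<pi>))"

definition col_injective :: "nat => nat set list => nat list list => bool" where
 "col_injective n T t \<longleftrightarrow> (\<forall>a\<in>{1..n}. \<forall>b\<in>{1..n}. tcol t a = tcol t b --> trow T a = trow T b --> a = b)"

lemma matches_permuted:
 assumes "\<pi> permutes {1..n}" "\<And>a. a \<in> {1..n} ==> trow T' a = trow T (\<pi> a)"
 shows "matches n S T (w \<circ> pinv \<pi>) \<longleftrightarrow> matches n S T' w"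
proof -
 have "card {a\<in>{1..n}. trow T a \<le> i \<and> k \<le> (w \<circ> pinv \<pi>) a} = card {a\<in>{1..n}. trow T' a \<le> i \<and> k \<le> w a}" for i k
 proof -
  have "card {a\<in>{1..n}. trow T a \<le> i \<and> k \<le> (w \<circ> pinv \<pi>) a} = card {a\<in>{1..n}. trow T (\<pi> a) \<le> i \<and> k \<le> (w \<circ> pinv \<pi>) (\<pi> a)}"
   by (rule card_permutes_vimage[OF assms(1), symmetric])
  also have "{a\<in>{1..n}. trow T (\<pi> a) \<le> i \<and> k \<le> (w \<circ> pinv \<pi>) (\<pi> a)} = {a\<in>{1..n}. trow T' a \<le> i \<and> k \<le> w a}"
   using assms(2) permutes_inverses(2)[OF assms(1)] by (intro Collect_cong) auto
  finally show ?thesis .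
 qed
 thus ?thesis by (simp add: matches_def)
qed

text \<open>Two entries of a column lying in the same row of \<open>T\<close> give a sign-reversing involution of the
 column stabilizer.  The cancellation takes place over the integers since \<open>k\<close> may have characteristic two.\<close>

lemma alternating_sum_zero:
 assumes t: "t \<in> tableaux n \<mu>" and bad: "\<not> col_injective n T t"
 shows "(\<Sum>\<pi>\<in>column_stabilizer n t. of_int (sign \<pi>) * (if matches n S T (w \<circ> pinv \<pi>) then 1 else 0)) = (0::'k::field)"
proof -
 let ?C = "column_stabilizer n t" and ?g = "%\<pi>. if matches n S T (w \<circ> pinv \<pi>) then 1 else (0::int)"
 obtain a b where ab: "a \<in> {1..n}" "b \<in> {1..n}" "tcol t a = tcol t b" "trow T a = trow T b" "a \<noteq> b"
  using bad unfolding col_injective_def by blast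
 define \<tau> where "\<tau> = transpose a b"
 have \<tau>: "\<tau> permutes {1..n}" "\<tau> \<circ> \<tau> = id" "pinv \<tau> = \<tau>" "sign \<tau> = -1" "trow T (\<tau> x) = trow T x" "tcol t (\<tau> x) = tcol t x" for x
  using ab by (simp_all add: \<tau>_def permutes_swap_id sign_swap_id transpose_def)
 have cs: "\<tau> \<circ> \<pi> \<in> ?C" if "\<pi> \<in> ?C" for \<pi>
  using that \<tau> permutes_compose[of \<pi> "{1..n}" \<tau>] by (auto simp: column_stabilizer_iff[OF t])
 have inv: "\<tau> \<circ> (\<tau> \<circ> \<pi>) = \<pi>" for \<pi> using \<tau>(2) by (simp add: comp_assoc[symmetric])
 have "bij_betw (%\<pi>. \<tau> \<circ> \<pi>) ?C ?C"
  by (rule bij_betw_byWitness[where f' = "%\<pi>. \<tau> \<circ> \<pi>"]) (use cs inv in auto)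
 hence "(\<Sum>\<pi>\<in>?C. sign \<pi> * ?g \<pi>) = (\<Sum>\<pi>\<in>?C. sign (\<tau> \<circ> \<pi>) * ?g (\<tau> \<circ> \<pi>))"
  by (rule sum.reindex_bij_betw[symmetric])
 also have "\<dots> = (\<Sum>\<pi>\<in>?C. - (sign \<pi> * ?g \<pi>))"
 proof (rule sum.cong[OF refl])
  fix \<pi> assume "\<pi> \<in> ?C"
  hence p: "\<pi> permutes {1..n}" by (simp add: column_stabilizer_iff[OF t])
  have "sign (\<tau> \<circ> \<pi>) = sign \<tau> * sign \<pi>"
   using \<tau>(1) p by (intro sign_compose) (auto simp: permutation_permutes)
  moreover have "pinv (\<tau> \<circ> \<pi>) = pinv \<pi> \<circ> \<tau>"
   using o_inv_distrib[OF permutes_bij[OF \<tau>(1)] permutes_bij[OF p]] \<tau>(3) by simp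
  hence "matches n S T (w \<circ> pinv (\<tau> \<circ> \<pi>)) \<longleftrightarrow> matches n S T (w \<circ> pinv \<pi>)"
   using matches_permuted[OF \<tau>(1), of T T S "w \<circ> pinv \<pi>"] \<tau>(3,5) by (simp add: comp_assoc)
  ultimately show "sign (\<tau> \<circ> \<pi>) * ?g (\<tau> \<circ> \<pi>) = - (sign \<pi> * ?g \<pi>)" using \<tau>(4) by simp
 qed
 also have "\<dots> = - (\<Sum>\<pi>\<in>?C. sign \<pi> * ?g \<pi>)" by (rule sum_negf)
 finally have "(\<Sum>\<pi>\<in>?C. sign \<pi> * ?g \<pi>) = 0" by simp
 hence "of_int (\<Sum>\<pi>\<in>?C. sign \<pi> * ?g \<pi>) = (0::'k)" by simp
 moreover have "of_int (\<Sum>\<pi>\<in>?C. sign \<pi> * ?g \<pi>) = (\<Sum>\<pi>\<in>?C. of_int (sign \<pi>) * (if matches n S T (w \<circ> pinv \<pi>) then 1 else 0 :: 'k))"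
  unfolding of_int_sum of_int_mult by (intro sum.cong refl) simp
 ultimately show ?thesis by simp
qed

locale sst_tableau =
 fixes n :: nat and ms \<rho> S t
 assumes ms: "sum_list ms = n" and \<rho>: "\<rho> \<in> Par n" and S: "S \<in> sst ms \<rho>" and t: "t \<in> tableaux n (plist \<rho>)"
begin

abbreviation "row \<equiv> trow (tabloid t)"
abbreviation "col \<equiv> tcol t"

lemma S_Par: "S k \<in> Par (sum_list (drop k ms))" and S_strip: "hstrip (S (Suc k)) (S k)"
 using sst_D[OF S] \<rho> ms by auto

lemma S_mono: "k \<le> k' ==> S k' i \<le> S k i"
 by (rule lift_Suc_antimono_le[of "%k. S k i"]) (use S_strip in \<open>auto simp: hstrip_def\<close>)

lemma S_end: "length ms \<le> k ==> S k i = 0"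
 using S_Par[of k] by (simp add: Par_0)

lemma cell: "a \<in> {1..n} ==> col a < \<rho> (row a)"
 using tableau_cell[OF t] plist(2)[OF \<rho>] by fastforce

lemma cell_ex: "j < \<rho> i ==> \<exists>a\<in>{1..n}. row a = i \<and> col a = j"
 using tableau_nth[OF t, of i j] plist(1,2)[OF \<rho>, of i] by auto

lemma cell_inj: "a \<in> {1..n} ==> b \<in> {1..n} ==> col a = col b ==> row a = row b ==> a = b"
 using tableau_cell(3)[OF t] by metis

lemma le_sword: "a \<in> {1..n} ==> k \<le> sword n S t a \<longleftrightarrow> col a < S k (row a)"
proof -
 assume a: "a \<in> {1..n}"
 let ?P = "%k. S (Suc k) (row a) \<le> col a"
 have m: "sword n S t a = (LEAST k. ?P k)" using a by (simp add: sword_def)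
 have P: "?P (sword n S t a)" unfolding m by (rule LeastI[of _ "length ms"]) (simp add: S_end)
 show ?thesis
 proof (cases "k \<le> sword n S t a")
  case True
  have "col a < S k (row a)"
  proof (cases k)
   case 0 thus ?thesis using cell[OF a] sst_0[OF S] by simp
  next
   case (Suc k')
   thus ?thesis using not_less_Least[of k' ?P] True m by simp
  qed
  thus ?thesis using True by simp
 next
  case False
  thus ?thesis using S_mono[of "Suc (sword n S t a)" k "row a"] P by simp
 qed
qed

lemma card_sword: "card {a\<in>{1..n}. row a \<le> i \<and> k \<le> sword n S t a} = psum S i k"
proof -
 have "bij_betw (%a. (row a, col a)) {a\<in>{1..n}. row a \<le> i \<and> k \<le> sword n S t a} (SIGMA i':{..i}. {..<S k i'})"
 proof (rule bij_betw_imageI)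
  show "inj_on (%a. (row a, col a)) {a\<in>{1..n}. row a \<le> i \<and> k \<le> sword n S t a}" by (auto simp: inj_on_def intro: cell_inj)
  show "(%a. (row a, col a)) ` {a\<in>{1..n}. row a \<le> i \<and> k \<le> sword n S t a} = (SIGMA i':{..i}. {..<S k i'})"
  proof (intro equalityI subsetI)
   fix x assume "x \<in> (SIGMA i':{..i}. {..<S k i'})"
   then obtain i' j where x: "x = (i', j)" "i' \<le> i" "j < S k i'" by auto
   hence "j < \<rho> i'" using S_mono[of 0 k i'] sst_0[OF S] by simp
   then obtain a where "a \<in> {1..n}" "row a = i'" "col a = j" using cell_ex by blast
   thus "x \<in> (%a. (row a, col a)) ` {a\<in>{1..n}. row a \<le> i \<and> k \<le> sword n S t a}" using x le_sword by (intro image_eqI[of _ _ a]) auto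
  qed (auto simp: le_sword)
 qed
 thus ?thesis by (auto dest!: bij_betw_same_card simp: psum_def)
qed

lemma sword_words: "sword n S t \<in> words n ms"
proof -
 have r: "row a \<le> n" if "a \<in> {1..n}" for a using cell[OF that] ParD(2)[OF \<rho>, of "row a"] by (cases "row a \<le> n") auto
 have c: "card {a\<in>{1..n}. k \<le> sword n S t a} = sum_list (drop k ms)" for k
 proof -
  have "sum_list (take k ms) + sum_list (drop k ms) = n" using ms by (metis append_take_drop_id sum_list_append)
  hence "psum S n k = sum_list (drop k ms)" using ParD(3)[OF S_Par, of k "Suc n"] by (simp add: psum_def lessThan_Suc_atMost)
  moreover have "{a\<in>{1..n}. k \<le> sword n S t a} = {a\<in>{1..n}. row a \<le> n \<and> k \<le> sword n S t a}" using r by auto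
  ultimately show ?thesis using card_sword[of n k] by simp
 qed
 have "card {a\<in>{1..n}. sword n S t a = k} = ms ! k" if "k < length ms" for k
 proof -
  have "{a\<in>{1..n}. k \<le> sword n S t a} = {a\<in>{1..n}. sword n S t a = k} \<union> {a\<in>{1..n}. Suc k \<le> sword n S t a}" by auto
  hence "sum_list (drop k ms) = card {a\<in>{1..n}. sword n S t a = k} + sum_list (drop (Suc k) ms)"
   unfolding c[symmetric] by (simp add: card_Un_disjoint disjoint_iff)
  moreover have "sum_list (drop k ms) = ms ! k + sum_list (drop (Suc k) ms)"
   unfolding Cons_nth_drop_Suc[OF that, symmetric] by simp
  ultimately show ?thesis by simp
 qed
 moreover have "sword n S t a < length ms" if "a \<in> {1..n}" for a
  using le_sword[OF that, of "length ms"] by (simp add: S_end)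
 moreover have "sword n S t \<in> extensional {1..n}" by (simp add: sword_def)
 ultimately show ?thesis by (simp add: words_def PiE_def Pi_iff)
qed

lemma sword_decr:
 assumes "a \<in> {1..n}" "b \<in> {1..n}" "col a = col b" "row a < row b"
 shows "sword n S t b < sword n S t a"
proof -
 let ?k = "sword n S t b"
 obtain r where r: "row b = Suc r" "row a \<le> r" using assms(4) by (cases "row b") auto
 have "col b < S ?k (row b)" using le_sword[OF assms(2), of ?k] by simp
 also have "\<dots> \<le> S (Suc ?k) r" using S_strip[of ?k] r by (simp add: hstrip_def)
 also have "\<dots> \<le> S (Suc ?k) (row a)" by (rule descD[OF ParD(1)[OF S_Par] r(2)])
 finally show ?thesis using le_sword[OF assms(1), of "Suc ?k"] assms(3) by simp
qed

lemma filling: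
 assumes \<pi>: "\<pi> \<in> column_stabilizer n t" and T: "col_injective n T t"
 shows "column_filling {1..n} row col (%a. trow T (\<pi> a)) (sword n S t)"
proof
 fix a b assume ab: "a \<in> {1..n}" "b \<in> {1..n}" "col a = col b"
 show "row a = row b ==> a = b" using cell_inj[OF ab] .
 show "row a < row b ==> sword n S t b < sword n S t a" by (rule sword_decr[OF ab])
 have p: "\<pi> permutes {1..n}" "col (\<pi> a) = col (\<pi> b)" using \<pi> ab by (auto simp: column_stabilizer_iff[OF t])
 assume "trow T (\<pi> a) = trow T (\<pi> b)"
 hence "\<pi> a = \<pi> b" using T p(2) ab permutes_in_image[OF p(1)] unfolding col_injective_def by blast
 thus "a = b" using permutes_inj[OF p(1)] by (simp add: injD)
next
 fix a i assume a: "a \<in> {1..n}" "i < row a"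
 have "col a < \<rho> i" using cell[OF a(1)] descD[OF ParD(1)[OF \<rho>], of i "row a"] a(2) by simp
 thus "\<exists>b\<in>{1..n}. col b = col a \<and> row b = i" using cell_ex by blast
qed simp

lemma matches_card:
 assumes p: "\<pi> permutes {1..n}" and m: "matches n S' T (sword n S t \<circ> pinv \<pi>)"
 shows "card {a\<in>{1..n}. trow T (\<pi> a) \<le> i \<and> k \<le> sword n S t a} = psum S' i k"
proof -
 have "trow (map (image (pinv \<pi>)) T) a = trow T (\<pi> a)" for a
  using trow_image[OF permutes_inv[OF p]] permutes_inv_inv[OF p] by simp
 thus ?thesis using matches_permuted[OF p, of "map (image (pinv \<pi>)) T" T S' "sword n S t"] m by (simp add: matches_def)
qed

text \<open>A nonzero value excludes, by \<open>alternating_sum_zero\<close>, that a column of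
  \<open>t\<close> meets a row of \<open>T\<close> twice, and it yields a column permutation
  \<open>\<pi>\<close> whose word matches. Then \<open>filling_le\<close>, with the row of
  \<open>\<pi> a\<close> in \<open>T\<close> as \<open>q a\<close>, compares the partial
  sums.\<close>

lemma pairing_le:
 assumes "pairing n S t (%w. if matches n S' T w then 1 else 0) \<noteq> (0::'k::field)"
 shows "psum S' i k \<le> psum S i k"
proof -
 have T: "col_injective n T t" using assms alternating_sum_zero[OF t, of T S' "sword n S t"] unfolding pairing_def by blast
 have "\<exists>\<pi>\<in>column_stabilizer n t. matches n S' T (sword n S t \<circ> pinv \<pi>)"
 proof (rule ccontr)
  assume "\<not> ?thesis"
  hence "pairing n S t (%w. if matches n S' T w then 1 else 0) = (0::'k)" unfolding pairing_def by (intro sum.neutral) auto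
  thus False using assms by blast
 qed
 then obtain \<pi> where \<pi>: "\<pi> \<in> column_stabilizer n t" "matches n S' T (sword n S t \<circ> pinv \<pi>)" by blast
 hence p: "\<pi> permutes {1..n}" by (simp add: column_stabilizer_iff[OF t])
 interpret column_filling "{1..n}" row col "%a. trow T (\<pi> a)" "sword n S t" by (rule filling[OF \<pi>(1) T])
 show ?thesis using filling_le[of i k] unfolding matches_card[OF p \<pi>(2)] card_sword .
qed

lemma col_injective_tabloid:
 assumes \<pi>: "\<pi> \<in> column_stabilizer n t"
 shows "col_injective n (map (image \<pi>) (tabloid t)) t"
proof -
 have p: "\<pi> permutes {1..n}" using \<pi> by (simp add: column_stabilizer_iff[OF t])
 have c: "col (pinv \<pi> a) = col a" "pinv \<pi> a \<in> {1..n}" if "a \<in> {1..n}" for a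
 proof -
  show i: "pinv \<pi> a \<in> {1..n}" using that permutes_in_image[OF permutes_inv[OF p]] by simp
  hence "col (\<pi> (pinv \<pi> a)) = col (pinv \<pi> a)" using \<pi> unfolding column_stabilizer_iff[OF t] by blast
  thus "col (pinv \<pi> a) = col a" using permutes_inverses[OF p] by simp
 qed
 have "a = b" if "pinv \<pi> a = pinv \<pi> b" for a b using that permutes_inverses(1)[OF p] by metis
 thus ?thesis unfolding col_injective_def trow_image[OF p] using cell_inj c by metis
qed

text \<open>If a column of \<open>t\<close> meets a row of \<open>T\<close> twice, both sides
  vanish. Otherwise the two signed sums agree term by term: by \<open>filling_rigid\<close> the word
  of \<open>\<pi>\<close> can match \<open>S\<close> along \<open>T\<close> only if \<open>T\<close>
  is the image of the tabloid of \<open>t\<close> under \<open>\<pi>\<close>.\<close>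

lemma pairing_polytabloid:
 assumes T: "T \<in> tabloid ` tableaux n (plist \<rho>)"
 shows "pairing n S t (%w. if matches n S T w then 1 else 0) = (polytabloid n t T :: 'k::field)"
proof (cases "col_injective n T t")
 case False
 have "basis_vec (map (image \<pi>) (tabloid t)) T = (0::'k)" if "\<pi> \<in> column_stabilizer n t" for \<pi>
  using False col_injective_tabloid[OF that] by (auto simp: basis_vec_def)
 hence "polytabloid n t T = (0::'k)" by (simp add: polytabloid_def)
 thus ?thesis using alternating_sum_zero[OF t False] by (simp add: pairing_def)
next
 case True
 have "matches n S T (sword n S t \<circ> pinv \<pi>) \<longleftrightarrow> T = map (image \<pi>) (tabloid t)" if \<pi>: "\<pi> \<in> column_stabilizer n t" for \<pi>
 proof -
  have p: "\<pi> permutes {1..n}" using \<pi> by (simp add: column_stabilizer_iff[OF t])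
  interpret column_filling "{1..n}" row col "%a. trow T (\<pi> a)" "sword n S t" by (rule filling[OF \<pi> True])
  show ?thesis
  proof
   assume m: "matches n S T (sword n S t \<circ> pinv \<pi>)"
   have e: "trow T (\<pi> b) = row b" if "b \<in> {1..n}" for b
    by (rule filling_rigid[OF _ that]) (simp only: matches_card[OF p m] card_sword)
   obtain t' where t': "t' \<in> tableaux n (plist \<rho>)" "T = tabloid t'" using T by blast
   have "tabloid t' = tabloid (map (map \<pi>) t)"
   proof (rule tabloid_eqI[OF t'(1) tableau_image(1)[OF t p]])
    fix a assume "a \<in> {1..n}"
    hence "pinv \<pi> a \<in> {1..n}" using permutes_in_image[OF permutes_inv[OF p]] by simp
    from e[OF this] show "trow (tabloid t') a = trow (tabloid (map (map \<pi>) t)) a"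
     unfolding tableau_image(2)[OF t p] trow_image[OF p] t'(2)[symmetric] permutes_inverses(1)[OF p] .
   qed
   thus "T = map (image \<pi>) (tabloid t)" using t' tableau_image(2)[OF t p] by simp
  next
   assume T: "T = map (image \<pi>) (tabloid t)"
   have "matches n S (tabloid t) (sword n S t)" unfolding matches_def using card_sword by blast
   thus "matches n S T (sword n S t \<circ> pinv \<pi>)"
    using matches_permuted[OF p, of "tabloid t" T S "sword n S t"] trow_image[OF p] permutes_inverses(2)[OF p] T by simp
  qed
 qed
 thus ?thesis unfolding pairing_def polytabloid_def by (intro sum.cong refl) (simp add: basis_vec_def)
qed

end

lemma column_stabilizer_image:
 assumes t: "t \<in> tableaux n \<mu>" and p: "\<pi> permutes {1..n}"
 shows "bij_betw (%\<sigma>. \<pi> \<circ> \<sigma> \<circ> pinv \<pi>) (column_stabilizer n t) (column_stabilizer n (map (map \<pi>) t))"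
proof (rule bij_betw_byWitness[where f' = "%\<sigma>. pinv \<pi> \<circ> \<sigma> \<circ> \<pi>"])
 note t' = tableau_image(1)[OF t p]
 note pi = permutes_inverses[OF p]
 show "\<forall>\<sigma>\<in>column_stabilizer n t. pinv \<pi> \<circ> (\<pi> \<circ> \<sigma> \<circ> pinv \<pi>) \<circ> \<pi> = \<sigma>" using pi by (simp add: fun_eq_iff)
 show "\<forall>\<sigma>\<in>column_stabilizer n (map (map \<pi>) t). \<pi> \<circ> (pinv \<pi> \<circ> \<sigma> \<circ> \<pi>) \<circ> pinv \<pi> = \<sigma>" using pi by (simp add: fun_eq_iff)
 show "(%\<sigma>. \<pi> \<circ> \<sigma> \<circ> pinv \<pi>) ` column_stabilizer n t \<subseteq> column_stabilizer n (map (map \<pi>) t)"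
 proof (rule image_subsetI)
  fix \<sigma> assume s: "\<sigma> \<in> column_stabilizer n t"
  hence "\<pi> \<circ> \<sigma> \<circ> pinv \<pi> permutes {1..n}" using p by (intro permutes_compose permutes_inv) (auto simp: column_stabilizer_iff[OF t])
  moreover have "tcol (map (map \<pi>) t) (\<pi> (\<sigma> (pinv \<pi> a))) = tcol (map (map \<pi>) t) a" if "a \<in> {1..n}" for a
  proof -
   have "pinv \<pi> a \<in> {1..n}" using that permutes_in_image[OF permutes_inv[OF p]] by simp
   hence b: "pinv \<pi> a \<in> {1..n}" "\<sigma> (pinv \<pi> a) \<in> {1..n}" "tcol t (\<sigma> (pinv \<pi> a)) = tcol t (pinv \<pi> a)"
    using s permutes_in_image[of \<sigma> "{1..n}"] unfolding column_stabilizer_iff[OF t] by blast+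
   thus ?thesis using tableau_image(3)[OF t p b(1)] tableau_image(3)[OF t p b(2)] pi(1) by simp
  qed
  ultimately show "\<pi> \<circ> \<sigma> \<circ> pinv \<pi> \<in> column_stabilizer n (map (map \<pi>) t)" by (simp add: column_stabilizer_iff[OF t'])
 qed
 show "(%\<sigma>. pinv \<pi> \<circ> \<sigma> \<circ> \<pi>) ` column_stabilizer n (map (map \<pi>) t) \<subseteq> column_stabilizer n t"
 proof (rule image_subsetI)
  fix \<sigma> assume s: "\<sigma> \<in> column_stabilizer n (map (map \<pi>) t)"
  hence sp: "\<sigma> permutes {1..n}" by (simp add: column_stabilizer_iff[OF t'])
  hence "pinv \<pi> \<circ> \<sigma> \<circ> \<pi> permutes {1..n}" using p by (intro permutes_compose permutes_inv)
  moreover have "tcol t (pinv \<pi> (\<sigma> (\<pi> a))) = tcol t a" if a: "a \<in> {1..n}" for a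
  proof -
   have b: "\<pi> a \<in> {1..n}" "pinv \<pi> (\<sigma> (\<pi> a)) \<in> {1..n}"
    using a permutes_in_image[OF permutes_inv[OF p]] permutes_in_image[OF p] permutes_in_image[OF sp] by simp_all
   have "tcol (map (map \<pi>) t) (\<sigma> (\<pi> a)) = tcol (map (map \<pi>) t) (\<pi> a)" using s b(1) unfolding column_stabilizer_iff[OF t'] by blast
   thus ?thesis using tableau_image(3)[OF t p a] tableau_image(3)[OF t p b(2)] pi(1) by simp
  qed
  ultimately show "pinv \<pi> \<circ> \<sigma> \<circ> \<pi> \<in> column_stabilizer n t" by (simp add: column_stabilizer_iff[OF t])
 qed
qed

context
 fixes n t \<mu> \<pi> assumes t: "t \<in> tableaux n \<mu>" and p: "\<pi> permutes {1..n}"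
begin

lemma sum_column_stabilizer_image:
 "(\<Sum>\<sigma>\<in>column_stabilizer n (map (map \<pi>) t). of_int (sign \<sigma>) * g \<sigma>) =
  (\<Sum>\<sigma>\<in>column_stabilizer n t. of_int (sign \<sigma>) * (g (\<pi> \<circ> \<sigma> \<circ> pinv \<pi>) :: 'k::field))"
proof -
 have "sign (\<pi> \<circ> \<sigma> \<circ> pinv \<pi>) = sign \<sigma>" if "\<sigma> \<in> column_stabilizer n t" for \<sigma>
 proof -
  have "permutation \<pi>" "permutation \<sigma>" "permutation (pinv \<pi>)"
   using that p permutes_inv[OF p] by (auto simp: column_stabilizer_iff[OF t] permutation_permutes)
  thus ?thesis by (simp add: sign_compose sign_inverse permutation_compose)
 qed
 thus ?thesis
  unfolding sum.reindex_bij_betw[OF column_stabilizer_image[OF t p], symmetric] by (intro sum.cong refl) simp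
qed

lemma sword_image: "sword n S (map (map \<pi>) t) = sword n S t \<circ> pinv \<pi>"
proof
 fix a show "sword n S (map (map \<pi>) t) a = (sword n S t \<circ> pinv \<pi>) a"
 proof (cases "a \<in> {1..n}")
  case True
  hence "pinv \<pi> a \<in> {1..n}" using permutes_in_image[OF permutes_inv[OF p]] by simp
  thus ?thesis using True tableau_image(3)[OF t p, of "pinv \<pi> a"] permutes_inverses(1)[OF p]
   by (simp add: sword_def tableau_image(2)[OF t p] trow_image[OF p])
 next
  case False
  thus ?thesis using permutes_not_in[OF permutes_inv[OF p] False] False by (simp only: sword_def comp_apply restrict_apply if_False)
 qed
qed

lemma inv_conj: "\<sigma> permutes {1..n} ==> pinv (\<pi> \<circ> \<sigma> \<circ> pinv \<pi>) = \<pi> \<circ> pinv \<sigma> \<circ> pinv \<pi>"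
 by (rule inv_unique_comp) (simp_all add: fun_eq_iff permutes_inverses[OF p] permutes_inverses[of \<sigma>])

text \<open>Conjugation by \<open>\<pi>\<close> carries the column stabilizer of \<open>t\<close> to
  that of the renamed tableau and keeps signs. With \<open>polytabloid_image\<close> this makes
  functionals and polytabloids equivariant in the same way.\<close>

lemma pairing_image: "pairing n S (map (map \<pi>) t) u = pairing n S t (%w. u (w \<circ> pinv \<pi>) :: 'k::field)"
 unfolding pairing_def sum_column_stabilizer_image sword_image
proof (intro sum.cong refl arg_cong2[where f = "(*)"] arg_cong[where f = u])
 fix \<sigma> assume "\<sigma> \<in> column_stabilizer n t"
 hence "\<sigma> permutes {1..n}" by (simp add: column_stabilizer_iff[OF t])
 thus "sword n S t \<circ> pinv \<pi> \<circ> pinv (\<pi> \<circ> \<sigma> \<circ> pinv \<pi>) = sword n S t \<circ> pinv \<sigma> \<circ> pinv \<pi>"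
  by (simp add: inv_conj fun_eq_iff permutes_inverses[OF p])
qed

lemma polytabloid_image: "polytabloid n (map (map \<pi>) t) T = (polytabloid n t (map (image (pinv \<pi>)) T) :: 'k::field)"
 unfolding polytabloid_def sum_column_stabilizer_image tableau_image(2)[OF t p]
proof (intro sum.cong refl arg_cong2[where f = "(*)"])
 fix \<sigma>
 have c: "map (image f) (map (image g) X) = map (image (f \<circ> g)) X" for f g and X :: "nat set list" by (simp add: image_comp)
 have "T = map (image (\<pi> \<circ> \<sigma> \<circ> pinv \<pi>)) (map (image \<pi>) (tabloid t)) \<longleftrightarrow> map (image (pinv \<pi>)) T = map (image \<sigma>) (tabloid t)"
 proof
  assume "T = map (image (\<pi> \<circ> \<sigma> \<circ> pinv \<pi>)) (map (image \<pi>) (tabloid t))"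
  moreover have "pinv \<pi> \<circ> (\<pi> \<circ> \<sigma> \<circ> pinv \<pi> \<circ> \<pi>) = \<sigma>" by (simp add: fun_eq_iff permutes_inverses[OF p])
  ultimately show "map (image (pinv \<pi>)) T = map (image \<sigma>) (tabloid t)" unfolding c by (simp only: c)
 next
  assume a: "map (image (pinv \<pi>)) T = map (image \<sigma>) (tabloid t)"
  have "T = map (image (\<pi> \<circ> pinv \<pi>)) T" by (simp add: permutes_inv_o[OF p] )
  also have "\<dots> = map (image \<pi>) (map (image \<sigma>) (tabloid t))" unfolding a[symmetric] c ..
  also have "\<dots> = map (image (\<pi> \<circ> \<sigma> \<circ> pinv \<pi>)) (map (image \<pi>) (tabloid t))"
   unfolding c by (simp add: comp_assoc permutes_inv_o[OF p])
  finally show "T = map (image (\<pi> \<circ> \<sigma> \<circ> pinv \<pi>)) (map (image \<pi>) (tabloid t))" .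
 qed
 thus "basis_vec (map (image (\<pi> \<circ> \<sigma> \<circ> pinv \<pi>)) (map (image \<pi>) (tabloid t))) T =
  (basis_vec (map (image \<sigma>) (tabloid t)) (map (image (pinv \<pi>)) T) :: 'k)" by (simp add: basis_vec_def)
qed

end

section \<open>The filtration by dual Specht modules\<close>

lemma fun_vector_space: "vector_space (%(c::'k::field) (f::'a => 'k) x. c * f x)"
 by unfold_locales (auto simp: fun_eq_iff algebra_simps)

lemma sum_fun_apply: "(\<Sum>i\<in>A. g i) x = (\<Sum>i\<in>A. g i (x::'a) :: 'b::comm_monoid_add)"
 by (induction A rule: infinite_finite_induct) auto

text \<open>In the equation of index \<open>i\<close> the coefficients below \<open>i\<close> vanish
  by induction and the entries at all other \<open>j \<noteq> i\<close> by triangularity, which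
  leaves \<open>c i\<close>. It is stated for a downward closed \<open>J\<close>, so that some of
  the equations already kill the coefficients with the same indices.\<close>

lemma triangular_vanish:
 fixes a :: "'i => 'i => 'k::field"
 assumes I: "finite I" and wf: "wf r" and J: "J \<subseteq> I" and down: "\<And>i j. i \<in> J ==> j \<in> I ==> (j, i) \<in> r ==> j \<in> J"
  and diag: "\<And>i. i \<in> I ==> a i i = 1" and tri: "\<And>i j. i \<in> I ==> j \<in> I ==> a i j \<noteq> 0 ==> j = i \<or> (j, i) \<in> r"
  and zero: "\<And>i. i \<in> J ==> (\<Sum>j\<in>I. c j * a i j) = 0"
 shows "i \<in> J ==> c i = 0"
proof (induction i rule: wf_induct_rule[OF wf])
 case (1 i)
 have i: "i \<in> I" using 1 J by blast
 have "c j * a i j = 0" if "j \<in> I - {i}" for j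
  using 1(1)[of j] down[OF 1(2), of j] tri[OF i, of j] that by auto
 hence "(\<Sum>j\<in>I - {i}. c j * a i j) = 0" by (simp add: sum.neutral)
 thus ?case using zero[OF 1(2)] sum.remove[OF I i, of "%j. c j * a i j"] diag[OF i] by simp
qed

text \<open>Triangularity makes the \<open>b i\<close> independent, and their number is the
  dimension of the space of functions supported on \<open>W\<close>.\<close>

lemma triangular_spanning:
 fixes b :: "'i => 'a => 'k::field" and F :: "'i => ('a => 'k) => 'k"
 assumes I: "finite I" and W: "finite W" "card I = card W" and wf: "wf r"
  and diag: "\<And>i. i \<in> I ==> F i (b i) = 1" and tri: "\<And>i j. i \<in> I ==> j \<in> I ==> F i (b j) \<noteq> 0 ==> j = i \<or> (j, i) \<in> r"
  and lin: "\<And>i c. i \<in> I ==> F i (%y. \<Sum>j\<in>I. c j * b j y) = (\<Sum>j\<in>I. c j * F i (b j))" and F0: "\<And>i. i \<in> I ==> F i (%_. 0) = 0"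
  and supp: "\<And>i y. i \<in> I ==> y \<notin> W ==> b i y = 0" and v: "\<And>y. y \<notin> W ==> v y = 0"
 shows "\<exists>c. v = (%y. \<Sum>i\<in>I. c i * b i y)"
proof -
 interpret V: vector_space "%(c::'k) (f::'a => 'k) x. c * f x" by (rule fun_vector_space)
 have inj: "inj_on b I"
 proof (rule inj_onI, rule ccontr)
  fix i j assume ij: "i \<in> I" "j \<in> I" "b i = b j" "i \<noteq> j"
  hence "(j, i) \<in> r" "(i, j) \<in> r" using tri[of i j] tri[of j i] diag[of i] diag[of j] by auto
  thus False using wf_asym[OF wf] by blast
 qed
 have comb: "(\<Sum>x\<in>b ` I. (%y. u x * x y)) = (%y. \<Sum>i\<in>I. u (b i) * b i y)" for u
  by (rule ext) (simp add: sum_fun_apply sum.reindex[OF inj])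
 have indep: "V.independent (b ` I)"
 proof -
  have "u x = 0" if u: "(\<Sum>x\<in>b ` I. (%y. u x * x y)) = 0" and x: "x \<in> b ` I" for u x
  proof -
   have "(\<Sum>j\<in>I. u (b j) * F i (b j)) = 0" if "i \<in> I" for i
    using lin[OF that, of "%j. u (b j)"] u F0[OF that] unfolding comb by (simp add: zero_fun_def)
   hence "u (b i) = 0" if "i \<in> I" for i
    using triangular_vanish[where a = "%i j. F i (b j)" and J = I, OF I wf _ _ diag tri, of "%j. u (b j)" i] that by auto
   thus ?thesis using x by blast
  qed
  thus ?thesis using V.dependent_finite[OF finite_imageI[OF I], of b] by blast
 qed
 define \<delta> :: "'a => 'a => 'k" where "\<delta> w y = (if y = w then 1 else 0)" for w y
 have sp: "x \<in> V.span (\<delta> ` W)" if x: "\<And>y. y \<notin> W ==> x y = 0" for x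
 proof -
  have e: "x = (\<Sum>w\<in>W. (%y. x w * \<delta> w y))"
  proof
   fix y show "x y = (\<Sum>w\<in>W. (%y. x w * \<delta> w y)) y"
    using x[of y] W(1) by (cases "y \<in> W") (simp_all add: sum_fun_apply \<delta>_def if_distrib sum.delta cong: if_cong)
  qed
  show ?thesis by (subst e) (intro V.span_sum V.span_scale V.span_base imageI)
 qed
 have "v \<in> V.span (b ` I)"
 proof (rule ccontr)
  assume n: "v \<notin> V.span (b ` I)"
  hence "V.independent (insert v (b ` I))" using indep by (rule V.independent_insertI)
  moreover have "insert v (b ` I) \<subseteq> V.span (\<delta> ` W)" using sp v supp by blast
  ultimately have "card (insert v (b ` I)) \<le> card (\<delta> ` W)" using V.independent_span_bound W(1) by blast
  moreover have "v \<notin> b ` I" using n V.span_base by blast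
  ultimately show False using I W card_image[OF inj] card_image_le[OF W(1), of \<delta>] by simp
 qed
 then obtain u where "v = (\<Sum>x\<in>b ` I. (%y. u x * x y))" using V.span_finite[OF finite_imageI[OF I]] by auto
 thus ?thesis unfolding comb by (intro exI[of _ "%i. u (b i)"])
qed

text \<open>A linear form on a subspace extends to the whole space of functions, where it is given
  by coordinates. For the Specht module this lifts a form to all combinations of tabloids.\<close>

lemma functional_extension:
 fixes V :: "('a => 'k::field) set"
 assumes X: "finite X" and supp: "\<And>v y. v \<in> V ==> y \<notin> X ==> v y = 0"
  and V0: "(%_. 0) \<in> V" and add: "\<And>v w. v \<in> V ==> w \<in> V ==> (%y. v y + w y) \<in> V" and scale: "\<And>c v. v \<in> V ==> (%y. c * v y) \<in> V"
  and \<phi>: "\<And>v w. v \<in> V ==> w \<in> V ==> \<phi> (%y. v y + w y) = \<phi> v + \<phi> w" "\<And>c v. v \<in> V ==> \<phi> (%y. c * v y) = c * (\<phi> v :: 'k)"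
 shows "\<exists>x. \<forall>v\<in>V. \<phi> v = (\<Sum>y\<in>X. x y * v y)"
proof -
 interpret P: vector_space_pair "%(c::'k) (f::'a => 'k) x. c * f x" "(*)"
  unfolding vector_space_pair_def by (auto simp: fun_vector_space vector_space_def algebra_simps)
 obtain B where B: "B \<subseteq> V" "P.vs1.independent B" "V \<subseteq> P.vs1.span B" by (rule P.vs1.maximal_independent_subset)
 obtain g where g: "Vector_Spaces.linear (%c f x. c * f x) (*) g" "\<forall>x\<in>B. g x = \<phi> x" using P.linear_independent_extend[OF B(2)] by blast
 interpret g: Vector_Spaces.linear "%(c::'k) (f::'a => 'k) x. c * f x" "(*)" g by (rule g(1))
 have "v \<in> V \<and> g v = \<phi> v" if "v \<in> P.vs1.span B" for v
  using that
 proof (induction rule: P.vs1.span_induct_alt)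
  case base
  have "\<phi> (%_. 0) = 0" using \<phi>(2)[OF V0, of 0] by simp
  thus ?case using V0 g.zero by (simp add: zero_fun_def)
 next
  case (step c x y)
  hence x: "x \<in> V" "g x = \<phi> x" using B(1) g(2) by auto
  have e: "(%y. c * x y) + y = (%z. c * x z + y z)" by (simp add: plus_fun_def)
  show ?case unfolding g.add g.scale unfolding e using step.IH x add[OF scale[OF x(1)]] \<phi>(1)[OF scale[OF x(1)]] \<phi>(2)[OF x(1)] by simp
 qed
 hence V: "\<phi> v = g v" if "v \<in> V" for v using that B(3) by auto
 have "g v = (\<Sum>y\<in>X. g (%z. if z = y then 1 else 0) * v y)" if "v \<in> V" for v
 proof -
  have "v = (\<Sum>y\<in>X. (%z. v y * (if z = y then 1 else 0)))"
  proof
   fix z show "v z = (\<Sum>y\<in>X. (%z. v y * (if z = y then 1 else 0))) z"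
    using supp[OF that, of z] X by (cases "z \<in> X") (simp_all add: sum_fun_apply if_distrib sum.delta cong: if_cong)
  qed
  hence "g v = (\<Sum>y\<in>X. g (%z. v y * (if z = y then 1 else 0)))" using g.sum by metis
  thus ?thesis unfolding g.scale by (simp add: mult.commute)
 qed
 thus ?thesis using V by (intro exI[of _ "%y. g (%z. if z = y then 1 else 0)"]) simp
qed

text \<open>The letter \<open>k\<close> of a chain of content \<open>(1, ..., 1)\<close> becomes the
  entry \<open>k + 1\<close>. Entries thus decrease along rows and columns, in agreement with the
  convention for \<open>sst\<close>.\<close>

definition std_tableau :: "(nat => nat => nat) => nat list list" where
 "std_tableau R = map (%i. map (%j. Suc (LEAST k. R (Suc k) i \<le> j)) [0..<R 0 i]) [0..<length (plist (R 0))]"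

lemma std_tableau:
 assumes R: "R \<in> sst (replicate n 1) \<rho>" and \<rho>: "\<rho> \<in> Par n"
 shows "std_tableau R \<in> tableaux n (plist \<rho>)" "sword n R (std_tableau R) = (\<lambda>a\<in>{1..n}. a - 1)"
proof -
 have s: "sum_list (drop k (replicate n 1)) = n - k" for k by (simp add: sum_list_replicate)
 have R0: "R 0 = \<rho>" by (rule sst_0[OF R])
 have P: "R k \<in> Par (n - k)" and hs: "hstrip (R (Suc k)) (R k)" for k using sst_D[OF R, of k] \<rho> s[of k] s[of 0] by auto
 have mono: "R k' i \<le> R k i" if "k \<le> k'" for k k' i
  by (rule lift_Suc_antimono_le[of "%k. R k i", OF _ that]) (use hs in \<open>auto simp: hstrip_def\<close>)
 let ?t = "std_tableau R"
 have nth: "?t ! i ! j = Suc (LEAST k. R (Suc k) i \<le> j)" if "i < length (plist \<rho>)" "j < \<rho> i" for i j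
  using that R0 by (simp add: std_tableau_def)
 have len: "map length ?t = plist \<rho>"
  by (rule nth_equalityI) (simp_all add: std_tableau_def R0 plist(2)[OF \<rho>])
 have rows: "length ?t = length (plist \<rho>)" "length (?t ! i) = \<rho> i" if "i < length (plist \<rho>)" for i
  using that by (simp_all add: std_tableau_def R0)
 have rows0: "length ?t = length (plist \<rho>)" by (simp add: std_tableau_def R0)
 have "set (concat ?t) = {1..n}"
 proof (intro equalityI subsetI)
  fix x assume "x \<in> set (concat ?t)"
  then obtain i j where ij: "i < length (plist \<rho>)" "j < \<rho> i" "x = ?t ! i ! j"
   unfolding set_concat using rows rows0 by (auto simp: in_set_conv_nth)
  have "n \<noteq> 0" using ij(2) ParD(2)[OF \<rho>, of i] by (cases n) auto
  moreover have "R n i = 0" using ParD(2)[OF P[of n]] by simp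
  ultimately have "(LEAST k. R (Suc k) i \<le> j) \<le> n - 1" by (intro Least_le) simp
  thus "x \<in> {1..n}" using ij nth[OF ij(1,2)] \<open>n \<noteq> 0\<close> by simp
 next
  fix a assume a: "a \<in> {1..n}"
  define k where "k = a - 1"
  have k: "k < n" "a = Suc k" using a by (auto simp: k_def)
  have "\<exists>i. R (Suc k) i < R k i"
  proof (rule ccontr)
   assume "\<not> ?thesis"
   hence "R (Suc k) = R k" using mono[of k "Suc k"] by (intro ext antisym) (auto simp: not_less)
   thus False using ParD(3)[OF P[of k], of n] ParD(3)[OF P[of "Suc k"], of n] k by simp
  qed
  then obtain i where i: "R (Suc k) i < R k i" by blast
  let ?j = "R (Suc k) i"
  have j: "?j < \<rho> i" using i mono[of 0 k i] R0 by simp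
  hence il: "i < length (plist \<rho>)" using plist(1)[OF \<rho>] by simp
  have "(LEAST k. R (Suc k) i \<le> ?j) = k"
  proof (rule Least_equality)
   fix k' assume "R (Suc k') i \<le> ?j"
   thus "k \<le> k'" using i mono[of "Suc k'" k i] by (cases "k \<le> k'") auto
  qed simp
  hence "?t ! i ! ?j = a" using nth[OF il j] k by simp
  moreover have "?t ! i ! ?j \<in> set (?t ! i)" "?t ! i \<in> set ?t" using rows[OF il] il j by simp_all
  ultimately show "a \<in> set (concat ?t)" by auto
 qed
 moreover have "length (concat ?t) = n" using len plist(3)[OF \<rho>] by (simp add: length_concat is_partition_def)
 ultimately show t: "?t \<in> tableaux n (plist \<rho>)" using len by (simp add: tableaux_def card_distinct)
 show "sword n R ?t = (\<lambda>a\<in>{1..n}. a - 1)"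
 proof (rule ext)
  fix a show "sword n R ?t a = (\<lambda>a\<in>{1..n}. a - 1) a"
  proof (cases "a \<in> {1..n}")
   case True
   note c = tableau_cell[OF t True]
   have "a = Suc (LEAST k. R (Suc k) (trow (tabloid ?t) a) \<le> tcol ?t a)"
    using nth[OF c(1)] c(2,3) plist(2)[OF \<rho> c(1)] by simp
   thus ?thesis using True by (simp add: sword_def)
  qed (simp only: sword_def restrict_apply if_False)
 qed
qed

lemma sst_tableau_std: "R \<in> sst (replicate n 1) \<rho> ==> \<rho> \<in> Par n ==> sst_tableau n (replicate n 1) \<rho> R (std_tableau R)"
 using std_tableau(1) by unfold_locales (auto simp: sum_list_replicate)

lemma id_column_stabilizer: "id \<in> column_stabilizer n t"
 by (simp add: column_stabilizer_def permutes_id)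

text \<open>The dominance relation between a polytabloid and its tabloids is another instance of
  \<open>filling_le\<close>: the filling is \<open>a - 1\<close> at the entry \<open>a\<close>, and
  the column permutation is the identity.\<close>

lemma polytabloid_std_le:
 assumes R: "R \<in> sst (replicate n 1) \<rho>" and R': "R' \<in> sst (replicate n 1) \<rho>" and \<rho>: "\<rho> \<in> Par n"
  and ne: "polytabloid n (std_tableau R) (tabloid (std_tableau R')) \<noteq> (0::'k::field)"
 shows "psum R' i k \<le> psum R i k"
proof -
 interpret A: sst_tableau n "replicate n 1" \<rho> R "std_tableau R" by (rule sst_tableau_std[OF R \<rho>])
 interpret B: sst_tableau n "replicate n 1" \<rho> R' "std_tableau R'" by (rule sst_tableau_std[OF R' \<rho>])
 have "\<exists>\<pi>\<in>column_stabilizer n (std_tableau R). tabloid (std_tableau R') = map (image \<pi>) (tabloid (std_tableau R))"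
 proof (rule ccontr)
  assume "\<not> ?thesis"
  hence "polytabloid n (std_tableau R) (tabloid (std_tableau R')) = (0::'k)"
   unfolding polytabloid_def by (intro sum.neutral) (auto simp: basis_vec_def)
  thus False using ne by blast
 qed
 hence "col_injective n (tabloid (std_tableau R')) (std_tableau R)" using A.col_injective_tabloid by metis
 from column_filling.filling_le[OF A.filling[OF id_column_stabilizer this], of i k] A.card_sword[of i k] B.card_sword[of i k]
 show ?thesis unfolding std_tableau(2)[OF R \<rho>] std_tableau(2)[OF R' \<rho>] by simp
qed

text \<open>A permutation preserving both the rows and the columns of \<open>t\<close> is the
  identity, so its tabloid occurs exactly once, with sign 1.\<close>

lemma polytabloid_diag:
 assumes t: "t \<in> tableaux n \<mu>"
 shows "polytabloid n t (tabloid t) = (1::'k::field)"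
proof -
 have "tabloid t = map (image \<pi>) (tabloid t) \<longleftrightarrow> \<pi> = id" if "\<pi> \<in> column_stabilizer n t" for \<pi>
 proof
  assume e: "tabloid t = map (image \<pi>) (tabloid t)"
  have p: "\<pi> permutes {1..n}" "\<forall>a\<in>{1..n}. tcol t (\<pi> a) = tcol t a" using that by (auto simp: column_stabilizer_iff[OF t])
  have "\<pi> a = a" if a: "a \<in> {1..n}" for a
  proof -
   have "trow (tabloid t) (\<pi> a) = trow (tabloid t) a"
    using trow_image[OF p(1), of "tabloid t" "\<pi> a"] e permutes_inverses(2)[OF p(1)] by simp
   moreover have "tcol t (\<pi> a) = tcol t a" using p(2) a by blast
   moreover have "\<pi> a \<in> {1..n}" using permutes_in_image[OF p(1)] a by blast
   ultimately show ?thesis using tableau_cell(3)[OF t] a by metis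
  qed
  thus "\<pi> = id" using permutes_not_in[OF p(1)] by (metis eq_id_iff)
 qed simp
 hence "polytabloid n t (tabloid t) = (\<Sum>\<pi>\<in>column_stabilizer n t. if \<pi> = id then 1 else (0::'k))"
  unfolding polytabloid_def by (intro sum.cong refl) (auto simp: basis_vec_def sign_id)
 thus ?thesis using finite_column_stabilizer[OF t] id_column_stabilizer by (simp add: sum.delta)
qed

text \<open>Adding up all partial sums turns the dominance order on chains into a strictly
  increasing natural number, and so into a well-founded comparison.\<close>

definition key :: "nat => nat => (nat => nat => nat) => nat" where
 "key n K S = (\<Sum>k<K. \<Sum>i<n. psum S i k)"

text \<open>If the totals of termwise comparable sums agree, then all partial sums agree, and so do
  the shapes for \<open>k < K\<close> and \<open>i < n\<close>; outside this range both chains are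
  zero.\<close>

lemma key_less:
 assumes S: "S \<in> sst ms \<rho>" "\<rho> \<in> Par n" "sum_list ms = n" "length ms \<le> K"
  and S': "S' \<in> sst ms' \<rho>'" "\<rho>' \<in> Par n" "sum_list ms' = n" "length ms' \<le> K"
  and le: "\<And>i k. psum S i k \<le> psum S' i k" and ne: "S \<noteq> S'"
 shows "key n K S < key n K S'"
proof (rule ccontr)
 assume "\<not> key n K S < key n K S'"
 moreover have "key n K S \<le> key n K S'" unfolding key_def by (intro sum_mono le)
 ultimately have e: "key n K S = key n K S'" by simp
 have ps: "psum S i k = psum S' i k" if "k < K" "i < n" for i k
 proof -
  have "(\<Sum>i<n. psum S i k) = (\<Sum>i<n. psum S' i k)"
   by (rule sum_mono_inv[OF e[unfolded key_def]]) (use that in \<open>auto intro: sum_mono le\<close>)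
  thus ?thesis by (rule sum_mono_inv) (use that le in auto)
 qed
 have out: "T k i = 0" if "T \<in> sst js \<rho>" "\<rho> \<in> Par n" "sum_list js = n" "length js \<le> K" "k \<ge> K \<or> i \<ge> n" for T js \<rho> k i
 proof -
  have P: "T k \<in> Par (sum_list (drop k js))" using sst_D[OF that(1), of k] that(2,3) by simp
  have "sum_list (take k js) + sum_list (drop k js) = n" using that(3) by (metis append_take_drop_id sum_list_append)
  thus ?thesis using that(4,5) ParD(2)[OF P, of i] by auto
 qed
 have "S k i = S' k i" for k i
 proof (cases "k < K \<and> i < n")
  case True
  thus ?thesis using ps[of k i] ps[of k "i - 1"] by (cases i) (auto simp: psum_def)
 next
  case False thus ?thesis using out[OF S, of k i] out[OF S', of k i] by auto
 qed
 thus False using ne by blast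
qed

lemma pairing_sum: "pairing n S t (%w. \<Sum>j\<in>A. c j * u j w) = (\<Sum>j\<in>A. c j * (pairing n S t (u j) :: 'k::field))"
 unfolding pairing_def sum_distrib_left by (subst sum.swap) (simp add: mult_ac)

section \<open>The triangular basis\<close>

locale word_modules =
 fixes n :: nat and \<nu>s :: "nat list list" and ty :: "'k::field itself"
 assumes sums: "\<nu> \<in> set \<nu>s ==> sum_list \<nu> = n"
begin

definition "Y = (SIGMA i:{..<length \<nu>s}. words n (\<nu>s ! i))"
text \<open>Each element will contribute one dual Specht module to the filtration, for the outermost
  shape \<open>sh x\<close> of its chain.\<close>

definition "Sig = (SIGMA i:{..<length \<nu>s}. \<Union>\<rho>\<in>Par n. sst (\<nu>s ! i) \<rho>)"
abbreviation "M \<equiv> fun_module n Y (%\<pi> (i, w). (i, w \<circ> \<pi>)) :: ((nat => nat) => 'k, nat \<times> (nat => nat) => 'k) module"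
abbreviation "sh x \<equiv> snd x 0"
abbreviation "tx x \<equiv> tableaux n (plist (sh x))"
definition ev :: "nat \<times> (nat => nat => nat) => nat list list => (nat \<times> (nat => nat) => 'k) => 'k" where
 "ev x t v = pairing n (snd x) t (%w. v (fst x, w))"
text \<open>The image of the tabloid \<open>T\<close> under the semistandard homomorphism belonging
  to the chain: the sum of all words of the summand with the row contents of the chain along
  \<open>T\<close>.\<close>

definition bv :: "nat \<times> (nat => nat => nat) => nat set list => nat \<times> (nat => nat) => 'k" where
 "bv x T y = (if fst y = fst x \<and> y \<in> Y \<and> matches n (snd x) T (snd y) then 1 else 0)"
text \<open>The bound on the length covers the contents in \<open>\<nu>s\<close> and also
  \<open>(1, ..., 1)\<close> of length \<open>n\<close>, so that one function orders the
  semistandard and the standard chains.\<close>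

definition "kk x = key n (n + sum_list (map length \<nu>s)) x"

lemma SigD:
 assumes "x \<in> Sig"
 shows "fst x < length \<nu>s" "snd x \<in> sst (\<nu>s ! fst x) (sh x)" "sh x \<in> Par n" "sum_list (\<nu>s ! fst x) = n"
  "length (\<nu>s ! fst x) \<le> n + sum_list (map length \<nu>s)" "t \<in> tx x ==> sst_tableau n (\<nu>s ! fst x) (sh x) (snd x) t"
proof -
 obtain \<rho> where i: "fst x < length \<nu>s" and \<rho>: "\<rho> \<in> Par n" "snd x \<in> sst (\<nu>s ! fst x) \<rho>" using assms by (auto simp: Sig_def)
 have "\<rho> = sh x" using sst_0[OF \<rho>(2)] by simp
 thus a: "snd x \<in> sst (\<nu>s ! fst x) (sh x)" "sh x \<in> Par n" "fst x < length \<nu>s" using i \<rho> by auto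
 show s: "sum_list (\<nu>s ! fst x) = n" using sums i by simp
 have "length (\<nu>s ! fst x) \<in> set (map length \<nu>s)" using i by simp
 thus "length (\<nu>s ! fst x) \<le> n + sum_list (map length \<nu>s)" using member_le_sum_list[of "length (\<nu>s ! fst x)"] trans_le_add2 by blast
 show "t \<in> tx x ==> sst_tableau n (\<nu>s ! fst x) (sh x) (snd x) t" by unfold_locales (use s a in auto)
qed

lemma ev_sum: "ev x t (%y. \<Sum>j\<in>A. c j * u j y) = (\<Sum>j\<in>A. c j * ev x t (u j))"
 unfolding ev_def by (rule pairing_sum)

lemma ev_zero: "ev x t (%_. 0) = 0"
 using ev_sum[of x t "%_. 0" "%_ _. 0" "{}"] by simp

lemma ev_add: "ev x t (%y. v y + w y) = ev x t v + ev x t w"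
 using ev_sum[of x t "%_. 1" "%b. if b then v else w" UNIV] by (simp add: UNIV_bool add.commute)

lemma ev_bv:
 assumes x: "x \<in> Sig" and x': "x' \<in> Sig" and t: "t \<in> tx x"
 shows "ev x t (bv x' T) = (if fst x' = fst x then pairing n (snd x) t (%w. if matches n (snd x') T w then 1 else 0) else 0)"
proof -
 interpret sst_tableau n "\<nu>s ! fst x" "sh x" "snd x" t by (rule SigD(6)[OF x t])
 have "(fst x, sword n (snd x) t \<circ> pinv \<pi>) \<in> Y" if "\<pi> \<in> column_stabilizer n t" for \<pi>
  using that words_comp[OF sword_words permutes_inv] SigD(1)[OF x] by (auto simp: Y_def column_stabilizer_iff[OF t])
 thus ?thesis unfolding ev_def pairing_def bv_def by (auto intro!: sum.cong sum.neutral)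
qed

text \<open>If the chains agree, a nonzero value requires the same summand, so
  \<open>x' = x\<close>. If they differ, the dominance from \<open>pairing_le\<close> becomes strict
  in \<open>kk\<close>.\<close>

lemma ev_bv_nonzero:
 assumes x: "x \<in> Sig" and x': "x' \<in> Sig" and t: "t \<in> tx x" and ne: "ev x t (bv x' T) \<noteq> 0"
 shows "x' = x \<or> kk (snd x') < kk (snd x)"
proof (cases "snd x' = snd x")
 case True thus ?thesis using ne unfolding ev_bv[OF x x' t] by (auto split: if_splits simp: prod_eq_iff)
next
 case False
 interpret sst_tableau n "\<nu>s ! fst x" "sh x" "snd x" t by (rule SigD(6)[OF x t])
 have "pairing n (snd x) t (%w. if matches n (snd x') T w then 1 else 0) \<noteq> (0::'k)"
  using ne unfolding ev_bv[OF x x' t] by (auto split: if_splits)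
 from pairing_le[OF this] have "kk (snd x') < kk (snd x)" unfolding kk_def
  by (intro key_less[OF SigD(2-5)[OF x'] SigD(2-5)[OF x]] False)
 thus ?thesis by blast
qed

lemma ev_bv_same:
 assumes x: "x \<in> Sig" and t: "t \<in> tx x" and T: "T \<in> tabloid ` tx x"
 shows "ev x t (bv x T) = polytabloid n t T"
proof -
 interpret sst_tableau n "\<nu>s ! fst x" "sh x" "snd x" t by (rule SigD(6)[OF x t])
 show ?thesis using pairing_polytabloid[OF T, where 'k = 'k] by (simp add: ev_bv[OF x x t])
qed

definition "I = (SIGMA x:Sig. sst (replicate n 1) (sh x))"
definition "bb p = bv (fst p) (tabloid (std_tableau (snd p)))"
text \<open>Lexicographic, with the semistandard chain first and the standard chain within it.
  Distinct \<open>x\<close> with equal \<open>kk\<close> are not comparable; by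
  \<open>ev_bv_nonzero\<close> the pairings between them vanish.\<close>

definition "r = {(p', p). kk (snd (fst p')) < kk (snd (fst p)) \<or> fst p' = (fst p :: nat \<times> (nat => nat => nat)) \<and> kk (snd p') < kk (snd p)}"

lemma finite_Sig: "finite Sig"
 unfolding Sig_def using card_sst by (intro finite_SigmaI finite_UN_I) auto

lemma finite_I: "finite I"
 unfolding I_def using card_sst finite_Sig by (intro finite_SigmaI) auto

lemma wf_r: "wf r"
 by (rule wf_subset[OF wf_inv_image[OF wf_lex_prod[OF wf_less_than wf_less_than], of "%p. (kk (snd (fst p)), kk (snd p))"]])
  (auto simp: r_def)

lemma card_I: "card I = card Y"
proof -
 have "card I = (\<Sum>x\<in>Sig. std_count n (sh x))" unfolding I_def
  using card_sst finite_Sig by (subst card_SigmaI) (auto simp: std_count_def)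
 also have "\<dots> = (\<Sum>i<length \<nu>s. \<Sum>S\<in>(\<Union>\<rho>\<in>Par n. sst (\<nu>s ! i) \<rho>). std_count n (S 0))"
  unfolding Sig_def using card_sst by (subst sum.Sigma) (auto simp: case_prod_beta)
 also have "\<dots> = (\<Sum>i<length \<nu>s. card (words n (\<nu>s ! i)))"
 proof (rule sum.cong[OF refl])
  fix i assume "i \<in> {..<length \<nu>s}"
  hence s: "sum_list (\<nu>s ! i) = n" using sums by simp
  have "(\<Sum>S\<in>(\<Union>\<rho>\<in>Par n. sst (\<nu>s ! i) \<rho>). std_count n (S 0)) = (\<Sum>\<rho>\<in>Par n. \<Sum>S\<in>sst (\<nu>s ! i) \<rho>. std_count n (S 0))"
   by (rule sum.UNION_disjoint) (use card_sst in \<open>auto simp: disjoint_iff dest: sst_0\<close>)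
  also have "\<dots> = (\<Sum>\<rho>\<in>Par n. kostka (\<nu>s ! i) \<rho> * std_count n \<rho>)"
  proof (rule sum.cong[OF refl])
   fix \<rho>
   have "(\<Sum>S\<in>sst (\<nu>s ! i) \<rho>. std_count n (S 0)) = (\<Sum>S\<in>sst (\<nu>s ! i) \<rho>. std_count n \<rho>)"
    by (intro sum.cong refl) (simp add: sst_0)
   thus "(\<Sum>S\<in>sst (\<nu>s ! i) \<rho>. std_count n (S 0)) = kostka (\<nu>s ! i) \<rho> * std_count n \<rho>" using card_sst by simp
  qed
  finally show "(\<Sum>S\<in>(\<Union>\<rho>\<in>Par n. sst (\<nu>s ! i) \<rho>). std_count n (S 0)) = card (words n (\<nu>s ! i))" using sum_kostka_std[OF s] by simp
 qed
 also have "\<dots> = card Y" unfolding Y_def by (subst card_SigmaI) auto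
 finally show ?thesis .
qed

lemma I_D:
 assumes "p \<in> I"
 shows "fst p \<in> Sig" "snd p \<in> sst (replicate n 1) (sh (fst p))" "std_tableau (snd p) \<in> tx (fst p)"
 using assms std_tableau(1) SigD(3) unfolding I_def by auto

lemma tri:
 assumes "p \<in> I" "p' \<in> I" "ev (fst p) (std_tableau (snd p)) (bb p') \<noteq> 0"
 shows "p' = p \<or> (p', p) \<in> r"
proof (cases "fst p' = fst p \<and> snd p' \<noteq> snd p")
 case False
 thus ?thesis using ev_bv_nonzero[OF I_D(1)[OF assms(1)] I_D(1)[OF assms(2)] I_D(3)[OF assms(1)]] assms(3)
  by (auto simp: r_def bb_def prod_eq_iff)
next
 case True
 note p = I_D[OF assms(1)] and p' = I_D[OF assms(2)]
 have P: "sh (fst p) \<in> Par n" by (rule SigD(3)[OF p(1)])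
 have "polytabloid n (std_tableau (snd p)) (tabloid (std_tableau (snd p'))) \<noteq> (0::'k)"
  using assms(3) ev_bv_same[OF p(1,3), of "tabloid (std_tableau (snd p'))"] p'(3) True by (simp add: bb_def)
 from polytabloid_std_le[OF p(2) _ P this] p'(2) True
 have "kk (snd p') < kk (snd p)" unfolding kk_def
  by (intro key_less[OF _ P _ _ p(2) P]) (auto simp: sum_list_replicate)
 thus ?thesis using True by (simp add: r_def)
qed

lemma diag: "p \<in> I ==> ev (fst p) (std_tableau (snd p)) (bb p) = 1"
 using ev_bv_same[OF I_D(1,3), of p "tabloid (std_tableau (snd p))"] polytabloid_diag[OF I_D(3)] I_D(3) by (simp add: bb_def)

lemma expand: "v \<in> carrier M ==> \<exists>c. v = (%y. \<Sum>p\<in>I. c p * bb p y)"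
 by (rule triangular_spanning[where F = "%p. ev (fst p) (std_tableau (snd p))", OF finite_I _ card_I wf_r diag tri ev_sum ev_zero])
  (auto simp: Y_def bb_def bv_def fun_module_simps)

end

section \<open>The filtration and its quotients\<close>

context word_modules
begin

text \<open>Listed with \<open>kk\<close> decreasing, so that the functionals at later places vanish
  on the vectors at earlier ones.\<close>

definition "xs = rev (sort_key (%x. kk (snd x)) (SOME l. distinct l \<and> set l = Sig))"
definition "U k = {v \<in> carrier M. \<forall>a. k \<le> a \<and> a < length xs --> (\<forall>t\<in>tx (xs ! a). ev (xs ! a) t v = 0)}"

abbreviation (input) "ts k \<equiv> tx (xs ! k)"
abbreviation (input) "tt k \<equiv> tabloid ` ts k"

lemma xs: "distinct xs" "set xs = Sig" "kk (snd (xs ! a)) < kk (snd (xs ! b)) ==> a < length xs ==> b < length xs ==> b < a"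
proof -
 have l: "distinct (SOME l. distinct l \<and> set l = Sig) \<and> set (SOME l. distinct l \<and> set l = Sig) = Sig"
  by (rule someI_ex) (use finite_distinct_list[OF finite_Sig] in blast)
 thus "distinct xs" "set xs = Sig" by (simp_all add: xs_def)
 have "sorted (map (%x. kk (snd x)) (rev xs))" by (simp add: xs_def)
 hence "sorted_wrt (%x y. kk (snd y) \<le> kk (snd x)) xs" by (simp add: sorted_map sorted_wrt_rev)
 hence le: "kk (snd (xs ! b)) \<le> kk (snd (xs ! a))" if "a < b" "b < length xs" for a b using that by (simp add: sorted_wrt_iff_nth_less)
 assume "kk (snd (xs ! a)) < kk (snd (xs ! b))" "a < length xs" "b < length xs"
 thus "b < a" using le[of a b] by (cases a b rule: linorder_cases) auto
qed

lemma xs_Sig: "k < length xs ==> xs ! k \<in> Sig"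
 using xs(2) nth_mem by blast

lemma xs_nth: "x \<in> Sig ==> \<exists>a<length xs. x = xs ! a"
 using in_set_conv_nth[of x xs] xs(2) by auto

text \<open>A smaller \<open>kk\<close> means a later place, so the indices at places from
  \<open>k\<close> on are closed downwards in \<open>r\<close>. The vanishing functionals therefore
  form a triangular system for just these coefficients.\<close>

lemma U_coefficients:
 assumes v: "v = (%y. \<Sum>p\<in>I. c p * bb p y)" and U: "v \<in> U k" and p: "p \<in> I" "fst p = xs ! a" "k \<le> a" "a < length xs"
 shows "c p = 0"
proof -
 let ?J = "{p \<in> I. \<exists>a\<ge>k. a < length xs \<and> fst p = xs ! a}"
 show ?thesis
 proof (rule triangular_vanish[where J = ?J and a = "%p p'. ev (fst p) (std_tableau (snd p)) (bb p')", OF finite_I wf_r _ _ diag tri])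
  show "?J \<subseteq> I" by blast
  show "p \<in> ?J" using p by blast
  show "p' \<in> ?J" if h: "p \<in> ?J" "p' \<in> I" "(p', p) \<in> r" for p p'
  proof (cases "fst p' = fst p")
   case False
   obtain a where a: "k \<le> a" "a < length xs" "fst p = xs ! a" using h(1) by blast
   obtain a' where a': "a' < length xs" "fst p' = xs ! a'" using xs_nth[OF I_D(1)[OF h(2)]] by blast
   have "a < a'" by (rule xs(3)) (use h(3) False a a' in \<open>auto simp: r_def\<close>)
   thus ?thesis using h(2) a a' by (auto intro!: exI[of _ a'])
  qed (use h in auto)
  show "(\<Sum>j\<in>I. c j * ev (fst p) (std_tableau (snd p)) (bb j)) = 0" if "p \<in> ?J" for p
   unfolding ev_sum[symmetric] v[symmetric] using U that I_D(3)[of p] unfolding U_def by auto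
 qed
qed

lemma U_0: "U 0 = {%_. 0}"
proof (intro equalityI subsetI)
 fix v assume v: "v \<in> U 0"
 hence "v \<in> carrier M" by (simp add: U_def)
 then obtain c where c: "v = (%y. \<Sum>p\<in>I. c p * bb p y)" using expand by blast
 have "c p = 0" if p: "p \<in> I" for p
 proof -
  obtain a where "a < length xs" "fst p = xs ! a" using xs_nth[OF I_D(1)[OF p]] by blast
  thus ?thesis using U_coefficients[OF c v p] by blast
 qed
 thus "v \<in> {%_. 0}" unfolding c by simp
qed (simp add: U_def fun_module_simps ev_zero)

lemma U_length: "U (length xs) = carrier M"
 by (auto simp: U_def)

lemma U_Suc: "k \<le> k' ==> U k \<subseteq> U k'"
 by (auto simp: U_def)

lemma U_subset: "U k \<subseteq> carrier M"
 by (auto simp: U_def)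

lemma U_add: "v \<in> U k ==> w \<in> U k ==> (%y. v y + w y) \<in> U k"
 by (simp add: U_def fun_module_simps ev_add)

lemma ev_smult:
 assumes x: "x \<in> Sig" and t: "t \<in> tx x"
 shows "ev x t (f \<odot>\<^bsub>M\<^esub> v) = (\<Sum>\<pi>\<in>Sym n. f \<pi> * ev x (map (map \<pi>) t) v)"
proof -
 have "ev x t (f \<odot>\<^bsub>M\<^esub> v) = (\<Sum>\<pi>\<in>Sym n. f \<pi> * pairing n (snd x) t (%w. v (fst x, w \<circ> pinv \<pi>)))"
  by (simp add: ev_def fun_module_simps pairing_sum)
 also have "\<dots> = (\<Sum>\<pi>\<in>Sym n. f \<pi> * ev x (map (map \<pi>) t) v)"
  by (intro sum.cong refl) (simp add: ev_def pairing_image[OF t])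
 finally show ?thesis .
qed

lemma M_smult_closed: "v \<in> carrier M ==> f \<odot>\<^bsub>M\<^esub> v \<in> carrier M"
proof -
 assume v: "v \<in> carrier M"
 have "v (fst y, snd y \<circ> pinv \<pi>) = 0" if y: "y \<notin> Y" and p: "\<pi> permutes {1..n}" for y \<pi>
 proof -
  have "snd y = snd y \<circ> pinv \<pi> \<circ> \<pi>" by (simp add: comp_assoc permutes_inv_o[OF p])
  hence "(fst y, snd y \<circ> pinv \<pi>) \<notin> Y" using y words_comp[OF _ p, of "snd y \<circ> pinv \<pi>" "\<nu>s ! fst y"] by (cases y) (auto simp: Y_def)
  thus ?thesis using v by (simp add: fun_module_simps)
 qed
 thus ?thesis by (auto simp: fun_module_simps intro!: sum.neutral)
qed

lemma U_smult: "v \<in> U k ==> f \<odot>\<^bsub>M\<^esub> v \<in> U k"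
 using M_smult_closed[of v f] ev_smult[OF xs_Sig] tableau_image(1) unfolding U_def by (auto intro!: sum.neutral)

text \<open>Vectors at places after \<open>k\<close> do not occur in \<open>v\<close>, and those at
  places before \<open>k\<close> are not seen by the functionals at \<open>k\<close>. What remains
  are the vectors at \<open>k\<close> itself, whose pairings are coefficients of polytabloids. One
  coordinate vector \<open>x\<close> thus serves all tableaux \<open>t\<close>, and the values
  satisfy every linear relation between the polytabloids.\<close>

lemma U_coordinates:
 assumes k: "k < length xs" and v: "v \<in> U (Suc k)"
 shows "\<exists>x. \<forall>t\<in>ts k. ev (xs ! k) t v = (\<Sum>T\<in>tt k. x T * polytabloid n t T)"
proof -
 let ?x = "xs ! k"
 let ?q = "%p T. fst p = ?x \<and> tabloid (std_tableau (snd p)) = T"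
 note x = xs_Sig[OF k]
 obtain c where c: "v = (%y. \<Sum>p\<in>I. c p * bb p y)" using expand v unfolding U_def by blast
 have "ev ?x t v = (\<Sum>T\<in>tabloid ` tx ?x. (\<Sum>p\<in>I. if ?q p T then c p else 0) * polytabloid n t T)" if t: "t \<in> tx ?x" for t
 proof -
  have "c p * ev ?x t (bb p) = (\<Sum>T\<in>tabloid ` tx ?x. (if ?q p T then c p else 0) * polytabloid n t T)" if p: "p \<in> I" for p
  proof (cases "fst p = ?x")
   case True
   hence T: "tabloid (std_tableau (snd p)) \<in> tabloid ` tx ?x" using I_D(3)[OF p] by auto
   have "(\<Sum>T\<in>tabloid ` tx ?x. (if ?q p T then c p else 0) * polytabloid n t T) =
    (\<Sum>T\<in>tabloid ` tx ?x. if tabloid (std_tableau (snd p)) = T then c p * polytabloid n t T else 0)"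
    using True by (intro sum.cong) auto
   thus ?thesis using T ev_bv_same[OF x t T] True by (simp add: bb_def sum.delta')
  next
   case False
   have "c p * ev ?x t (bb p) = 0"
   proof (rule ccontr)
    assume ne: "\<not> ?thesis"
    hence "kk (snd (fst p)) < kk (snd ?x)" using ev_bv_nonzero[OF x I_D(1)[OF p] t] False by (auto simp: bb_def)
    moreover obtain a where a: "a < length xs" "fst p = xs ! a" using xs_nth[OF I_D(1)[OF p]] by blast
    ultimately have "k < a" using xs(3)[of a k] k by simp
    thus False using U_coefficients[OF c v p a(2)] a(1) ne by simp
   qed
   thus ?thesis using False by (simp add: sum.neutral)
  qed
  hence "ev ?x t v = (\<Sum>p\<in>I. \<Sum>T\<in>tabloid ` tx ?x. (if ?q p T then c p else 0) * polytabloid n t T)"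
   unfolding c ev_sum by simp
  thus ?thesis unfolding sum_distrib_right by (subst sum.swap)
 qed
 thus ?thesis by (intro exI[of _ "%T. \<Sum>p\<in>I. if ?q p T then c p else 0"]) blast
qed

abbreviation "Sp k \<equiv> specht_module n (plist (sh (xs ! k))) :: ((nat => nat) => 'k, nat set list => 'k) module"
abbreviation "D k \<equiv> dual_module n (Sp k)"
text \<open>The coordinates are a choice and in general not unique. The form \<open>H k v\<close>
  does not depend on it, since the polytabloids span the Specht module and its values there are
  those of the functionals.\<close>

definition "X k v = (SOME x. \<forall>t\<in>ts k. ev (xs ! k) t v = (\<Sum>T\<in>tt k. x T * polytabloid n t T))"
definition "H k v = (\<lambda>s\<in>carrier (Sp k). \<Sum>T\<in>tt k. X k v T * s T)"

lemma Sp_simps: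
 "s \<in> carrier (Sp k) \<longleftrightarrow> (\<exists>c. s = (%T. \<Sum>t\<in>ts k. c t * polytabloid n t T))"
 "add (Sp k) = (%v w T. v T + w T)" "f \<odot>\<^bsub>Sp k\<^esub> s = (%T. \<Sum>\<pi>\<in>Sym n. f \<pi> * s (map (image \<pi>) T))"
 by (simp_all add: specht_module_def)

lemma basis_vec_smult:
 assumes "\<sigma> permutes {1..n}" shows "(%\<pi>. c * basis_vec \<sigma> \<pi>) \<odot>\<^bsub>Sp k\<^esub> s = (%T. c * s (map (image \<sigma>) T))"
proof
 fix T
 have "(\<Sum>\<pi>\<in>Sym n. c * basis_vec \<sigma> \<pi> * s (map (image \<pi>) T)) = (\<Sum>\<pi>\<in>Sym n. if \<pi> = \<sigma> then c * s (map (image \<sigma>) T) else 0)"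
  by (intro sum.cong refl) (simp add: basis_vec_def)
 thus "((%\<pi>. c * basis_vec \<sigma> \<pi>) \<odot>\<^bsub>Sp k\<^esub> s) T = c * s (map (image \<sigma>) T)" using assms by (simp add: Sp_simps)
qed

lemma scalar_smult: "(%\<pi>. c * basis_vec id \<pi>) \<odot>\<^bsub>Sp k\<^esub> s = (%T. c * s T)"
 using basis_vec_smult[OF permutes_id, where c = c and k = k and s = s] by simp

lemma polytabloid_in: "t \<in> ts k ==> polytabloid n t \<in> carrier (Sp k)"
proof -
 assume t: "t \<in> ts k"
 have "polytabloid n t T = (\<Sum>t'\<in>ts k. (if t' = t then 1 else 0) * polytabloid n t' T :: 'k)" for T :: "nat set list"
 proof -
  have e: "(\<Sum>t'\<in>ts k. (if t' = t then 1 else 0) * polytabloid n t' T) = (\<Sum>t'\<in>ts k. if t' = t then polytabloid n t T else (0::'k))"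
   by (rule sum.cong) auto
  show ?thesis unfolding e using t by simp
 qed
 thus "polytabloid n t \<in> carrier (Sp k)" unfolding Sp_simps by (intro exI[of _ "%t'. if t' = t then 1 else 0"]) blast
qed

lemma Sp_closed:
 "(%_. 0) \<in> carrier (Sp k)" "s \<in> carrier (Sp k) ==> s' \<in> carrier (Sp k) ==> (%T. s T + s' T) \<in> carrier (Sp k)"
 "s \<in> carrier (Sp k) ==> (%T. c * s T) \<in> carrier (Sp k)"
proof -
 show "(%_. 0) \<in> carrier (Sp k)" unfolding Sp_simps by (intro exI[of _ "%_. 0"]) simp
next
 assume "s \<in> carrier (Sp k)" "s' \<in> carrier (Sp k)"
 then obtain a b where ab: "s = (%T. \<Sum>t\<in>ts k. a t * polytabloid n t T)" "s' = (%T. \<Sum>t\<in>ts k. b t * polytabloid n t T)"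
  unfolding Sp_simps by blast
 show "(%T. s T + s' T) \<in> carrier (Sp k)" unfolding Sp_simps ab
  by (intro exI[of _ "%t. a t + b t"]) (simp add: sum.distrib distrib_right)
next
 assume "s \<in> carrier (Sp k)"
 then obtain a where a: "s = (%T. \<Sum>t\<in>ts k. a t * polytabloid n t T)" unfolding Sp_simps by blast
 show "(%T. c * s T) \<in> carrier (Sp k)" unfolding Sp_simps a
  by (intro exI[of _ "%t. c * a t"]) (simp add: sum_distrib_left mult.assoc)
qed

lemma Sp_sum: "(\<And>i. i \<in> A ==> g i \<in> carrier (Sp k)) ==> (%T. \<Sum>i\<in>A. c i * g i T) \<in> carrier (Sp k)"
 by (induction A rule: infinite_finite_induct) (use Sp_closed in auto)

lemma Sp_combination: "(%T. \<Sum>t\<in>ts k. c t * polytabloid n t T) \<in> carrier (Sp k)"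
 unfolding Sp_simps by blast

lemma Sp_supp: "s \<in> carrier (Sp k) ==> T \<notin> tt k ==> s T = 0"
proof -
 assume s: "s \<in> carrier (Sp k)" and T: "T \<notin> tt k"
 have "polytabloid n t T = (0::'k)" if t: "t \<in> ts k" for t
 proof -
  have "T \<noteq> map (image \<pi>) (tabloid t)" if "\<pi> \<in> column_stabilizer n t" for \<pi>
   using T tableau_image(1,2)[OF t, of \<pi>] that unfolding column_stabilizer_iff[OF t] by (metis imageI)
  thus ?thesis unfolding polytabloid_def by (intro sum.neutral) (auto simp: basis_vec_def)
 qed
 thus "s T = 0" using s unfolding Sp_simps by auto
qed

lemma Sp_permute:
 assumes p: "\<pi> permutes {1..n}"
 shows "(%T. \<Sum>t\<in>ts k. c t * polytabloid n t (map (image (pinv \<pi>)) T)) = (%T. \<Sum>t\<in>ts k. c t * (polytabloid n (map (map \<pi>) t) T :: 'k))"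
  "s \<in> carrier (Sp k) ==> (%T. s (map (image (pinv \<pi>)) T)) \<in> carrier (Sp k)"
proof -
 show e: "(%T. \<Sum>t\<in>ts k. c t * polytabloid n t (map (image (pinv \<pi>)) T)) = (%T. \<Sum>t\<in>ts k. c t * (polytabloid n (map (map \<pi>) t) T :: 'k))" for c
  by (intro ext sum.cong refl) (simp add: polytabloid_image[OF _ p])
 assume "s \<in> carrier (Sp k)"
 then obtain a where a: "s = (%T. \<Sum>t\<in>ts k. a t * polytabloid n t T)" unfolding Sp_simps by blast
 show "(%T. s (map (image (pinv \<pi>)) T)) \<in> carrier (Sp k)" unfolding a e
  by (intro Sp_sum polytabloid_in tableau_image(1)[OF _ p])
qed

lemma D_simps:
 "\<phi> \<in> carrier (D k) \<longleftrightarrow> \<phi> \<in> extensional (carrier (Sp k)) \<and>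
   (\<forall>s\<in>carrier (Sp k). \<forall>s'\<in>carrier (Sp k). \<phi> (%T. s T + s' T) = \<phi> s + \<phi> s') \<and> (\<forall>c. \<forall>s\<in>carrier (Sp k). \<phi> (%T. c * s T) = c * \<phi> s)"
 "\<phi> \<oplus>\<^bsub>D k\<^esub> \<psi> = (\<lambda>s\<in>carrier (Sp k). \<phi> s + \<psi> s)" "\<zero>\<^bsub>D k\<^esub> = (\<lambda>s\<in>carrier (Sp k). 0)"
 "f \<odot>\<^bsub>D k\<^esub> \<phi> = (\<lambda>s\<in>carrier (Sp k). \<Sum>\<pi>\<in>Sym n. f \<pi> * \<phi> (%T. s (map (image (pinv \<pi>)) T)))"
proof -
 have "f \<pi> * \<phi> (basis_vec (pinv \<pi>) \<odot>\<^bsub>Sp k\<^esub> s) = f \<pi> * \<phi> (%T. s (map (image (pinv \<pi>)) T))" if "\<pi> \<in> Sym n" for \<pi> s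
  using basis_vec_smult[where \<sigma> = "pinv \<pi>" and c = 1 and k = k and s = s] that by (simp add: permutes_inv)
 hence "(\<Sum>\<pi>\<in>Sym n. f \<pi> * \<phi> (basis_vec (pinv \<pi>) \<odot>\<^bsub>Sp k\<^esub> s)) = (\<Sum>\<pi>\<in>Sym n. f \<pi> * \<phi> (%T. s (map (image (pinv \<pi>)) T)))" for s
  by (rule sum.cong[OF refl])
 thus "f \<odot>\<^bsub>D k\<^esub> \<phi> = (\<lambda>s\<in>carrier (Sp k). \<Sum>\<pi>\<in>Sym n. f \<pi> * \<phi> (%T. s (map (image (pinv \<pi>)) T)))"
  by (simp add: dual_module_def)
qed (simp_all add: dual_module_def scalar_smult, simp add: Sp_simps(2))

context
 fixes k assumes k: "k < length xs"
begin

lemma X: "v \<in> U (Suc k) ==> t \<in> ts k ==> ev (xs ! k) t v = (\<Sum>T\<in>tt k. X k v T * polytabloid n t T)"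
 using someI_ex[OF U_coordinates[OF k, of v]] unfolding X_def by blast

text \<open>The map \<open>g\<close> prepares for the action of a permutation, which renames the
  tableaux in a combination of polytabloids.\<close>

lemma H_combination:
 assumes v: "v \<in> U (Suc k)" and g: "\<And>t. t \<in> ts k ==> g t \<in> ts k"
 shows "H k v (%T. \<Sum>t\<in>ts k. c t * polytabloid n (g t) T) = (\<Sum>t\<in>ts k. c t * ev (xs ! k) (g t) v)"
proof -
 have "(%T. \<Sum>t\<in>ts k. c t * polytabloid n (g t) T) \<in> carrier (Sp k)" by (intro Sp_sum polytabloid_in g)
 hence "H k v (%T. \<Sum>t\<in>ts k. c t * polytabloid n (g t) T) = (\<Sum>T\<in>tt k. \<Sum>t\<in>ts k. c t * (X k v T * polytabloid n (g t) T))"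
  by (simp add: H_def sum_distrib_left mult_ac)
 also have "\<dots> = (\<Sum>t\<in>ts k. c t * ev (xs ! k) (g t) v)"
  by (subst sum.swap) (simp add: sum_distrib_left[symmetric] X[OF v g])
 finally show ?thesis .
qed

lemma H_polytabloid: "v \<in> U (Suc k) ==> t \<in> ts k ==> H k v (polytabloid n t) = ev (xs ! k) t v"
 by (simp add: H_def polytabloid_in X)

lemma H_eqI:
 assumes v: "v \<in> U (Suc k)" and e: "\<phi> \<in> extensional (carrier (Sp k))"
  and c: "\<And>c. \<phi> (%T. \<Sum>t\<in>ts k. c t * polytabloid n t T) = (\<Sum>t\<in>ts k. c t * ev (xs ! k) t v)"
 shows "H k v = \<phi>"
proof (rule extensionalityI[of _ "carrier (Sp k)"])
 fix s assume "s \<in> carrier (Sp k)"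
 thus "H k v s = \<phi> s" unfolding Sp_simps using H_combination[OF v, of "%t. t"] c by auto
qed (use e in \<open>auto simp: H_def\<close>)

lemma H_dual: "H k v \<in> carrier (D k)"
 unfolding D_simps by (auto simp: H_def Sp_closed sum.distrib sum_distrib_left algebra_simps)

lemma H_add: "v \<in> U (Suc k) ==> w \<in> U (Suc k) ==> H k (%y. v y + w y) = H k v \<oplus>\<^bsub>D k\<^esub> H k w"
 unfolding D_simps
 by (rule H_eqI[OF U_add]) (simp_all add: H_combination[of _ "%t. t"] Sp_combination ev_add sum.distrib distrib_left)

text \<open>Both actions rename tableaux by \<open>\<pi>\<close>: on functions this is
  \<open>ev_smult\<close>, on the Specht module \<open>Sp_permute\<close>.\<close>

lemma H_smult:
 assumes v: "v \<in> U (Suc k)"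
 shows "H k (f \<odot>\<^bsub>M\<^esub> v) = f \<odot>\<^bsub>D k\<^esub> H k v"
proof (rule H_eqI[OF U_smult[OF v]])
 fix c
 let ?s = "%T. \<Sum>t\<in>ts k. c t * polytabloid n t T :: 'k"
 have s: "?s \<in> carrier (Sp k)" by (rule Sp_combination)
 have "(f \<odot>\<^bsub>D k\<^esub> H k v) ?s = (\<Sum>\<pi>\<in>Sym n. f \<pi> * H k v (%T. ?s (map (image (pinv \<pi>)) T)))"
  unfolding D_simps using s by simp
 also have "\<dots> = (\<Sum>\<pi>\<in>Sym n. f \<pi> * (\<Sum>t\<in>ts k. c t * ev (xs ! k) (map (map \<pi>) t) v))"
 proof (intro sum.cong refl)
  fix \<pi> assume "\<pi> \<in> Sym n"
  hence p: "\<pi> permutes {1..n}" by simp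
  show "f \<pi> * H k v (%T. ?s (map (image (pinv \<pi>)) T)) = f \<pi> * (\<Sum>t\<in>ts k. c t * ev (xs ! k) (map (map \<pi>) t) v)"
   unfolding Sp_permute(1)[OF p] by (subst H_combination[OF v]) (use tableau_image(1)[OF _ p] in auto)
 qed
 also have "\<dots> = (\<Sum>t\<in>ts k. c t * ev (xs ! k) t (f \<odot>\<^bsub>M\<^esub> v))"
  by (simp add: ev_smult[OF xs_Sig[OF k]] sum_distrib_left mult_ac cong: sum.cong) (rule sum.swap)
 finally show "(f \<odot>\<^bsub>D k\<^esub> H k v) ?s = (\<Sum>t\<in>ts k. c t * ev (xs ! k) t (f \<odot>\<^bsub>M\<^esub> v))" .
qed (simp add: D_simps)

lemma H_kernel: "v \<in> U (Suc k) ==> H k v = \<zero>\<^bsub>D k\<^esub> \<longleftrightarrow> v \<in> U k"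
proof
 assume v: "v \<in> U (Suc k)" and z: "H k v = \<zero>\<^bsub>D k\<^esub>"
 have "ev (xs ! k) t v = 0" if "t \<in> ts k" for t
  using H_polytabloid[OF v that] polytabloid_in[OF that] unfolding z D_simps by simp
 thus "v \<in> U k" using v unfolding U_def using Suc_leI le_neq_implies_less by blast
next
 assume "v \<in> U (Suc k)" "v \<in> U k"
 thus "H k v = \<zero>\<^bsub>D k\<^esub>" using k by (intro H_eqI) (simp_all add: D_simps U_def Sp_combination)
qed

text \<open>The form is extended to all combinations of tabloids, and its coordinates
  \<open>z\<close> are used as coefficients of the vectors \<open>bv\<close>. By triangularity the
  functionals at later places vanish on this combination, so it lies in
  \<open>U (Suc k)\<close>.\<close>

lemma H_surj:
 assumes \<phi>: "\<phi> \<in> carrier (D k)"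
 shows "\<exists>v\<in>U (Suc k). H k v = \<phi>"
proof -
 note x = xs_Sig[OF k]
 have "\<exists>x. \<forall>s\<in>carrier (Sp k). \<phi> s = (\<Sum>T\<in>tt k. x T * s T)"
  by (rule functional_extension) (use \<phi> Sp_supp Sp_closed in \<open>auto simp: D_simps\<close>)
 then obtain z where z: "\<And>s. s \<in> carrier (Sp k) ==> \<phi> s = (\<Sum>T\<in>tt k. z T * s T)" by blast
 define v where "v = (%y. \<Sum>T\<in>tt k. z T * bv (xs ! k) T y)"
 have "ev (xs ! a) t v = 0" if "Suc k \<le> a" "a < length xs" "t \<in> tx (xs ! a)" for a t
 proof -
  have "ev (xs ! a) t (bv (xs ! k) T) = 0" for T
  proof (rule ccontr)
   assume "\<not> ?thesis"
   hence "xs ! k = xs ! a \<or> kk (snd (xs ! k)) < kk (snd (xs ! a))" using ev_bv_nonzero[OF xs_Sig[OF that(2)] x that(3)] by blast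
   thus False using xs(3)[of k a] xs(1) k that by (auto simp: nth_eq_iff_index_eq)
  qed
  thus ?thesis unfolding v_def ev_sum by simp
 qed
 moreover have "v \<in> carrier M" by (auto simp: v_def fun_module_simps bv_def)
 ultimately have v: "v \<in> U (Suc k)" by (simp add: U_def)
 have e: "ev (xs ! k) t v = \<phi> (polytabloid n t)" if "t \<in> ts k" for t
  unfolding v_def ev_sum z[OF polytabloid_in[OF that]] using ev_bv_same[OF x that] by (intro sum.cong refl) auto
 have "H k v = \<phi>"
 proof (rule H_eqI[OF v])
  show "\<phi> \<in> extensional (carrier (Sp k))" using \<phi> by (simp add: D_simps)
  fix c
  have "(%T. \<Sum>t\<in>A. c t * polytabloid n t T) \<in> carrier (Sp k) \<and> \<phi> (%T. \<Sum>t\<in>A. c t * polytabloid n t T) = (\<Sum>t\<in>A. c t * \<phi> (polytabloid n t))"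
   if "A \<subseteq> ts k" for A
  proof
   show s: "(%T. \<Sum>t\<in>A. c t * polytabloid n t T) \<in> carrier (Sp k)" using that by (intro Sp_sum polytabloid_in) auto
   have "(\<Sum>T\<in>tt k. z T * (\<Sum>t\<in>A. c t * polytabloid n t T)) = (\<Sum>t\<in>A. c t * (\<Sum>T\<in>tt k. z T * polytabloid n t T))"
    unfolding sum_distrib_left by (subst sum.swap) (simp add: mult_ac)
   also have "\<dots> = (\<Sum>t\<in>A. c t * \<phi> (polytabloid n t))" using that z polytabloid_in by (intro sum.cong refl) auto
   finally show "\<phi> (%T. \<Sum>t\<in>A. c t * polytabloid n t T) = (\<Sum>t\<in>A. c t * \<phi> (polytabloid n t))" using z[OF s] by simp
  qed
  thus "\<phi> (%T. \<Sum>t\<in>ts k. c t * polytabloid n t T) = (\<Sum>t\<in>ts k. c t * ev (xs ! k) t v)" using e by simp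
 qed
 thus ?thesis using v by blast
qed

lemma shape_partition: "is_partition n (plist (sh (xs ! k)))"
 by (rule plist(3)[OF SigD(3)[OF xs_Sig[OF k]]])

end

end

text \<open>Adapted to \<open>quot_module\<close>, where the action is a union of cosets:
  \<open>h\<close> is constant on the coset of \<open>x\<close>, so it takes a single value on the
  whole union, and this value is compatible with the action on \<open>E\<close>.\<close>

lemma first_isomorphism:
 assumes L: "comm_group (add_monoid L)" and V': "subgroup V' (add_monoid L)" and V: "subgroup V (add_monoid L)" "V \<subseteq> V'"
  and smult: "\<And>a x. a \<in> carrier R ==> x \<in> V' ==> a \<odot>\<^bsub>L\<^esub> x \<in> V'"
  and h: "\<And>x. x \<in> V' ==> h x \<in> carrier E" "\<And>x y. x \<in> V' ==> y \<in> V' ==> h (x \<oplus>\<^bsub>L\<^esub> y) = h x \<oplus>\<^bsub>E\<^esub> h y"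
   "\<And>a x. a \<in> carrier R ==> x \<in> V' ==> h (a \<odot>\<^bsub>L\<^esub> x) = a \<odot>\<^bsub>E\<^esub> h x"
   "\<And>x. x \<in> V' ==> h x = \<zero>\<^bsub>E\<^esub> \<longleftrightarrow> x \<in> V" "\<And>z. z \<in> carrier E ==> \<exists>x\<in>V'. h x = z"
 shows "module_isomorphic R (quot_module (L\<lparr>carrier := V'\<rparr>) V) E"
proof -
 interpret L: comm_group "add_monoid L" by (rule L)
 let ?G = "add_monoid (L\<lparr>carrier := V'\<rparr>)" and ?Q = "quot_module (L\<lparr>carrier := V'\<rparr>) V"
 have G: "?G = (add_monoid L)\<lparr>carrier := V'\<rparr>" by simp
 have gG: "group ?G" unfolding G by (rule subgroup.subgroup_is_group[OF V' L.group_axioms])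
 have hG: "h \<in> hom ?G (add_monoid E)" using h(1,2) by (auto simp: hom_def)
 have onto: "h ` carrier ?G = carrier (add_monoid E)" using h(1,5) by force
 have "\<zero>\<^bsub>L\<^esub> \<in> V" using subgroup.one_closed[OF V(1)] by simp
 hence h0: "h \<zero>\<^bsub>L\<^esub> = \<zero>\<^bsub>E\<^esub>" using h(4)[of "\<zero>\<^bsub>L\<^esub>"] V(2) by blast
 \<comment> \<open>That \<open>E\<close> is a group is not assumed; it follows because
   \<open>E\<close> is the image of a group under \<open>h\<close>.\<close>
 have "group ((add_monoid E)\<lparr>carrier := h ` carrier ?G, one := h \<one>\<^bsub>?G\<^esub>\<rparr>)" by (rule group.hom_imp_img_group[OF gG hG])
 hence gE: "group (add_monoid E)" unfolding onto using h0 by simp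
 interpret h: group_hom ?G "add_monoid E" h unfolding group_hom_def group_hom_axioms_def using gG gE hG by blast
 have ker: "kernel ?G (add_monoid E) h = V" using h(4) V(2) by (auto simp: kernel_def)
 have coset: "h c = h x \<and> c \<in> V'" if c: "c \<in> V +>\<^bsub>L\<lparr>carrier := V'\<rparr>\<^esub> x" and x: "x \<in> V'" for c x
 proof -
  obtain v where v: "v \<in> V" "c = v \<oplus>\<^bsub>L\<^esub> x" using c by (auto simp: a_r_coset_def r_coset_def)
  hence "h c = h v \<oplus>\<^bsub>E\<^esub> h x" "h v = \<zero>\<^bsub>E\<^esub>" using h(2,4) V(2) x by auto
  moreover have "\<one>\<^bsub>add_monoid E\<^esub> \<otimes>\<^bsub>add_monoid E\<^esub> h x = h x" using h(1)[OF x] by (intro h.H.l_one) simp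
  moreover have "c \<in> V'" using subgroup.m_closed[OF V', of v x] v V(2) x by auto
  ultimately show ?thesis by simp
 qed
 have self: "x \<in> V +>\<^bsub>L\<lparr>carrier := V'\<rparr>\<^esub> x" if "x \<in> V'" for x
  using \<open>\<zero>\<^bsub>L\<^esub> \<in> V\<close> L.l_one[of x] subgroup.subset[OF V'] that by (force simp: a_r_coset_def r_coset_def)
 hence elem: "the_elem (h ` (V +>\<^bsub>L\<lparr>carrier := V'\<rparr>\<^esub> x)) = h x" if "x \<in> V'" for x
 proof -
  have "h ` (V +>\<^bsub>L\<lparr>carrier := V'\<rparr>\<^esub> x) = {h x}" using coset[OF _ that] self[OF that] by blast
  thus ?thesis by simp
 qed
 have Q: "carrier ?Q = carrier (?G Mod V)" "monoid.mult (add_monoid ?Q) = monoid.mult (?G Mod V)"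
  by (simp_all add: quot_module_def FactGroup_def A_RCOSETS_def set_add_def)
 have "(%X. the_elem (h ` X)) \<in> iso (?G Mod V) (add_monoid E)" using h.FactGroup_iso_set[OF onto] unfolding ker .
 hence iso: "(%X. the_elem (h ` X)) \<in> iso (add_monoid ?Q) (add_monoid E)" using Q by (simp add: iso_def hom_def)
 have sm: "the_elem (h ` (a \<odot>\<^bsub>?Q\<^esub> C)) = a \<odot>\<^bsub>E\<^esub> the_elem (h ` C)" if a: "a \<in> carrier R" and C: "C \<in> carrier ?Q" for a C
 proof -
  obtain x where x: "x \<in> V'" "C = V +>\<^bsub>L\<lparr>carrier := V'\<rparr>\<^esub> x" using C by (auto simp: quot_module_def A_RCOSETS_def RCOSETS_def a_r_coset_def)
  have im: "h ` (V +>\<^bsub>L\<lparr>carrier := V'\<rparr>\<^esub> (a \<odot>\<^bsub>L\<^esub> c)) = {a \<odot>\<^bsub>E\<^esub> h x}" if "c \<in> C" for c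
  proof -
   have c: "c \<in> V'" "h c = h x" using coset[of c x] that x by auto
   have "h y = a \<odot>\<^bsub>E\<^esub> h x" if "y \<in> V +>\<^bsub>L\<lparr>carrier := V'\<rparr>\<^esub> (a \<odot>\<^bsub>L\<^esub> c)" for y
    using coset[OF that smult[OF a c(1)]] h(3)[OF a c(1)] c(2) by simp
   hence "h ` (V +>\<^bsub>L\<lparr>carrier := V'\<rparr>\<^esub> (a \<odot>\<^bsub>L\<^esub> c)) \<subseteq> {a \<odot>\<^bsub>E\<^esub> h x}" by auto
   thus ?thesis using imageI[OF self[OF smult[OF a c(1)]], of h] by auto
  qed
  have "h ` (a \<odot>\<^bsub>?Q\<^esub> C) = (\<Union>c\<in>C. h ` (V +>\<^bsub>L\<lparr>carrier := V'\<rparr>\<^esub> (a \<odot>\<^bsub>L\<^esub> c)))" by (simp add: quot_module_def image_UN)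
  also have "\<dots> = {a \<odot>\<^bsub>E\<^esub> h x}" using im self[OF x(1)] x(2) by blast
  finally show ?thesis using elem[OF x(1)] x(2) by simp
 qed
 show ?thesis unfolding module_isomorphic_def by (rule bexI[OF _ iso]) (intro ballI sm)
qed

context word_modules
begin

lemma U_subgroup: "subgroup (U k) (add_monoid M)"
proof (rule subgroup_funI)
 show "comm_group (add_monoid M)" by (rule comm_group_funI) (auto simp: fun_module_simps)
 show "(%_. 0) \<in> U k" by (simp add: U_def fun_module_simps ev_zero)
 show "(%d. - f d) \<in> U k" if "f \<in> U k" for f
 proof -
  have "ev x t (%d. - f d) = - ev x t f" for x t using ev_sum[of x t "%_. -1" "%_. f" "{()}"] by simp
  thus ?thesis using that by (simp add: U_def fun_module_simps)
 qed
qed (use U_add U_subset in \<open>auto simp: fun_module_simps\<close>)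

theorem dual_specht_filtration:
 fixes L :: "((nat => nat) => 'k, 'x) module"
 assumes L: "comm_group (add_monoid L)" and smult: "\<And>f x. x \<in> carrier L ==> f \<odot>\<^bsub>L\<^esub> x \<in> carrier L"
  and g: "module_iso (kSym n) L M g"
 shows "has_dual_specht_filtration n L"
proof -
 let ?kS = "kSym n :: ((nat => nat) => 'k) ring"
 interpret L: comm_group "add_monoid L" by (rule L)
 define V where "V k = {x \<in> carrier L. g x \<in> U k}" for k
 have gM: "g x \<in> carrier M" if "x \<in> carrier L" for x using g that by (auto simp: module_iso_def bij_betw_def)
 have ghom: "g \<in> hom (add_monoid L) (add_monoid M)" using g by (simp add: module_iso_def)
 have gadd: "g (x \<oplus>\<^bsub>L\<^esub> y) = (%z. g x z + g y z)" if "x \<in> carrier L" "y \<in> carrier L" for x y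
  using hom_mult[OF ghom, of x y] that by (simp add: fun_module_simps)
 have gsm: "g (f \<odot>\<^bsub>L\<^esub> x) = f \<odot>\<^bsub>M\<^esub> g x" if "f \<in> carrier ?kS" "x \<in> carrier L" for f x
  using g that by (simp add: module_iso_def)
 have ginj: "inj_on g (carrier L)" and gsurj: "g ` carrier L = carrier M" using g by (auto simp: module_iso_def bij_betw_def)
 have "comm_group (add_monoid M)" by (rule comm_group_funI) (auto simp: fun_module_simps)
 from subgroup_hom_vimage[OF L this ghom U_subgroup] have Vsub: "subgroup (V k) (add_monoid L)" for k by (simp add: V_def)
 have Vsm: "f \<odot>\<^bsub>L\<^esub> x \<in> V k" if "f \<in> carrier ?kS" "x \<in> V k" for f x k
  using that smult gsm U_smult by (simp add: V_def)
 have zero: "\<zero>\<^bsub>L\<^esub> \<in> carrier L" "\<zero>\<^bsub>L\<^esub> \<oplus>\<^bsub>L\<^esub> \<zero>\<^bsub>L\<^esub> = \<zero>\<^bsub>L\<^esub>" using L.one_closed L.r_one[of "\<zero>\<^bsub>L\<^esub>"] by simp_all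
 have "g \<zero>\<^bsub>L\<^esub> z = g \<zero>\<^bsub>L\<^esub> z + g \<zero>\<^bsub>L\<^esub> z" for z using fun_cong[OF gadd[OF zero(1,1)], of z] unfolding zero(2) .
 hence g0: "g \<zero>\<^bsub>L\<^esub> = (%_. 0)" unfolding add_cancel_right_right by blast
 have V0: "V 0 = {\<zero>\<^bsub>L\<^esub>}"
 proof (intro equalityI subsetI)
  fix x assume "x \<in> V 0"
  hence "x \<in> carrier L" "g x = g \<zero>\<^bsub>L\<^esub>" by (simp_all add: V_def U_0 g0)
  thus "x \<in> {\<zero>\<^bsub>L\<^esub>}" using inj_onD[OF ginj _ _ zero(1)] by simp
 qed (simp add: V_def U_0 g0 zero(1))
 have Vm: "V k \<subseteq> V (Suc k)" for k using U_Suc[of k "Suc k"] by (auto simp: V_def)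
 have "module_isomorphic ?kS (quot_module (L\<lparr>carrier := V (Suc k)\<rparr>) (V k)) (D k)" if k: "k < length xs" for k
 proof (rule first_isomorphism[OF L Vsub Vsub, where h = "%x. H k (g x)"])
  show "V k \<subseteq> V (Suc k)" by (rule Vm)
  show "H k (g x) = \<zero>\<^bsub>D k\<^esub> \<longleftrightarrow> x \<in> V k" if "x \<in> V (Suc k)" for x using that H_kernel[OF k] by (simp add: V_def)
  show "\<exists>x\<in>V (Suc k). H k (g x) = z" if z: "z \<in> carrier (D k)" for z
  proof -
   obtain v where v: "v \<in> U (Suc k)" "H k v = z" using H_surj[OF k z] by blast
   have "v \<in> g ` carrier L" unfolding gsurj by (rule subsetD[OF U_subset v(1)])
   then obtain x where "x \<in> carrier L" "g x = v" by blast
   thus ?thesis using v by (auto simp: V_def)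
  qed
 qed (use Vsm H_dual[OF k] H_add[OF k] H_smult[OF k] gadd gsm in \<open>auto simp: V_def\<close>)
 moreover have "V (length xs) = carrier L" unfolding V_def U_length using gM by blast
 moreover have "submodule (V k) ?kS L" for k
  using Vsub Vsm by (simp add: submodule_def submodule_axioms_def)
 ultimately show ?thesis unfolding has_dual_specht_filtration_def
  using V0 shape_partition Vm
  by (intro exI[of _ "length xs"] exI[of _ V] exI[of _ "%k. plist (sh (xs ! k))"]) blast
qed

end

context layer
begin

theorem layer_res_structure:
 "(\<exists>\<nu>s. (\<forall>\<nu>\<in>set \<nu>s. is_partition n \<nu>) \<and> module_isomorphic kn L (direct_sum (map (perm_module n) \<nu>s))) \<and> has_dual_specht_filtration n L"
proof -
 obtain \<nu>s h where \<nu>s: "\<forall>\<nu>\<in>set \<nu>s. is_partition n \<nu>"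
  and h: "module_iso kn L (wmod n \<nu>s) h"
  using layer_res_words by blast
 interpret W: word_modules n \<nu>s "TYPE('k)" by unfold_locales (use \<nu>s in \<open>auto simp: is_partition_def\<close>)
 have "has_dual_specht_filtration n L"
  by (rule W.dual_specht_filtration[OF L_group _ h[folded W.Y_def]]) (use hom_carrier[OF L_smult(1)] in auto)
 moreover obtain g where "module_iso kn (wmod n \<nu>s)
  (direct_sum (map (perm_module n) \<nu>s)) g"
  using fun_module_iso_direct_sum[OF W.sums] by blast
 ultimately show ?thesis using \<nu>s module_iso_trans[OF h] unfolding module_isomorphic_iff by blast
qed

end

theorem corollary22:
 fixes \<delta> :: "'k::alg_closed_field" and r n l :: nat and lam :: "nat list"
 assumes "r \<ge> 1" and "\<delta> \<noteq> 0" and "n \<le> r" and "l \<le> r" and "is_partition l lam"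
 shows "(\<exists>\<nu>s. (\<forall>\<nu> \<in> set \<nu>s. is_partition n \<nu>) \<and>
      module_isomorphic (group_algebra (Sym n))
       (layer_res r \<delta> n (layer_ind r \<delta> l (perm_module l lam)))
       (direct_sum (map (perm_module n) \<nu>s)))
    \<and> has_dual_specht_filtration n (layer_res r \<delta> n (layer_ind r \<delta> l (perm_module l lam)))"
proof -
 interpret layer r n l \<delta> lam
  by unfold_locales (use assms in \<open>auto simp: is_partition_def\<close>)
 show ?thesis by (rule layer_res_structure)
qed

end
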